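(* Let $E^{\pm}$ be the operators on the $F$-algebra of symmetric functions $\Xi_F$ (in infinitely many variables) obtained as the limits of the operators $E^{\pm}_{\mathbf m}$ (see context). For $\alpha\in Z_n^{0,0}$ write $E^{\pm}m_\alpha=\sum_{\beta\in Z_n^{0,0}}h^{\pm}_{\alpha,\beta}\,m_\beta$ with $h^{\pm}_{\alpha,\beta}\in F$, and for a family $\mathcal F\subset Z_n^{0,0}$ put $H^{\pm}_{\mathcal F,\mathcal F}=(h^{\pm}_{\alpha,\beta})_{\alpha,\beta\in\mathcal F}$. Suppose that the following (Conjecture A) holds: for any two distinct families $\mathcal F,\mathcal F'$ in $Z_n^{0,0}$, the matrices $H^{\pm}_{\mathcal F,\mathcal F}$ and $H^{\pm}_{\mathcal F',\mathcal F'}$ have no common eigenvalues (for the sign $+$ and for the sign $-$, respectively). Then the Macdonald functions $P^{\pm}_{\Lambda}\in\Xi_F$ ($\Lambda=\Lambda(\alpha)\in Z_n^{1,0}$) are characterized by the following two properties (i.e. they satisfy them and are the unique system of functions doing so): $$P^{\pm}_{\Lambda(\alpha)}=m_\alpha+\sum_{\beta<\alpha}w^{\pm}_{\alpha,\beta}\,m_\beta\qquad(w^{\pm}_{\alpha,\beta}\in F),$$ $$E^{\pm}P^{\pm}_{\Lambda(\alpha)}=\sum_{\beta\sim\alpha}h^{\pm}_{\alpha,\beta}\,P^{\pm}_{\Lambda(\beta)}.$$ In particular, the $P^{\pm}_\Lambda$ are determined independently of the choice of the total order $\prec$.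
   Context: **Symmetric functions.** $e\ge1$; $\zeta$ is a primitive $e$-th root of unity in $\mathbb C$; $q,t$ are independent indeterminates and $F=\mathbb C(q,t)$. Upper indices $k$ of variables are read mod $e$. For a sequence of positive integers $\mathbf m=(m_0,\dots,m_{e-1})$ let $x=(x^{(k)}_j)$, $0\le k\le e-1$, $1\le j\le m_k$, let $\mathfrak S_{\mathbf m}=\prod_k\mathfrak S_{m_k}$ permute the variables $x^{(k)}_j$ for each $k$ separately, with sign character $\varepsilon$, and let $\Xi_{\mathbf m,F}=F[x]^{\mathfrak S_{\mathbf m}}$. Fix one such $\mathbf m$; below it may be replaced by $\mathbf m'=(m_0+l,\dots,m_{e-1}+l)$, $l\ge0$. The restriction homomorphism $\rho_{\mathbf m',\mathbf m}:\Xi_{\mathbf m',F}\to\Xi_{\mathbf m,F}$ sets $x^{(k)}_j=0$ for $j>m_k$. The (graded) inverse limit of the $\Xi_{\mathbf m',F}$ is the algebra $\Xi_F$ of symmetric functions in infinitely many variables $x^{(k)}_1,x^{(k)}_2,\dots$ $(0\le k\le e-1)$. For an $e$-partition $\alpha=(\alpha^{(0)},\dots,\alpha^{(e-1)})$ put $m_\alpha=\prod_k m_{\alpha^{(k)}}(x^{(k)})$ and $s_\alpha=\prod_k s_{\alpha^{(k)}}(x^{(k)})$ (usual monomial symmetric and Schur functions). $Z_n^{0,0}=Z_n^{0,0}(\mathbf m)$ is the set of $e$-partitions $\alpha$ of total size $n$ with $\alpha^{(k)}$ written with $m_k$ parts (padded by zeros). Adding zeros identifies $\alpha$ with an element of $Z_n^{0,0}(\mathbf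 m')$, and after enough such shifts every $e$-partition of $n$ is included; the notions below are invariant under these shifts. **Scalar product.** For $r\ge1$ put $p^{(i)}_r=\sum_{j=0}^{e-1}\zeta^{ij}p_r(x^{(j)})$ ($p_r$ the power sum), $p_0^{(i)}=1$, and $p_\alpha=\prod_k\prod_j p^{(k)}_{\alpha^{(k)}_j}$. The sesquilinear form on $\Xi_F$ (linear in the first variable, conjugate-linear in the second with $q,t$ fixed) is defined by $\langle p_\alpha,p_\beta\rangle=\delta_{\alpha,\beta}\,z_\alpha(q,t)$, where $$z_\alpha(q,t)=z_\alpha\prod_{k=0}^{e-1}\prod_{j=1}^{l(\alpha^{(k)})}\frac{1-\zeta^kq^{\alpha^{(k)}_j}}{1-\zeta^kt^{\alpha^{(k)}_j}},\qquad z_\alpha=e^{\sum_k l(\alpha^{(k)})}\prod_k z_{\alpha^{(k)}},$$ $l(\lambda)$ is the number of nonzero parts of a partition $\lambda$, and $z_\lambda=\prod_{i\ge1}i^{n_i}n_i!$ for $\lambda=(1^{n_1},2^{n_2},\dots)$. **Symbols (type $(1,0)$).** $\delta=(\delta^{(0)},\dots,\delta^{(e-1)})$ with $\delta^{(k)}=(m_k-1,\dots,1,0)$; $\Lambda(\alpha)=\alpha+\delta$ (entrywise) and $Z_n^{1,0}=\{\Lambda(\alpha)\mid\alpha\in Z_n^{0,0}\}$. Write $\alpha\sim\beta$ and $\Lambda(\alpha)\sim\Lambda(\beta)$ if all entries of $\Lambda(\alpha)$ and $\Lambda(\beta)$ coincide with multiplicities; the equivalence classes are the families. Let $\lambda(\alpha)$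 be the partition obtained by arranging all entries of $\Lambda(\alpha)$ in weakly decreasing order; it depends only on the family. Define $\beta<\alpha$ to mean that $\lambda(\beta)\neq\lambda(\alpha)$ and $\lambda(\beta)$ is smaller than $\lambda(\alpha)$ in the dominance order. With $n(\lambda)=\sum_{i\ge1}(i-1)\lambda_i$, put $a(\alpha)=n(\lambda(\alpha))-n(\lambda(0))$, where $\lambda(0)$ is the sorted sequence of entries of $\delta$. $\prec$ is a fixed total order on $Z_n^{0,0}$, compatible with $<$, such that $a(\alpha)\ge a(\beta)$ whenever $\alpha\prec\beta$ and each family is an interval. **Macdonald functions.** $P^{\pm}_\Lambda\in\Xi_F$ ($\Lambda\in Z_n^{1,0}$) are the unique functions such that $P^{\pm}_{\Lambda(\alpha)}=s_\alpha+\sum_\beta u^{\pm}_{\alpha,\beta}s_\beta$ with $u^{\pm}_{\alpha,\beta}\in F$, $u^{\pm}_{\alpha,\beta}=0$ unless $\beta\prec\alpha$ and $\beta\not\sim\alpha$, and $\langle P^+_\Lambda,P^-_{\Lambda'}\rangle=0$ unless $\Lambda\sim\Lambda'$. **Operators.** Let $Z(\mathbf m)$ be the set of arrays $\beta=(\beta^{(k)}_j)$ ($0\le k\le e-1$, $1\le j\le m_k$) of nonnegative integers, $x^\beta=\prod(x^{(k)}_j)^{\beta^{(k)}_j}$, with $\mathfrak S_{\mathbf m}$ acting so that $w(x^\beta)=x^{w(\beta)}$. Let $\mathcal I=\{\mathbf i=(i_0,\dots,i_{e-1})\mid 1\le i_k\le m_k\}$. For $\mathbf i\in\mathcal I$,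 $T^{\pm}_{q,\mathbf i}$ is the $F$-linear operator on $F[x]$ replacing simultaneously $x^{(k)}_{i_k}$ by $q\,x^{(k\mp1)}_{i_{k\mp1}}$ for all $k$ (indices mod $e$) and fixing the other variables. Put $\langle\beta,\mathbf i\rangle=\sum_k\beta^{(k)}_{i_k}$ and define $\beta_{\mathbf i\pm}\in Z(\mathbf m)$ by $T^{\pm}_{q,\mathbf i}x^\beta=q^{\langle\beta,\mathbf i\rangle}x^{\beta_{\mathbf i\pm}}$. With $a_\delta(x)=\sum_{w\in\mathfrak S_{\mathbf m}}\varepsilon(w)w(x^\delta)$, put $$D^1_{\mathbf m,\pm}=a_\delta(x)^{-1}\sum_{w\in\mathfrak S_{\mathbf m}}\varepsilon(w)\sum_{\mathbf i\in\mathcal I}x^{w(\delta)_{\mathbf i\pm}}\,t^{\langle w(\delta),\mathbf i\rangle}\,T^{\pm}_{q,\mathbf i},$$ an operator on $\Xi_{\mathbf m,F}$, and $$E^{\pm}_{\mathbf m}=t^{-M}D^1_{\mathbf m,\pm}-\sum_{\mathbf i\in\mathcal I}t^{\langle\delta,\mathbf i\rangle-M},\qquad M=\sum_k m_k.$$ The paper asserts that these are compatible with restriction, $\rho_{\mathbf m',\mathbf m}\circ E^{\pm}_{\mathbf m'}=E^{\pm}_{\mathbf m}\circ\rho_{\mathbf m',\mathbf m}$ for $\mathbf m'=(m_0+1,\dots,m_{e-1}+1)$, and $E^{\pm}$ is the resulting limit operator on $\Xi_F$. The coefficients satisfy $h^{\pm}_{\alpha,\beta}=0$ unless $\beta\sim\alpha$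 or $\beta<\alpha$.
   Formalization: For e≥2 the operators E_m as written commute with restriction only up to a scalar, so their limit does not exist; scalars (zero allowed) are added at each level to make them compatible. Z_n^{0,0} and families are taken after enough shifts to include all e-partitions of n. *)

theory Defs
  imports
    Complex_Main
    "HOL-Library.Poly_Mapping"
    "HOL-Library.Multiset"
    "HOL-Library.FuncSet"
    "HOL-Combinatorics.Permutations"
    "HOL-Computational_Algebra.Computational_Algebra"
    "HOL-Algebra.Algebraic_Closure_Type"
begin

text \<open>\<open>F = \<complex>(q,t)\<close> is the field of fractions of \<open>\<complex>[q][t]\<close>: the inner polynomial variable is \<open>q\<close>,
  the outer one is \<open>t\<close>.\<close>

type_synonym fld = "complex poly poly fract"

definition cF :: "complex \<Rightarrow> fld" where "cF c = Fract [:[:c:]:] 1"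
definition qF :: fld where "qF = Fract [:[:0, 1:]:] 1"
definition tF :: fld where "tF = Fract [:0, 1:] 1"

definition cnj_pp :: "complex poly poly \<Rightarrow> complex poly poly" where
  "cnj_pp = map_poly (map_poly cnj)"

lemma map_poly_cnj_mult: "map_poly cnj (a * b) = map_poly cnj a * map_poly cnj b"
  by (intro poly_eqI) (simp add: coeff_map_poly coeff_mult)

lemma map_poly_cnj_sum: "map_poly cnj (sum f A) = (\<Sum>x\<in>A. map_poly cnj (f x))"
  by (intro poly_eqI) (simp add: coeff_map_poly coeff_sum)

lemma cnj_pp_mult: "cnj_pp (a * b) = cnj_pp a * cnj_pp b"
  unfolding cnj_pp_def
  by (intro poly_eqI) (simp add: coeff_map_poly coeff_mult map_poly_cnj_mult map_poly_cnj_sum)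

lemma map_poly_cnj_eq_0_iff: "map_poly cnj a = 0 \<longleftrightarrow> a = 0"
  by (simp add: map_poly_eq_0_iff)

lemma cnj_pp_eq_0_iff: "cnj_pp a = 0 \<longleftrightarrow> a = 0"
  unfolding cnj_pp_def by (simp add: map_poly_eq_0_iff map_poly_cnj_eq_0_iff)

text \<open>The automorphism of \<open>F\<close> that conjugates the complex coefficients and fixes \<open>q\<close> and \<open>t\<close>.\<close>

definition cnj_F :: "fld \<Rightarrow> fld" where
  "cnj_F x = (THE y. \<exists>a b. b \<noteq> 0 \<and> x = Fract a b \<and> y = Fract (cnj_pp a) (cnj_pp b))"

lemma cnj_F_Fract:
  assumes "b \<noteq> 0"
  shows "cnj_F (Fract a b) = Fract (cnj_pp a) (cnj_pp b)"
  unfolding cnj_F_def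
proof (rule the_equality)
  show "\<exists>a' b'. b' \<noteq> 0 \<and> Fract a b = Fract a' b' \<and>
          Fract (cnj_pp a) (cnj_pp b) = Fract (cnj_pp a') (cnj_pp b')"
    using assms by blast
next
  fix y assume "\<exists>a' b'. b' \<noteq> 0 \<and> Fract a b = Fract a' b' \<and> y = Fract (cnj_pp a') (cnj_pp b')"
  then obtain a' b' where ab: "b' \<noteq> 0" "Fract a b = Fract a' b'"
    "y = Fract (cnj_pp a') (cnj_pp b')" by blast
  from ab(1,2) assms have "a * b' = a' * b" by (simp add: eq_fract)
  then have "cnj_pp a * cnj_pp b' = cnj_pp a' * cnj_pp b" by (simp flip: cnj_pp_mult)
  with ab assms show "y = Fract (cnj_pp a) (cnj_pp b)"
    by (simp add: eq_fract cnj_pp_eq_0_iff)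
qed

text \<open>The pair \<open>(k, j)\<close> stands for the position of the variable \<open>x\<^sup>(\<^sup>k\<^sup>)\<close> with lower index \<open>j + 1\<close>;
  positions within a block are counted from \<open>0\<close>. Arrays of nonnegative integers are the exponents
  of monomials. An \<open>e\<close>-partition is an array too, so that padding it by zeros does not change it.\<close>

type_synonym arr = "nat \<times> nat \<Rightarrow>\<^sub>0 nat"
type_synonym mpol = "arr \<Rightarrow>\<^sub>0 fld"

abbreviation keys :: "('a \<Rightarrow>\<^sub>0 'b::zero) \<Rightarrow> 'a set" where "keys \<equiv> Poly_Mapping.keys"
abbreviation lookup :: "('a \<Rightarrow>\<^sub>0 'b::zero) \<Rightarrow> 'a \<Rightarrow> 'b" where "lookup \<equiv> Poly_Mapping.lookup"

definition idx :: "nat \<Rightarrow> (nat \<Rightarrow> nat) \<Rightarrow> (nat \<times> nat) set" where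
  "idx e m = {(k, j). k < e \<and> j < m k}"

definition shift :: "(nat \<Rightarrow> nat) \<Rightarrow> nat \<Rightarrow> nat \<Rightarrow> nat" where
  "shift m l = (\<lambda>k. m k + l)"

definition total :: "arr \<Rightarrow> nat" where
  "total \<beta> = (\<Sum>v\<in>keys \<beta>. lookup \<beta> v)"

definition Const :: "fld \<Rightarrow> mpol" where "Const c = Poly_Mapping.single 0 c"
definition monom_arr :: "arr \<Rightarrow> mpol" where "monom_arr \<beta> = Poly_Mapping.single \<beta> 1"
definition Var :: "nat \<times> nat \<Rightarrow> mpol" where "Var v = monom_arr (Poly_Mapping.single v 1)"

definition msubst :: "(nat \<times> nat \<Rightarrow> mpol) \<Rightarrow> mpol \<Rightarrow> mpol" where
  "msubst \<sigma> f = (\<Sum>\<beta>\<in>keys f. Const (lookup f \<beta>) * (\<Prod>v\<in>keys \<beta>. \<sigma> v ^ lookup \<beta> v))"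

text \<open>The exact quotient \<open>f / g\<close>; it is only used where \<open>g \<noteq> 0\<close> divides \<open>f\<close>.\<close>

definition mquot :: "mpol \<Rightarrow> mpol \<Rightarrow> mpol" where
  "mquot f g = (THE h. h * g = f)"

definition act :: "(nat \<times> nat \<Rightarrow> nat \<times> nat) \<Rightarrow> arr \<Rightarrow> arr" where
  "act w \<beta> = Poly_Mapping.map_key (inv_into UNIV w) \<beta>"

definition Sm :: "nat \<Rightarrow> (nat \<Rightarrow> nat) \<Rightarrow> (nat \<times> nat \<Rightarrow> nat \<times> nat) set" where
  "Sm e m = {w. w permutes idx e m \<and> (\<forall>v. fst (w v) = fst v)}"

definition alternant :: "(nat \<times> nat \<Rightarrow> nat \<times> nat) set \<Rightarrow> arr \<Rightarrow> mpol" where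
  "alternant G \<beta> = (\<Sum>w\<in>G. of_int (sign w) * monom_arr (act w \<beta>))"

definition Xi_fin :: "nat \<Rightarrow> (nat \<Rightarrow> nat) \<Rightarrow> mpol set" where
  "Xi_fin e m = {f. (\<forall>\<beta>\<in>keys f. keys \<beta> \<subseteq> idx e m) \<and> (\<forall>w\<in>Sm e m. msubst (Var \<circ> w) f = f)}"

definition restr :: "(nat \<Rightarrow> nat) \<Rightarrow> mpol \<Rightarrow> mpol" where
  "restr m = msubst (\<lambda>(k, j). if j < m k then Var (k, j) else 0)"

text \<open>The graded inverse limit: an element \<open>f\<close> is the sequence of its images \<open>f l\<close> in the rings of
  symmetric polynomials for \<open>(m\<^sub>0 + l, \<dots>, m\<^bsub>e-1\<^esub> + l)\<close>, compatible with restriction and of bounded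
  degree.\<close>

type_synonym symfun = "nat \<Rightarrow> mpol"

definition Xi :: "nat \<Rightarrow> (nat \<Rightarrow> nat) \<Rightarrow> symfun set" where
  "Xi e m = {f. (\<forall>l. f l \<in> Xi_fin e (shift m l)) \<and>
                (\<forall>l. restr (shift m l) (f (Suc l)) = f l) \<and>
                (\<exists>d. \<forall>l. \<forall>\<beta>\<in>keys (f l). total \<beta> \<le> d)}"

definition lincomb :: "'i set \<Rightarrow> ('i \<Rightarrow> fld) \<Rightarrow> ('i \<Rightarrow> symfun) \<Rightarrow> symfun" where
  "lincomb A c g = (\<lambda>l. \<Sum>i\<in>A. Const (c i) * g i l)"

definition epart :: "nat \<Rightarrow> arr set" where
  "epart e = {\<alpha>. (\<forall>(k, j)\<in>keys \<alpha>. k < e) \<and> (\<forall>k j. lookup \<alpha> (k, Suc j) \<le> lookup \<alpha> (k, j))}"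

text \<open>In a block of \<open>N\<close> variables the functions of a partition with more than \<open>N\<close> parts are \<open>0\<close>.\<close>

definition barr :: "nat \<Rightarrow> nat \<Rightarrow> (nat \<Rightarrow> nat) \<Rightarrow> arr" where
  "barr k N \<mu> = (\<Sum>j<N. Poly_Mapping.single (k, j) (\<mu> j))"

definition bperm :: "nat \<Rightarrow> nat \<Rightarrow> (nat \<times> nat \<Rightarrow> nat \<times> nat) set" where
  "bperm k N = {w. w permutes ({k} \<times> {..<N})}"

definition mon_block :: "nat \<Rightarrow> nat \<Rightarrow> (nat \<Rightarrow> nat) \<Rightarrow> mpol" where
  "mon_block k N \<mu> =
     (if \<forall>j\<ge>N. \<mu> j = 0 then \<Sum>\<nu>\<in>(\<lambda>w. act w (barr k N \<mu>)) ` bperm k N. monom_arr \<nu> else 0)"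

definition schur_block :: "nat \<Rightarrow> nat \<Rightarrow> (nat \<Rightarrow> nat) \<Rightarrow> mpol" where
  "schur_block k N \<mu> =
     (if \<forall>j\<ge>N. \<mu> j = 0
      then mquot (alternant (bperm k N) (barr k N (\<lambda>j. \<mu> j + (N - 1 - j))))
                 (alternant (bperm k N) (barr k N (\<lambda>j. N - 1 - j)))
      else 0)"

definition msym :: "nat \<Rightarrow> (nat \<Rightarrow> nat) \<Rightarrow> arr \<Rightarrow> symfun" where
  "msym e m \<alpha> = (\<lambda>l. \<Prod>k<e. mon_block k (shift m l k) (\<lambda>j. lookup \<alpha> (k, j)))"

definition schur :: "nat \<Rightarrow> (nat \<Rightarrow> nat) \<Rightarrow> arr \<Rightarrow> symfun" where
  "schur e m \<alpha> = (\<lambda>l. \<Prod>k<e. schur_block k (shift m l k) (\<lambda>j. lookup \<alpha> (k, j)))"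

definition primitive_root_of_unity :: "nat \<Rightarrow> complex \<Rightarrow> bool" where
  "primitive_root_of_unity e \<zeta> \<longleftrightarrow> \<zeta> ^ e = 1 \<and> (\<forall>j. 0 < j \<and> j < e \<longrightarrow> \<zeta> ^ j \<noteq> 1)"

definition psum :: "nat \<Rightarrow> (nat \<Rightarrow> nat) \<Rightarrow> complex \<Rightarrow> nat \<Rightarrow> nat \<Rightarrow> symfun" where
  "psum e m \<zeta> i r = (\<lambda>l. \<Sum>j<e. Const (cF (\<zeta> ^ (i * j))) * (\<Sum>u<shift m l j. Var (j, u) ^ r))"

text \<open>Since \<open>p\<^sub>0 = 1\<close> by convention, only the nonzero parts, i.e. the positions in
  \<^term>\<open>keys \<alpha>\<close>, contribute.\<close>

definition pfun :: "nat \<Rightarrow> (nat \<Rightarrow> nat) \<Rightarrow> complex \<Rightarrow> arr \<Rightarrow> symfun" where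
  "pfun e m \<zeta> \<alpha> = (\<lambda>l. \<Prod>(k, j)\<in>keys \<alpha>. psum e m \<zeta> k (lookup \<alpha> (k, j)) l)"

definition z_block :: "arr \<Rightarrow> nat \<Rightarrow> nat" where
  "z_block \<alpha> k = (\<Prod>i=1..total \<alpha>. let n = card {j. lookup \<alpha> (k, j) = i} in i ^ n * fact n)"

definition z_qt :: "nat \<Rightarrow> complex \<Rightarrow> arr \<Rightarrow> fld" where
  "z_qt e \<zeta> \<alpha> =
     of_nat (e ^ (\<Sum>k<e. card {j. lookup \<alpha> (k, j) \<noteq> 0}) * (\<Prod>k<e. z_block \<alpha> k)) *
     (\<Prod>(k, j)\<in>keys \<alpha>. (1 - cF (\<zeta> ^ k) * qF ^ lookup \<alpha> (k, j)) /
                       (1 - cF (\<zeta> ^ k) * tF ^ lookup \<alpha> (k, j)))"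

text \<open>Well defined because the \<open>p\<^sub>\<alpha>\<close>, \<open>\<alpha>\<close> an \<open>e\<close>-partition, form an \<open>F\<close>-basis.\<close>

definition pcoord :: "nat \<Rightarrow> (nat \<Rightarrow> nat) \<Rightarrow> complex \<Rightarrow> symfun \<Rightarrow> (arr \<Rightarrow>\<^sub>0 fld)" where
  "pcoord e m \<zeta> f =
     (THE c. keys c \<subseteq> epart e \<and> f = lincomb (keys c) (lookup c) (pfun e m \<zeta>))"

definition scal :: "nat \<Rightarrow> (nat \<Rightarrow> nat) \<Rightarrow> complex \<Rightarrow> symfun \<Rightarrow> symfun \<Rightarrow> fld" where
  "scal e m \<zeta> f g =
     (\<Sum>\<alpha>\<in>keys (pcoord e m \<zeta> f).
        lookup (pcoord e m \<zeta> f) \<alpha> * cnj_F (lookup (pcoord e m \<zeta> g) \<alpha>) * z_qt e \<zeta> \<alpha>)"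

definition Z00 :: "nat \<Rightarrow> (nat \<Rightarrow> nat) \<Rightarrow> nat \<Rightarrow> arr set" where
  "Z00 e m n = {\<alpha> \<in> epart e. keys \<alpha> \<subseteq> idx e m \<and> total \<alpha> = n}"

definition delta :: "nat \<Rightarrow> (nat \<Rightarrow> nat) \<Rightarrow> arr" where
  "delta e m = (\<Sum>(k, j)\<in>idx e m. Poly_Mapping.single (k, j) (m k - 1 - j))"

definition Lam :: "nat \<Rightarrow> (nat \<Rightarrow> nat) \<Rightarrow> arr \<Rightarrow> arr" where
  "Lam e m \<alpha> = \<alpha> + delta e m"

definition entries :: "nat \<Rightarrow> (nat \<Rightarrow> nat) \<Rightarrow> arr \<Rightarrow> nat multiset" where
  "entries e m \<alpha> = image_mset (lookup (Lam e m \<alpha>)) (mset_set (idx e m))"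

definition sim :: "nat \<Rightarrow> (nat \<Rightarrow> nat) \<Rightarrow> arr \<Rightarrow> arr \<Rightarrow> bool" where
  "sim e m \<alpha> \<beta> \<longleftrightarrow> entries e m \<alpha> = entries e m \<beta>"

definition families :: "nat \<Rightarrow> (nat \<Rightarrow> nat) \<Rightarrow> nat \<Rightarrow> arr set set" where
  "families e m n = Z00 e m n // {(\<alpha>, \<beta>) \<in> Z00 e m n \<times> Z00 e m n. sim e m \<alpha> \<beta>}"

definition lam :: "nat \<Rightarrow> (nat \<Rightarrow> nat) \<Rightarrow> arr \<Rightarrow> nat list" where
  "lam e m \<alpha> = rev (sorted_list_of_multiset (entries e m \<alpha>))"

definition dominated :: "nat list \<Rightarrow> nat list \<Rightarrow> bool" where
  "dominated xs ys \<longleftrightarrow> sum_list xs = sum_list ys \<and>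
     (\<forall>i. sum_list (take i xs) \<le> sum_list (take i ys))"

definition below :: "nat \<Rightarrow> (nat \<Rightarrow> nat) \<Rightarrow> arr \<Rightarrow> arr \<Rightarrow> bool" where
  "below e m \<beta> \<alpha> \<longleftrightarrow> lam e m \<beta> \<noteq> lam e m \<alpha> \<and> dominated (lam e m \<beta>) (lam e m \<alpha>)"

definition nfun :: "nat list \<Rightarrow> nat" where
  "nfun xs = (\<Sum>i<length xs. i * xs ! i)"

definition afun :: "nat \<Rightarrow> (nat \<Rightarrow> nat) \<Rightarrow> arr \<Rightarrow> int" where
  "afun e m \<alpha> = int (nfun (lam e m \<alpha>)) - int (nfun (lam e m 0))"

text \<open>\<^term>\<open>(\<beta>, \<alpha>) \<in> r\<close> means \<open>\<beta> \<prec> \<alpha>\<close>.\<close>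

definition admissible_order :: "nat \<Rightarrow> (nat \<Rightarrow> nat) \<Rightarrow> nat \<Rightarrow> (arr \<times> arr) set \<Rightarrow> bool" where
  "admissible_order e m n r \<longleftrightarrow>
     r \<subseteq> Z00 e m n \<times> Z00 e m n \<and> strict_linear_order_on (Z00 e m n) r \<and>
     (\<forall>\<alpha>\<in>Z00 e m n. \<forall>\<beta>\<in>Z00 e m n. below e m \<beta> \<alpha> \<longrightarrow> (\<beta>, \<alpha>) \<in> r) \<and>
     (\<forall>(\<alpha>, \<beta>)\<in>r. afun e m \<alpha> \<ge> afun e m \<beta>) \<and>
     (\<forall>\<F>\<in>families e m n. \<forall>\<alpha>\<in>\<F>. \<forall>\<gamma>\<in>\<F>. \<forall>\<beta>. (\<alpha>, \<beta>) \<in> r \<and> (\<beta>, \<gamma>) \<in> r \<longrightarrow> \<beta> \<in> \<F>)"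

datatype pm = SPlus | SMinus

text \<open>A system of functions is indexed by symbols. The space of symmetric functions is built from \<open>m\<close>,
  while the symbols are formed with \<open>M = (m\<^sub>0 + L, \<dots>, m\<^bsub>e-1\<^esub> + L)\<close>; they are compared only for
  \<open>L\<close> so large that every \<open>e\<close>-partition of \<open>n\<close> occurs in \<^term>\<open>Z00 e M n\<close>.\<close>

definition macdonald ::
  "nat \<Rightarrow> (nat \<Rightarrow> nat) \<Rightarrow> nat \<Rightarrow> complex \<Rightarrow> nat \<Rightarrow> (arr \<times> arr) set \<Rightarrow> (pm \<Rightarrow> arr \<Rightarrow> symfun) \<Rightarrow> bool"
where
  "macdonald e m L \<zeta> n r P \<longleftrightarrow> (let M = shift m L; Z = Z00 e M n in
     (\<forall>s. \<forall>\<alpha>\<in>Z. P s (Lam e M \<alpha>) \<in> Xi e m) \<and>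
     (\<forall>s. \<exists>u. \<forall>\<alpha>\<in>Z. P s (Lam e M \<alpha>) =
        (\<lambda>l. schur e m \<alpha> l +
           lincomb {\<beta>\<in>Z. (\<beta>, \<alpha>) \<in> r \<and> \<not> sim e M \<beta> \<alpha>} (u \<alpha>) (schur e m) l)) \<and>
     (\<forall>\<alpha>\<in>Z. \<forall>\<beta>\<in>Z. \<not> sim e M \<alpha> \<beta> \<longrightarrow>
        scal e m \<zeta> (P SPlus (Lam e M \<alpha>)) (P SMinus (Lam e M \<beta>)) = 0))"

definition Iset :: "nat \<Rightarrow> (nat \<Rightarrow> nat) \<Rightarrow> (nat \<Rightarrow> nat) set" where
  "Iset e m = (\<Pi>\<^sub>E k\<in>{..<e}. {..<m k})"

text \<open>The residue class of \<open>k \<mp> 1\<close> modulo \<open>e\<close> for the sign \<open>\<plusminus>\<close>.\<close>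

fun nbr :: "nat \<Rightarrow> pm \<Rightarrow> nat \<Rightarrow> nat" where
  "nbr e SPlus k = (k + e - 1) mod e"
| "nbr e SMinus k = (k + 1) mod e"

definition Top :: "nat \<Rightarrow> pm \<Rightarrow> (nat \<Rightarrow> nat) \<Rightarrow> mpol \<Rightarrow> mpol" where
  "Top e s i = msubst (\<lambda>(k, j). if k < e \<and> j = i k
                         then Const qF * Var (nbr e s k, i (nbr e s k)) else Var (k, j))"

definition pairing :: "nat \<Rightarrow> arr \<Rightarrow> (nat \<Rightarrow> nat) \<Rightarrow> nat" where
  "pairing e \<beta> i = (\<Sum>k<e. lookup \<beta> (k, i k))"

definition moved :: "nat \<Rightarrow> pm \<Rightarrow> (nat \<Rightarrow> nat) \<Rightarrow> arr \<Rightarrow> arr" where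
  "moved e s i \<beta> =
     (THE \<gamma>. Top e s i (monom_arr \<beta>) = Const (qF ^ pairing e \<beta> i) * monom_arr \<gamma>)"

definition Dop :: "nat \<Rightarrow> (nat \<Rightarrow> nat) \<Rightarrow> pm \<Rightarrow> mpol \<Rightarrow> mpol" where
  "Dop e m s f = mquot
     (\<Sum>w\<in>Sm e m. of_int (sign w) *
        (\<Sum>i\<in>Iset e m. monom_arr (moved e s i (act w (delta e m))) *
           Const (tF ^ pairing e (act w (delta e m)) i) * Top e s i f))
     (alternant (Sm e m) (delta e m))"

definition Eop :: "nat \<Rightarrow> (nat \<Rightarrow> nat) \<Rightarrow> pm \<Rightarrow> mpol \<Rightarrow> mpol" where
  "Eop e m s f = (let M = (\<Sum>k<e. m k) in
     Const (tF powi (- int M)) * Dop e m s f -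
     Const (\<Sum>i\<in>Iset e m. tF powi (int (pairing e (delta e m) i) - int M)) * f)"

text \<open>
  The limit of the operators \<^const>\<open>Eop\<close> requires that they commute with restriction. For \<open>e = 1\<close>
  they do. For \<open>e \<ge> 2\<close> they do so only up to a scalar: for \<open>e = 2\<close> one has \<open>E 1 = 0\<close> at
  \<open>m = (1,1)\<close>, but \<open>E 1 = t\<^sup>-\<^sup>4(1 + t\<^sup>2) - t\<^sup>-\<^sup>4(1 + t)\<^sup>2 = -2t\<^sup>-\<^sup>3\<close> at \<open>m = (2,2)\<close>. Therefore scalars
  \<open>c l\<close> are added at the levels \<open>(m\<^sub>0 + l, \<dots>, m\<^bsub>e-1\<^esub> + l)\<close>. The choice \<open>c = 0\<close> gives the
  operators \<^const>\<open>Eop\<close> themselves; taking for \<open>c l\<close> the sum of \<open>t\<close> to the power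
  \<open>\<langle>\<delta>,i\<rangle> - M\<close> over those index sequences \<open>i\<close> for which the entries of \<open>\<delta>\<close> at the positions
  \<open>(k, i\<^sub>k)\<close> are not all equal gives operators that commute with restriction for every \<open>e\<close>.
\<close>

definition E_level ::
  "nat \<Rightarrow> (nat \<Rightarrow> nat) \<Rightarrow> (nat \<Rightarrow> fld) \<Rightarrow> pm \<Rightarrow> nat \<Rightarrow> mpol \<Rightarrow> mpol" where
  "E_level e m c s l f = Eop e (shift m l) s f + Const (c l) * f"

definition restriction_compatible :: "nat \<Rightarrow> (nat \<Rightarrow> nat) \<Rightarrow> (nat \<Rightarrow> fld) \<Rightarrow> bool" where
  "restriction_compatible e m c \<longleftrightarrow> (\<forall>s l. \<forall>f\<in>Xi_fin e (shift m (Suc l)).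
     restr (shift m l) (E_level e m c s (Suc l) f) = E_level e m c s l (restr (shift m l) f))"

definition E_lim ::
  "nat \<Rightarrow> (nat \<Rightarrow> nat) \<Rightarrow> (nat \<Rightarrow> fld) \<Rightarrow> pm \<Rightarrow> symfun \<Rightarrow> symfun" where
  "E_lim e m c s f = (\<lambda>l. E_level e m c s l (f l))"

text \<open>Eigenvalues of a square matrix indexed by a finite set \<open>A\<close>, taken in an algebraic closure of
  \<open>F\<close>.\<close>

definition eigenvalue_on :: "'i set \<Rightarrow> ('i \<Rightarrow> 'i \<Rightarrow> fld) \<Rightarrow> fld alg_closure \<Rightarrow> bool" where
  "eigenvalue_on A H \<kappa> \<longleftrightarrow> (\<exists>v. (\<exists>\<alpha>\<in>A. v \<alpha> \<noteq> 0) \<and>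
     (\<forall>\<alpha>\<in>A. (\<Sum>\<beta>\<in>A. to_ac (H \<alpha> \<beta>) * v \<beta>) = \<kappa> * v \<alpha>))"

definition conjecture_A ::
  "nat \<Rightarrow> (nat \<Rightarrow> nat) \<Rightarrow> nat \<Rightarrow> (pm \<Rightarrow> arr \<Rightarrow> arr \<Rightarrow> fld) \<Rightarrow> bool" where
  "conjecture_A e m n h \<longleftrightarrow> (\<forall>s. \<forall>\<F>\<in>families e m n. \<forall>\<F>'\<in>families e m n. \<F> \<noteq> \<F>' \<longrightarrow>
     \<not> (\<exists>\<kappa>. eigenvalue_on \<F> (h s) \<kappa> \<and> eigenvalue_on \<F>' (h s) \<kappa>))"

definition characterized ::
  "nat \<Rightarrow> (nat \<Rightarrow> nat) \<Rightarrow> nat \<Rightarrow> nat \<Rightarrow> (nat \<Rightarrow> fld) \<Rightarrow> (pm \<Rightarrow> arr \<Rightarrow> arr \<Rightarrow> fld) \<Rightarrow>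
     pm \<Rightarrow> (arr \<Rightarrow> symfun) \<Rightarrow> bool" where
  "characterized e m L n c h s Q \<longleftrightarrow> (let M = shift m L; Z = Z00 e M n in
     (\<forall>\<alpha>\<in>Z. Q (Lam e M \<alpha>) \<in> Xi e m) \<and>
     (\<exists>w. \<forall>\<alpha>\<in>Z. Q (Lam e M \<alpha>) =
        (\<lambda>l. msym e m \<alpha> l + lincomb {\<beta>\<in>Z. below e M \<beta> \<alpha>} (w \<alpha>) (msym e m) l)) \<and>
     (\<forall>\<alpha>\<in>Z. E_lim e m c s (Q (Lam e M \<alpha>)) =
        lincomb {\<beta>\<in>Z. sim e M \<beta> \<alpha>} (h s \<alpha>) (\<lambda>\<beta>. Q (Lam e M \<beta>))))"

end

theory Submission
  imports Defs "HOL-Library.Product_Lexorder"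
begin

text \<open>
  Orthogonality makes the Macdonald functions eigenvectors of \<open>E\<^sup>\<plusminus>\<close> up to a matrix inside each
  family, and the absence of common eigenvalues leaves room for only one system of this kind, whose
  coordinates over the monomial functions are then triangular for the order by dominance.

  All functions involved are homogeneous of degree \<open>n\<close>, and such a function is determined by its
  image in the polynomials with at least \<open>n\<close> variables in each block (\<open>hom_Xi_eqI\<close>). There,
  multiplication by \<open>a\<^sub>\<delta>\<close> turns symmetric polynomials into alternating ones, which are controlled by
  their coefficients at the exponents \<open>\<Lambda>(\<beta>)\<close>.

  Triangularity. Up to permutations of all positions, the exponents of \<open>m\<^sub>\<alpha> a\<^sub>\<delta>\<close> and of the
  numerator \<open>a\<^sub>\<delta> D m\<^sub>\<alpha>\<close> have the form \<open>\<delta> + w(\<alpha>)\<close>. Its sorted entries are dominated by those of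
  \<open>\<delta> + \<alpha>\<close>, with equality only for \<open>w(\<alpha>) = \<alpha>\<close> (\<open>dominated_permuted\<close>, \<open>permuted_ent_eq\<close>). Therefore
  the Schur functions are unitriangular over the monomial functions (\<open>schur_unitriangular\<close>), and
  the matrix of \<open>E\<^sup>\<plusminus>\<close> has nonzero entries only for \<open>\<beta> \<sim> \<alpha>\<close> or \<open>\<beta> < \<alpha>\<close> (\<open>Dop_mono_triangular\<close>).

  Adjointness. Let \<open>B\<close> be the sesquilinear form for which the monomials are orthonormal. If
  \<open>q = t\<close>, the numerator \<open>a\<^sub>\<delta> D\<^sup>\<plusminus> f\<close> is the sum of the polynomials \<open>T\<^sup>\<plusminus>\<^sub>i(a\<^sub>\<delta> f)\<close>, and \<open>T\<^sup>+\<^sub>i\<close> and \<open>T\<^sup>-\<^sub>i\<close>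
  are adjoint for \<open>B\<close>, because they permute the monomials up to powers of \<open>t\<close>. In low degrees the
  adjoint of the multiplication by a power sum acts on \<open>a\<^sub>\<delta>\<close> times polynomials in the power sums as
  a multiple of a derivative (\<open>down_pmono\<close>); so the products \<open>p\<^sub>\<alpha> a\<^sub>\<delta>\<close> are orthogonal for \<open>B\<close> with
  square norms proportional to \<open>z\<^sub>\<alpha>\<close>, and for \<open>q = t\<close> the scalar product is \<open>B(f a\<^sub>\<delta>, g a\<^sub>\<delta>)\<close> up to a
  constant. For general \<open>q\<close> one has \<open>T\<^sub>q p = (1 - u) p + u T\<^sub>t p\<close> on a power sum \<open>p\<close>,
  where \<open>u\<close> is the factor of \<open>z\<^sub>\<alpha>(q,t)\<close> that belongs to \<open>p\<close> (\<open>TT_ps_interpolate\<close>). Expanding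
  products binomially and moving the unaffected power sums to the other side reduces the claim to
  \<open>q = t\<close> (\<open>Num_adjoint\<close>). Hence \<open>\<langle>E\<^sup>+ f, g\<rangle> = \<langle>f, E\<^sup>- g\<rangle> + \<kappa> \<langle>f, g\<rangle>\<close> for a scalar \<open>\<kappa>\<close>
  (\<open>SF_E_adjoint\<close>).

  Eigenvectors. The difference \<open>R\<close> of \<open>E\<^sup>+ P\<^sup>+\<^sub>\<alpha>\<close> and the sum of the \<open>h\<^sub>\<alpha>\<^sub>\<beta> P\<^sup>+\<^sub>\<beta>\<close> over \<open>\<beta> \<sim> \<alpha>\<close> only
  involves families before that of \<open>\<alpha>\<close> in the order \<open>\<prec>\<close>. It is orthogonal to all \<open>P\<^sup>-\<^sub>\<gamma>\<close>: if the
  family of \<open>\<gamma>\<close> comes before that of \<open>\<alpha>\<close>, by moving \<open>E\<^sup>+\<close> to the other side, and otherwise because of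
  its support. As the form is nondegenerate, \<open>R = 0\<close> (\<open>orthogonal_eigen\<close>).

  Sylvester equations. In coordinates \<open>W\<close> over the monomial functions the eigenvector property
  reads \<open>W H = H' W\<close>, where \<open>H'\<close> is the block diagonal part of \<open>H\<close>. As \<open>H\<close> is triangular, each block
  of \<open>W\<close> between different families satisfies \<open>W H\<^sub>2 = H\<^sub>1 W\<close> with blocks \<open>H\<^sub>1\<close>, \<open>H\<^sub>2\<close> of \<open>H\<close>, once the
  blocks with larger second index vanish or agree for two solutions. A nonzero solution would give
  \<open>H\<^sub>1\<close> and \<open>H\<^sub>2\<close> a common eigenvalue (\<open>intertwiner_common_eigenvalue\<close>). This propagation
  (\<open>eigen_system_zero\<close>) restricts \<open>W\<close> to \<open>\<beta> = \<alpha>\<close> and \<open>\<beta> < \<alpha>\<close>, and it shows uniqueness. The order \<open>\<prec>\<close>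
  does not occur in the characterizing properties, so that the functions do not depend on it.
\<close>


section \<open>The coefficient field and its conjugation\<close>

text \<open>Characteristic \<open>0\<close> makes alternating polynomials vanish at exponents with a repeated entry,
  and the numbers \<open>z\<^sub>\<alpha>\<close> and the orders of the symmetric groups invertible.\<close>

instance fract :: ("{idom, ring_char_0}") ring_char_0
proof
  show "inj (of_nat :: nat \<Rightarrow> 'a fract)"
    by (rule injI) (simp add: Fract_of_nat_eq[symmetric] eq_fract)
qed

lemma fld_cases:
  fixes x :: fld
  obtains a b where "x = Fract a b" "b \<noteq> 0"
  by (rule Fract_cases) auto

lemma cnj_pp_add: "cnj_pp (a + b) = cnj_pp a + cnj_pp b"
  unfolding cnj_pp_def by (intro poly_eqI) (simp add: coeff_map_poly)

lemma cnj_pp_1: "cnj_pp 1 = 1"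
  unfolding cnj_pp_def by (intro poly_eqI) (simp add: coeff_map_poly)

lemma cnj_pp_invol: "cnj_pp (cnj_pp a) = a"
  unfolding cnj_pp_def by (intro poly_eqI) (simp add: coeff_map_poly)

lemma cnj_F_add [simp]: "cnj_F (x + y) = cnj_F x + cnj_F y"
  by (rule fld_cases[of x], rule fld_cases[of y])
     (simp add: cnj_F_Fract cnj_pp_add cnj_pp_mult cnj_pp_eq_0_iff)

lemma cnj_F_mult [simp]: "cnj_F (x * y) = cnj_F x * cnj_F y"
  by (rule fld_cases[of x], rule fld_cases[of y])
     (simp add: cnj_F_Fract cnj_pp_mult cnj_pp_eq_0_iff)

lemma cnj_F_1 [simp]: "cnj_F 1 = 1"
  by (simp add: One_fract_def cnj_F_Fract cnj_pp_1)

lemma cnj_F_0 [simp]: "cnj_F 0 = 0"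
  using cnj_F_add[of 0 0] by simp

lemma cnj_F_invol [simp]: "cnj_F (cnj_F x) = x"
  by (rule fld_cases[of x]) (simp add: cnj_F_Fract cnj_pp_invol cnj_pp_eq_0_iff)

lemma cnj_F_minus [simp]: "cnj_F (- x) = - cnj_F x"
  using cnj_F_add[of x "- x"] by (simp add: eq_neg_iff_add_eq_0 add.commute)

lemma cnj_F_diff [simp]: "cnj_F (x - y) = cnj_F x - cnj_F y"
  using cnj_F_add[of x "- y"] by simp

lemma cnj_F_eq_0 [simp]: "cnj_F x = 0 \<longleftrightarrow> x = 0"
  by (metis cnj_F_0 cnj_F_invol)

lemma cnj_F_inverse [simp]: "cnj_F (inverse x) = inverse (cnj_F x)"
proof (cases "x = 0")
  case False
  then have "cnj_F x * cnj_F (inverse x) = 1"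
    by (simp flip: cnj_F_mult)
  then show ?thesis by (rule inverse_unique[symmetric])
qed simp

lemma cnj_F_divide [simp]: "cnj_F (x / y) = cnj_F x / cnj_F y"
  by (simp add: divide_inverse)

lemma cnj_F_power [simp]: "cnj_F (x ^ k) = cnj_F x ^ k"
  by (induction k) simp_all

lemma cnj_F_powi [simp]: "cnj_F (x powi k) = cnj_F x powi k"
  by (simp add: power_int_def)

lemma cnj_F_of_nat [simp]: "cnj_F (of_nat k) = of_nat k"
  by (induction k) simp_all

lemma cnj_F_of_int [simp]: "cnj_F (of_int k) = of_int k"
  by (cases k rule: int_cases2) simp_all

lemma cnj_F_sum [simp]: "cnj_F (sum f A) = (\<Sum>x\<in>A. cnj_F (f x))"
  by (induction A rule: infinite_finite_induct) simp_all

lemma cnj_F_prod [simp]: "cnj_F (prod f A) = (\<Prod>x\<in>A. cnj_F (f x))"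
  by (induction A rule: infinite_finite_induct) simp_all

lemma cnj_F_qF [simp]: "cnj_F qF = qF"
proof -
  have "cnj_pp [:[:0, 1:]:] = [:[:0, 1:]:]"
    by (simp add: cnj_pp_def map_poly_pCons)
  then show ?thesis by (simp add: qF_def cnj_F_Fract cnj_pp_1)
qed

lemma cnj_F_tF [simp]: "cnj_F tF = tF"
proof -
  have "cnj_pp [:0, 1:] = [:0, 1:]"
    by (simp add: cnj_pp_def map_poly_pCons)
  then show ?thesis by (simp add: tF_def cnj_F_Fract cnj_pp_1)
qed

lemma cnj_F_cF [simp]: "cnj_F (cF c) = cF (cnj c)"
proof -
  have "cnj_pp [:[:c:]:] = [:[:cnj c:]:]"
    by (simp add: cnj_pp_def map_poly_pCons)
  then show ?thesis by (simp add: cF_def cnj_F_Fract cnj_pp_1)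
qed

lemma cF_mult: "cF (a * b) = cF a * cF b"
  by (simp add: cF_def)

lemma cF_1 [simp]: "cF 1 = 1"
  by (simp add: cF_def One_fract_def pCons_one)

lemma cF_0 [simp]: "cF 0 = 0"
  by (simp add: cF_def Zero_fract_def)

lemma cF_add: "cF (a + b) = cF a + cF b"
  by (simp add: cF_def)

lemma cF_sum: "cF (sum f A) = (\<Sum>x\<in>A. cF (f x))"
  by (induction A rule: infinite_finite_induct) (simp_all add: cF_add)

lemma cF_of_nat: "cF (of_nat k) = of_nat k"
  by (induction k) (simp_all add: cF_add)

lemma tF_nonzero [simp]: "tF \<noteq> 0"
  by (simp add: tF_def Zero_fract_def eq_fract)

lemma qF_nonzero [simp]: "qF \<noteq> 0"
  by (simp add: qF_def Zero_fract_def eq_fract)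

lemma Fract_power: "Fract a 1 ^ k = Fract (a ^ k) (1::'a::idom)"
  by (induction k) (simp_all add: One_fract_def)

text \<open>These are the factors of \<open>z\<^sub>\<alpha>(q,t)\<close>; at \<open>q = 0\<close> or \<open>t = 0\<close> the equations \<open>c q\<^sup>r = 1\<close> and
  \<open>c t\<^sup>r = 1\<close> would read \<open>0 = 1\<close>.\<close>

lemma one_minus_q_nonzero:
  assumes "r \<ge> 1" shows "1 - cF c * qF ^ r \<noteq> 0"
proof
  assume "1 - cF c * qF ^ r = 0"
  then have "cF c * qF ^ r = 1" by simp
  then have eq: "[:[:c:]:] * [:[:0, 1:]:] ^ r = (1 :: complex poly poly)"
    by (simp only: cF_def qF_def Fract_power One_fract_def mult_fract) (simp add: eq_fract)
  have "poly (poly ([:[:c:]:] * [:[:0, 1:]:] ^ r) 0) 0 = (0::complex)"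
    using assms by (simp add: zero_power)
  with eq show False by simp
qed

lemma one_minus_t_nonzero:
  assumes "r \<ge> 1" shows "1 - cF c * tF ^ r \<noteq> 0"
proof
  assume "1 - cF c * tF ^ r = 0"
  then have "cF c * tF ^ r = 1" by simp
  then have eq: "[:[:c:]:] * [:0, 1:] ^ r = (1 :: complex poly poly)"
    by (simp only: cF_def tF_def Fract_power One_fract_def mult_fract) (simp add: eq_fract)
  have "poly ([:[:c:]:] * [:0, 1:] ^ r) 0 = (0::complex poly)"
    using assms by (simp add: zero_power)
  with eq show False by simp
qed

section \<open>Polynomials: monomials, substitution, permutation of variables\<close>

lemma monom_arr_0 [simp]: "monom_arr 0 = 1"
  by (simp add: monom_arr_def)

lemma monom_arr_add: "monom_arr (\<beta> + \<gamma>) = monom_arr \<beta> * monom_arr \<gamma>"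
  by (simp add: monom_arr_def mult_single)

lemma Const_0 [simp]: "Const 0 = 0" by (simp add: Const_def)
lemma Const_1 [simp]: "Const 1 = 1" by (simp add: Const_def)
lemma Const_add: "Const (a + b) = Const a + Const b" by (simp add: Const_def single_add)
lemma Const_mult: "Const (a * b) = Const a * Const b" by (simp add: Const_def mult_single)
lemma Const_minus: "Const (- a) = - Const a" by (simp add: Const_def single_uminus)
lemma Const_diff: "Const (a - b) = Const a - Const b" by (simp add: Const_def single_diff)
lemma Const_power: "Const (a ^ k) = Const a ^ k"
  by (induction k) (simp_all add: Const_mult)
lemma Const_of_int: "Const (of_int k) = of_int k" by (simp add: Const_def)
lemma Const_of_nat: "Const (of_nat k) = of_nat k" by (simp add: Const_def)
lemma Const_sum: "Const (sum f A) = (\<Sum>x\<in>A. Const (f x))"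
  by (induction A rule: infinite_finite_induct) (simp_all add: Const_add)
lemma Const_prod: "Const (prod f A) = (\<Prod>x\<in>A. Const (f x))"
  by (induction A rule: infinite_finite_induct) (simp_all add: Const_mult)

lemma Const_mult_monom: "Const c * monom_arr \<beta> = Poly_Mapping.single \<beta> c"
  by (simp add: Const_def monom_arr_def mult_single)

lemma lookup_Const_mult [simp]: "lookup (Const c * f) \<beta> = c * lookup f \<beta>"
proof -
  have "Const c * f = Poly_Mapping.map ((*) c) f"
    by (simp add: Const_def mult_map_scale_conv_mult)
  then show ?thesis by (simp add: Poly_Mapping.map.rep_eq when_def)
qed

lemma lookup_of_int_mult [simp]: "lookup (of_int k * f) \<beta> = of_int k * lookup (f::mpol) \<beta>"
  by (simp flip: Const_of_int)

lemma lookup_monom: "lookup (monom_arr \<gamma>) \<beta> = (if \<beta> = \<gamma> then 1 else 0)"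
  by (simp add: monom_arr_def lookup_single when_def)

lemma keys_monom [simp]: "keys (monom_arr \<beta>) = {\<beta>}"
  by (simp add: monom_arr_def)

lemma mpol_expand: "f = (\<Sum>\<beta>\<in>keys f. Const (lookup f \<beta>) * monom_arr \<beta>)"
  by (rule poly_mapping_eqI)
     (simp add: lookup_sum lookup_monom if_distrib[of "\<lambda>x. _ * x"] sum.delta in_keys_iff cong: if_cong)

lemma mpol_induct [case_names monom add]:
  assumes "\<And>c \<beta>. Q (Const c * monom_arr \<beta>)" "\<And>f g. Q f \<Longrightarrow> Q g \<Longrightarrow> Q (f + g)"
  shows "Q (f::mpol)"
proof -
  have "Q 0" using assms(1)[of 0 0] by simp
  then have "Q (\<Sum>\<beta>\<in>A. Const (lookup f \<beta>) * monom_arr \<beta>)" for A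
    by (induction A rule: infinite_finite_induct) (auto intro: assms)
  from this[of "keys f"] show ?thesis by (simp only: mpol_expand[symmetric])
qed

lemma lookup_monom_mult: "lookup (monom_arr \<beta> * f) (\<beta> + \<gamma>) = lookup (f::mpol) \<gamma>"
proof (induction f rule: mpol_induct)
  case (monom c \<delta>)
  have eq: "monom_arr \<beta> * (Const c * monom_arr \<delta>) = Const c * monom_arr (\<beta> + \<delta>)"
    by (simp add: monom_arr_add ac_simps)
  show ?case unfolding eq by (simp add: lookup_monom)
qed (simp add: distrib_left lookup_add)

definition meval :: "(nat \<times> nat \<Rightarrow> mpol) \<Rightarrow> arr \<Rightarrow> mpol" where
  "meval \<sigma> \<beta> = (\<Prod>v\<in>keys \<beta>. \<sigma> v ^ lookup \<beta> v)"

lemma meval_superset: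
  assumes "finite A" "keys \<beta> \<subseteq> A"
  shows "meval \<sigma> \<beta> = (\<Prod>v\<in>A. \<sigma> v ^ lookup \<beta> v)"
  unfolding meval_def using assms by (intro prod.mono_neutral_left) (auto simp: in_keys_iff)

lemma meval_add: "meval \<sigma> (\<beta> + \<gamma>) = meval \<sigma> \<beta> * meval \<sigma> \<gamma>"
proof -
  let ?A = "keys \<beta> \<union> keys \<gamma>"
  have "finite ?A" "keys \<beta> \<subseteq> ?A" "keys \<gamma> \<subseteq> ?A" "keys (\<beta> + \<gamma>) \<subseteq> ?A"
    using Poly_Mapping.keys_add[of \<beta> \<gamma>] by auto
  then show ?thesis
    by (simp add: meval_superset[of ?A] lookup_add power_add prod.distrib)
qed

lemma msubst_superset:
  assumes "finite A" "keys f \<subseteq> A"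
  shows "msubst \<sigma> f = (\<Sum>\<beta>\<in>A. Const (lookup f \<beta>) * meval \<sigma> \<beta>)"
  unfolding msubst_def meval_def[symmetric] using assms
  by (intro sum.mono_neutral_left) (auto simp: in_keys_iff)

lemma msubst_add: "msubst \<sigma> (f + g) = msubst \<sigma> f + msubst \<sigma> g"
proof -
  let ?A = "keys f \<union> keys g"
  have "finite ?A" "keys f \<subseteq> ?A" "keys g \<subseteq> ?A" "keys (f + g) \<subseteq> ?A"
    using Poly_Mapping.keys_add[of f g] by auto
  then show ?thesis
    by (simp add: msubst_superset[of ?A] lookup_add Const_add distrib_right sum.distrib)
qed

lemma msubst_monom_c: "msubst \<sigma> (Const c * monom_arr \<beta>) = Const c * meval \<sigma> \<beta>"
  by (subst msubst_superset[of "{\<beta>}"]) (auto simp: Const_mult_monom)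

lemma msubst_monom: "msubst \<sigma> (monom_arr \<beta>) = meval \<sigma> \<beta>"
  using msubst_monom_c[of \<sigma> 1 \<beta>] by simp

lemma msubst_0 [simp]: "msubst \<sigma> 0 = 0" by (simp add: msubst_def)

lemma msubst_Const [simp]: "msubst \<sigma> (Const c) = Const c"
  using msubst_monom_c[of \<sigma> c 0] by (simp add: meval_def)

lemma msubst_1 [simp]: "msubst \<sigma> 1 = 1"
  using msubst_Const[of \<sigma> 1] by simp

lemma msubst_mult: "msubst \<sigma> (f * g) = msubst \<sigma> f * msubst \<sigma> g"
proof (induction f rule: mpol_induct)
  case f: (monom c \<beta>)
  show ?case
  proof (induction g rule: mpol_induct)
    case (monom d \<gamma>)
    have "(Const c * monom_arr \<beta>) * (Const d * monom_arr \<gamma>) = Const (c * d) * monom_arr (\<beta> + \<gamma>)"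
      by (simp add: Const_mult monom_arr_add)
    then show ?case
      by (simp only: msubst_monom_c meval_add) (simp add: Const_mult)
  qed (simp add: distrib_left msubst_add)
qed (simp add: distrib_right msubst_add)

lemma msubst_sum: "msubst \<sigma> (sum f A) = (\<Sum>x\<in>A. msubst \<sigma> (f x))"
  by (induction A rule: infinite_finite_induct) (simp_all add: msubst_add)

lemma msubst_prod: "msubst \<sigma> (prod f A) = (\<Prod>x\<in>A. msubst \<sigma> (f x))"
  by (induction A rule: infinite_finite_induct) (simp_all add: msubst_mult)

lemma msubst_power: "msubst \<sigma> (f ^ k) = msubst \<sigma> f ^ k"
  by (induction k) (simp_all add: msubst_mult)

lemma msubst_of_int [simp]: "msubst \<sigma> (of_int k) = of_int k"
  by (simp flip: Const_of_int)

lemma msubst_Var [simp]: "msubst \<sigma> (Var v) = \<sigma> v"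
  by (simp add: Var_def msubst_monom meval_def)

lemma msubst_comp: "msubst \<sigma> (msubst \<tau> f) = msubst (\<lambda>v. msubst \<sigma> (\<tau> v)) f"
proof (induction f rule: mpol_induct)
  case (monom c \<beta>)
  then show ?case
    by (simp add: msubst_monom_c msubst_monom msubst_mult meval_def msubst_prod msubst_power)
qed (simp add: msubst_add)

lemma arr_expand: "finite A \<Longrightarrow> keys \<beta> \<subseteq> A \<Longrightarrow> \<beta> = (\<Sum>v\<in>A. Poly_Mapping.single v (lookup (\<beta>::arr) v))"
  by (rule poly_mapping_eqI)
     (auto simp: lookup_sum lookup_single when_def sum.delta in_keys_iff)

lemma monom_sum: "monom_arr (sum f A) = (\<Prod>x\<in>A. monom_arr (f x))"
  by (induction A rule: infinite_finite_induct) (simp_all add: monom_arr_add)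

lemma monom_scale: "monom_arr (Poly_Mapping.single v k) = Var v ^ k"
proof (induction k)
  case (Suc k)
  have "Poly_Mapping.single v (Suc k) = Poly_Mapping.single v 1 + Poly_Mapping.single v k"
    by (simp flip: single_add)
  then show ?case using Suc by (simp add: monom_arr_add Var_def)
qed simp

lemma meval_Var: "meval Var \<beta> = monom_arr \<beta>"
proof -
  have "monom_arr \<beta> = monom_arr (\<Sum>v\<in>keys \<beta>. Poly_Mapping.single v (lookup \<beta> v))"
    by (rule arg_cong[where f = monom_arr], rule arr_expand) auto
  then show ?thesis by (simp add: meval_def monom_sum monom_scale)
qed

abbreviation pinv :: "('a \<Rightarrow> 'b) \<Rightarrow> 'b \<Rightarrow> 'a" where "pinv \<equiv> inv_into UNIV"

lemma lookup_act:
  assumes "bij w" shows "lookup (act w \<beta>) v = lookup \<beta> (pinv w v)"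
proof -
  have "inj (pinv w)" using assms by (simp add: bij_imp_bij_inv bij_is_inj)
  then show ?thesis by (simp add: act_def map_key.rep_eq)
qed

lemma lookup_act_apply:
  assumes "bij w" shows "lookup (act w \<beta>) (w v) = lookup \<beta> v"
  using assms by (simp add: lookup_act bij_is_inj)

lemma act_eqI:
  assumes "bij w" "\<And>v. lookup \<beta> v = lookup \<gamma> (w v)"
  shows "act w \<beta> = \<gamma>"
  by (rule poly_mapping_eqI) (simp add: lookup_act assms bij_is_surj surj_f_inv_f)

lemma act_add: "bij w \<Longrightarrow> act w (\<beta> + \<gamma>) = act w \<beta> + act w \<gamma>"
  by (rule act_eqI) (simp_all add: lookup_add lookup_act_apply)

lemma act_comp: "bij w \<Longrightarrow> bij w' \<Longrightarrow> act w (act w' \<beta>) = act (w \<circ> w') \<beta>"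
  by (rule poly_mapping_eqI) (simp add: lookup_act bij_comp o_inv_distrib)

lemma act_id [simp]: "act id \<beta> = \<beta>"
  by (rule act_eqI) simp_all

lemma act_inv [simp]: "bij w \<Longrightarrow> act (pinv w) (act w \<beta>) = \<beta>" "bij w \<Longrightarrow> act w (act (pinv w) \<beta>) = \<beta>"
  by (rule act_eqI; simp add: bij_imp_bij_inv lookup_act bij_is_inj bij_is_surj surj_f_inv_f inv_inv_eq)+

lemma act_inj: "bij w \<Longrightarrow> act w \<beta> = act w \<gamma> \<longleftrightarrow> \<beta> = \<gamma>"
  by (metis act_inv(1))

lemma keys_act: "bij w \<Longrightarrow> keys (act w \<beta>) = w ` keys \<beta>"
  by (force simp: in_keys_iff lookup_act image_iff bij_is_inj bij_is_surj surj_f_inv_f)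

lemma total_superset: "finite A \<Longrightarrow> keys \<beta> \<subseteq> A \<Longrightarrow> total \<beta> = (\<Sum>v\<in>A. lookup \<beta> v)"
  unfolding total_def by (intro sum.mono_neutral_left) (auto simp: in_keys_iff)

lemma total_add [simp]: "total (\<beta> + \<gamma>) = total \<beta> + total \<gamma>"
proof -
  let ?A = "keys \<beta> \<union> keys \<gamma>"
  have "finite ?A" "keys \<beta> \<subseteq> ?A" "keys \<gamma> \<subseteq> ?A" "keys (\<beta> + \<gamma>) \<subseteq> ?A"
    using Poly_Mapping.keys_add[of \<beta> \<gamma>] by auto
  then show ?thesis by (simp add: total_superset[of ?A] lookup_add sum.distrib)
qed

lemma total_act [simp]: "bij w \<Longrightarrow> total (act w \<beta>) = total \<beta>"
proof -
  assume w: "bij w"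
  have "total (act w \<beta>) = (\<Sum>v\<in>w ` keys \<beta>. lookup (act w \<beta>) v)"
    by (simp add: total_def keys_act[OF w])
  also have "\<dots> = (\<Sum>v\<in>keys \<beta>. lookup (act w \<beta>) (w v))"
    using w by (subst sum.reindex) (auto intro: inj_on_subset[OF bij_is_inj])
  finally show ?thesis by (simp add: lookup_act_apply[OF w] total_def)
qed

lemma total_single [simp]: "total (Poly_Mapping.single v k) = k"
  by (simp add: total_def)

text \<open>A substitution that permutes the variables and scales them permutes the coefficients up to
  scalars; the action of permutations and the operators \<open>T\<close> are of this form.\<close>

lemma meval_monomial:
  assumes "bij w"
  shows "meval (\<lambda>v. Const (a v) * Var (w v)) \<beta> = Const (\<Prod>v\<in>keys \<beta>. a v ^ lookup \<beta> v) * monom_arr (act w \<beta>)"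
proof -
  have "monom_arr (act w \<beta>) = (\<Prod>v\<in>w ` keys \<beta>. Var v ^ lookup (act w \<beta>) v)"
    using meval_Var[of "act w \<beta>"] by (simp add: meval_def keys_act[OF assms])
  also have "\<dots> = (\<Prod>v\<in>keys \<beta>. Var (w v) ^ lookup \<beta> v)"
    using assms by (subst prod.reindex) (auto intro: inj_on_subset[OF bij_is_inj] simp: lookup_act_apply)
  finally show ?thesis
    by (simp add: meval_def power_mult_distrib prod.distrib Const_prod Const_power)
qed

lemma lookup_msubst_monomial:
  assumes "bij w"
  shows "lookup (msubst (\<lambda>v. Const (a v) * Var (w v)) f) (act w \<beta>)
       = (\<Prod>v\<in>keys \<beta>. a v ^ lookup \<beta> v) * lookup f \<beta>"
proof (induction f rule: mpol_induct)
  case (monom c \<gamma>)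
  then show ?case
    by (simp add: msubst_monom_c meval_monomial[OF assms] lookup_monom act_inj[OF assms])
qed (simp add: msubst_add lookup_add distrib_left)

lemma lookup_msubst_perm:
  assumes "bij w" shows "lookup (msubst (Var \<circ> w) f) (act w \<beta>) = lookup f \<beta>"
  using lookup_msubst_monomial[OF assms, of "\<lambda>_. 1" f \<beta>] by (simp add: o_def)

lemma msubst_perm_monom: "bij w \<Longrightarrow> msubst (Var \<circ> w) (monom_arr \<beta>) = monom_arr (act w \<beta>)"
  using meval_monomial[of w "\<lambda>_. 1" \<beta>] by (simp add: msubst_monom o_def)

lemma keys_mult_elim:
  assumes "lookup (f * g) \<gamma> \<noteq> 0"
  obtains \<alpha> \<beta> where "\<gamma> = \<alpha> + \<beta>" "lookup (f::mpol) \<alpha> \<noteq> 0" "lookup g \<beta> \<noteq> 0"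
  using assms keys_mult[of f g] by (fastforce simp: in_keys_iff[symmetric])

definition supp_in :: "(nat \<times> nat) set \<Rightarrow> mpol \<Rightarrow> bool" where
  "supp_in A f \<longleftrightarrow> (\<forall>\<beta>\<in>keys f. keys \<beta> \<subseteq> A)"

definition homog :: "nat \<Rightarrow> mpol \<Rightarrow> bool" where
  "homog d f \<longleftrightarrow> (\<forall>\<beta>\<in>keys f. total \<beta> = d)"

lemma supp_in_alt: "supp_in A f \<longleftrightarrow> (\<forall>\<beta>. lookup f \<beta> \<noteq> 0 \<longrightarrow> keys \<beta> \<subseteq> A)"
  by (auto simp: supp_in_def in_keys_iff)
lemma homog_alt: "homog d f \<longleftrightarrow> (\<forall>\<beta>. lookup f \<beta> \<noteq> 0 \<longrightarrow> total \<beta> = d)"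
  by (auto simp: homog_def in_keys_iff)

lemma supp_in_0 [simp]: "supp_in A 0" by (simp add: supp_in_def)
lemma homog_0 [simp]: "homog d 0" by (simp add: homog_def)
lemma supp_in_1 [simp]: "supp_in A 1" by (simp add: supp_in_def)
lemma supp_in_add: "supp_in A f \<Longrightarrow> supp_in A g \<Longrightarrow> supp_in A (f + g)"
  by (auto simp: supp_in_alt lookup_add) (metis add.right_neutral subset_iff)
lemma homog_add: "homog d f \<Longrightarrow> homog d g \<Longrightarrow> homog d (f + g)"
  by (auto simp: homog_alt lookup_add) (metis add.right_neutral)
lemma supp_in_sum: "(\<And>x. x \<in> B \<Longrightarrow> supp_in A (f x)) \<Longrightarrow> supp_in A (sum f B)"
  by (induction B rule: infinite_finite_induct) (simp_all add: supp_in_add)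
lemma homog_sum: "(\<And>x. x \<in> B \<Longrightarrow> homog d (f x)) \<Longrightarrow> homog d (sum f B)"
  by (induction B rule: infinite_finite_induct) (simp_all add: homog_add)
lemma supp_in_Const: "supp_in A f \<Longrightarrow> supp_in A (Const c * f)"
  by (auto simp: supp_in_alt)
lemma homog_Const: "homog d f \<Longrightarrow> homog d (Const c * f)"
  by (auto simp: homog_alt)
lemma supp_in_mult: "supp_in A f \<Longrightarrow> supp_in A g \<Longrightarrow> supp_in A (f * g)"
  unfolding supp_in_alt
proof (intro allI impI)
  fix \<gamma> assume f: "\<forall>\<beta>. lookup f \<beta> \<noteq> 0 \<longrightarrow> keys \<beta> \<subseteq> A" and g: "\<forall>\<beta>. lookup g \<beta> \<noteq> 0 \<longrightarrow> keys \<beta> \<subseteq> A"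
    and "lookup (f * g) \<gamma> \<noteq> 0"
  then obtain \<alpha> \<beta> where "\<gamma> = \<alpha> + \<beta>" "lookup f \<alpha> \<noteq> 0" "lookup g \<beta> \<noteq> 0"
    by (elim keys_mult_elim)
  with f g show "keys \<gamma> \<subseteq> A" using Poly_Mapping.keys_add[of \<alpha> \<beta>] by blast
qed
lemma homog_mult: "homog d f \<Longrightarrow> homog d' g \<Longrightarrow> homog (d + d') (f * g)"
  unfolding homog_alt
proof (intro allI impI)
  fix \<gamma> assume "\<forall>\<beta>. lookup f \<beta> \<noteq> 0 \<longrightarrow> total \<beta> = d" "\<forall>\<beta>. lookup g \<beta> \<noteq> 0 \<longrightarrow> total \<beta> = d'"
    and "lookup (f * g) \<gamma> \<noteq> 0"
  then show "total \<gamma> = d + d'" by (elim keys_mult_elim) simp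
qed
lemma supp_in_prod: "(\<And>x. x \<in> B \<Longrightarrow> supp_in A (f x)) \<Longrightarrow> supp_in A (prod f B)"
  by (induction B rule: infinite_finite_induct) (simp_all add: supp_in_mult)
lemma supp_in_power: "supp_in A f \<Longrightarrow> supp_in A (f ^ k)"
  by (induction k) (simp_all add: supp_in_mult)
lemma homog_power: "homog d f \<Longrightarrow> homog (k * d) (f ^ k)"
  by (induction k) (auto simp: homog_mult homog_def[of 0] total_def)
lemma supp_in_monom: "keys \<beta> \<subseteq> A \<Longrightarrow> supp_in A (monom_arr \<beta>)" by (simp add: supp_in_def)
lemma homog_monom: "homog (total \<beta>) (monom_arr \<beta>)" by (simp add: homog_def)
lemma homog_prod: "(\<And>x. x \<in> B \<Longrightarrow> homog (d x) (f x)) \<Longrightarrow> homog (sum d B) (prod f B)"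
  by (induction B rule: infinite_finite_induct) (auto simp: homog_mult homog_def[of 0] total_def)

section \<open>Arrays, sorting, and alternating polynomials\<close>

lemma idx_iff [simp]: "(k, j) \<in> idx e m \<longleftrightarrow> k < e \<and> j < m k"
  by (simp add: idx_def)

lemma idx_Sigma: "idx e m = Sigma {..<e} (\<lambda>k. {..<m k})"
  by (auto simp: idx_def)

lemma finite_idx [simp]: "finite (idx e m)"
  by (simp add: idx_Sigma)

lemma Sm_bij: "w \<in> Sm e m \<Longrightarrow> bij w"
  unfolding Sm_def by (blast intro: permutes_bij)

lemma Sm_permutes: "w \<in> Sm e m \<Longrightarrow> w permutes idx e m"
  by (simp add: Sm_def)

lemma Sm_fst: "w \<in> Sm e m \<Longrightarrow> fst (w v) = fst v"
  unfolding Sm_def by blast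

lemma SmI: "w permutes idx e m \<Longrightarrow> (\<And>v. fst (w v) = fst v) \<Longrightarrow> w \<in> Sm e m"
  unfolding Sm_def by blast

lemma Sm_permutation: "w \<in> Sm e m \<Longrightarrow> permutation w"
  unfolding permutation_permutes using finite_idx Sm_permutes by blast

lemma finite_Sm [simp]: "finite (Sm e m)"
  by (rule finite_subset[OF _ finite_permutations[OF finite_idx]]) (auto simp: Sm_def)

lemma Sm_id [simp]: "id \<in> Sm e m"
  by (rule SmI) (simp_all add: permutes_id)

lemma Sm_comp: "w \<in> Sm e m \<Longrightarrow> w' \<in> Sm e m \<Longrightarrow> w \<circ> w' \<in> Sm e m"
  by (rule SmI) (simp_all add: permutes_compose Sm_permutes Sm_fst)

lemma Sm_inv: assumes "w \<in> Sm e m" shows "pinv w \<in> Sm e m"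
proof -
  have "fst (pinv w v) = fst v" for v
    using Sm_bij[OF assms] Sm_fst[OF assms] by (metis bij_inv_eq_iff)
  then show ?thesis using assms by (intro SmI) (simp_all add: Sm_permutes permutes_inv)
qed

lemma Sm_in_idx: "w \<in> Sm e m \<Longrightarrow> w v \<in> idx e m \<longleftrightarrow> v \<in> idx e m"
  by (rule permutes_in_image[OF Sm_permutes])

lemma keys_act_Sm: "w \<in> Sm e m \<Longrightarrow> keys (act w \<beta>) \<subseteq> idx e m \<longleftrightarrow> keys \<beta> \<subseteq> idx e m"
  using Sm_in_idx[of w e m] by (auto simp: keys_act[OF Sm_bij])

lemma sum_Sm_left: assumes "w0 \<in> Sm e m"
  shows "(\<Sum>w\<in>Sm e m. f w) = (\<Sum>w\<in>Sm e m. f (w0 \<circ> w))"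
proof -
  have "w0 \<circ> pinv w0 = id" "pinv w0 \<circ> w0 = id"
    using Sm_bij[OF assms] by (simp_all add: bij_is_inj bij_is_surj flip: surj_iff)
  then show ?thesis
    using assms
    by (intro sum.reindex_bij_witness[of _ "\<lambda>w. w0 \<circ> w" "\<lambda>w. pinv w0 \<circ> w"]) (auto simp: Sm_comp Sm_inv o_assoc)
qed

lemma blockperm_Sm:
  assumes "\<And>k. k < e \<Longrightarrow> p k permutes {..<m k}"
  shows "(\<lambda>(k, j). if k < e then (k, p k j) else (k, j)) \<in> Sm e m" (is "?w \<in> _")
proof -
  have "inj_on ?w (idx e m)"
    using assms by (auto simp: inj_on_def) (metis injD permutes_inj)
  moreover have "?w ` idx e m \<subseteq> idx e m"
    using assms permutes_in_image by fastforce
  ultimately have "bij_betw ?w (idx e m) (idx e m)"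
    by (simp add: bij_betw_def endo_inj_surj)
  moreover have "?w v = v" if "v \<notin> idx e m" for v
    using that assms permutes_not_in by (cases v) fastforce
  ultimately have "?w permutes idx e m" by (rule bij_imp_permutes)
  then show ?thesis by (rule SmI) (simp add: case_prod_unfold)
qed

definition blk :: "(nat \<Rightarrow> nat) \<Rightarrow> arr \<Rightarrow> nat \<Rightarrow> nat multiset" where
  "blk m \<beta> k = image_mset (\<lambda>j. lookup \<beta> (k, j)) (mset_set {..<m k})"

lemma lookup_outside: "keys \<beta> \<subseteq> A \<Longrightarrow> v \<notin> A \<Longrightarrow> lookup \<beta> v = 0"
  by (meson in_keys_iff subsetD)

lemma arr_eqI:
  assumes "keys \<beta> \<subseteq> idx e m" "keys \<gamma> \<subseteq> idx e m"
    and "\<And>k j. k < e \<Longrightarrow> j < m k \<Longrightarrow> lookup \<beta> (k, j) = lookup \<gamma> (k, j)"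
  shows "\<beta> = \<gamma>"
proof (rule poly_mapping_eqI)
  fix v show "lookup \<beta> v = lookup \<gamma> v"
    using assms by (cases v, cases "v \<in> idx e m") (auto simp: lookup_outside)
qed

lemma blk_eq_imp_act:
  assumes "keys \<beta> \<subseteq> idx e m" "keys \<gamma> \<subseteq> idx e m" "\<And>k. k < e \<Longrightarrow> blk m \<beta> k = blk m \<gamma> k"
  obtains w where "w \<in> Sm e m" "act w \<beta> = \<gamma>"
proof -
  have "\<exists>p. p permutes {..<m k} \<and> (\<forall>j<m k. lookup \<beta> (k, j) = lookup \<gamma> (k, p j))" if "k < e" for k
  proof -
    have "image_mset (\<lambda>j. lookup \<beta> (k, j)) (mset_set {..<m k}) = image_mset (\<lambda>j. lookup \<gamma> (k, j)) (mset_set {..<m k})"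
      using assms(3)[OF that] by (simp add: blk_def)
    then obtain p where "p permutes {..<m k}" "\<forall>j\<in>{..<m k}. lookup \<beta> (k, j) = lookup \<gamma> (k, p j)"
      by (rule image_mset_eq_implies_permutes[OF finite_lessThan])
    then show ?thesis by auto
  qed
  then obtain p where p: "\<And>k. k < e \<Longrightarrow> p k permutes {..<m k}"
    "\<And>k j. k < e \<Longrightarrow> j < m k \<Longrightarrow> lookup \<beta> (k, j) = lookup \<gamma> (k, p k j)"
    by metis
  define w where "w = (\<lambda>(k, j). if k < e then (k, p k j) else (k, j))"
  have w: "w \<in> Sm e m" unfolding w_def using p(1) by (rule blockperm_Sm)
  have "lookup \<beta> v = lookup \<gamma> (w v)" for v
  proof (cases "v \<in> idx e m")
    case True
    then show ?thesis by (cases v) (auto simp: w_def p)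
  next
    case False
    then show ?thesis using Sm_in_idx[OF w, of v] assms(1,2) by (simp add: lookup_outside)
  qed
  then have "act w \<beta> = \<gamma>" by (intro act_eqI Sm_bij[OF w])
  with w show ?thesis by (rule that)
qed

lemma blk_act:
  assumes "w \<in> Sm e m" "k < e"
  shows "blk m (act w \<beta>) k = blk m \<beta> k"
proof -
  have bij: "bij w" by (rule Sm_bij[OF assms(1)])
  have wi: "pinv w \<in> Sm e m" by (rule Sm_inv[OF assms(1)])
  define p where "p = (\<lambda>j. snd (pinv w (k, j)))"
  have p: "pinv w (k, j) = (k, p j)" for j
    using Sm_fst[OF wi, of "(k, j)"] by (simp add: p_def prod_eq_iff)
  have "inj p" 
    by (rule injI) (metis (full_types) p bij bij_imp_bij_inv bij_is_inj inj_eq prod.inject)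
  moreover have "p ` {..<m k} \<subseteq> {..<m k}"
    using Sm_in_idx[OF wi, of "(k, _)"] assms(2) by (auto simp: p)
  ultimately have "p ` {..<m k} = {..<m k}"
    by (simp add: endo_inj_surj inj_on_subset)
  then have "image_mset p (mset_set {..<m k}) = mset_set {..<m k}"
    using \<open>inj p\<close> by (simp add: image_mset_mset_set inj_on_subset)
  moreover have "blk m (act w \<beta>) k = image_mset (\<lambda>j. lookup \<beta> (k, j)) (image_mset p (mset_set {..<m k}))"
    by (simp add: blk_def lookup_act[OF bij] p multiset.map_comp o_def)
  ultimately show ?thesis by (simp add: blk_def)
qed

lemma epart_mono: "\<alpha> \<in> epart e \<Longrightarrow> i \<le> j \<Longrightarrow> lookup \<alpha> (k, j) \<le> lookup \<alpha> (k, i)"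
  using lift_Suc_antimono_le[of "\<lambda>j. lookup \<alpha> (k, j)" i j] by (simp add: epart_def)

lemma mset_map_blk: "mset (map (\<lambda>j. lookup \<beta> (k, j)) [0..<m k]) = blk m \<beta> k"
  by (simp add: blk_def atLeast0LessThan flip: mset_set_set)

lemma decreasing_unique:
  assumes "keys \<beta> \<subseteq> idx e m" "keys \<gamma> \<subseteq> idx e m" "\<And>k. k < e \<Longrightarrow> blk m \<beta> k = blk m \<gamma> k"
    and "\<And>k i j. k < e \<Longrightarrow> i \<le> j \<Longrightarrow> j < m k \<Longrightarrow> lookup \<beta> (k, j) \<le> lookup \<beta> (k, i)"
    and "\<And>k i j. k < e \<Longrightarrow> i \<le> j \<Longrightarrow> j < m k \<Longrightarrow> lookup \<gamma> (k, j) \<le> lookup \<gamma> (k, i)"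
  shows "\<beta> = \<gamma>"
proof (rule arr_eqI[OF assms(1,2)])
  fix k j assume k: "k < e" and j: "j < m k"
  let ?l = "\<lambda>\<beta>. map (\<lambda>j. lookup \<beta> (k, j)) [0..<m k]"
  have "sorted (rev (?l \<beta>))" "sorted (rev (?l \<gamma>))"
    using assms(4,5)[OF k] by (auto simp: sorted_rev_iff_nth_mono)
  moreover have "mset (rev (?l \<beta>)) = mset (rev (?l \<gamma>))"
    using assms(3)[OF k] by (simp only: mset_rev mset_map_blk)
  ultimately have "rev (?l \<beta>) = rev (?l \<gamma>)"
    by (metis properties_for_sort)
  then have "?l \<beta> = ?l \<gamma>" by (simp only: rev_is_rev_conv)
  from arg_cong[OF this, of "\<lambda>l. l ! j"] show "lookup \<beta> (k, j) = lookup \<gamma> (k, j)" using j by simp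
qed

definition mk_arr :: "nat \<Rightarrow> (nat \<Rightarrow> nat) \<Rightarrow> (nat \<times> nat \<Rightarrow> nat) \<Rightarrow> arr" where
  "mk_arr e m f = (\<Sum>v\<in>idx e m. Poly_Mapping.single v (f v))"

lemma lookup_mk_arr: "lookup (mk_arr e m f) v = (if v \<in> idx e m then f v else 0)"
  by (simp add: mk_arr_def lookup_sum lookup_single when_def sum.delta)

lemma keys_mk_arr: "keys (mk_arr e m f) \<subseteq> idx e m"
  by (auto simp: in_keys_iff lookup_mk_arr split: if_splits)

lemma lookup_delta: "lookup (delta e m) (k, j) = (if k < e \<and> j < m k then m k - 1 - j else 0)"
proof -
  have "delta e m = mk_arr e m (\<lambda>(k, j). m k - 1 - j)"
    unfolding delta_def mk_arr_def by (rule sum.cong) auto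
  then show ?thesis by (simp add: lookup_mk_arr)
qed

lemma keys_delta: "keys (delta e m) \<subseteq> idx e m"
  by (auto simp: in_keys_iff lookup_delta split: if_splits)

lemma sort_blocks:
  assumes "keys \<beta> \<subseteq> idx e m"
  obtains w \<alpha> where "w \<in> Sm e m" "act w \<beta> = \<alpha>" "\<alpha> \<in> epart e" "keys \<alpha> \<subseteq> idx e m"
proof -
  define xs where "xs = (\<lambda>k. rev (sort (map (\<lambda>j. lookup \<beta> (k, j)) [0..<m k])))"
  define \<alpha> where "\<alpha> = mk_arr e m (\<lambda>(k, j). xs k ! j)"
  have len: "length (xs k) = m k" for k by (simp add: xs_def)
  have l: "lookup \<alpha> (k, j) = (if k < e \<and> j < m k then xs k ! j else 0)" for k j
    by (simp add: \<alpha>_def lookup_mk_arr)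
  have keys: "keys \<alpha> \<subseteq> idx e m" unfolding \<alpha>_def by (rule keys_mk_arr)
  have dec: "xs k ! Suc j \<le> xs k ! j" if "Suc j < m k" for k j
  proof -
    have "sorted (rev (xs k))" by (simp add: xs_def)
    then show ?thesis using that len[of k] by (simp add: sorted_rev_iff_nth_Suc)
  qed
  have "\<alpha> \<in> epart e"
    using keys by (auto simp: epart_def l dec)
  moreover have "blk m \<beta> k = blk m \<alpha> k" if "k < e" for k
  proof -
    have "map (\<lambda>j. lookup \<alpha> (k, j)) [0..<m k] = xs k"
      using that by (intro nth_equalityI) (auto simp: l len)
    then have "blk m \<alpha> k = mset (xs k)" by (metis mset_map_blk)
    also have "\<dots> = blk m \<beta> k" by (simp add: xs_def mset_map_blk flip: mset_map)
    finally show ?thesis by simp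
  qed
  ultimately show ?thesis using keys assms that by (metis blk_eq_imp_act)
qed

lemma Lam_lookup: "lookup (Lam e m \<alpha>) v = lookup \<alpha> v + lookup (delta e m) v"
  by (simp add: Lam_def lookup_add)

lemma keys_Lam: "keys \<alpha> \<subseteq> idx e m \<Longrightarrow> keys (Lam e m \<alpha>) \<subseteq> idx e m"
  unfolding Lam_def using Poly_Mapping.keys_add[of \<alpha> "delta e m"] keys_delta[of e m] by blast

lemma Lam_inj: "Lam e m \<alpha> = Lam e m \<beta> \<longleftrightarrow> \<alpha> = \<beta>"
  by (simp add: Lam_def)

lemma Lam_strict:
  assumes "\<alpha> \<in> epart e" "k < e" "i < j" "j < m k"
  shows "lookup (Lam e m \<alpha>) (k, j) < lookup (Lam e m \<alpha>) (k, i)"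
  using epart_mono[OF assms(1), of i j k] assms by (simp add: Lam_lookup lookup_delta)

text \<open>The entries of \<open>\<Lambda>(\<alpha>)\<close> are strictly decreasing in each block, so that its stabilizer is
  trivial and its orbit contains no other array of this kind.\<close>

lemma act_Lam_eq:
  assumes "\<alpha> \<in> epart e" "\<beta> \<in> epart e" "keys \<alpha> \<subseteq> idx e m" "keys \<beta> \<subseteq> idx e m"
    and w: "w \<in> Sm e m" and eq: "act w (Lam e m \<alpha>) = Lam e m \<beta>"
  shows "\<alpha> = \<beta>" "w = id"
proof -
  have mono: "lookup (Lam e m \<gamma>) (k, j) \<le> lookup (Lam e m \<gamma>) (k, i)"
    if "\<gamma> \<in> epart e" "k < e" "i \<le> j" "j < m k" for \<gamma> k i j
    using Lam_strict[of \<gamma> e k i j m] that by (cases "i = j") (auto intro: less_imp_le)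
  have "Lam e m \<alpha> = Lam e m \<beta>"
  proof (rule decreasing_unique[OF keys_Lam[OF assms(3)] keys_Lam[OF assms(4)]])
    show "blk m (Lam e m \<alpha>) k = blk m (Lam e m \<beta>) k" if "k < e" for k
      using blk_act[OF w that, of "Lam e m \<alpha>"] eq by simp
  qed (use mono assms(1,2) in auto)
  then show 1: "\<alpha> = \<beta>" by (simp add: Lam_inj)
  have "w v = v" for v
  proof (cases "v \<in> idx e m")
    case True
    obtain k j where v: "v = (k, j)" by force
    obtain j' where wv: "w v = (k, j')" using Sm_fst[OF w, of v] v by (metis fst_conv prod.collapse)
    have *: "k < e" "j < m k" "j' < m k" using Sm_in_idx[OF w, of v] True v wv by auto
    have "lookup (Lam e m \<alpha>) (k, j') = lookup (Lam e m \<alpha>) (k, j)"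
      using lookup_act_apply[OF Sm_bij[OF w], of "Lam e m \<alpha>" v] eq 1 v wv by simp
    then have "j = j'"
      using Lam_strict[OF assms(1) *(1), of j j' m] Lam_strict[OF assms(1) *(1), of j' j m] * 
      by (metis nat_neq_iff)
    then show ?thesis using wv v by simp
  next
    case False
    then show ?thesis by (rule permutes_not_in[OF Sm_permutes[OF w]])
  qed
  then show "w = id" by auto
qed

text \<open>After sorting, the entries of a block are strictly decreasing, hence at least those of the
  staircase, and subtracting the staircase leaves a partition.\<close>

lemma strict_rep:
  assumes keys: "keys \<gamma> \<subseteq> idx e m"
    and inj: "\<And>k. k < e \<Longrightarrow> inj_on (\<lambda>j. lookup \<gamma> (k, j)) {..<m k}"
  obtains w \<alpha> where "w \<in> Sm e m" "act w (Lam e m \<alpha>) = \<gamma>" "\<alpha> \<in> epart e" "keys \<alpha> \<subseteq> idx e m"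
    "total \<gamma> = total \<alpha> + total (delta e m)"
proof -
  obtain w g where w: "w \<in> Sm e m" "act w \<gamma> = g" "g \<in> epart e" "keys g \<subseteq> idx e m"
    using sort_blocks[OF keys] .
  have lg: "lookup g v = lookup \<gamma> (pinv w v)" for v
    using w(2) by (metis lookup_act Sm_bij w(1))
  have strict: "lookup g (k, Suc j) < lookup g (k, j)" if "k < e" "Suc j < m k" for k j
  proof -
    have wi: "pinv w \<in> Sm e m" by (rule Sm_inv[OF w(1)])
    obtain i i' where i: "pinv w (k, j) = (k, i)" "pinv w (k, Suc j) = (k, i')"
      using Sm_fst[OF wi, of "(k, j)"] Sm_fst[OF wi, of "(k, Suc j)"] by (metis fst_conv prod.collapse)
    have "i \<noteq> i'" using i Sm_bij[OF wi] by (metis bij_pointE n_not_Suc_n prod.inject)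
    moreover have "i < m k" "i' < m k"
      using Sm_in_idx[OF wi, of "(k, j)"] Sm_in_idx[OF wi, of "(k, Suc j)"] i that by auto
    ultimately have "lookup g (k, Suc j) \<noteq> lookup g (k, j)"
      using inj[OF that(1)] by (auto simp: lg i inj_on_def)
    then show ?thesis using w(3) by (auto simp: epart_def le_less)
  qed
  have ge: "lookup g (k, j) \<ge> m k - 1 - j" if "k < e" "j < m k" for k j
    using that(2)
  proof (induction "m k - 1 - j" arbitrary: j)
    case (Suc d)
    then have "d = m k - 1 - Suc j" "Suc j < m k" by auto
    with Suc(1)[of "Suc j"] strict[OF that(1), of j] Suc(2) show ?case by linarith
  qed simp
  define \<alpha> where "\<alpha> = g - delta e m"
  have la: "lookup \<alpha> v = lookup g v - lookup (delta e m) v" for v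
    by (simp add: \<alpha>_def lookup_minus)
  have keys': "keys \<alpha> \<subseteq> idx e m"
  proof -
    have "keys \<alpha> \<subseteq> keys g" by (auto simp: in_keys_iff la)
    then show ?thesis using w(4) by simp
  qed
  have "\<alpha> \<in> epart e"
  proof -
    have "lookup \<alpha> (k, Suc j) \<le> lookup \<alpha> (k, j)" for k j
    proof (cases "k < e \<and> Suc j < m k")
      case True
      then show ?thesis using strict[of k j] by (auto simp: la lookup_delta)
    next
      case False
      then have "(k, Suc j) \<notin> idx e m" by simp
      then show ?thesis by (simp add: lookup_outside[OF keys'])
    qed
    then show ?thesis using keys' by (auto simp: epart_def)
  qed
  moreover have L: "Lam e m \<alpha> = g"
  proof (rule arr_eqI[OF keys_Lam[OF keys'] w(4)])
    fix k j assume "k < e" "j < m k"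
    then show "lookup (Lam e m \<alpha>) (k, j) = lookup g (k, j)"
      using le_add_diff_inverse2[OF ge[of k j]] by (simp add: Lam_lookup la lookup_delta)
  qed
  moreover have "act (pinv w) g = \<gamma>" using w(2) Sm_bij[OF w(1)] by auto
  moreover have "total \<gamma> = total \<alpha> + total (delta e m)"
    using w(2) L by (metis Lam_def total_add total_act Sm_bij w(1))
  ultimately show ?thesis using that[of "pinv w" \<alpha>] Sm_inv[OF w(1)] keys' by simp
qed

definition symmetric_poly :: "nat \<Rightarrow> (nat \<Rightarrow> nat) \<Rightarrow> mpol \<Rightarrow> bool" where
  "symmetric_poly e m f \<longleftrightarrow> (\<forall>w\<in>Sm e m. msubst (Var \<circ> w) f = f)"

definition alternating :: "nat \<Rightarrow> (nat \<Rightarrow> nat) \<Rightarrow> mpol \<Rightarrow> bool" where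
  "alternating e m F \<longleftrightarrow> (\<forall>w\<in>Sm e m. msubst (Var \<circ> w) F = of_int (sign w) * F)"

lemma symmetric_lookup:
  "symmetric_poly e m f \<Longrightarrow> w \<in> Sm e m \<Longrightarrow> lookup f (act w \<beta>) = lookup f \<beta>"
  by (metis lookup_msubst_perm Sm_bij symmetric_poly_def)

lemma symmetricI:
  assumes "\<And>w \<beta>. w \<in> Sm e m \<Longrightarrow> lookup f (act w \<beta>) = lookup f \<beta>"
  shows "symmetric_poly e m f"
  unfolding symmetric_poly_def
proof (intro ballI poly_mapping_eqI)
  fix w \<gamma> assume w: "w \<in> Sm e m"
  have "lookup (msubst (Var \<circ> w) f) (act w (act (pinv w) \<gamma>)) = lookup f (act (pinv w) \<gamma>)"
    by (rule lookup_msubst_perm[OF Sm_bij[OF w]])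
  then show "lookup (msubst (Var \<circ> w) f) \<gamma> = lookup f \<gamma>"
    using assms[OF Sm_inv[OF w], of \<gamma>] Sm_bij[OF w] by simp
qed

lemma of_int_sign_sq: "of_int (sign w) * (of_int (sign w) * x) = (x :: 'a::comm_ring_1)"
  by (simp add: sign_def)

lemma alternating_lookup:
  assumes "alternating e m F" "w \<in> Sm e m"
  shows "lookup F (act w \<beta>) = of_int (sign w) * lookup F \<beta>"
proof -
  have "lookup F \<beta> = of_int (sign w) * lookup F (act w \<beta>)"
    using assms lookup_msubst_perm[OF Sm_bij[OF assms(2)], of F \<beta>] by (simp add: alternating_def)
  then show ?thesis by (simp add: of_int_sign_sq)
qed

lemma symmetric_0 [simp]: "symmetric_poly e m 0" by (simp add: symmetric_poly_def)
lemma symmetric_1 [simp]: "symmetric_poly e m 1" by (simp add: symmetric_poly_def)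
lemma symmetric_add: "symmetric_poly e m f \<Longrightarrow> symmetric_poly e m g \<Longrightarrow> symmetric_poly e m (f + g)"
  by (simp add: symmetric_poly_def msubst_add)
lemma symmetric_mult: "symmetric_poly e m f \<Longrightarrow> symmetric_poly e m g \<Longrightarrow> symmetric_poly e m (f * g)"
  by (simp add: symmetric_poly_def msubst_mult)
lemma symmetric_Const: "symmetric_poly e m f \<Longrightarrow> symmetric_poly e m (Const c * f)"
  by (simp add: symmetric_poly_def msubst_mult)
lemma symmetric_sum: "(\<And>x. x \<in> B \<Longrightarrow> symmetric_poly e m (f x)) \<Longrightarrow> symmetric_poly e m (sum f B)"
  by (induction B rule: infinite_finite_induct) (simp_all add: symmetric_add)
lemma symmetric_prod: "(\<And>x. x \<in> B \<Longrightarrow> symmetric_poly e m (f x)) \<Longrightarrow> symmetric_poly e m (prod f B)"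
  by (induction B rule: infinite_finite_induct) (simp_all add: symmetric_mult)
lemma symmetric_power: "symmetric_poly e m f \<Longrightarrow> symmetric_poly e m (f ^ k)"
  by (induction k) (simp_all add: symmetric_mult)
lemma alternating_mult: "symmetric_poly e m f \<Longrightarrow> alternating e m F \<Longrightarrow> alternating e m (f * F)"
  by (simp add: symmetric_poly_def alternating_def msubst_mult mult_ac)
lemma alternating_Const: "alternating e m F \<Longrightarrow> alternating e m (Const c * F)"
  by (simp add: alternating_def msubst_mult mult_ac)
lemma alternating_0 [simp]: "alternating e m 0" by (simp add: alternating_def)
lemma alternating_add: "alternating e m F \<Longrightarrow> alternating e m G \<Longrightarrow> alternating e m (F + G)"
  by (simp add: alternating_def msubst_add distrib_left)
lemma alternating_sum: "(\<And>x. x \<in> B \<Longrightarrow> alternating e m (f x)) \<Longrightarrow> alternating e m (sum f B)"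
  by (induction B rule: infinite_finite_induct) (simp_all add: alternating_add)

abbreviation alt :: "nat \<Rightarrow> (nat \<Rightarrow> nat) \<Rightarrow> arr \<Rightarrow> mpol" where
  "alt e m \<gamma> \<equiv> alternant (Sm e m) \<gamma>"

abbreviation adelta :: "nat \<Rightarrow> (nat \<Rightarrow> nat) \<Rightarrow> mpol" where
  "adelta e m \<equiv> alt e m (delta e m)"

lemma alternating_alt: "alternating e m (alt e m \<gamma>)"
  unfolding alternating_def
proof
  fix w assume w: "w \<in> Sm e m"
  have "msubst (Var \<circ> w) (alt e m \<gamma>) = (\<Sum>w'\<in>Sm e m. of_int (sign w') * monom_arr (act (w \<circ> w') \<gamma>))"
    by (simp add: alternant_def msubst_sum msubst_mult msubst_perm_monom[OF Sm_bij[OF w]] act_comp[OF Sm_bij[OF w] Sm_bij])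
  also have "\<dots> = of_int (sign w) * (\<Sum>w'\<in>Sm e m. of_int (sign (w \<circ> w')) * monom_arr (act (w \<circ> w') \<gamma>))"
    unfolding sum_distrib_left
    by (intro sum.cong refl)
       (simp add: sign_compose Sm_permutation[OF w] Sm_permutation of_int_sign_sq mult.assoc)
  also have "\<dots> = of_int (sign w) * alt e m \<gamma>"
    unfolding alternant_def by (simp only: sum_Sm_left[OF w, of "\<lambda>w'. of_int (sign w') * monom_arr (act w' \<gamma>)"])
  finally show "msubst (Var \<circ> w) (alt e m \<gamma>) = of_int (sign w) * alt e m \<gamma>" .
qed

lemma lookup_alternant:
  "lookup (alternant G \<gamma>) \<beta> = (\<Sum>w\<in>G. if act w \<gamma> = \<beta> then of_int (sign w) else 0)"
  unfolding alternant_def lookup_sum lookup_of_int_mult lookup_monom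
  by (intro sum.cong) auto

lemma lookup_alternant_nonzero:
  assumes "lookup (alternant G \<gamma>) \<beta> \<noteq> 0" obtains w where "w \<in> G" "act w \<gamma> = \<beta>"
proof (rule ccontr)
  assume "\<not> thesis"
  with that have "\<forall>w\<in>G. act w \<gamma> \<noteq> \<beta>" by blast
  then have "lookup (alternant G \<gamma>) \<beta> = 0" unfolding lookup_alternant by (intro sum.neutral) simp
  with assms show False by simp
qed

lemma supp_in_alt': "keys \<gamma> \<subseteq> idx e m \<Longrightarrow> supp_in (idx e m) (alt e m \<gamma>)"
  unfolding supp_in_alt by (metis lookup_alternant_nonzero keys_act_Sm)

lemma homog_alt': "homog (total \<gamma>) (alt e m \<gamma>)"
  unfolding homog_alt by (metis lookup_alternant_nonzero total_act Sm_bij)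

lemma lookup_alt_Lam:
  assumes "\<alpha> \<in> epart e" "\<beta> \<in> epart e" "keys \<alpha> \<subseteq> idx e m" "keys \<beta> \<subseteq> idx e m"
  shows "lookup (alt e m (Lam e m \<alpha>)) (Lam e m \<beta>) = (if \<alpha> = \<beta> then 1 else 0)"
proof (cases "\<alpha> = \<beta>")
  case True
  have "lookup (alt e m (Lam e m \<alpha>)) (Lam e m \<beta>) = (\<Sum>w\<in>Sm e m. if w = id then 1 else 0)"
    unfolding lookup_alternant
    by (intro sum.cong refl) (use act_Lam_eq(2)[OF assms] True in \<open>auto simp: sign_id\<close>)
  then show ?thesis using True by (simp add: sum.delta)
next
  case False
  then have "lookup (alt e m (Lam e m \<alpha>)) (Lam e m \<beta>) = 0"
    using act_Lam_eq(1)[OF assms] lookup_alternant_nonzero by metis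
  with False show ?thesis by simp
qed

lemma transpose_Sm:
  assumes "k < e" "i < m k" "j < m k"
  shows "transpose (k, i) (k, j) \<in> Sm e m"
  using assms by (intro SmI) (auto simp: permutes_swap_id transpose_def)

lemma alternating_swap:
  assumes "alternating e m F" "k < e" "i < m k" "j < m k" "i \<noteq> j"
  shows "lookup F (act (transpose (k, i) (k, j)) \<beta>) = - lookup F \<beta>"
  using alternating_lookup[OF assms(1) transpose_Sm[of k e i m j], of \<beta>] assms(2-4) assms(5)
  by (simp add: sign_swap_id)

text \<open>The transposition of two positions with equal entries fixes the exponent and changes the
  sign.\<close>

lemma alternating_repeat:
  assumes "alternating e m F" "k < e" "i < m k" "j < m k" "i \<noteq> j" "lookup \<beta> (k, i) = lookup \<beta> (k, j)"
  shows "lookup F \<beta> = 0"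
proof -
  have "act (transpose (k, i) (k, j)) \<beta> = \<beta>"
    by (rule act_eqI) (use assms(6) in \<open>auto simp: transpose_def bij_swap_iff\<close>)
  then have "lookup F \<beta> = - lookup F \<beta>"
    using alternating_swap[OF assms(1-5), of \<beta>] by simp
  then have "2 * lookup F \<beta> = 0" by (simp add: eq_neg_iff_add_eq_0)
  then show ?thesis by simp
qed

lemma alternating_inj:
  assumes "alternating e m F" "lookup F \<beta> \<noteq> 0" "k < e"
  shows "inj_on (\<lambda>j. lookup \<beta> (k, j)) {..<m k}"
  using alternating_repeat[OF assms(1,3)] assms(2) by (auto simp: inj_on_def)

lemma alternating_rep:
  assumes "alternating e m F" "supp_in (idx e m) F" "lookup F \<gamma> \<noteq> 0"
  obtains w \<alpha> where "w \<in> Sm e m" "act w (Lam e m \<alpha>) = \<gamma>" "\<alpha> \<in> epart e" "keys \<alpha> \<subseteq> idx e m"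
    "total \<gamma> = total \<alpha> + total (delta e m)"
  using strict_rep[of \<gamma> e m thesis] alternating_inj[OF assms(1,3)] assms(2,3)
  by (auto simp: supp_in_alt)

lemma finite_bounded_arrays: "finite A \<Longrightarrow> finite {\<beta>::arr. keys \<beta> \<subseteq> A \<and> total \<beta> \<le> n}"
proof -
  assume A: "finite A"
  let ?S = "{\<beta>::arr. keys \<beta> \<subseteq> A \<and> total \<beta> \<le> n}"
  have "lookup \<beta> v \<le> n" if "\<beta> \<in> ?S" for \<beta> v
  proof (cases "v \<in> keys \<beta>")
    case True
    then have "lookup \<beta> v \<le> total \<beta>" unfolding total_def by (intro member_le_sum) auto
    with that show ?thesis by simp
  qed (simp add: in_keys_iff)
  then have "(\<lambda>\<beta>. restrict (lookup \<beta>) A) ` ?S \<subseteq> (\<Pi>\<^sub>E v\<in>A. {..n})" by auto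
  then have "finite ((\<lambda>\<beta>. restrict (lookup \<beta>) A) ` ?S)"
    by (rule finite_subset) (simp add: A finite_PiE)
  moreover have "inj_on (\<lambda>\<beta>. restrict (lookup \<beta>) A) ?S"
  proof (rule inj_onI)
    fix \<beta> \<gamma> assume *: "\<beta> \<in> ?S" "\<gamma> \<in> ?S" "restrict (lookup \<beta>) A = restrict (lookup \<gamma>) A"
    show "\<beta> = \<gamma>"
    proof (rule poly_mapping_eqI)
      fix v show "lookup \<beta> v = lookup \<gamma> v"
        using * by (cases "v \<in> A") (auto simp: lookup_outside dest: fun_cong[of _ _ v])
    qed
  qed
  ultimately show ?thesis by (rule finite_imageD)
qed

lemma finite_Z00 [simp]: "finite (Z00 e m n)"
  by (rule finite_subset[OF _ finite_bounded_arrays[OF finite_idx, of e m n]]) (auto simp: Z00_def)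

lemma alternating_rep_homog:
  assumes "alternating e m F" "supp_in (idx e m) F" "homog (d + total (delta e m)) F" "lookup F \<gamma> \<noteq> 0"
  obtains w \<alpha> where "w \<in> Sm e m" "act w (Lam e m \<alpha>) = \<gamma>" "\<alpha> \<in> Z00 e m d"
proof -
  obtain w \<alpha> where w: "w \<in> Sm e m" "act w (Lam e m \<alpha>) = \<gamma>" "\<alpha> \<in> epart e" "keys \<alpha> \<subseteq> idx e m"
    "total \<gamma> = total \<alpha> + total (delta e m)"
    using alternating_rep[OF assms(1,2,4)] .
  moreover have "total \<gamma> = d + total (delta e m)" using assms(3,4) by (auto simp: homog_alt)
  ultimately have "\<alpha> \<in> Z00 e m d" by (simp add: Z00_def)
  with w(1,2) show ?thesis by (rule that)
qed

text \<open>The alternants of the strictly decreasing exponents form a basis of the alternating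
  polynomials, and the coordinates can be read off at these exponents.\<close>

lemma alternating_expand:
  assumes F: "alternating e m F" "supp_in (idx e m) F" "homog (d + total (delta e m)) F"
  shows "F = (\<Sum>\<alpha>\<in>Z00 e m d. Const (lookup F (Lam e m \<alpha>)) * alt e m (Lam e m \<alpha>))" (is "F = ?G")
proof (rule poly_mapping_eqI)
  fix \<gamma>
  have altG: "alternating e m ?G"
    by (intro alternating_sum alternating_Const alternating_alt)
  have suppG: "supp_in (idx e m) ?G"
    by (intro supp_in_sum supp_in_Const supp_in_alt' keys_Lam) (auto simp: Z00_def)
  have homG: "homog (d + total (delta e m)) ?G"
  proof (intro homog_sum homog_Const)
    fix \<alpha> assume "\<alpha> \<in> Z00 e m d"
    then have "d + total (delta e m) = total (Lam e m \<alpha>)" by (simp add: Z00_def Lam_def)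
    then show "homog (d + total (delta e m)) (alt e m (Lam e m \<alpha>))" by (metis homog_alt')
  qed
  have at_Lam: "lookup F (Lam e m \<beta>) = lookup ?G (Lam e m \<beta>)" if "\<beta> \<in> Z00 e m d" for \<beta>
  proof -
    have "lookup ?G (Lam e m \<beta>) = (\<Sum>\<alpha>\<in>Z00 e m d. if \<alpha> = \<beta> then lookup F (Lam e m \<alpha>) else 0)"
      unfolding lookup_sum by (intro sum.cong refl) (use that in \<open>auto simp: lookup_alt_Lam Z00_def\<close>)
    then show ?thesis using that by (simp add: sum.delta)
  qed
  show "lookup F \<gamma> = lookup ?G \<gamma>"
  proof (cases "lookup F \<gamma> = 0 \<and> lookup ?G \<gamma> = 0")
    case False
    have "\<exists>w \<alpha>. w \<in> Sm e m \<and> act w (Lam e m \<alpha>) = \<gamma> \<and> \<alpha> \<in> Z00 e m d"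
    proof (cases "lookup F \<gamma> = 0")
      case True
      with False have nz: "lookup ?G \<gamma> \<noteq> 0" by auto
      show ?thesis
        by (rule alternating_rep_homog[OF altG suppG homG nz]) blast
    next
      case nz: False
      show ?thesis
        by (rule alternating_rep_homog[OF F nz]) blast
    qed
    then obtain w \<alpha> where w: "w \<in> Sm e m" "\<gamma> = act w (Lam e m \<alpha>)" "\<alpha> \<in> Z00 e m d" by blast
    show ?thesis
      unfolding w(2) alternating_lookup[OF F(1) w(1)] alternating_lookup[OF altG w(1)] at_Lam[OF w(3)] ..
  qed simp
qed

lemma alt_delta_nonzero: "adelta e m \<noteq> 0"
proof
  assume *: "adelta e m = 0"
  have "lookup (alt e m (Lam e m 0)) (Lam e m 0) = 1"
    using lookup_alt_Lam[of 0 e 0 m] by (simp add: epart_def)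
  then show False using * by (simp add: Lam_def)
qed

section \<open>Dominance\<close>

lemma sum_le_prefix:
  fixes a :: "nat \<Rightarrow> nat"
  assumes anti: "\<And>i j. i \<le> j \<Longrightarrow> a j \<le> a i" and "finite A"
  shows "sum a A \<le> sum a {..<card A}"
  using \<open>finite A\<close>
proof (induction "card A" arbitrary: A)
  case (Suc n)
  then have ne: "A \<noteq> {}" by auto
  let ?M = "Max A"
  have M: "?M \<in> A" using ne Suc.prems by simp
  have "A \<subseteq> {..?M}" using Suc.prems by auto
  then have "card A \<le> Suc ?M" by (metis card_atMost card_mono finite_atMost)
  then have "n \<le> ?M" using Suc.hyps(2) by simp
  have c: "card (A - {?M}) = n" using Suc.hyps(2) M Suc.prems by simp
  have "sum a A = sum a (A - {?M}) + a ?M"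
    using M Suc.prems by (simp add: sum.remove add.commute)
  also have "\<dots> \<le> sum a {..<n} + a n"
    using Suc.hyps(1)[of "A - {?M}"] c Suc.prems anti[OF \<open>n \<le> ?M\<close>] by (intro add_mono) auto
  finally show ?case using Suc.hyps(2) by (metis sum.lessThan_Suc)
qed simp

lemma sum_list_take: "sum_list (take i xs) = (\<Sum>j<min i (length xs). xs ! j)"
  by (simp add: sum_list_sum_nth atLeast0LessThan min.commute)

definition desc :: "nat multiset \<Rightarrow> nat list" where
  "desc S = rev (sorted_list_of_multiset S)"

lemma mset_desc [simp]: "mset (desc S) = S"
  by (simp add: desc_def)

lemma desc_inj: "desc S = desc S' \<longleftrightarrow> S = S'"
  by (metis mset_desc)

lemma desc_enum:
  assumes "finite I"
  obtains vs where "set vs = I" "distinct vs" "desc (image_mset f (mset_set I)) = map f vs"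
    "\<And>i j. i \<le> j \<Longrightarrow> j < length vs \<Longrightarrow> f (vs ! j) \<le> f (vs ! i)"
proof -
  obtain vs0 where vs0: "set vs0 = I" "distinct vs0" using finite_distinct_list[OF assms] by blast
  define us where "us = sort_key f vs0"
  have us: "set us = I" "distinct us" "sorted (map f us)" using vs0 by (simp_all add: us_def)
  have "mset (map f us) = image_mset f (mset_set I)"
    using us(1,2) by (metis mset_map mset_set_set)
  then have "sorted_list_of_multiset (image_mset f (mset_set I)) = map f us"
    using us(3) by (metis sorted_list_of_multiset_mset sorted_sort_id)
  then have "desc (image_mset f (mset_set I)) = map f (rev us)"
    by (simp add: desc_def rev_map)
  moreover have "f (rev us ! j) \<le> f (rev us ! i)" if "i \<le> j" "j < length (rev us)" for i j
  proof -
    have "sorted (rev (map f (rev us)))" using us(3) by (simp add: rev_map)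
    then show ?thesis using that by (simp add: sorted_rev_iff_nth_mono)
  qed
  ultimately show ?thesis using that[of "rev us"] us by simp
qed

text \<open>Together with \<open>desc_attained\<close>: the sum of the \<open>i\<close> largest entries is the maximum of the sums over
  \<open>i\<close> positions. Dominance is always verified by comparing such sums over sets of positions.\<close>

lemma sum_le_desc:
  assumes "finite I" "A \<subseteq> I"
  shows "sum f A \<le> sum_list (take (card A) (desc (image_mset f (mset_set I))))"
proof -
  obtain vs where vs: "set vs = I" "distinct vs" "desc (image_mset f (mset_set I)) = map f vs"
    "\<And>i j. i \<le> j \<Longrightarrow> j < length vs \<Longrightarrow> f (vs ! j) \<le> f (vs ! i)"
    using desc_enum[OF assms(1), of f] by metis
  define J where "J = {j. j < length vs \<and> vs ! j \<in> A}"
  define a where "a = (\<lambda>j. if j < length vs then f (vs ! j) else 0)"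
  have inj: "inj_on ((!) vs) J" using vs(2) by (auto simp: J_def inj_on_def nth_eq_iff_index_eq)
  have im: "(!) vs ` J = A" using vs(1) assms(2) by (fastforce simp: J_def in_set_conv_nth)
  have fin: "finite J" by (simp add: J_def)
  have card: "card J = card A" using inj im by (metis card_image)
  have "sum f A = sum a J"
    unfolding im[symmetric] sum.reindex[OF inj] by (rule sum.cong) (auto simp: J_def a_def)
  also have "\<dots> \<le> sum a {..<card J}"
    by (rule sum_le_prefix) (use vs(4) fin in \<open>auto simp: a_def\<close>)
  also have "card J \<le> length vs"
    using card_mono[of "{..<length vs}" J] by (auto simp: J_def)
  then have "sum a {..<card J} = sum_list (take (card J) (map f vs))"
    unfolding sum_list_take by (intro sum.cong) (auto simp: a_def)
  finally show ?thesis by (simp add: card vs(3))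
qed

lemma desc_attained:
  assumes "finite I" "i \<le> card I"
  obtains A where "A \<subseteq> I" "card A = i" "sum f A = sum_list (take i (desc (image_mset f (mset_set I))))"
proof -
  obtain vs where vs: "set vs = I" "distinct vs" "desc (image_mset f (mset_set I)) = map f vs"
    using desc_enum[OF assms(1), of f] by metis
  have len: "length vs = card I" using vs by (metis distinct_card)
  show ?thesis
  proof
    show "set (take i vs) \<subseteq> I" using vs(1) set_take_subset by fast
    show "card (set (take i vs)) = i" using vs(2) assms(2) len by (simp add: distinct_card)
    show "sum f (set (take i vs)) = sum_list (take i (desc (image_mset f (mset_set I))))"
      using vs(2,3) by (simp add: take_map sum_list_distinct_conv_sum_set)
  qed
qed

definition ent :: "nat \<Rightarrow> (nat \<Rightarrow> nat) \<Rightarrow> arr \<Rightarrow> nat multiset" where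
  "ent e m \<gamma> = image_mset (lookup \<gamma>) (mset_set (idx e m))"

lemma entries_ent: "entries e m \<alpha> = ent e m (Lam e m \<alpha>)"
  by (simp add: entries_def ent_def)

lemma lam_desc: "lam e m \<alpha> = desc (ent e m (Lam e m \<alpha>))"
  by (simp add: lam_def desc_def entries_ent)

lemma ent_act:
  assumes "p permutes idx e m" shows "ent e m (act p \<gamma>) = ent e m \<gamma>"
proof -
  have b: "bij p" using assms by (rule permutes_bij)
  have "lookup (act p \<gamma>) = lookup \<gamma> \<circ> pinv p" by (rule ext) (simp add: lookup_act[OF b])
  then have "ent e m (act p \<gamma>) = image_mset (lookup \<gamma>) (image_mset (pinv p) (mset_set (idx e m)))"
    by (simp add: ent_def multiset.map_comp)
  also have "image_mset (pinv p) (mset_set (idx e m)) = mset_set (idx e m)"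
    using permutes_inv[OF assms] by (subst image_mset_mset_set)
      (auto simp: permutes_image intro: inj_on_subset[OF permutes_inj])
  finally show ?thesis by (simp add: ent_def)
qed

text \<open>Moves the positions of \<open>A\<close> to the front of their blocks, where a partition has its largest
  entries.\<close>

definition initial_of :: "nat \<Rightarrow> (nat \<times> nat) set \<Rightarrow> (nat \<times> nat) set" where
  "initial_of e A = Sigma {..<e} (\<lambda>k. {..<card {v \<in> A. fst v = k}})"

lemma initial_of_act:
  assumes "w \<in> Sm e m" shows "initial_of e' (w ` A) = initial_of e' A"
proof -
  have "card {v \<in> w ` A. fst v = k} = card {v \<in> A. fst v = k}" for k
  proof -
    have "{v \<in> w ` A. fst v = k} = w ` {v \<in> A. fst v = k}" using Sm_fst[OF assms] by auto
    then show ?thesis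
      by (simp only: card_image[OF inj_on_subset[OF bij_is_inj[OF Sm_bij[OF assms]] subset_UNIV]])
  qed
  then show ?thesis by (simp add: initial_of_def)
qed

lemma sum_over_blocks:
  assumes "A \<subseteq> idx e m"
  shows "sum f A = (\<Sum>k<e. \<Sum>j\<in>{j. (k, j) \<in> A}. f (k, j))"
proof -
  have "A = Sigma {..<e} (\<lambda>k. {j. (k, j) \<in> A})" using assms by (auto simp: idx_def)
  moreover have "finite {j. (k, j) \<in> A}" for k
  proof -
    have "{j. (k, j) \<in> A} \<subseteq> {..<m k}" using assms by auto
    then show ?thesis by (rule finite_subset) simp
  qed
  ultimately show ?thesis by (subst sum.Sigma) auto
qed

lemma sum_idx: "sum f (idx e m) = (\<Sum>k<e. \<Sum>j<m k. f (k, j))"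
  unfolding idx_Sigma by (subst sum.Sigma) auto

lemma block_card:
  assumes "A \<subseteq> idx e m" shows "card {v \<in> A. fst v = k} = card {j. (k, j) \<in> A}"
proof -
  have "{v \<in> A. fst v = k} = Pair k ` {j. (k, j) \<in> A}" by force
  then show ?thesis by (simp add: card_image inj_on_def)
qed

lemma finite_block: "A \<subseteq> idx e m \<Longrightarrow> finite {j. (k, j) \<in> A}"
  by (rule finite_subset[of _ "{..<m k}"]) auto

lemma sum_le_initial:
  assumes "\<gamma> \<in> epart e" "A \<subseteq> idx e m"
  shows "sum (lookup \<gamma>) A \<le> sum (lookup \<gamma>) (initial_of e A)"
proof -
  have "sum (lookup \<gamma>) A \<le> (\<Sum>k<e. \<Sum>j<card {j. (k, j) \<in> A}. lookup \<gamma> (k, j))"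
    unfolding sum_over_blocks[OF assms(2)]
    by (intro sum_mono sum_le_prefix epart_mono[OF assms(1)] finite_block[OF assms(2)])
  also have "\<dots> = sum (lookup \<gamma>) (initial_of e A)"
    unfolding initial_of_def block_card[OF assms(2)] by (subst sum.Sigma) auto
  finally show ?thesis .
qed

lemma initial_of_idx:
  assumes "A \<subseteq> idx e m" shows "initial_of e A \<subseteq> idx e m" "card (initial_of e A) = card A"
proof -
  have le: "card {j. (k, j) \<in> A} \<le> m k" for k
  proof -
    have "{j. (k, j) \<in> A} \<subseteq> {..<m k}" using assms by auto
    from card_mono[OF _ this] show ?thesis by simp
  qed
  have "j < m k" if "j < card {j. (k, j) \<in> A}" for k j
    using that le[of k] by (rule less_le_trans)
  then show "initial_of e A \<subseteq> idx e m"
    unfolding initial_of_def block_card[OF assms] by auto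
  have "card A = (\<Sum>v\<in>A. 1)" by simp
  also have "\<dots> = (\<Sum>k<e. card {j. (k, j) \<in> A})" unfolding sum_over_blocks[OF assms] by simp
  also have "\<dots> = card (initial_of e A)"
    unfolding initial_of_def block_card[OF assms] by (simp add: card_SigmaI)
  finally show "card (initial_of e A) = card A" by simp
qed

lemma delta_epart: "delta e m \<in> epart e"
  using keys_delta[of e m] by (auto simp: epart_def lookup_delta)

lemma act_sum: assumes "w \<in> Sm e m"
  shows "sum (lookup (act w \<alpha>)) A = sum (lookup \<alpha>) (pinv w ` A)"
proof -
  have "inj (pinv w)" using Sm_bij[OF assms] by (simp add: bij_imp_bij_inv bij_is_inj)
  then show ?thesis
    by (subst sum.reindex) (auto simp: lookup_act[OF Sm_bij[OF assms]] intro: inj_on_subset)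
qed

lemma sum_act_le:
  assumes "\<alpha> \<in> epart e" "w \<in> Sm e m" "A \<subseteq> idx e m"
  shows "sum (lookup (act w \<alpha>)) A \<le> sum (lookup \<alpha>) (initial_of e A)"
proof -
  have "pinv w ` A \<subseteq> idx e m" using assms(3) Sm_in_idx[OF Sm_inv[OF assms(2)]] by auto
  from sum_le_initial[OF assms(1) this] show ?thesis
    by (simp add: act_sum[OF assms(2)] initial_of_act[OF Sm_inv[OF assms(2)]])
qed

lemma sum_list_desc: "finite I \<Longrightarrow> sum_list (desc (image_mset f (mset_set I))) = sum f I"
  by (simp flip: sum_mset_sum_list add: sum_unfold_sum_mset)

lemma length_desc: "length (desc S) = size S"
  by (metis mset_desc size_mset)

text \<open>Permuting a partition inside its blocks before adding the staircase can only make the sorted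
  sequence of all entries smaller: any \<open>i\<close> entries of the permuted array are bounded by the sum of
  the first entries in each block of the unpermuted one.\<close>

lemma dominated_permuted:
  assumes \<alpha>: "\<alpha> \<in> epart e" "keys \<alpha> \<subseteq> idx e m" and w: "w \<in> Sm e m"
  shows "dominated (desc (ent e m (delta e m + act w \<alpha>))) (desc (ent e m (Lam e m \<alpha>)))"
proof -
  let ?f = "lookup (delta e m + act w \<alpha>)" and ?g = "lookup (Lam e m \<alpha>)" and ?I = "idx e m"
  let ?F = "desc (image_mset ?f (mset_set ?I))" and ?G = "desc (image_mset ?g (mset_set ?I))"
  have "pinv w ` ?I = ?I"
    using permutes_image[OF permutes_inv[OF Sm_permutes[OF w]]] .
  then have "sum ?f ?I = sum ?g ?I"
    by (simp add: lookup_add Lam_lookup sum.distrib act_sum[OF w])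
  then have tot: "sum_list ?F = sum_list ?G" by (simp add: sum_list_desc)
  have len: "length ?F = card ?I" "length ?G = card ?I" by (simp_all add: length_desc)
  have "sum_list (take i ?F) \<le> sum_list (take i ?G)" for i
  proof (cases "i \<le> card ?I")
    case True
    obtain A where A: "A \<subseteq> ?I" "card A = i" "sum ?f A = sum_list (take i ?F)"
      using desc_attained[OF finite_idx True] by metis
    have "sum ?f A \<le> sum (lookup (delta e m)) (initial_of e A) + sum (lookup \<alpha>) (initial_of e A)"
      unfolding lookup_add sum.distrib
      by (rule add_mono[OF sum_le_initial[OF delta_epart A(1)] sum_act_le[OF \<alpha>(1) w A(1)]])
    also have "\<dots> = sum ?g (initial_of e A)" by (simp add: Lam_lookup sum.distrib add.commute)
    also have "\<dots> \<le> sum_list (take (card (initial_of e A)) ?G)"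
      by (intro sum_le_desc initial_of_idx A(1)) simp
    finally show ?thesis using A initial_of_idx(2)[OF A(1)] by simp
  qed (use tot len in simp)
  with tot show ?thesis by (simp add: dominated_def ent_def)
qed

lemma sum_prefix_sums: "(\<Sum>i<m. \<Sum>j<i. b j) = (\<Sum>j<m. (m - 1 - j) * (b j :: nat))"
proof (induction m)
  case (Suc m)
  have "(\<Sum>j<Suc m. (Suc m - 1 - j) * b j) = (\<Sum>j<m. (m - 1 - j) * b j + b j)"
  proof -
    have "(Suc m - 1 - j) * b j = (m - 1 - j) * b j + b j" if "j < m" for j
    proof -
      have "Suc m - 1 - j = Suc (m - 1 - j)" using that by simp
      then show ?thesis by simp
    qed
    then show ?thesis unfolding sum.lessThan_Suc by simp
  qed
  then show ?case using Suc by (simp add: sum.distrib)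
qed simp

text \<open>The sum of squares of all entries decides when the dominance is strict: it determines
  the pairing with the staircase, which is a sum of initial sums.\<close>

lemma permuted_ent_eq:
  assumes \<alpha>: "\<alpha> \<in> epart e" "keys \<alpha> \<subseteq> idx e m" and w: "w \<in> Sm e m"
    and eq: "ent e m (delta e m + act w \<alpha>) = ent e m (Lam e m \<alpha>)"
  shows "act w \<alpha> = \<alpha>"
proof -
  let ?b = "lookup (act w \<alpha>)" and ?a = "lookup \<alpha>" and ?d = "lookup (delta e m)" and ?I = "idx e m"
  have sq: "(\<Sum>v\<in>?I. h (lookup \<beta> v)) = sum_mset (image_mset h (ent e m \<beta>))" for h :: "nat \<Rightarrow> nat" and \<beta>
    by (simp add: ent_def sum_unfold_sum_mset multiset.map_comp o_def)
  have "(\<Sum>v\<in>?I. (?d v + ?b v)\<^sup>2) = (\<Sum>v\<in>?I. (?d v + ?a v)\<^sup>2)"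
    using sq[of "\<lambda>x. x\<^sup>2" "delta e m + act w \<alpha>"] sq[of "\<lambda>x. x\<^sup>2" "Lam e m \<alpha>"] eq
    by (simp add: lookup_add Lam_lookup add.commute)
  moreover have "(\<Sum>v\<in>?I. (?b v)\<^sup>2) = (\<Sum>v\<in>?I. (?a v)\<^sup>2)"
    using sq[of "\<lambda>x. x\<^sup>2" "act w \<alpha>"] sq[of "\<lambda>x. x\<^sup>2" \<alpha>] ent_act[OF Sm_permutes[OF w]] by simp
  ultimately have "2 * (\<Sum>v\<in>?I. ?d v * ?b v) = 2 * (\<Sum>v\<in>?I. ?d v * ?a v)"
    by (simp add: power2_sum sum.distrib sum_distrib_left mult.assoc)
  then have dd: "(\<Sum>v\<in>?I. ?d v * ?b v) = (\<Sum>v\<in>?I. ?d v * ?a v)" by simp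
  have pair: "(\<Sum>v\<in>?I. ?d v * h v) = (\<Sum>(k, i)\<in>?I. \<Sum>j<i. h (k, j))" for h :: "nat \<times> nat \<Rightarrow> nat"
  proof -
    have "(\<Sum>v\<in>?I. ?d v * h v) = (\<Sum>k<e. \<Sum>j<m k. (m k - 1 - j) * h (k, j))"
      unfolding sum_idx by (intro sum.cong refl) (simp add: lookup_delta)
    then show ?thesis by (simp add: sum_prefix_sums sum_idx)
  qed
  have le: "(\<Sum>j<i. ?b (k, j)) \<le> (\<Sum>j<i. ?a (k, j))" if "k < e" "i \<le> m k" for k i
  proof -
    let ?A = "Pair k ` {..<i}"
    have A: "?A \<subseteq> ?I" using that by auto
    have "initial_of e ?A = ?A"
    proof -
      have "{v \<in> ?A. fst v = k'} = (if k' = k then ?A else {})" for k' by auto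
      then have "card {v \<in> ?A. fst v = k'} = (if k' = k then i else 0)" for k'
        by (simp add: card_image inj_on_def)
      then show ?thesis using that(1) by (auto simp: initial_of_def split: if_splits)
    qed
    with sum_act_le[OF \<alpha>(1) w A] show ?thesis by (simp add: sum.reindex inj_on_def)
  qed
  have pre: "(\<Sum>j<i. ?b (k, j)) = (\<Sum>j<i. ?a (k, j))" if "k < e" "i < m k" for k i
    using sum_mono_inv[of "\<lambda>(k, i). \<Sum>j<i. ?b (k, j)" ?I "\<lambda>(k, i). \<Sum>j<i. ?a (k, j)" "(k, i)"]
      dd[unfolded pair] le that by auto
  have full: "(\<Sum>j<m k. ?b (k, j)) = (\<Sum>j<m k. ?a (k, j))" if "k < e" for k
  proof -
    have "(\<Sum>j<m k. lookup \<beta> (k, j)) = sum_mset (blk m \<beta> k)" for \<beta>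
      by (simp add: blk_def sum_unfold_sum_mset)
    then show ?thesis using blk_act[OF w that] by simp
  qed
  show ?thesis
  proof (rule arr_eqI)
    fix k j assume k: "k < e" "j < m k"
    have "(\<Sum>j<Suc j. ?b (k, j)) = (\<Sum>j<Suc j. ?a (k, j))"
      using pre[OF k(1), of "Suc j"] full[OF k(1)] k(2) by (cases "Suc j = m k") auto
    with pre[OF k] show "?b (k, j) = ?a (k, j)" by simp
  qed (use \<alpha>(2) keys_act_Sm[OF w] in auto)
qed

lemma dominated_trans: "dominated xs ys \<Longrightarrow> dominated ys zs \<Longrightarrow> dominated xs zs"
  unfolding dominated_def using le_trans by metis

lemma dominated_antisym:
  assumes "dominated xs ys" "dominated ys xs" "length xs = length ys" shows "xs = ys"
proof (rule nth_equalityI)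
  have eq: "sum_list (take i xs) = sum_list (take i ys)" for i
    using assms by (simp add: dominated_def eq_iff)
  fix i assume "i < length xs"
  then show "xs ! i = ys ! i"
    using eq[of "Suc i"] eq[of i] assms(3) by (simp add: take_Suc_conv_app_nth)
qed (rule assms(3))

lemma length_lam: "length (lam e m \<alpha>) = card (idx e m)"
  by (simp add: lam_desc length_desc ent_def)

lemma below_trans: "below e m \<alpha> \<beta> \<Longrightarrow> below e m \<beta> \<gamma> \<Longrightarrow> below e m \<alpha> \<gamma>"
  unfolding below_def by (metis dominated_trans dominated_antisym length_lam)

lemma below_irrefl: "\<not> below e m \<alpha> \<alpha>"
  by (simp add: below_def)

lemma sim_lam: "sim e m \<alpha> \<beta> \<longleftrightarrow> lam e m \<alpha> = lam e m \<beta>"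
  by (simp add: sim_def lam_desc desc_inj entries_ent)

lemma below_sim: "below e m \<alpha> \<beta> \<Longrightarrow> \<not> sim e m \<alpha> \<beta>"
  by (simp add: below_def sim_lam)

lemma below_sim_left: "sim e m \<alpha>' \<alpha> \<Longrightarrow> below e m \<alpha>' \<beta> \<longleftrightarrow> below e m \<alpha> \<beta>"
  by (simp add: below_def sim_lam)

lemma below_sim_right: "sim e m \<beta>' \<beta> \<Longrightarrow> below e m \<alpha> \<beta>' \<longleftrightarrow> below e m \<alpha> \<beta>"
  by (simp add: below_def sim_lam)

lemma finite_wf_below:
  assumes "finite Z"
  shows "wf {(\<beta>, \<alpha>). \<alpha> \<in> Z \<and> \<beta> \<in> Z \<and> below e m \<beta> \<alpha>}"
proof (rule finite_acyclic_wf)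
  let ?r = "{(\<beta>, \<alpha>). \<alpha> \<in> Z \<and> \<beta> \<in> Z \<and> below e m \<beta> \<alpha>}"
  show "finite ?r" by (rule finite_subset[OF _ finite_cartesian_product[OF assms assms]]) auto
  have "trans ?r" by (rule transI) (auto intro: below_trans)
  then show "acyclic ?r" by (simp add: acyclic_def below_irrefl)
qed

section \<open>Monomial symmetric polynomials and Schur polynomials\<close>

definition orbit :: "nat \<Rightarrow> (nat \<Rightarrow> nat) \<Rightarrow> arr \<Rightarrow> arr set" where
  "orbit e m \<alpha> = (\<lambda>w. act w \<alpha>) ` Sm e m"

text \<open>The product over the blocks of the usual monomial symmetric polynomials, as an orbit sum.\<close>

definition monsym :: "nat \<Rightarrow> (nat \<Rightarrow> nat) \<Rightarrow> arr \<Rightarrow> mpol" where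
  "monsym e m \<alpha> = (\<Sum>\<beta>\<in>orbit e m \<alpha>. monom_arr \<beta>)"

lemma finite_orbit [simp]: "finite (orbit e m \<alpha>)"
  by (simp add: orbit_def)

lemma lookup_mono: "lookup (monsym e m \<alpha>) \<beta> = (if \<beta> \<in> orbit e m \<alpha> then 1 else 0)"
  by (simp add: monsym_def lookup_sum lookup_monom sum.delta)

lemma keys_mono: "keys (monsym e m \<alpha>) = orbit e m \<alpha>"
  by (auto simp: in_keys_iff lookup_mono split: if_splits)

lemma orbit_act: assumes "w \<in> Sm e m" shows "act w \<beta> \<in> orbit e m \<alpha> \<longleftrightarrow> \<beta> \<in> orbit e m \<alpha>"
proof
  have *: "act w \<beta> \<in> orbit e m \<alpha>" if "w \<in> Sm e m" "\<beta> \<in> orbit e m \<alpha>" for w \<beta>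
    using that by (auto simp: orbit_def act_comp Sm_bij Sm_comp)
  show "act w \<beta> \<in> orbit e m \<alpha> \<Longrightarrow> \<beta> \<in> orbit e m \<alpha>"
    using *[OF Sm_inv[OF assms], of "act w \<beta>"] by (simp add: Sm_bij[OF assms])
qed (use assms in \<open>auto simp: orbit_def act_comp Sm_bij Sm_comp\<close>)

lemma orbit_self [simp]: "\<alpha> \<in> orbit e m \<alpha>"
  unfolding orbit_def by (rule image_eqI[of _ _ id]) auto

lemma symmetric_mono: "symmetric_poly e m (monsym e m \<alpha>)"
  by (rule symmetricI) (simp add: lookup_mono orbit_act)

lemma supp_mono: "keys \<alpha> \<subseteq> idx e m \<Longrightarrow> supp_in (idx e m) (monsym e m \<alpha>)"
  by (auto simp: supp_in_def keys_mono orbit_def keys_act_Sm)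

lemma homog_mono: "homog (total \<alpha>) (monsym e m \<alpha>)"
  by (auto simp: homog_def keys_mono orbit_def Sm_bij)

lemma orbit_epart:
  assumes "\<alpha> \<in> epart e" "keys \<alpha> \<subseteq> idx e m" "\<beta> \<in> epart e" "keys \<beta> \<subseteq> idx e m" "\<beta> \<in> orbit e m \<alpha>"
  shows "\<beta> = \<alpha>"
proof -
  obtain w where w: "w \<in> Sm e m" "\<beta> = act w \<alpha>" using assms(5) by (auto simp: orbit_def)
  show ?thesis
    by (rule decreasing_unique[OF assms(4,2)]) (use w blk_act epart_mono assms(1,3) in auto)
qed

lemma lookup_mono_Z:
  assumes "\<alpha> \<in> Z00 e m d" "\<beta> \<in> Z00 e m d'"
  shows "lookup (monsym e m \<alpha>) \<beta> = (if \<alpha> = \<beta> then 1 else 0)"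
  using assms orbit_epart[of \<alpha> e m \<beta>] by (auto simp: lookup_mono Z00_def)

lemma lookup_vanishes:
  "supp_in A f \<Longrightarrow> homog d f \<Longrightarrow> \<not> (keys \<gamma> \<subseteq> A \<and> total \<gamma> = d) \<Longrightarrow> lookup f \<gamma> = 0"
  by (auto simp: supp_in_alt homog_alt)

lemma symmetric_expand:
  assumes "symmetric_poly e m f" "supp_in (idx e m) f" "homog d f"
  shows "f = (\<Sum>\<alpha>\<in>Z00 e m d. Const (lookup f \<alpha>) * monsym e m \<alpha>)" (is "f = ?g")
proof (rule poly_mapping_eqI)
  fix \<gamma>
  have symg: "symmetric_poly e m ?g"
    by (intro symmetric_sum symmetric_Const symmetric_mono)
  have at: "lookup f \<beta> = lookup ?g \<beta>" if "\<beta> \<in> Z00 e m d" for \<beta>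
  proof -
    have "lookup ?g \<beta> = (\<Sum>\<alpha>\<in>Z00 e m d. if \<alpha> = \<beta> then lookup f \<alpha> else 0)"
      unfolding lookup_sum by (intro sum.cong refl) (use that in \<open>auto simp: lookup_mono_Z\<close>)
    then show ?thesis using that by (simp add: sum.delta)
  qed
  show "lookup f \<gamma> = lookup ?g \<gamma>"
  proof (cases "keys \<gamma> \<subseteq> idx e m \<and> total \<gamma> = d")
    case True
    then obtain w \<alpha> where w: "w \<in> Sm e m" "act w \<gamma> = \<alpha>" "\<alpha> \<in> epart e" "keys \<alpha> \<subseteq> idx e m"
      using sort_blocks[of \<gamma> e m] by metis
    then have "\<alpha> \<in> Z00 e m d" using True by (auto simp: Z00_def Sm_bij)
    from at[OF this] show ?thesis
      unfolding w(2)[symmetric] symmetric_lookup[OF assms(1) w(1)] symmetric_lookup[OF symg w(1)] .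
  next
    case False
    have "supp_in (idx e m) ?g" by (intro supp_in_sum supp_in_Const supp_mono) (auto simp: Z00_def)
    moreover have "homog d ?g" by (intro homog_sum homog_Const) (auto simp: Z00_def homog_mono)
    ultimately show ?thesis
      using lookup_vanishes[OF _ _ False, of ?g] lookup_vanishes[OF assms(2,3) False] by (simp only:)
  qed
qed

lemma mono_coeffs_unique:
  assumes "(\<Sum>\<alpha>\<in>Z00 e m d. Const (a \<alpha>) * monsym e m \<alpha>) = (\<Sum>\<alpha>\<in>Z00 e m d. Const (b \<alpha>) * monsym e m \<alpha>)"
    and "\<beta> \<in> Z00 e m d"
  shows "a \<beta> = b \<beta>"
proof -
  have "lookup (\<Sum>\<alpha>\<in>Z00 e m d. Const (c \<alpha>) * monsym e m \<alpha>) \<beta> = c \<beta>" for c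
  proof -
    have "lookup (\<Sum>\<alpha>\<in>Z00 e m d. Const (c \<alpha>) * monsym e m \<alpha>) \<beta> = (\<Sum>\<alpha>\<in>Z00 e m d. if \<alpha> = \<beta> then c \<alpha> else 0)"
      unfolding lookup_sum by (intro sum.cong refl) (use assms(2) in \<open>auto simp: lookup_mono_Z\<close>)
    then show ?thesis using assms(2) by (simp add: sum.delta)
  qed
  from this[of a] this[of b] assms(1) show ?thesis by simp
qed

text \<open>The exponents in \<open>m\<^sub>\<nu> a\<^sub>\<delta>\<close>, up to permutation inside the blocks, are of the form
  \<open>\<delta> + w(\<nu>)\<close>.\<close>

lemma mono_times_delta_keys:
  assumes \<nu>: "\<nu> \<in> epart e" "keys \<nu> \<subseteq> idx e m"
    and w: "w \<in> Sm e m" and \<beta>: "\<beta> \<in> orbit e m \<nu>"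
  obtains w' where "w' \<in> Sm e m" "act w (delta e m) + \<beta> = act w (delta e m + act w' \<nu>)"
proof -
  obtain w1 where w1: "w1 \<in> Sm e m" "\<beta> = act w1 \<nu>" using \<beta> by (auto simp: orbit_def)
  note b = Sm_bij[OF w] Sm_bij[OF w1(1)] Sm_bij[OF Sm_inv[OF w]]
  have "act w (delta e m) + \<beta> = act w (delta e m + act (pinv w \<circ> w1) \<nu>)"
    using b by (simp add: w1(2) act_add flip: act_comp)
  then show ?thesis using that[of "pinv w \<circ> w1"] w w1(1) by (simp add: Sm_comp Sm_inv)
qed

lemma mono_times_delta_dominated:
  assumes \<nu>: "\<nu> \<in> epart e" "keys \<nu> \<subseteq> idx e m" and nz: "lookup (monsym e m \<nu> * adelta e m) \<gamma> \<noteq> 0"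
  shows "dominated (desc (ent e m \<gamma>)) (lam e m \<nu>)"
proof -
  obtain \<beta> \<beta>' where \<beta>: "\<gamma> = \<beta> + \<beta>'" "lookup (monsym e m \<nu>) \<beta> \<noteq> 0" "lookup (adelta e m) \<beta>' \<noteq> 0"
    using keys_mult_elim[OF nz] .
  obtain w where w: "w \<in> Sm e m" "\<beta>' = act w (delta e m)"
    using lookup_alternant_nonzero[OF \<beta>(3)] by metis
  have "\<beta> \<in> orbit e m \<nu>" using \<beta>(2) by (auto simp: lookup_mono split: if_splits)
  then obtain w' where w': "w' \<in> Sm e m" "act w (delta e m) + \<beta> = act w (delta e m + act w' \<nu>)"
    using mono_times_delta_keys[OF \<nu> w(1)] by metis
  have "ent e m \<gamma> = ent e m (delta e m + act w' \<nu>)"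
    using \<beta>(1) w(2) w'(2) ent_act[OF Sm_permutes[OF w(1)]] by (simp add: add.commute)
  then show ?thesis using dominated_permuted[OF \<nu> w'(1)] by (simp add: lam_desc)
qed

text \<open>For two symbols, being dominated means being in the same family or below; in the first case the
  dominance is an equality, which leaves only one term.\<close>

lemma mono_times_delta_at_Lam:
  assumes \<nu>: "\<nu> \<in> Z00 e m d" and \<gamma>: "\<gamma> \<in> Z00 e m d"
  shows "lookup (monsym e m \<nu> * adelta e m) (Lam e m \<gamma>) \<noteq> 0 \<Longrightarrow> \<gamma> = \<nu> \<or> below e m \<gamma> \<nu>"
    and "lookup (monsym e m \<nu> * adelta e m) (Lam e m \<nu>) = 1"
proof -
  have \<nu>': "\<nu> \<in> epart e" "keys \<nu> \<subseteq> idx e m" and \<gamma>': "\<gamma> \<in> epart e" "keys \<gamma> \<subseteq> idx e m"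
    using \<nu> \<gamma> by (auto simp: Z00_def)
  \<comment> \<open>only the identity contributes to an exponent with the entries of \<open>\<Lambda>(\<nu>)\<close>\<close>
  have key: "w = id \<and> \<beta> = \<nu> \<and> \<gamma> = \<nu>"
    if w: "w \<in> Sm e m" and \<beta>: "\<beta> \<in> orbit e m \<nu>" and eq: "\<beta> + act w (delta e m) = Lam e m \<gamma>"
      and sim: "ent e m (Lam e m \<gamma>) = ent e m (Lam e m \<nu>)" and \<gamma>': "\<gamma> \<in> epart e" "keys \<gamma> \<subseteq> idx e m"
    for w \<beta> \<gamma>
  proof -
    obtain w' where w': "w' \<in> Sm e m" "act w (delta e m) + \<beta> = act w (delta e m + act w' \<nu>)"
      using mono_times_delta_keys[OF \<nu>' w \<beta>] .
    have "ent e m (delta e m + act w' \<nu>) = ent e m (Lam e m \<nu>)"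
      using w'(2) eq sim ent_act[OF Sm_permutes[OF w], of "delta e m + act w' \<nu>"] by (simp add: add.commute)
    then have "act w' \<nu> = \<nu>" by (rule permuted_ent_eq[OF \<nu>' w'(1)])
    then have *: "act w (Lam e m \<nu>) = Lam e m \<gamma>" using w'(2) eq by (simp add: Lam_def add.commute)
    have "\<nu> = \<gamma>" "w = id" using act_Lam_eq[OF \<nu>'(1) \<gamma>'(1) \<nu>'(2) \<gamma>'(2) w *] by auto
    then show ?thesis using eq by (simp add: Lam_def)
  qed
  show "\<gamma> = \<nu> \<or> below e m \<gamma> \<nu>" if nz: "lookup (monsym e m \<nu> * adelta e m) (Lam e m \<gamma>) \<noteq> 0"
  proof (cases "lam e m \<gamma> = lam e m \<nu>")
    case True
    obtain \<beta> \<beta>' where \<beta>: "Lam e m \<gamma> = \<beta> + \<beta>'" "lookup (monsym e m \<nu>) \<beta> \<noteq> 0" "lookup (adelta e m) \<beta>' \<noteq> 0"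
      using keys_mult_elim[OF nz] .
    obtain w where w: "w \<in> Sm e m" "\<beta>' = act w (delta e m)"
      using lookup_alternant_nonzero[OF \<beta>(3)] by metis
    show ?thesis
      using key[OF w(1) _ _ _ \<gamma>', of \<beta>] \<beta> w(2) True
      by (auto simp: lookup_mono lam_desc desc_inj split: if_splits)
  next
    case False
    then show ?thesis
      using mono_times_delta_dominated[OF \<nu>' nz] by (simp add: below_def lam_desc)
  qed
  have "monsym e m \<nu> * adelta e m
      = (\<Sum>\<beta>\<in>orbit e m \<nu>. \<Sum>w\<in>Sm e m. of_int (sign w) * monom_arr (\<beta> + act w (delta e m)))"
    by (simp add: monsym_def alternant_def sum_product monom_arr_add mult.left_commute)
  then have "lookup (monsym e m \<nu> * adelta e m) (Lam e m \<nu>)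
      = (\<Sum>\<beta>\<in>orbit e m \<nu>. \<Sum>w\<in>Sm e m. of_int (sign w) * (if Lam e m \<nu> = \<beta> + act w (delta e m) then 1 else 0))"
    by (simp only: lookup_sum lookup_of_int_mult lookup_monom)
  also have "\<dots> = (\<Sum>\<beta>\<in>orbit e m \<nu>. \<Sum>w\<in>Sm e m. if w = id then (if \<beta> = \<nu> then 1 else 0) else 0)"
  proof (intro sum.cong refl)
    fix \<beta> w assume \<beta>: "\<beta> \<in> orbit e m \<nu>" and w: "w \<in> Sm e m"
    show "of_int (sign w) * (if Lam e m \<nu> = \<beta> + act w (delta e m) then 1 else 0)
        = (if w = id then (if \<beta> = \<nu> then 1 else 0) else (0::fld))"
    proof (cases "Lam e m \<nu> = \<beta> + act w (delta e m)")
      case True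
      then have "w = id \<and> \<beta> = \<nu>" using key[OF w \<beta> _ _ \<nu>'] by simp
      then show ?thesis using True by (simp add: sign_id)
    next
      case False
      then show ?thesis by (auto simp: Lam_def)
    qed
  qed
  also have "\<dots> = 1" by (simp add: sum.delta)
  finally show "lookup (monsym e m \<nu> * adelta e m) (Lam e m \<nu>) = 1" .
qed

lemma alternating_mono_delta:
  assumes "\<nu> \<in> Z00 e m d"
  shows "alternating e m (monsym e m \<nu> * adelta e m)"
    "supp_in (idx e m) (monsym e m \<nu> * adelta e m)"
    "homog (d + total (delta e m)) (monsym e m \<nu> * adelta e m)"
  using assms homog_mono[of \<nu> e m] homog_alt'[of "delta e m" e m]
  by (auto simp: Z00_def intro!: alternating_mult symmetric_mono alternating_alt supp_in_mult supp_mono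
      supp_in_alt' keys_delta homog_mult)

text \<open>Unitriangularity of the Schur polynomials over the monomial ones, obtained by inverting
  the expansion of \<open>m\<^sub>\<alpha> a\<^sub>\<delta>\<close> in alternants.\<close>

lemma alt_Lam_mono:
  assumes "\<alpha> \<in> Z00 e m d"
  shows "\<exists>K. alt e m (Lam e m \<alpha>) = (monsym e m \<alpha> + (\<Sum>\<beta>\<in>{\<beta> \<in> Z00 e m d. below e m \<beta> \<alpha>}. Const (K \<beta>) * monsym e m \<beta>)) * adelta e m"
  using finite_wf_below[OF finite_Z00, of e m d e m] assms
proof (induction \<alpha> rule: wf_induct_rule)
  case (less \<alpha>)
  let ?Z = "Z00 e m d" and ?a = "adelta e m"
  let ?B = "{\<beta> \<in> ?Z. below e m \<beta> \<alpha>}"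
  define K where "K = (\<lambda>\<beta>. SOME K. alt e m (Lam e m \<beta>) = (monsym e m \<beta> + (\<Sum>\<gamma>\<in>{\<gamma> \<in> ?Z. below e m \<gamma> \<beta>}. Const (K \<gamma>) * monsym e m \<gamma>)) * ?a)"
  have K: "alt e m (Lam e m \<beta>) = (monsym e m \<beta> + (\<Sum>\<gamma>\<in>{\<gamma> \<in> ?Z. below e m \<gamma> \<beta>}. Const (K \<beta> \<gamma>) * monsym e m \<gamma>)) * ?a"
    if "\<beta> \<in> ?B" for \<beta>
  proof -
    have "\<exists>K. alt e m (Lam e m \<beta>) = (monsym e m \<beta> + (\<Sum>\<gamma>\<in>{\<gamma> \<in> ?Z. below e m \<gamma> \<beta>}. Const (K \<gamma>) * monsym e m \<gamma>)) * ?a"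
      by (rule less.IH) (use that less.prems in simp_all)
    then show ?thesis unfolding K_def by (rule someI_ex)
  qed
  define L where "L = (\<lambda>\<beta>. lookup (monsym e m \<alpha> * ?a) (Lam e m \<beta>))"
  let ?M = "\<lambda>\<beta> \<gamma>. if \<gamma> = \<beta> then 1 else if below e m \<gamma> \<beta> then K \<beta> \<gamma> else 0"
  have M: "alt e m (Lam e m \<beta>) = (\<Sum>\<gamma>\<in>?B. Const (?M \<beta> \<gamma>) * monsym e m \<gamma>) * ?a" if "\<beta> \<in> ?B" for \<beta>
  proof -
    have sub: "insert \<beta> {\<gamma> \<in> ?Z. below e m \<gamma> \<beta>} \<subseteq> ?B" using that below_trans by blast
    have "(\<Sum>\<gamma>\<in>?B. Const (?M \<beta> \<gamma>) * monsym e m \<gamma>) = (\<Sum>\<gamma>\<in>insert \<beta> {\<gamma> \<in> ?Z. below e m \<gamma> \<beta>}. Const (?M \<beta> \<gamma>) * monsym e m \<gamma>)"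
      by (rule sum.mono_neutral_right) (use sub in auto)
    also have "\<dots> = monsym e m \<beta> + (\<Sum>\<gamma>\<in>{\<gamma> \<in> ?Z. below e m \<gamma> \<beta>}. Const (?M \<beta> \<gamma>) * monsym e m \<gamma>)"
      by (subst sum.insert) (auto simp: below_irrefl)
    also have "(\<Sum>\<gamma>\<in>{\<gamma> \<in> ?Z. below e m \<gamma> \<beta>}. Const (?M \<beta> \<gamma>) * monsym e m \<gamma>) = (\<Sum>\<gamma>\<in>{\<gamma> \<in> ?Z. below e m \<gamma> \<beta>}. Const (K \<beta> \<gamma>) * monsym e m \<gamma>)"
      by (intro sum.cong refl) (auto simp: below_irrefl)
    finally show ?thesis using K[OF that] by simp
  qed
  have "monsym e m \<alpha> * ?a = (\<Sum>\<beta>\<in>?Z. Const (L \<beta>) * alt e m (Lam e m \<beta>))"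
    unfolding L_def by (rule alternating_expand) (rule alternating_mono_delta[OF less.prems])+
  also have "\<dots> = (\<Sum>\<beta>\<in>insert \<alpha> ?B. Const (L \<beta>) * alt e m (Lam e m \<beta>))"
  proof (rule sum.mono_neutral_right)
    show "\<forall>\<beta>\<in>?Z - insert \<alpha> ?B. Const (L \<beta>) * alt e m (Lam e m \<beta>) = 0"
    proof
      fix \<beta> assume \<beta>: "\<beta> \<in> ?Z - insert \<alpha> ?B"
      then have "L \<beta> = 0"
        using mono_times_delta_at_Lam(1)[OF less.prems, of \<beta>] unfolding L_def by blast
      then show "Const (L \<beta>) * alt e m (Lam e m \<beta>) = 0" by simp
    qed
  qed (use less.prems in auto)
  also have "\<dots> = alt e m (Lam e m \<alpha>) + (\<Sum>\<beta>\<in>?B. Const (L \<beta>) * alt e m (Lam e m \<beta>))"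
    using mono_times_delta_at_Lam(2)[OF less.prems less.prems] by (subst sum.insert) (auto simp: below_irrefl L_def)
  also have "(\<Sum>\<beta>\<in>?B. Const (L \<beta>) * alt e m (Lam e m \<beta>)) = (\<Sum>\<beta>\<in>?B. Const (L \<beta>) * ((\<Sum>\<gamma>\<in>?B. Const (?M \<beta> \<gamma>) * monsym e m \<gamma>) * ?a))"
    by (intro sum.cong refl arg_cong[where f = "\<lambda>x. _ * x"] M)
  also have "\<dots> = (\<Sum>\<gamma>\<in>?B. Const (\<Sum>\<beta>\<in>?B. L \<beta> * ?M \<beta> \<gamma>) * monsym e m \<gamma>) * ?a"
    unfolding sum_distrib_right sum_distrib_left Const_sum Const_mult
    by (subst sum.swap) (simp add: mult.assoc)
  finally have "alt e m (Lam e m \<alpha>) = (monsym e m \<alpha> - (\<Sum>\<gamma>\<in>?B. Const (\<Sum>\<beta>\<in>?B. L \<beta> * ?M \<beta> \<gamma>) * monsym e m \<gamma>)) * ?a"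
    by (simp add: algebra_simps)
  then show ?case
    by (intro exI[of _ "\<lambda>\<gamma>. - (\<Sum>\<beta>\<in>?B. L \<beta> * ?M \<beta> \<gamma>)"]) (simp only: Const_minus mult_minus_left sum_negf add_uminus_conv_diff)
qed

text \<open>It suffices to divide the members of the basis of alternants, and these are divisible by the
  preceding expansion.\<close>

lemma alternating_divisible:
  assumes "alternating e m F" "supp_in (idx e m) F" "homog (d + total (delta e m)) F"
  obtains f where "f * adelta e m = F"
proof -
  define g where "g = (\<lambda>\<alpha>. SOME g. alt e m (Lam e m \<alpha>) = g * adelta e m)"
  have g: "alt e m (Lam e m \<alpha>) = g \<alpha> * adelta e m" if "\<alpha> \<in> Z00 e m d" for \<alpha>
    unfolding g_def using alt_Lam_mono[OF that] by (intro someI_ex[of "\<lambda>g. _ = g * _"]) blast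
  have "F = (\<Sum>\<alpha>\<in>Z00 e m d. Const (lookup F (Lam e m \<alpha>)) * alt e m (Lam e m \<alpha>))"
    by (rule alternating_expand[OF assms])
  also have "\<dots> = (\<Sum>\<alpha>\<in>Z00 e m d. Const (lookup F (Lam e m \<alpha>)) * g \<alpha>) * adelta e m"
    unfolding sum_distrib_right by (intro sum.cong refl) (simp add: g mult.assoc)
  finally have "(\<Sum>\<alpha>\<in>Z00 e m d. Const (lookup F (Lam e m \<alpha>)) * g \<alpha>) * adelta e m = F" by (rule sym)
  then show ?thesis by (rule that)
qed

lemma mquot_eqI: "h * g = f \<Longrightarrow> g \<noteq> 0 \<Longrightarrow> mquot f g = h"
  unfolding mquot_def by (rule the_equality) auto

section \<open>Factorization over the blocks\<close>

lemma keys_orbit: "a \<in> orbit e m \<alpha> \<Longrightarrow> keys a \<subseteq> idx e m \<longleftrightarrow> keys \<alpha> \<subseteq> idx e m"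
  using keys_act_Sm[of _ e m \<alpha>] by (force simp: orbit_def simp del: idx_iff)

lemma act_fix:
  assumes "bij w" "\<And>v. v \<in> keys \<beta> \<Longrightarrow> w v = v" shows "act w \<beta> = \<beta>"
proof (rule act_eqI[OF assms(1)])
  fix v show "lookup \<beta> v = lookup \<beta> (w v)"
  proof (cases "w v \<in> keys \<beta>")
    case True
    then have "w v = v" using assms by (metis bij_is_inj inj_eq)
    then show ?thesis by simp
  next
    case False
    then have "v \<notin> keys \<beta>" using assms(2) by metis
    with False show ?thesis by (simp add: in_keys_iff)
  qed
qed

lemma bperm_bij: "v \<in> bperm k N \<Longrightarrow> bij v"
  by (auto simp: bperm_def intro: permutes_bij)

text \<open>Splitting off the last block allows products over the blocks to be treated by induction on
  \<open>e\<close>.\<close>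

lemma Sm_Suc_bij:
  "bij_betw (\<lambda>(u, v). u \<circ> v) (Sm e m \<times> bperm e (m e)) (Sm (Suc e) m)"
proof (rule bij_betwI')
  let ?B = "{e} \<times> {..<m e}"
  have idxS: "idx (Suc e) m = idx e m \<union> ?B" by (auto simp: idx_def less_Suc_eq)
  have disj: "idx e m \<inter> ?B = {}" by (auto simp: idx_def)
  have inj: "u = u' \<and> v = v'"
    if u: "u permutes idx e m" "u' permutes idx e m" and v: "v permutes ?B" "v' permutes ?B"
      and eq: "u \<circ> v = u' \<circ> v'" for u u' v v'
  proof -
    have fixu: "w x = x" if "w permutes idx e m" "x \<in> ?B" for w x
      using permutes_not_in[OF that(1)] disj that(2) by blast
    have "v x = v' x" for x
    proof (cases "x \<in> ?B")
      case True
      have "v x \<in> ?B" "v' x \<in> ?B" using True v by (simp_all only: permutes_in_image)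
      then have "u (v x) = v x" "u' (v' x) = v' x" using fixu[OF u(1)] fixu[OF u(2)] by auto
      with fun_cong[OF eq, of x] show ?thesis by simp
    next
      case False
      then show ?thesis using v by (metis permutes_not_in)
    qed
    then have "v = v'" by auto
    with eq have "u \<circ> v = u' \<circ> v" by simp
    then have uv: "u (v y) = u' (v y)" for y by (metis o_apply)
    have "u x = u' x" for x
    proof -
      obtain y where "x = v y" using permutes_surj[OF v(1)] by (metis surjD)
      then show ?thesis using uv by simp
    qed
    then have "u = u'" by auto
    with \<open>v = v'\<close> show ?thesis by simp
  qed
  fix x y assume "x \<in> Sm e m \<times> bperm e (m e)" "y \<in> Sm e m \<times> bperm e (m e)"
  then show "((case x of (u, v) \<Rightarrow> u \<circ> v) = (case y of (u, v) \<Rightarrow> u \<circ> v)) = (x = y)"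
    using inj[of "fst x" "fst y" "snd x" "snd y"] by (auto simp: Sm_permutes bperm_def case_prod_unfold prod_eq_iff)
next
  fix x assume x: "x \<in> Sm e m \<times> bperm e (m e)"
  obtain u v where uv: "x = (u, v)" "u \<in> Sm e m" "v permutes {e} \<times> {..<m e}"
    using x by (auto simp: bperm_def)
  have "u permutes idx (Suc e) m" "v permutes idx (Suc e) m"
    using Sm_permutes[OF uv(2)] uv(3) by (auto elim!: permutes_subset simp: idx_def)
  moreover have fstv: "fst (v y) = fst y" for y
  proof (cases "y \<in> {e} \<times> {..<m e}")
    case True
    then have "v y \<in> {e} \<times> {..<m e}" using uv(3) by (simp only: permutes_in_image)
    with True show ?thesis by auto
  next
    case False
    then show ?thesis using permutes_not_in[OF uv(3) False] by simp
  qed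
  ultimately show "(case x of (u, v) \<Rightarrow> u \<circ> v) \<in> Sm (Suc e) m"
    unfolding uv(1) prod.case by (intro SmI permutes_compose) (simp_all only: o_apply Sm_fst[OF uv(2)] fstv)
next
  fix w assume w: "w \<in> Sm (Suc e) m"
  define u where "u = (\<lambda>x. if fst x < e then w x else x)"
  define v where "v = (\<lambda>x. if fst x = e then w x else x)"
  have wi: "inj w" and wf: "fst (w x) = fst x" for x
    using w by (simp_all add: Sm_bij bij_is_inj Sm_fst)
  have out: "w x = x" if "x \<notin> idx (Suc e) m" for x
    using permutes_not_in[OF Sm_permutes[OF w] that] .
  have into: "w x \<in> idx (Suc e) m \<longleftrightarrow> x \<in> idx (Suc e) m" for x by (rule Sm_in_idx[OF w])
  have "u permutes idx e m"
  proof (rule bij_imp_permutes)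
    have "u x \<in> idx e m" if "x \<in> idx e m" for x
    proof -
      have "fst x < e" "x \<in> idx (Suc e) m" using that by (auto simp: idx_def)
      then have "w x \<in> idx (Suc e) m" "fst (w x) < e" using into wf by auto
      then show ?thesis using \<open>fst x < e\<close> by (cases "w x") (auto simp: u_def)
    qed
    moreover have "inj_on u (idx e m)" using wi by (auto simp: u_def inj_on_def idx_def)
    ultimately show "bij_betw u (idx e m) (idx e m)"
      by (simp add: bij_betw_def endo_inj_surj image_subset_iff)
    show "u x = x" if "x \<notin> idx e m" for x
      using that out[of x] by (cases x) (auto simp: u_def)
  qed
  moreover have "fst (u x) = fst x" for x by (simp add: u_def wf)
  ultimately have "u \<in> Sm e m" by (rule SmI)
  moreover have "v permutes {e} \<times> {..<m e}"
  proof (rule bij_imp_permutes)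
    have "v x \<in> {e} \<times> {..<m e}" if "x \<in> {e} \<times> {..<m e}" for x
    proof -
      have "fst x = e" "x \<in> idx (Suc e) m" using that by (auto simp: idx_def)
      then have "w x \<in> idx (Suc e) m" "fst (w x) = e" using into wf by auto
      then show ?thesis using \<open>fst x = e\<close> by (cases "w x") (auto simp: v_def)
    qed
    moreover have "inj_on v ({e} \<times> {..<m e})" using wi by (auto simp: v_def inj_on_def)
    ultimately show "bij_betw v ({e} \<times> {..<m e}) ({e} \<times> {..<m e})"
      by (simp add: bij_betw_def endo_inj_surj image_subset_iff)
    show "v x = x" if "x \<notin> {e} \<times> {..<m e}" for x
      using that out[of x] by (cases x) (auto simp: v_def)
  qed
  moreover have "w = u \<circ> v"
  proof
    fix x
    show "w x = (u \<circ> v) x"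
    proof (cases "x \<in> idx (Suc e) m")
      case True
      then show ?thesis using wf[of x] by (cases x) (auto simp: u_def v_def)
    next
      case False
      then show ?thesis using out[OF False] by (simp add: u_def v_def)
    qed
  qed
  ultimately show "\<exists>x\<in>Sm e m \<times> bperm e (m e). w = (case x of (u, v) \<Rightarrow> u \<circ> v)"
    by (intro bexI[of _ "(u, v)"]) (auto simp: bperm_def)
qed

lemma act_blocks:
  assumes "u \<in> Sm e m" "v \<in> bperm e (m e)" "keys \<gamma>1 \<subseteq> idx e m" "keys \<gamma>2 \<subseteq> {e} \<times> {..<m e}"
  shows "act (u \<circ> v) (\<gamma>1 + \<gamma>2) = act u \<gamma>1 + act v \<gamma>2"
proof -
  have v: "v permutes {e} \<times> {..<m e}" using assms(2) by (simp add: bperm_def)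
  note b = Sm_bij[OF assms(1)] bperm_bij[OF assms(2)]
  have "act v \<gamma>1 = \<gamma>1"
  proof (rule act_fix[OF b(2)])
    fix x assume "x \<in> keys \<gamma>1"
    then have "x \<notin> {e} \<times> {..<m e}" using assms(3) by (auto simp: idx_def)
    then show "v x = x" by (rule permutes_not_in[OF v])
  qed
  moreover have "act u (act v \<gamma>2) = act v \<gamma>2"
  proof (rule act_fix[OF b(1)])
    fix x assume "x \<in> keys (act v \<gamma>2)"
    then have "x \<in> v ` ({e} \<times> {..<m e})" using assms(4) by (auto simp: keys_act[OF b(2)])
    then have "x \<in> {e} \<times> {..<m e}" by (simp only: permutes_image[OF v])
    then have "x \<notin> idx e m" by (auto simp: idx_def)
    then show "u x = x" by (rule permutes_not_in[OF Sm_permutes[OF assms(1)]])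
  qed
  ultimately show ?thesis by (simp add: act_comp[OF b, symmetric] act_add[OF b(1)] act_add[OF b(2)])
qed

lemma finite_bperm [simp]: "finite (bperm k N)"
  unfolding bperm_def by (rule finite_permutations) simp

lemma bperm_permutation: "v \<in> bperm k N \<Longrightarrow> permutation v"
  unfolding permutation_permutes bperm_def by (rule exI[of _ "{k} \<times> {..<N}"]) simp

lemma alt_Suc:
  assumes "keys \<gamma>1 \<subseteq> idx e m" "keys \<gamma>2 \<subseteq> {e} \<times> {..<m e}"
  shows "alt (Suc e) m (\<gamma>1 + \<gamma>2) = alt e m \<gamma>1 * alternant (bperm e (m e)) \<gamma>2"
proof -
  have "alt (Suc e) m (\<gamma>1 + \<gamma>2) = (\<Sum>(u, v)\<in>Sm e m \<times> bperm e (m e). of_int (sign (u \<circ> v)) * monom_arr (act (u \<circ> v) (\<gamma>1 + \<gamma>2)))"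
    unfolding alternant_def
    by (subst sum.reindex_bij_betw[OF Sm_Suc_bij, symmetric]) (simp add: case_prod_unfold)
  also have "\<dots> = (\<Sum>(u, v)\<in>Sm e m \<times> bperm e (m e). (of_int (sign u) * monom_arr (act u \<gamma>1)) * (of_int (sign v) * monom_arr (act v \<gamma>2)))"
  proof (rule sum.cong[OF refl], clarify)
    fix u v assume u: "u \<in> Sm e m" and v: "v \<in> bperm e (m e)"
    show "of_int (sign (u \<circ> v)) * monom_arr (act (u \<circ> v) (\<gamma>1 + \<gamma>2))
      = of_int (sign u) * monom_arr (act u \<gamma>1) * (of_int (sign v) * monom_arr (act v \<gamma>2))"
      unfolding act_blocks[OF u v assms] sign_compose[OF Sm_permutation[OF u] bperm_permutation[OF v]]
      by (simp add: monom_arr_add mult_ac)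
  qed
  also have "\<dots> = alt e m \<gamma>1 * alternant (bperm e (m e)) \<gamma>2"
    by (simp add: alternant_def sum_product sum.cartesian_product)
  finally show ?thesis .
qed

lemma lookup_barr: "lookup (barr k N \<mu>) v = (if fst v = k \<and> snd v < N then \<mu> (snd v) else 0)"
proof -
  have "lookup (barr k N \<mu>) v = (\<Sum>j<N. if j = snd v then (if fst v = k then \<mu> j else 0) else 0)"
    unfolding barr_def lookup_sum lookup_single
    by (intro sum.cong refl) (auto simp: when_def prod_eq_iff)
  then show ?thesis by (simp add: sum.delta)
qed

lemma keys_barr: "keys (barr k N \<mu>) \<subseteq> {k} \<times> {..<N}"
  by (auto simp: in_keys_iff lookup_barr split: if_splits)

lemma Sm_0: "Sm 0 m = {id}"
proof -
  have "idx 0 m = {}" by (auto simp: idx_def)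
  then show ?thesis by (auto simp: Sm_def permutes_empty)
qed

lemma keys_sum_barr: "keys (\<Sum>k<e. barr k (m k) (f k)) \<subseteq> idx e m"
proof -
  have "lookup (\<Sum>k<e. barr k (m k) (f k)) v = 0" if "v \<notin> idx e m" for v
    unfolding lookup_sum by (rule sum.neutral) (use that in \<open>cases v, auto simp: lookup_barr\<close>)
  then show ?thesis by (metis in_keys_iff subsetI)
qed

lemma alt_prod: "alt e m (\<Sum>k<e. barr k (m k) (f k)) = (\<Prod>k<e. alternant (bperm k (m k)) (barr k (m k) (f k)))"
proof (induction e)
  case 0
  then show ?case by (simp add: Sm_0 alternant_def sign_id)
next
  case (Suc e)
  then show ?case using alt_Suc[OF keys_sum_barr keys_barr] by simp
qed

lemma arr_as_blocks:
  assumes "keys \<beta> \<subseteq> idx e m" shows "\<beta> = (\<Sum>k<e. barr k (m k) (\<lambda>j. lookup \<beta> (k, j)))"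
proof (rule arr_eqI[OF assms keys_sum_barr])
  fix k j assume *: "k < e" "j < m k"
  have "lookup (\<Sum>i<e. barr i (m i) (\<lambda>j. lookup \<beta> (i, j))) (k, j) = (\<Sum>i<e. if i = k then lookup \<beta> (k, j) else 0)"
    unfolding lookup_sum by (intro sum.cong refl) (use * in \<open>auto simp: lookup_barr\<close>)
  then show "lookup \<beta> (k, j) = lookup (\<Sum>i<e. barr i (m i) (\<lambda>j. lookup \<beta> (i, j))) (k, j)"
    using * by (simp add: sum.delta)
qed

lemma orbit_Suc:
  assumes "keys \<gamma>1 \<subseteq> idx e m" "keys \<gamma>2 \<subseteq> {e} \<times> {..<m e}"
  shows "(\<Sum>\<beta>\<in>orbit (Suc e) m (\<gamma>1 + \<gamma>2). monom_arr \<beta>)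
       = (\<Sum>\<beta>\<in>orbit e m \<gamma>1. monom_arr \<beta>) * (\<Sum>\<nu>\<in>(\<lambda>w. act w \<gamma>2) ` bperm e (m e). monom_arr \<nu>)"
proof -
  let ?O2 = "(\<lambda>w. act w \<gamma>2) ` bperm e (m e)"
  have im: "orbit (Suc e) m (\<gamma>1 + \<gamma>2) = (\<lambda>(a, b). a + b) ` (orbit e m \<gamma>1 \<times> ?O2)"
  proof -
    have "orbit (Suc e) m (\<gamma>1 + \<gamma>2) = (\<lambda>w. act w (\<gamma>1 + \<gamma>2)) ` (\<lambda>(u, v). u \<circ> v) ` (Sm e m \<times> bperm e (m e))"
      using Sm_Suc_bij[of e m] by (simp add: orbit_def bij_betw_def)
    also have "\<dots> = (\<lambda>(u, v). act u \<gamma>1 + act v \<gamma>2) ` (Sm e m \<times> bperm e (m e))"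
      unfolding image_image by (intro image_cong refl) (use act_blocks[OF _ _ assms] in auto)
    also have "\<dots> = (\<lambda>(a, b). a + b) ` (orbit e m \<gamma>1 \<times> ?O2)"
      unfolding orbit_def by force
    finally show ?thesis .
  qed
  have k1: "keys a \<subseteq> idx e m" if "a \<in> orbit e m \<gamma>1" for a
    using that assms(1) by (simp add: keys_orbit)
  have k2: "keys b \<subseteq> {e} \<times> {..<m e}" if b: "b \<in> ?O2" for b
  proof -
    obtain v where v: "v \<in> bperm e (m e)" "b = act v \<gamma>2" using b by auto
    then have "keys b \<subseteq> v ` ({e} \<times> {..<m e})" using assms(2) by (auto simp: keys_act[OF bperm_bij[OF v(1)]])
    then show ?thesis using v(1) by (simp add: bperm_def permutes_image)
  qed
  have inj: "inj_on (\<lambda>(a, b). a + b) (orbit e m \<gamma>1 \<times> ?O2)"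
  proof (rule inj_onI)
    fix x y assume x: "x \<in> orbit e m \<gamma>1 \<times> ?O2" and y: "y \<in> orbit e m \<gamma>1 \<times> ?O2"
      and xy: "(case x of (a, b) \<Rightarrow> a + b) = (case y of (a, b) \<Rightarrow> a + b)"
    obtain a b a' b' where ab: "x = (a, b)" "y = (a', b')" by (cases x, cases y) auto
    have a: "a \<in> orbit e m \<gamma>1" "a' \<in> orbit e m \<gamma>1" and b: "b \<in> ?O2" "b' \<in> ?O2" and eq: "a + b = a' + b'"
      using x y xy by (simp_all only: ab mem_Sigma_iff prod.case)
    have "a = a'"
    proof (rule arr_eqI[OF k1[OF a(1)] k1[OF a(2)]])
      fix k j assume "k < e" "j < m k"
      then have "lookup b (k, j) = 0" "lookup b' (k, j) = 0"
        using lookup_outside[OF k2[OF b(1)], of "(k, j)"] lookup_outside[OF k2[OF b(2)], of "(k, j)"] by auto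
      then show "lookup a (k, j) = lookup a' (k, j)"
        using arg_cong[OF eq, of "\<lambda>x. lookup x (k, j)"] by (simp add: lookup_add)
    qed
    with eq show "x = y" by (simp add: ab)
  qed
  show ?thesis
    unfolding im by (subst sum.reindex[OF inj])
      (simp add: case_prod_unfold sum_product sum.cartesian_product monom_arr_add)
qed

lemma mono_prod:
  "monsym e m (\<Sum>k<e. barr k (m k) (f k)) = (\<Prod>k<e. \<Sum>\<nu>\<in>(\<lambda>w. act w (barr k (m k) (f k))) ` bperm k (m k). monom_arr \<nu>)"
proof (induction e)
  case 0
  then show ?case by (simp add: monsym_def orbit_def Sm_0)
next
  case (Suc e)
  then show ?case using orbit_Suc[OF keys_sum_barr keys_barr] by (simp add: monsym_def)
qed

definition fits :: "nat \<Rightarrow> (nat \<Rightarrow> nat) \<Rightarrow> arr \<Rightarrow> bool" where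
  "fits e m \<alpha> \<longleftrightarrow> keys \<alpha> \<subseteq> idx e m"

lemma fits_block: "fits e M \<alpha> \<Longrightarrow> k < e \<Longrightarrow> \<forall>j\<ge>M k. lookup \<alpha> (k, j) = 0"
  using lookup_outside[of \<alpha> "idx e M"] by (auto simp: fits_def)

lemma not_fits_block:
  assumes "\<alpha> \<in> epart e" "\<not> fits e M \<alpha>"
  obtains k where "k < e" "\<not> (\<forall>j\<ge>M k. lookup \<alpha> (k, j) = 0)"
proof -
  obtain v where v: "v \<in> keys \<alpha>" "v \<notin> idx e M" using assms(2) unfolding fits_def by blast
  obtain k j where kj: "v = (k, j)" by force
  have k: "k < e" using v(1) assms(1) kj by (auto simp: epart_def)
  have "M k \<le> j" "lookup \<alpha> (k, j) \<noteq> 0" using k v kj by (auto simp: in_keys_iff)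
  show ?thesis
  proof (rule that[OF k], rule notI)
    assume "\<forall>j\<ge>M k. lookup \<alpha> (k, j) = 0"
    from spec[OF this, of j] show False using \<open>M k \<le> j\<close> \<open>lookup \<alpha> (k, j) \<noteq> 0\<close> by simp
  qed
qed

lemma msym_mono:
  assumes "\<alpha> \<in> epart e"
  shows "msym e m \<alpha> l = (if fits e (shift m l) \<alpha> then monsym e (shift m l) \<alpha> else 0)"
proof (cases "fits e (shift m l) \<alpha>")
  case True
  have "msym e m \<alpha> l = (\<Prod>k<e. \<Sum>\<nu>\<in>(\<lambda>w. act w (barr k (shift m l k) (\<lambda>j. lookup \<alpha> (k, j)))) ` bperm k (shift m l k). monom_arr \<nu>)"
    unfolding msym_def using fits_block[OF True] by (intro prod.cong) (auto simp: mon_block_def)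
  also have "\<dots> = monsym e (shift m l) \<alpha>"
    using arr_as_blocks[of \<alpha> e "shift m l"] True mono_prod[of e "shift m l" "\<lambda>k j. lookup \<alpha> (k, j)"]
    by (simp add: fits_def)
  finally show ?thesis using True by simp
next
  case False
  obtain k where "k < e" "\<not> (\<forall>j\<ge>shift m l k. lookup \<alpha> (k, j) = 0)" using not_fits_block[OF assms False] .
  then have "mon_block k (shift m l k) (\<lambda>j. lookup \<alpha> (k, j)) = 0" unfolding mon_block_def by (intro if_not_P)
  then show ?thesis unfolding msym_def using False \<open>k < e\<close> by (auto intro!: prod_zero)
qed

text \<open>A single block is an instance of the general situation, with all other blocks empty.\<close>

definition only_block :: "nat \<Rightarrow> nat \<Rightarrow> nat \<Rightarrow> nat" where
  "only_block k N = (\<lambda>i. if i = k then N else 0)"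

lemma idx_only_block: "k < e \<Longrightarrow> idx e (only_block k N) = {k} \<times> {..<N}"
  by (auto simp: idx_def only_block_def split: if_splits)

lemma Sm_only_block:
  assumes "k < e" shows "Sm e (only_block k N) = bperm k N"
proof
  show "Sm e (only_block k N) \<subseteq> bperm k N"
    using Sm_permutes[of _ e "only_block k N"] by (auto simp: bperm_def idx_only_block[OF assms])
  show "bperm k N \<subseteq> Sm e (only_block k N)"
  proof
    fix v assume "v \<in> bperm k N"
    then have v: "v permutes {k} \<times> {..<N}" by (simp add: bperm_def)
    have "fst (v y) = fst y" for y
    proof (cases "y \<in> {k} \<times> {..<N}")
      case True
      then have "v y \<in> {k} \<times> {..<N}" using v by (simp only: permutes_in_image)
      with True show ?thesis by auto
    next
      case False
      then show ?thesis using permutes_not_in[OF v False] by simp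
    qed
    then show "v \<in> Sm e (only_block k N)" using v by (intro SmI) (simp_all add: idx_only_block[OF assms])
  qed
qed

lemma schur_block_times_delta:
  assumes "k < e" "\<And>j. \<mu> (Suc j) \<le> \<mu> j" "\<forall>j\<ge>N. \<mu> j = 0"
  shows "schur_block k N \<mu> * alternant (bperm k N) (barr k N (\<lambda>j. N - 1 - j))
       = alternant (bperm k N) (barr k N (\<lambda>j. \<mu> j + (N - 1 - j)))"
proof -
  let ?m = "only_block k N" and ?\<alpha> = "barr k N \<mu>"
  have d: "delta e ?m = barr k N (\<lambda>j. N - 1 - j)"
    by (rule poly_mapping_eqI) (use assms(1) in \<open>auto simp: lookup_delta lookup_barr only_block_def\<close>)
  have L: "Lam e ?m ?\<alpha> = barr k N (\<lambda>j. \<mu> j + (N - 1 - j))"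
    unfolding Lam_def d by (rule poly_mapping_eqI) (simp add: lookup_barr lookup_add)
  have "?\<alpha> \<in> epart e"
  proof -
    have "lookup ?\<alpha> (i, Suc j) \<le> lookup ?\<alpha> (i, j)" for i j using assms(2)[of j] by (simp add: lookup_barr)
    moreover have "i < e" if "(i, j) \<in> keys ?\<alpha>" for i j using that keys_barr[of k N \<mu>] assms(1) by auto
    ultimately show ?thesis by (auto simp: epart_def)
  qed
  then have "?\<alpha> \<in> Z00 e ?m (total ?\<alpha>)" using keys_barr by (simp add: Z00_def idx_only_block[OF assms(1)])
  from alt_Lam_mono[OF this] have "\<exists>h. h * adelta e ?m = alt e ?m (Lam e ?m ?\<alpha>)"
    by (elim exE) (rule exI, erule sym)
  then obtain h where h: "h * alternant (bperm k N) (barr k N (\<lambda>j. N - 1 - j)) = alternant (bperm k N) (barr k N (\<lambda>j. \<mu> j + (N - 1 - j)))"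
    unfolding L d Sm_only_block[OF assms(1)] by (elim exE)
  have "alternant (bperm k N) (barr k N (\<lambda>j. N - 1 - j)) \<noteq> 0"
    using alt_delta_nonzero[of e ?m] by (simp add: d Sm_only_block[OF assms(1)])
  note q = mquot_eqI[OF h this]
  show ?thesis unfolding schur_block_def if_P[OF assms(3)] q by (rule h)
qed

lemma schur_times_delta:
  assumes "\<alpha> \<in> epart e" "fits e (shift m l) \<alpha>"
  shows "schur e m \<alpha> l * adelta e (shift m l) = alt e (shift m l) (Lam e (shift m l) \<alpha>)"
proof -
  let ?M = "shift m l"
  have d: "delta e ?M = (\<Sum>k<e. barr k (?M k) (\<lambda>j. ?M k - 1 - j))"
  proof (rule arr_eqI[OF keys_delta keys_sum_barr])
    fix k j assume *: "k < e" "j < ?M k"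
    have "lookup (\<Sum>i<e. barr i (?M i) (\<lambda>j. ?M i - 1 - j)) (k, j) = (\<Sum>i<e. if i = k then ?M k - 1 - j else 0)"
      unfolding lookup_sum by (intro sum.cong refl) (use * in \<open>auto simp: lookup_barr\<close>)
    then show "lookup (delta e ?M) (k, j) = lookup (\<Sum>i<e. barr i (?M i) (\<lambda>j. ?M i - 1 - j)) (k, j)"
      using * by (simp add: sum.delta lookup_delta)
  qed
  have L: "Lam e ?M \<alpha> = (\<Sum>k<e. barr k (?M k) (\<lambda>j. lookup \<alpha> (k, j) + (?M k - 1 - j)))"
  proof -
    have "barr k N (\<lambda>j. \<mu> j + \<nu> j) = barr k N \<mu> + barr k N \<nu>" for k N \<mu> \<nu>
      by (rule poly_mapping_eqI) (simp add: lookup_barr lookup_add)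
    then show ?thesis
      using arr_as_blocks[of \<alpha> e ?M] assms(2) by (simp add: Lam_def d sum.distrib fits_def)
  qed
  show ?thesis
    unfolding L unfolding d alt_prod schur_def prod.distrib[symmetric]
    by (intro prod.cong refl schur_block_times_delta[of _ e] fits_block[OF assms(2)])
       (use assms(1) in \<open>auto simp: epart_def\<close>)
qed

lemma schur_not_fits:
  assumes "\<alpha> \<in> epart e" "\<not> fits e (shift m l) \<alpha>" shows "schur e m \<alpha> l = 0"
proof -
  obtain k where "k < e" "\<not> (\<forall>j\<ge>shift m l k. lookup \<alpha> (k, j) = 0)" using not_fits_block[OF assms] .
  then have "schur_block k (shift m l k) (\<lambda>j. lookup \<alpha> (k, j)) = 0" unfolding schur_block_def by (intro if_not_P)
  then show ?thesis unfolding schur_def using \<open>k < e\<close> by (auto intro!: prod_zero)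
qed

lemma schur_unitriangular:
  assumes "\<alpha> \<in> Z00 e (shift m l) d"
  shows "\<exists>K. schur e m \<alpha> l = monsym e (shift m l) \<alpha>
    + (\<Sum>\<beta>\<in>{\<beta> \<in> Z00 e (shift m l) d. below e (shift m l) \<beta> \<alpha>}. Const (K \<beta>) * monsym e (shift m l) \<beta>)"
proof -
  have "\<alpha> \<in> epart e" "fits e (shift m l) \<alpha>" using assms by (simp_all add: Z00_def fits_def)
  note s = schur_times_delta[OF this]
  from alt_Lam_mono[OF assms] show ?thesis
    unfolding s[symmetric] mult_right_cancel[OF alt_delta_nonzero] .
qed

section \<open>Symmetric functions in infinitely many variables\<close>

lemma lookup_restr:
  "lookup (restr m f) \<beta> = (if \<forall>(k, j)\<in>keys \<beta>. j < m k then lookup f \<beta> else 0)"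
proof (induction f rule: mpol_induct)
  case (monom c \<gamma>)
  let ?\<sigma> = "\<lambda>(k, j). if j < m k then Var (k, j) else 0"
  have "meval ?\<sigma> \<gamma> = (if \<forall>(k, j)\<in>keys \<gamma>. j < m k then monom_arr \<gamma> else 0)"
  proof (cases "\<forall>(k, j)\<in>keys \<gamma>. j < m k")
    case True
    then have "meval ?\<sigma> \<gamma> = meval Var \<gamma>" unfolding meval_def by (intro prod.cong) auto
    then show ?thesis using True by (simp add: meval_Var)
  next
    case False
    then obtain v where "v \<in> keys \<gamma>" "?\<sigma> v = 0" by auto
    moreover from this have "lookup \<gamma> v \<noteq> 0" by (simp add: in_keys_iff)
    ultimately have "meval ?\<sigma> \<gamma> = 0" unfolding meval_def by (intro prod_zero) (auto intro!: bexI[of _ v])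
    then show ?thesis by (simp only: if_not_P[OF False])
  qed
  then show ?case by (simp add: restr_def msubst_monom_c lookup_monom)
next
  case (add f g)
  then show ?case by (simp add: restr_def msubst_add lookup_add)
qed

lemma restr_0 [simp]: "restr m 0 = 0" by (simp add: restr_def)
lemma restr_Const: "restr m (Const c * f) = Const c * restr m f" by (simp add: restr_def msubst_mult)
lemma restr_sum: "restr m (sum f A) = (\<Sum>x\<in>A. restr m (f x))" by (simp add: restr_def msubst_sum)

lemma Sm_mono:
  assumes "\<And>k. m k \<le> m' k" shows "Sm e m \<subseteq> Sm e m'"
proof
  fix w assume w: "w \<in> Sm e m"
  have "idx e m \<subseteq> idx e m'" using assms by (auto intro: less_le_trans[OF _ assms])
  then show "w \<in> Sm e m'" using permutes_subset[OF Sm_permutes[OF w]] Sm_fst[OF w] by (intro SmI)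
qed

lemma restr_mono:
  assumes le: "\<And>k. m k \<le> m' k" and \<alpha>: "\<alpha> \<in> epart e" "keys \<alpha> \<subseteq> idx e m'"
  shows "restr m (monsym e m' \<alpha>) = (if fits e m \<alpha> then monsym e m \<alpha> else 0)"
proof (rule poly_mapping_eqI)
  fix \<beta>
  have sub: "idx e m \<subseteq> idx e m'" by (auto intro: less_le_trans[OF _ le])
  have 1: "fits e m \<alpha> \<and> \<beta> \<in> orbit e m \<alpha>" if \<beta>: "\<beta> \<in> orbit e m' \<alpha>" "keys \<beta> \<subseteq> idx e m"
  proof -
    obtain w \<gamma> where w: "w \<in> Sm e m" "act w \<beta> = \<gamma>" "\<gamma> \<in> epart e" "keys \<gamma> \<subseteq> idx e m"
      using sort_blocks[OF \<beta>(2)] .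
    have w': "w \<in> Sm e m'" using w(1) Sm_mono[of m m' e] le by blast
    have "\<gamma> \<in> orbit e m' \<alpha>" using \<beta>(1) w(2) orbit_act[OF w'] by metis
    then have "\<gamma> = \<alpha>" using orbit_epart[OF \<alpha> w(3)] w(4) sub by blast
    then have "act (pinv w) \<alpha> = \<beta>" using w(2) Sm_bij[OF w(1)] by auto
    then have "\<beta> \<in> orbit e m \<alpha>" using Sm_inv[OF w(1)] by (auto simp: orbit_def)
    then show ?thesis using w(4) \<open>\<gamma> = \<alpha>\<close> by (simp add: fits_def)
  qed
  have 2: "\<beta> \<in> orbit e m' \<alpha> \<and> keys \<beta> \<subseteq> idx e m" if fit: "fits e m \<alpha>" and orb: "\<beta> \<in> orbit e m \<alpha>"
  proof -
    have "\<beta> \<in> orbit e m' \<alpha>" using orb Sm_mono[of m m' e] le by (auto simp: orbit_def)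
    moreover have "keys \<beta> \<subseteq> idx e m" using fit keys_orbit[OF orb] by (simp add: fits_def)
    ultimately show ?thesis ..
  qed
  have 3: "(\<forall>(k, j)\<in>keys \<beta>. j < m k) \<longleftrightarrow> keys \<beta> \<subseteq> idx e m" if "\<beta> \<in> orbit e m' \<alpha>"
  proof -
    have "keys \<beta> \<subseteq> idx e m'" using that \<alpha>(2) by (simp add: keys_orbit)
    then show ?thesis by (auto simp: idx_def subset_iff)
  qed
  show "lookup (restr m (monsym e m' \<alpha>)) \<beta> = lookup (if fits e m \<alpha> then monsym e m \<alpha> else 0) \<beta>"
    using 1 2 3 by (auto simp: lookup_restr lookup_mono)
qed

lemma Xi_fin_iff: "f \<in> Xi_fin e m \<longleftrightarrow> supp_in (idx e m) f \<and> symmetric_poly e m f"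
  by (simp add: Xi_fin_def supp_in_def symmetric_poly_def)

definition hom_Xi :: "nat \<Rightarrow> (nat \<Rightarrow> nat) \<Rightarrow> nat \<Rightarrow> symfun set" where
  "hom_Xi e m n = {f. (\<forall>l. f l \<in> Xi_fin e (shift m l) \<and> homog n (f l) \<and> restr (shift m l) (f (Suc l)) = f l)}"

lemma hom_Xi_Xi: "f \<in> hom_Xi e m n \<Longrightarrow> f \<in> Xi e m"
  by (auto simp: hom_Xi_def Xi_def homog_def)

lemma hom_XiI: "f \<in> Xi e m \<Longrightarrow> (\<And>l. homog n (f l)) \<Longrightarrow> f \<in> hom_Xi e m n"
  by (auto simp: hom_Xi_def Xi_def)

lemma epart_fits:
  assumes \<alpha>: "\<alpha> \<in> epart e" and le: "\<And>k. k < e \<Longrightarrow> total \<alpha> \<le> M k"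
  shows "fits e M \<alpha>"
  unfolding fits_def
proof
  fix v assume v: "v \<in> keys \<alpha>"
  obtain k j where kj: "v = (k, j)" by force
  have k: "k < e" using \<alpha> v kj by (auto simp: epart_def)
  have "1 \<le> lookup \<alpha> (k, i)" if "i \<le> j" for i
    using epart_mono[OF \<alpha> that, of k] v kj by (simp add: in_keys_iff)
  then have "Suc j \<le> (\<Sum>i\<le>j. lookup \<alpha> (k, i))"
    using sum_mono[of "{..j}" "\<lambda>_. 1" "\<lambda>i. lookup \<alpha> (k, i)"] by simp
  also have "\<dots> = (\<Sum>v\<in>Pair k ` {..j}. lookup \<alpha> v)" by (subst sum.reindex) (auto simp: inj_on_def)
  also have "\<dots> \<le> (\<Sum>v\<in>keys \<alpha> \<union> Pair k ` {..j}. lookup \<alpha> v)" by (intro sum_mono2) auto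
  also have "\<dots> = total \<alpha>" by (rule total_superset[symmetric]) auto
  finally show "v \<in> idx e M" using le[OF k] k kj by simp
qed

lemma Z00_stable:
  assumes "\<And>k. k < e \<Longrightarrow> n \<le> M k" shows "Z00 e M n = {\<alpha> \<in> epart e. total \<alpha> = n}"
  using epart_fits[of _ e M] assms by (auto simp: Z00_def fits_def)

text \<open>The lower levels are restrictions of the level \<open>L\<close>. At the higher levels every \<open>e\<close>-partition of
  \<open>n\<close> already occurs at the level \<open>L\<close>, so that restriction loses no coefficient over the monomial
  basis.\<close>

lemma hom_Xi_zero:
  assumes f: "f \<in> hom_Xi e m n" and L: "\<forall>k<e. n \<le> shift m L k" and zero: "f L = 0"
  shows "f l = 0"
proof (cases "l \<le> L")
  case True
  then show ?thesis
  proof (induction l rule: inc_induct)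
    case (step l)
    then show ?case using f by (simp add: hom_Xi_def) (metis restr_0)
  qed (rule zero)
next
  case False
  then have "L \<le> l" by simp
  then show ?thesis
  proof (induction l rule: dec_induct)
    case (step l)
    let ?M = "shift m l" and ?M' = "shift m (Suc l)" and ?g = "f (Suc l)"
    have M: "n \<le> ?M k" if "k < e" for k using L that step(1) by (force simp: shift_def)
    then have M': "n \<le> ?M' k" if "k < e" for k using that by (force simp: shift_def)
    have g: "symmetric_poly e ?M' ?g" "supp_in (idx e ?M') ?g" "homog n ?g" and r: "restr ?M ?g = f l"
      using f by (auto simp: hom_Xi_def Xi_fin_iff)
    have "lookup ?g \<alpha> = 0" if "\<alpha> \<in> Z00 e ?M' n" for \<alpha>
    proof -
      have "\<alpha> \<in> Z00 e ?M n" using that by (simp only: Z00_stable[OF M] Z00_stable[OF M'])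
      then have "keys \<alpha> \<subseteq> idx e ?M" by (simp add: Z00_def)
      then have "lookup (restr ?M ?g) \<alpha> = lookup ?g \<alpha>" by (auto simp: lookup_restr idx_def)
      then show ?thesis using r step.IH by simp
    qed
    then show ?case by (subst symmetric_expand[OF g]) simp
  qed (rule zero)
qed

lemma lincomb_restr: 
  "(\<And>i. i \<in> A \<Longrightarrow> restr M (g i (Suc l)) = g i l) \<Longrightarrow> restr M (lincomb A c g (Suc l)) = lincomb A c g l"
  by (simp add: lincomb_def restr_sum restr_Const)

lemma hom_Xi_lincomb:
  assumes "\<And>i. i \<in> A \<Longrightarrow> g i \<in> hom_Xi e m n" shows "lincomb A c g \<in> hom_Xi e m n"
  unfolding hom_Xi_def
proof (clarify, intro conjI)
  fix l
  show "lincomb A c g l \<in> Xi_fin e (shift m l)" unfolding lincomb_def Xi_fin_iff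
    using assms by (auto simp: hom_Xi_def Xi_fin_iff intro!: supp_in_sum symmetric_sum supp_in_Const symmetric_Const)
  show "homog n (lincomb A c g l)" unfolding lincomb_def
    using assms by (auto simp: hom_Xi_def intro!: homog_sum homog_Const)
  show "restr (shift m l) (lincomb A c g (Suc l)) = lincomb A c g l"
    by (rule lincomb_restr) (use assms in \<open>auto simp: hom_Xi_def\<close>)
qed

lemma hom_Xi_diff:
  assumes "f \<in> hom_Xi e m n" "g \<in> hom_Xi e m n" shows "(\<lambda>l. f l - g l) \<in> hom_Xi e m n"
proof -
  have "(\<lambda>l. f l - g l) = lincomb {True, False} (\<lambda>b. if b then 1 else - 1) (\<lambda>b. if b then f else g)"
    by (rule ext) (simp add: lincomb_def Const_minus)
  then show ?thesis using assms by (auto intro!: hom_Xi_lincomb)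
qed

lemma hom_Xi_eqI:
  assumes "f \<in> hom_Xi e m n" "g \<in> hom_Xi e m n" "\<forall>k<e. n \<le> shift m L k" "f L = g L"
  shows "f = g"
  using hom_Xi_zero[OF hom_Xi_diff[OF assms(1,2)] assms(3)] assms(4) by auto

lemma msym_hom_Xi:
  assumes "\<alpha> \<in> epart e" shows "msym e m \<alpha> \<in> hom_Xi e m (total \<alpha>)"
  unfolding hom_Xi_def
proof (clarify, intro conjI)
  fix l
  show "msym e m \<alpha> l \<in> Xi_fin e (shift m l)"
    by (simp add: msym_mono[OF assms] Xi_fin_iff symmetric_mono supp_mono fits_def)
  show "homog (total \<alpha>) (msym e m \<alpha> l)"
    by (simp add: msym_mono[OF assms] homog_mono)
  have le: "shift m l k \<le> shift m (Suc l) k" for k by (simp add: shift_def)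
  have "fits e (shift m (Suc l)) \<alpha>" if "fits e (shift m l) \<alpha>"
    using that le by (auto simp: fits_def idx_def intro: less_le_trans)
  then show "restr (shift m l) (msym e m \<alpha> (Suc l)) = msym e m \<alpha> l"
    using restr_mono[OF le assms] by (auto simp: msym_mono[OF assms] fits_def)
qed

lemma schur_homog:
  assumes "\<alpha> \<in> epart e" shows "homog (total \<alpha>) (schur e m \<alpha> l)"
proof (cases "fits e (shift m l) \<alpha>")
  case True
  then have "\<alpha> \<in> Z00 e (shift m l) (total \<alpha>)" using assms by (simp add: Z00_def fits_def)
  from schur_unitriangular[OF this] obtain K where K: "schur e m \<alpha> l = monsym e (shift m l) \<alpha>
    + (\<Sum>\<beta>\<in>{\<beta> \<in> Z00 e (shift m l) (total \<alpha>). below e (shift m l) \<beta> \<alpha>}. Const (K \<beta>) * monsym e (shift m l) \<beta>)" ..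
  have "homog (total \<alpha>) (monsym e (shift m l) \<beta>)" if "\<beta> \<in> Z00 e (shift m l) (total \<alpha>)" for \<beta>
    using that homog_mono[of \<beta>] by (simp add: Z00_def)
  then show ?thesis unfolding K by (intro homog_add homog_mono homog_sum homog_Const) auto
qed (simp add: schur_not_fits[OF assms])

section \<open>The operators\<close>

text \<open>The permutation of positions underlying \<open>T\<^sub>i\<close>, and \<open>T\<^sub>i\<close> with an arbitrary scalar in place
  of \<open>q\<close>.\<close>

definition hop :: "nat \<Rightarrow> pm \<Rightarrow> (nat \<Rightarrow> nat) \<Rightarrow> nat \<times> nat \<Rightarrow> nat \<times> nat" where
  "hop e s i v = (if fst v < e \<and> snd v = i (fst v) then (nbr e s (fst v), i (nbr e s (fst v))) else v)"

definition hit :: "nat \<Rightarrow> (nat \<Rightarrow> nat) \<Rightarrow> nat \<times> nat \<Rightarrow> bool" where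
  "hit e i v \<longleftrightarrow> fst v < e \<and> snd v = i (fst v)"

definition TT :: "nat \<Rightarrow> fld \<Rightarrow> pm \<Rightarrow> (nat \<Rightarrow> nat) \<Rightarrow> mpol \<Rightarrow> mpol" where
  "TT e x s i = msubst (\<lambda>v. Const (if hit e i v then x else 1) * Var (hop e s i v))"

lemma hop_hit: "hop e s i v = (if hit e i v then (nbr e s (fst v), i (nbr e s (fst v))) else v)"
  by (simp add: hop_def hit_def)

lemma Top_TT: "Top e s i = TT e qF s i"
  unfolding Top_def TT_def by (intro arg_cong[where f = msubst] ext) (auto simp: hop_def hit_def)

fun opp :: "pm \<Rightarrow> pm" where "opp SPlus = SMinus" | "opp SMinus = SPlus"

lemma opp_opp [simp]: "opp (opp s) = s" by (cases s) auto

lemma nbr_less: "0 < e \<Longrightarrow> nbr e s k < e" by (cases s) auto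

lemma nbr_opp: assumes "k < e" shows "nbr e (opp s) (nbr e s k) = k"
proof (cases s)
  case SPlus
  show ?thesis
  proof (cases "k = 0")
    case True
    then show ?thesis using assms SPlus by simp
  next
    case False
    then have "(k + e - 1) mod e = k - 1" using assms by (simp add: mod_if)
    then show ?thesis using assms False SPlus by simp
  qed
next
  case SMinus
  show ?thesis
  proof (cases "k + 1 = e")
    case True
    then show ?thesis using SMinus by auto
  next
    case False
    then have "(k + 1) mod e = k + 1" using assms by simp
    then show ?thesis using assms SMinus by (simp add: mod_if)
  qed
qed

lemma nbr_opp': "k < e \<Longrightarrow> nbr e s (nbr e (opp s) k) = k"
  using nbr_opp[of k e "opp s"] by simp

lemma hop_opp: "hop e (opp s) i (hop e s i v) = v"
  by (cases v) (auto simp: hop_def nbr_opp nbr_less)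

lemma hop_bij: "bij (hop e s i)"
  by (rule bij_betw_byWitness[of _ "hop e (opp s) i"]) (use hop_opp[of e "opp s" i] in \<open>auto simp: hop_opp\<close>)

lemma pinv_hop: "pinv (hop e s i) = hop e (opp s) i"
  using hop_opp[of e "opp s" i] hop_opp[of e s i] by (intro inv_equality) auto

lemma hop_permutes:
  assumes "i \<in> Iset e m" shows "hop e s i permutes idx e m"
proof (rule bij_imp_permutes)
  have i: "i k < m k" if "k < e" for k using assms that by (auto simp: Iset_def)
  have sub: "hop e s i ` idx e m \<subseteq> idx e m" using i by (auto simp: hop_def nbr_less)
  show "bij_betw (hop e s i) (idx e m) (idx e m)"
    using endo_inj_surj[OF finite_idx sub] sub inj_on_subset[OF bij_is_inj[OF hop_bij] subset_UNIV] by (simp add: bij_betw_def)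
  show "hop e s i v = v" if "v \<notin> idx e m" for v
    using that i by (cases v) (auto simp: hop_def)
qed

lemma hit_prod: "(\<Prod>v\<in>keys \<beta>. (if hit e i v then x else 1) ^ lookup \<beta> v) = (x::fld) ^ pairing e \<beta> i"
proof -
  have "(\<Prod>v\<in>keys \<beta>. (if hit e i v then x else 1) ^ lookup \<beta> v) = (\<Prod>v\<in>keys \<beta> \<union> (\<lambda>k. (k, i k)) ` {..<e}. (if hit e i v then x else 1) ^ lookup \<beta> v)"
    by (rule prod.mono_neutral_left) (auto simp: in_keys_iff)
  also have "\<dots> = (\<Prod>v\<in>(\<lambda>k. (k, i k)) ` {..<e}. (if hit e i v then x else 1) ^ lookup \<beta> v)"
    by (rule prod.mono_neutral_right) (auto simp: hit_def)
  also have "\<dots> = (\<Prod>k<e. x ^ lookup \<beta> (k, i k))"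
    by (subst prod.reindex) (auto simp: inj_on_def hit_def)
  finally show ?thesis by (simp add: pairing_def power_sum)
qed

lemma TT_monom: "TT e x s i (monom_arr \<beta>) = Const (x ^ pairing e \<beta> i) * monom_arr (act (hop e s i) \<beta>)"
  unfolding TT_def msubst_monom meval_monomial[OF hop_bij] hit_prod ..

lemma lookup_TT: "lookup (TT e x s i f) (act (hop e s i) \<beta>) = x ^ pairing e \<beta> i * lookup f \<beta>"
  unfolding TT_def lookup_msubst_monomial[OF hop_bij] hit_prod ..

lemma lookup_TT': "lookup (TT e x s i f) \<gamma> = x ^ pairing e (act (hop e (opp s) i) \<gamma>) i * lookup f (act (hop e (opp s) i) \<gamma>)"
  using lookup_TT[of e x s i f "act (hop e (opp s) i) \<gamma>"] act_inv(2)[OF hop_bij, of e s i \<gamma>] by (simp add: pinv_hop)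

lemma pairing_hop: "pairing e (act (hop e s i) \<beta>) i = pairing e \<beta> i"
proof -
  have "pairing e (act (hop e s i) \<beta>) i = (\<Sum>k<e. lookup \<beta> (nbr e (opp s) k, i (nbr e (opp s) k)))"
    unfolding pairing_def by (intro sum.cong refl) (simp add: lookup_act[OF hop_bij] pinv_hop hop_def)
  also have "\<dots> = (\<Sum>k<e. lookup \<beta> (k, i k))"
    by (rule sum.reindex_bij_witness[of _ "nbr e s" "nbr e (opp s)"])
       (auto simp: nbr_opp nbr_opp' intro!: nbr_less)
  finally show ?thesis by (simp add: pairing_def)
qed

lemma TT_mult: "TT e x s i (f * g) = TT e x s i f * TT e x s i g" by (simp add: TT_def msubst_mult)
lemma TT_add: "TT e x s i (f + g) = TT e x s i f + TT e x s i g" by (simp add: TT_def msubst_add)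
lemma TT_sum: "TT e x s i (sum f A) = (\<Sum>a\<in>A. TT e x s i (f a))" by (simp add: TT_def msubst_sum)
lemma TT_prod: "TT e x s i (prod f A) = (\<Prod>a\<in>A. TT e x s i (f a))" by (simp add: TT_def msubst_prod)
lemma TT_power: "TT e x s i (f ^ k) = TT e x s i f ^ k" by (simp add: TT_def msubst_power)
lemma TT_Const [simp]: "TT e x s i (Const c) = Const c" by (simp add: TT_def)
lemma TT_of_int [simp]: "TT e x s i (of_int k) = of_int k" by (simp add: TT_def)
lemma supp_TT: "supp_in (idx e m) f \<Longrightarrow> i \<in> Iset e m \<Longrightarrow> supp_in (idx e m) (TT e x s i f)"
  unfolding supp_in_alt
proof (intro allI impI)
  fix \<gamma> assume f: "\<forall>\<beta>. lookup f \<beta> \<noteq> 0 \<longrightarrow> keys \<beta> \<subseteq> idx e m" and i: "i \<in> Iset e m" and "lookup (TT e x s i f) \<gamma> \<noteq> 0"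
  then have "keys (act (hop e (opp s) i) \<gamma>) \<subseteq> idx e m" by (auto simp: lookup_TT')
  then have "hop e (opp s) i ` keys \<gamma> \<subseteq> idx e m" by (simp add: keys_act[OF hop_bij])
  then show "keys \<gamma> \<subseteq> idx e m" using permutes_in_image[OF hop_permutes[OF i]] by blast
qed

lemma homog_TT: "homog d f \<Longrightarrow> homog d (TT e x s i f)"
  unfolding homog_alt by (auto simp: lookup_TT' hop_bij)

lemma moved_hop: assumes "e > 0" shows "moved e s i \<beta> = act (hop e s i) \<beta>"
  unfolding moved_def
proof (rule the_equality)
  show "Top e s i (monom_arr \<beta>) = Const (qF ^ pairing e \<beta> i) * monom_arr (act (hop e s i) \<beta>)"
    by (simp add: Top_TT TT_monom)
next
  fix \<gamma> assume "Top e s i (monom_arr \<beta>) = Const (qF ^ pairing e \<beta> i) * monom_arr \<gamma>"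
  then have "lookup (Const (qF ^ pairing e \<beta> i) * monom_arr (act (hop e s i) \<beta>)) \<gamma> = lookup (Const (qF ^ pairing e \<beta> i) * monom_arr \<gamma>) \<gamma>"
    by (simp only: Top_TT TT_monom)
  then show "\<gamma> = act (hop e s i) \<beta>" by (simp add: lookup_monom split: if_splits)
qed

text \<open>The numerator of \<open>D f\<close>, with an arbitrary scalar in place of \<open>q\<close>.\<close>

definition Num :: "nat \<Rightarrow> (nat \<Rightarrow> nat) \<Rightarrow> fld \<Rightarrow> pm \<Rightarrow> mpol \<Rightarrow> mpol" where
  "Num e m x s f = (\<Sum>i\<in>Iset e m. TT e tF s i (adelta e m) * TT e x s i f)"

lemma Num_sum: "Num e m x s (sum f A) = (\<Sum>a\<in>A. Num e m x s (f a))"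
  unfolding Num_def TT_sum sum_distrib_left by (rule sum.swap)

lemma Num_Const: "Num e m x s (Const c * f) = Const c * Num e m x s f"
  by (simp add: Num_def TT_mult sum_distrib_left mult_ac)

lemma Dop_Num: assumes "e > 0" shows "Dop e m s f = mquot (Num e m qF s f) (adelta e m)"
proof -
  have "(\<Sum>w\<in>Sm e m. of_int (sign w) * (\<Sum>i\<in>Iset e m. monom_arr (moved e s i (act w (delta e m))) *
           Const (tF ^ pairing e (act w (delta e m)) i) * Top e s i f))
     = (\<Sum>w\<in>Sm e m. \<Sum>i\<in>Iset e m. of_int (sign w) * TT e tF s i (monom_arr (act w (delta e m))) * TT e qF s i f)"
    unfolding sum_distrib_left
    by (intro sum.cong refl) (simp add: moved_hop[OF assms] TT_monom Top_TT mult_ac)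
  also have "\<dots> = Num e m qF s f"
    unfolding Num_def alternant_def TT_sum TT_mult TT_of_int sum_distrib_right
    by (rule sum.swap)
  finally show ?thesis by (simp add: Dop_def)
qed

text \<open>For \<open>q = t\<close> the two factors combine, because \<open>T\<^sub>i\<close> is multiplicative.\<close>

lemma Num_t: "Num e m tF s f = (\<Sum>i\<in>Iset e m. TT e tF s i (adelta e m * f))"
  by (simp add: Num_def TT_mult)

text \<open>The action of \<open>w\<close> on the index sequences \<open>i\<close>, through the positions \<open>(k, i\<^sub>k)\<close>.\<close>

definition reidx :: "nat \<Rightarrow> (nat \<times> nat \<Rightarrow> nat \<times> nat) \<Rightarrow> (nat \<Rightarrow> nat) \<Rightarrow> nat \<Rightarrow> nat" where
  "reidx e w i = restrict (\<lambda>k. snd (w (k, i k))) {..<e}"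

lemma reidx_apply: "w \<in> Sm e m \<Longrightarrow> k < e \<Longrightarrow> w (k, i k) = (k, reidx e w i k)"
  using Sm_fst[of w e m "(k, i k)"] by (simp add: reidx_def prod_eq_iff)

lemma reidx_Iset:
  assumes "w \<in> Sm e m" "i \<in> Iset e m" shows "reidx e w i \<in> Iset e m"
proof -
  have "reidx e w i k < m k" if "k < e" for k
  proof -
    have "(k, i k) \<in> idx e m" using assms(2) that by (auto simp: Iset_def)
    then have "w (k, i k) \<in> idx e m" by (simp only: Sm_in_idx[OF assms(1)])
    then show ?thesis by (simp add: reidx_apply[OF assms(1) that])
  qed
  then show ?thesis by (auto simp: Iset_def reidx_def)
qed

lemma reidx_inv:
  assumes "w \<in> Sm e m" "i \<in> Iset e m" shows "reidx e (pinv w) (reidx e w i) = i"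
proof
  fix k show "reidx e (pinv w) (reidx e w i) k = i k"
  proof (cases "k < e")
    case True
    have "pinv w (k, reidx e w i k) = (k, i k)"
      using reidx_apply[OF assms(1) True, of i] Sm_bij[OF assms(1)] by (metis bij_inv_eq_iff)
    then show ?thesis using True by (simp add: reidx_def)
  next
    case False
    then show ?thesis using assms(2) by (auto simp: reidx_def Iset_def PiE_def extensional_def)
  qed
qed

lemma hop_conj:
  assumes "w \<in> Sm e m" shows "hop e s (reidx e w i) (w v) = w (hop e s i v)" "hit e (reidx e w i) (w v) = hit e i v"
proof -
  have f: "fst (w v) = fst v" by (rule Sm_fst[OF assms])
  show h: "hit e (reidx e w i) (w v) = hit e i v"
  proof (cases "fst v < e")
    case True
    have "hit e (reidx e w i) (w v) \<longleftrightarrow> w v = w (fst v, i (fst v))"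
      using True f reidx_apply[OF assms True, of i] by (auto simp: hit_def prod_eq_iff)
    also have "\<dots> \<longleftrightarrow> v = (fst v, i (fst v))" using Sm_bij[OF assms] by (simp add: bij_is_inj inj_eq)
    finally show ?thesis using True by (auto simp: hit_def prod_eq_iff)
  qed (simp add: hit_def f)
  show "hop e s (reidx e w i) (w v) = w (hop e s i v)"
  proof (cases "hit e i v")
    case True
    then have "0 < e" by (auto simp: hit_def)
    with True h f show ?thesis
      using reidx_apply[OF assms nbr_less, of s "fst v" i] by (simp add: hop_def hit_def)
  next
    case False
    then show ?thesis using h by (simp add: hop_hit)
  qed
qed

lemma TT_perm:
  assumes "w \<in> Sm e m"
  shows "msubst (Var \<circ> w) (TT e x s i f) = TT e x s (reidx e w i) (msubst (Var \<circ> w) f)"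
  unfolding TT_def msubst_comp
  by (intro arg_cong[where f = "\<lambda>\<sigma>. msubst \<sigma> f"] ext) (simp add: msubst_mult hop_conj[OF assms])

text \<open>A permutation \<open>w\<close> of the variables conjugates \<open>T\<^sub>i\<close> to \<open>T\<^bsub>w(i)\<^esub>\<close>, hence permutes the summands of
  the numerator up to the sign from \<open>a\<^sub>\<delta>\<close>.\<close>

lemma alternating_Num:
  assumes "symmetric_poly e m f" shows "alternating e m (Num e m x s f)"
  unfolding alternating_def
proof
  fix w assume w: "w \<in> Sm e m"
  let ?a = "adelta e m"
  have "msubst (Var \<circ> w) (Num e m x s f) = (\<Sum>i\<in>Iset e m. TT e tF s (reidx e w i) (of_int (sign w) * ?a) * TT e x s (reidx e w i) f)"
    unfolding Num_def msubst_sum msubst_mult TT_perm[OF w]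
    using assms alternating_alt[of e m "delta e m"] w by (simp add: alternating_def symmetric_poly_def)
  also have "\<dots> = (\<Sum>i\<in>Iset e m. TT e tF s i (of_int (sign w) * ?a) * TT e x s i f)"
    by (rule sum.reindex_bij_witness[of _ "reidx e (pinv w)" "reidx e w"])
       (use w reidx_inv[OF w] reidx_inv[OF Sm_inv[OF w]] reidx_Iset[OF w] reidx_Iset[OF Sm_inv[OF w]]
          inv_inv_eq[OF Sm_bij[OF w]] in auto)
  finally show "msubst (Var \<circ> w) (Num e m x s f) = of_int (sign w) * Num e m x s f"
    by (simp add: Num_def TT_mult sum_distrib_left mult.assoc)
qed

lemma Dop_times_delta:
  assumes "e > 0" "symmetric_poly e m f" "supp_in (idx e m) f" "homog d f"
  shows "Dop e m s f * adelta e m = Num e m qF s f"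
proof -
  have "supp_in (idx e m) (Num e m qF s f)"
    unfolding Num_def by (intro supp_in_sum supp_in_mult supp_TT assms supp_in_alt' keys_delta)
  moreover have "homog (d + total (delta e m)) (Num e m qF s f)"
    unfolding Num_def add.commute[of d] by (intro homog_sum homog_mult homog_TT homog_alt' assms)
  ultimately obtain g where g: "g * adelta e m = Num e m qF s f"
    using alternating_divisible[OF alternating_Num[OF assms(2)]] by blast
  then show ?thesis unfolding Dop_Num[OF assms(1)] mquot_eqI[OF g alt_delta_nonzero] .
qed

text \<open>The exponents in the numerator of \<open>D m\<^sub>\<alpha>\<close> have, up to permutation of all positions, the form
  \<open>\<delta> + w(\<alpha>)\<close>.\<close>

lemma Num_mono_dominated:
  assumes \<alpha>: "\<alpha> \<in> epart e" "keys \<alpha> \<subseteq> idx e m" and nz: "lookup (Num e m x s (monsym e m \<alpha>)) \<gamma> \<noteq> 0"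
  shows "dominated (desc (ent e m \<gamma>)) (lam e m \<alpha>)"
proof -
  obtain i where i: "i \<in> Iset e m" "lookup (TT e tF s i (adelta e m) * TT e x s i (monsym e m \<alpha>)) \<gamma> \<noteq> 0"
    using nz unfolding Num_def lookup_sum by (metis (mono_tags, lifting) sum.neutral)
  obtain \<beta> \<beta>' where \<beta>: "\<gamma> = \<beta> + \<beta>'" "lookup (TT e tF s i (adelta e m)) \<beta> \<noteq> 0" "lookup (TT e x s i (monsym e m \<alpha>)) \<beta>' \<noteq> 0"
    using keys_mult_elim[OF i(2)] .
  define \<beta>1 where "\<beta>1 = act (hop e (opp s) i) \<beta>"
  define \<beta>2 where "\<beta>2 = act (hop e (opp s) i) \<beta>'"
  have "lookup (adelta e m) \<beta>1 \<noteq> 0" using \<beta>(2) by (auto simp: lookup_TT' \<beta>1_def)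
  then obtain w where w: "w \<in> Sm e m" "act w (delta e m) = \<beta>1" by (rule lookup_alternant_nonzero)
  have "\<beta>2 \<in> orbit e m \<alpha>" using \<beta>(3) by (auto simp: lookup_TT' lookup_mono \<beta>2_def split: if_splits)
  then obtain w' where w': "w' \<in> Sm e m" "act w (delta e m) + \<beta>2 = act w (delta e m + act w' \<alpha>)"
    using mono_times_delta_keys[OF \<alpha> w(1)] by metis
  have "act (hop e (opp s) i) \<gamma> = \<beta>1 + \<beta>2" by (simp add: \<beta>(1) \<beta>1_def \<beta>2_def act_add[OF hop_bij])
  then have "ent e m \<gamma> = ent e m (act w (delta e m + act w' \<alpha>))"
    using ent_act[OF hop_permutes[OF i(1)], of "opp s" \<gamma>] w(2) w'(2) by simp
  then have "ent e m \<gamma> = ent e m (delta e m + act w' \<alpha>)" by (simp add: ent_act[OF Sm_permutes[OF w(1)]])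
  then show ?thesis using dominated_permuted[OF \<alpha> w'(1)] by (simp add: lam_desc)
qed

text \<open>Among the \<open>\<beta>\<close> that violate the triangularity take a maximal \<open>\<gamma>\<close>. The exponent \<open>\<Lambda>(\<gamma>)\<close> then
  occurs in \<open>m\<^sub>\<gamma> a\<^sub>\<delta>\<close> but in no other term of \<open>a\<^sub>\<delta> D m\<^sub>\<alpha>\<close>, so that it is an exponent of the
  numerator, which is impossible.\<close>

lemma Dop_mono_triangular:
  assumes e: "e > 0" and \<alpha>: "\<alpha> \<in> Z00 e m d"
    and h: "Dop e m s (monsym e m \<alpha>) = (\<Sum>\<beta>\<in>Z00 e m d. Const (h \<beta>) * monsym e m \<beta>)"
    and \<beta>: "\<beta> \<in> Z00 e m d" and nz: "h \<beta> \<noteq> 0"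
  shows "sim e m \<beta> \<alpha> \<or> below e m \<beta> \<alpha>"
proof (rule ccontr)
  assume neg: "\<not> (sim e m \<beta> \<alpha> \<or> below e m \<beta> \<alpha>)"
  let ?Z = "Z00 e m d" and ?a = "adelta e m"
  define B where "B = {\<beta> \<in> ?Z. h \<beta> \<noteq> 0 \<and> \<not> (sim e m \<beta> \<alpha> \<or> below e m \<beta> \<alpha>)}"
  have "wf ({(\<beta>, \<alpha>). \<alpha> \<in> ?Z \<and> \<beta> \<in> ?Z \<and> below e m \<beta> \<alpha>}\<inverse>)"
  proof (rule finite_acyclic_wf_converse)
    show "finite {(\<beta>, \<alpha>). \<alpha> \<in> ?Z \<and> \<beta> \<in> ?Z \<and> below e m \<beta> \<alpha>}"
      by (rule finite_subset[of _ "?Z \<times> ?Z"]) auto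
    show "acyclic {(\<beta>, \<alpha>). \<alpha> \<in> ?Z \<and> \<beta> \<in> ?Z \<and> below e m \<beta> \<alpha>}"
      by (rule wf_acyclic[OF finite_wf_below[OF finite_Z00]])
  qed
  moreover have "\<beta> \<in> B" using \<beta> nz neg by (simp add: B_def)
  ultimately obtain \<gamma> where \<gamma>: "\<gamma> \<in> B" and max: "\<And>\<nu>. below e m \<gamma> \<nu> \<Longrightarrow> \<nu> \<in> ?Z \<Longrightarrow> \<nu> \<notin> B"
    by (rule wfE_min) (auto simp: B_def)
  have \<gamma>Z: "\<gamma> \<in> ?Z" using \<gamma> by (simp add: B_def)
  have \<alpha>': "\<alpha> \<in> epart e" "keys \<alpha> \<subseteq> idx e m" using \<alpha> by (simp_all add: Z00_def)
  have D: "Num e m qF s (monsym e m \<alpha>) = (\<Sum>\<nu>\<in>?Z. Const (h \<nu>) * (monsym e m \<nu> * ?a))"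
    using Dop_times_delta[OF e symmetric_mono supp_mono[OF \<alpha>'(2)] homog_mono, of s] h
    by (simp add: sum_distrib_right mult.assoc)
  have other: "h \<nu> * lookup (monsym e m \<nu> * ?a) (Lam e m \<gamma>) = 0" if \<nu>: "\<nu> \<in> ?Z" "\<nu> \<noteq> \<gamma>" for \<nu>
  proof (rule ccontr)
    assume *: "h \<nu> * lookup (monsym e m \<nu> * ?a) (Lam e m \<gamma>) \<noteq> 0"
    then have b: "below e m \<gamma> \<nu>" using mono_times_delta_at_Lam(1)[OF \<nu>(1) \<gamma>Z] \<nu>(2) by auto
    then have "\<nu> \<notin> B" using max \<nu>(1) by blast
    then have "sim e m \<nu> \<alpha> \<or> below e m \<nu> \<alpha>" using * \<nu>(1) by (auto simp: B_def)
    then have "below e m \<gamma> \<alpha>" using b below_trans below_sim_right by blast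
    then show False using \<gamma> by (simp add: B_def)
  qed
  have "lookup (Num e m qF s (monsym e m \<alpha>)) (Lam e m \<gamma>) = (\<Sum>\<nu>\<in>?Z. if \<nu> = \<gamma> then h \<gamma> else 0)"
    unfolding D lookup_sum lookup_Const_mult
    by (intro sum.cong refl) (use other mono_times_delta_at_Lam(2)[OF \<gamma>Z \<gamma>Z] in auto)
  then have "lookup (Num e m qF s (monsym e m \<alpha>)) (Lam e m \<gamma>) \<noteq> 0"
    using \<gamma> \<gamma>Z by (simp add: sum.delta B_def)
  from Num_mono_dominated[OF \<alpha>' this] have "sim e m \<gamma> \<alpha> \<or> below e m \<gamma> \<alpha>"
    by (auto simp: sim_lam below_def lam_desc)
  then show False using \<gamma> by (simp add: B_def)
qed

lemma E_level_times_delta: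
  assumes "e > 0" "symmetric_poly e (shift m l) f" "supp_in (idx e (shift m l)) f" "homog d f"
  shows "E_level e m c s l f * adelta e (shift m l) =
    Const (tF powi (- int (\<Sum>k<e. shift m l k))) * Num e (shift m l) qF s f
    + Const (c l - (\<Sum>i\<in>Iset e (shift m l). tF powi (int (pairing e (delta e (shift m l)) i) - int (\<Sum>k<e. shift m l k))))
        * (f * adelta e (shift m l))"
  using Dop_times_delta[OF assms, of s]
  by (simp add: E_level_def Eop_def Let_def Const_diff algebra_simps)

section \<open>The monomial pairing and power sums\<close>

text \<open>The second argument is a function on the exponents, since the adjoint of the multiplication by a
  power sum is most easily described on such functions.\<close>

definition pairing_form :: "mpol \<Rightarrow> (arr \<Rightarrow> fld) \<Rightarrow> fld" where
  "pairing_form F G = (\<Sum>\<gamma>\<in>keys F. lookup F \<gamma> * cnj_F (G \<gamma>))"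

abbreviation Bf :: "mpol \<Rightarrow> mpol \<Rightarrow> fld" where "Bf F G \<equiv> pairing_form F (lookup G)"

lemma pairing_form_superset:
  "finite A \<Longrightarrow> keys F \<subseteq> A \<Longrightarrow> pairing_form F G = (\<Sum>\<gamma>\<in>A. lookup F \<gamma> * cnj_F (G \<gamma>))"
  unfolding pairing_form_def by (intro sum.mono_neutral_left) (auto simp: in_keys_iff)

lemma pairing_form_add: "pairing_form (F + F') G = pairing_form F G + pairing_form F' G"
proof -
  let ?A = "keys F \<union> keys F'"
  have "finite ?A" "keys F \<subseteq> ?A" "keys F' \<subseteq> ?A" "keys (F + F') \<subseteq> ?A"
    using Poly_Mapping.keys_add[of F F'] by auto
  then show ?thesis
    by (simp add: pairing_form_superset[of ?A] lookup_add distrib_right sum.distrib)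
qed

lemma pairing_form_monom: "pairing_form (Const c * monom_arr \<beta>) G = c * cnj_F (G \<beta>)"
  by (subst pairing_form_superset[of "{\<beta>}"]) (auto simp: Const_mult_monom)

lemma pairing_form_0 [simp]: "pairing_form 0 G = 0" by (simp add: pairing_form_def)

lemma pairing_form_Const: "pairing_form (Const c * F) G = c * pairing_form F G"
proof (induction F rule: mpol_induct)
  case (monom d \<beta>)
  have "Const c * (Const d * monom_arr \<beta>) = Const (c * d) * monom_arr \<beta>" by (simp add: Const_mult mult.assoc)
  then show ?case by (simp only: pairing_form_monom) (simp add: mult.assoc)
qed (simp add: distrib_left pairing_form_add)

lemma pairing_form_sum: "pairing_form (sum F A) G = (\<Sum>a\<in>A. pairing_form (F a) G)"
  by (induction A rule: infinite_finite_induct) (simp_all add: pairing_form_add)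

lemma pairing_form_scale_right: "pairing_form F (\<lambda>\<gamma>. c * G \<gamma>) = cnj_F c * pairing_form F G"
  by (simp add: pairing_form_def sum_distrib_left mult_ac)

lemma Bf_hermitian: "Bf F G = cnj_F (Bf G F)"
proof -
  let ?A = "keys F \<union> keys G"
  have "Bf F G = (\<Sum>\<gamma>\<in>?A. lookup F \<gamma> * cnj_F (lookup G \<gamma>))"
    by (rule pairing_form_superset) auto
  moreover have "Bf G F = (\<Sum>\<gamma>\<in>?A. lookup G \<gamma> * cnj_F (lookup F \<gamma>))"
    by (rule pairing_form_superset) auto
  ultimately show ?thesis by (simp add: mult.commute)
qed

text \<open>\<open>T\<close> permutes the monomials up to powers of \<open>t\<close>, hence the operators for the two signs are
  adjoint.\<close>

lemma TT_adjoint: "Bf (TT e tF s i F) G = Bf F (TT e tF (opp s) i G)"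
proof (induction F rule: mpol_induct)
  case (monom c \<beta>)
  have "TT e tF s i (Const c * monom_arr \<beta>) = Const (c * tF ^ pairing e \<beta> i) * monom_arr (act (hop e s i) \<beta>)"
    by (simp add: TT_mult TT_monom Const_mult mult_ac)
  then show ?case
    by (simp only: pairing_form_monom lookup_TT' opp_opp pairing_hop) (simp add: mult_ac)
qed (simp add: TT_add pairing_form_add)

lemma Bf_sum_right: "Bf F (sum G A) = (\<Sum>a\<in>A. Bf F (G a))"
  by (subst Bf_hermitian, simp add: pairing_form_sum, intro sum.cong refl, rule Bf_hermitian[symmetric])

lemma Num_t_adjoint:
  "Bf (Num e m tF s f) (g * adelta e m) = Bf (f * adelta e m) (Num e m tF (opp s) g)"
  by (simp add: Num_t pairing_form_sum Bf_sum_right TT_adjoint mult.commute)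

definition ps :: "nat \<Rightarrow> (nat \<Rightarrow> nat) \<Rightarrow> complex \<Rightarrow> nat \<times> nat \<Rightarrow> mpol" where
  "ps e m \<zeta> v = (\<Sum>x\<in>idx e m. Const (cF (\<zeta> ^ (fst v * fst x))) * Var x ^ snd v)"

lemma psum_ps: "psum e m \<zeta> i r l = ps e (shift m l) \<zeta> (i, r)"
  unfolding psum_def ps_def sum_idx by (simp add: sum_distrib_left)

lemma symmetric_ps: "symmetric_poly e m (ps e m \<zeta> v)"
  unfolding symmetric_poly_def
proof
  fix w assume w: "w \<in> Sm e m"
  have "msubst (Var \<circ> w) (ps e m \<zeta> v) = (\<Sum>x\<in>idx e m. (\<lambda>x. Const (cF (\<zeta> ^ (fst v * fst x))) * Var x ^ snd v) (w x))"
    by (simp add: ps_def msubst_sum msubst_mult msubst_power Sm_fst[OF w])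
  also have "\<dots> = ps e m \<zeta> v"
    using sum.permute[OF Sm_permutes[OF w], of "\<lambda>x. Const (cF (\<zeta> ^ (fst v * fst x))) * Var x ^ snd v"]
    by (simp add: ps_def o_def)
  finally show "msubst (Var \<circ> w) (ps e m \<zeta> v) = ps e m \<zeta> v" .
qed

lemma supp_ps: "supp_in (idx e m) (ps e m \<zeta> v)"
  unfolding ps_def by (intro supp_in_sum supp_in_Const supp_in_power) (auto simp: Var_def supp_in_monom)

lemma homog_Var: "homog r (Var x ^ r)"
  using homog_monom[of "Poly_Mapping.single x r"] by (simp add: monom_scale)

lemma homog_ps: "homog (snd v) (ps e m \<zeta> v)"
  unfolding ps_def by (intro homog_sum homog_Const homog_Var)

context
  fixes e :: nat and \<zeta> :: complex
begin

text \<open>The power sum with label \<open>(k, r)\<close> has the factor \<open>\<zeta>\<^bsup>ki\<^esup>\<close> on the block \<open>i\<close>. The operators \<open>T\<close> shift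
  the blocks, which multiplies these factors by \<open>\<zeta>\<^sup>k\<close> or its conjugate.\<close>

definition om :: "pm \<Rightarrow> complex" where
  "om s = (case s of SPlus \<Rightarrow> \<zeta> | SMinus \<Rightarrow> cnj \<zeta>)"

text \<open>For \<open>x = q\<close> and the sign \<open>+\<close> these are the factors by which \<open>z\<^sub>\<alpha>(q,t)\<close> differs from \<open>z\<^sub>\<alpha>\<close>.\<close>

definition uu :: "pm \<Rightarrow> fld \<Rightarrow> nat \<times> nat \<Rightarrow> fld" where
  "uu s x v = (1 - cF (om s ^ fst v) * x ^ snd v) / (1 - cF (om s ^ fst v) * tF ^ snd v)"

text \<open>Adjoint for the monomial pairing to the multiplication by a power sum.\<close>

definition down :: "(nat \<Rightarrow> nat) \<Rightarrow> nat \<times> nat \<Rightarrow> (arr \<Rightarrow> fld) \<Rightarrow> arr \<Rightarrow> fld" where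
  "down m v G \<gamma> = (\<Sum>x\<in>idx e m. cF (cnj \<zeta> ^ (fst v * fst x)) * G (\<gamma> + Poly_Mapping.single x (snd v)))"

text \<open>A monomial in the power sums is given by the multiplicities \<open>N\<close> of its factors; \<open>B\<close> is a
  finite set of labels \<open>(k, r)\<close>.\<close>

definition pmono :: "(nat \<Rightarrow> nat) \<Rightarrow> (nat \<times> nat) set \<Rightarrow> (nat \<times> nat \<Rightarrow> nat) \<Rightarrow> mpol" where
  "pmono m B N = (\<Prod>v\<in>B. ps e m \<zeta> v ^ N v)"

definition wt :: "(nat \<times> nat) set \<Rightarrow> (nat \<times> nat \<Rightarrow> nat) \<Rightarrow> nat" where
  "wt B N = (\<Sum>v\<in>B. N v * snd v)"

definition labels :: "(nat \<times> nat) set \<Rightarrow> bool" where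
  "labels B \<longleftrightarrow> finite B \<and> (\<forall>v\<in>B. fst v < e \<and> snd v \<ge> 1)"

text \<open>The factor that arises when the adjoint of \<open>p\<^sub>v\<close> acts \<open>k\<close> times, as a multiple of a derivation,
  on the \<open>n\<close>-th power of \<open>p\<^sub>v\<close>.\<close>

definition KK :: "nat \<times> nat \<Rightarrow> nat \<Rightarrow> nat \<Rightarrow> nat" where
  "KK v k n = (e * snd v) ^ k * fact k * (n choose k)"

text \<open>Coefficient of the binomial expansion of the operators for \<open>x\<close> in terms of those for \<open>t\<close>: the
  exponents \<open>\<sigma>\<close> count the power sums on which the operator is replaced by the identity.\<close>

definition cc :: "pm \<Rightarrow> fld \<Rightarrow> (nat \<times> nat \<Rightarrow> nat) \<Rightarrow> (nat \<times> nat \<Rightarrow> nat) \<Rightarrow> nat \<times> nat \<Rightarrow> fld" where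
  "cc s x N \<sigma> v = of_nat (N v choose \<sigma> v) * (1 - uu s x v) ^ \<sigma> v * uu s x v ^ (N v - \<sigma> v)"

context
  assumes e_pos: "e \<ge> 1" and zeta: "primitive_root_of_unity e \<zeta>"
begin

lemma zeta_power: "\<zeta> ^ e = 1"
  using zeta by (simp add: primitive_root_of_unity_def)

lemma zeta_cnj: "\<zeta> * cnj \<zeta> = 1"
proof -
  have "norm \<zeta> ^ e = 1" by (simp add: zeta_power flip: norm_power)
  then have "norm \<zeta> = 1" using e_pos power_eq_iff_eq_base[of e "norm \<zeta>" 1] by simp
  then show ?thesis by (simp flip: complex_norm_square)
qed

lemma zeta_pow_cnj: "\<zeta> ^ k * cnj \<zeta> ^ k = 1"
  by (simp add: zeta_cnj flip: power_mult_distrib)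

lemma zeta_mod: "\<zeta> ^ (k mod e) = \<zeta> ^ k"
proof -
  have "\<zeta> ^ k = \<zeta> ^ (e * (k div e) + k mod e)" by simp
  also have "\<dots> = (\<zeta> ^ e) ^ (k div e) * \<zeta> ^ (k mod e)" by (simp only: power_add power_mult)
  finally show ?thesis by (simp add: zeta_power)
qed

lemma zeta_orth:
  assumes "i < e" "j < e"
  shows "(\<Sum>k<e. \<zeta> ^ (j * k) * cnj \<zeta> ^ (i * k)) = (if i = j then of_nat e else 0)"
proof -
  let ?z = "\<zeta> ^ j * cnj \<zeta> ^ i"
  have eq: "(\<Sum>k<e. \<zeta> ^ (j * k) * cnj \<zeta> ^ (i * k)) = (\<Sum>k<e. ?z ^ k)"
    by (simp add: power_mult_distrib power_mult)
  show ?thesis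
  proof (cases "i = j")
    case True
    then show ?thesis by (simp add: eq zeta_pow_cnj)
  next
    case False
    have ne: "\<zeta> ^ b \<noteq> \<zeta> ^ a" if "a < b" "b < e" for a b
    proof
      assume *: "\<zeta> ^ b = \<zeta> ^ a"
      have "\<zeta> ^ (b - a) = \<zeta> ^ (b - a) * (\<zeta> ^ a * cnj \<zeta> ^ a)" by (simp add: zeta_pow_cnj)
      also have "\<dots> = \<zeta> ^ b * cnj \<zeta> ^ a" using that by (simp flip: mult.assoc power_add)
      finally have "\<zeta> ^ (b - a) = 1" by (simp add: * zeta_pow_cnj)
      then show False using zeta that by (simp add: primitive_root_of_unity_def)
    qed
    have "?z \<noteq> 1"
    proof
      assume "?z = 1"
      then have "\<zeta> ^ j * (\<zeta> ^ i * cnj \<zeta> ^ i) = \<zeta> ^ i" by (simp add: mult_ac)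
      then have "\<zeta> ^ j = \<zeta> ^ i" by (simp add: zeta_pow_cnj)
      then show False using ne[of i j] ne[of j i] assms False by (metis nat_neq_iff)
    qed
    moreover have "?z ^ e = 1"
    proof -
      have "?z ^ e = (\<zeta> ^ e) ^ j * cnj (\<zeta> ^ e) ^ i"
        by (simp add: power_mult_distrib power_commutes flip: power_mult) (simp add: mult.commute)
      then show ?thesis by (simp add: zeta_power)
    qed
    ultimately show ?thesis using False by (simp add: eq geometric_sum)
  qed
qed

lemma om_opp: "om (opp s) = cnj (om s)" by (cases s) (simp_all add: om_def)

lemma zeta_nbr: "\<zeta> ^ nbr e (opp s) k = om s * \<zeta> ^ k"
proof (cases s)
  case SPlus
  then show ?thesis using zeta_mod[of "Suc k"] by (simp add: om_def)
next
  case SMinus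
  have "\<zeta> ^ (k + e - 1) = \<zeta> ^ (k + e - 1) * (\<zeta> * cnj \<zeta>)" by (simp add: zeta_cnj)
  also have "\<dots> = \<zeta> ^ Suc (k + e - 1) * cnj \<zeta>" by (simp add: mult_ac)
  also have "Suc (k + e - 1) = k + e" using e_pos by simp
  finally have "\<zeta> ^ (k + e - 1) = cnj \<zeta> * \<zeta> ^ k" by (simp add: power_add zeta_power)
  then show ?thesis using SMinus by (simp add: om_def zeta_mod)
qed

lemma cnj_uu: "cnj_F x = x \<Longrightarrow> cnj_F (uu s x v) = uu (opp s) x v"
  by (simp add: uu_def om_opp)

lemma hit_hop: "hit e i (hop e s i v) = hit e i v"
  by (auto simp: hit_def hop_def nbr_less)

lemma TT_ps:
  assumes i: "i \<in> Iset e m"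
  shows "TT e x s i (ps e m \<zeta> v) = (\<Sum>y\<in>idx e m.
     Const (cF (\<zeta> ^ (fst v * fst y)) * (if hit e i y then cF (om s ^ fst v) * x ^ snd v else 1)) * Var y ^ snd v)"
proof -
  let ?c = "\<lambda>y. cF (\<zeta> ^ (fst v * fst y))" and ?h = "hop e s i" and ?h' = "hop e (opp s) i"
  have "TT e x s i (ps e m \<zeta> v) = (\<Sum>y\<in>idx e m. Const (?c y * (if hit e i y then x ^ snd v else 1)) * Var (?h y) ^ snd v)"
    unfolding ps_def TT_sum TT_mult TT_power TT_Const
    by (intro sum.cong refl) (simp add: TT_def Const_mult power_mult_distrib Const_power)
  also have "\<dots> = (\<Sum>y\<in>idx e m. Const (?c (?h' y) * (if hit e i y then x ^ snd v else 1)) * Var y ^ snd v)"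
    using sum.permute[OF hop_permutes[OF i, of "opp s"], of "\<lambda>y. Const (?c y * (if hit e i y then x ^ snd v else 1)) * Var (?h y) ^ snd v"]
    by (simp add: o_def hit_hop hop_opp[of e "opp s", simplified])
  also have "\<dots> = (\<Sum>y\<in>idx e m. Const (?c y * (if hit e i y then cF (om s ^ fst v) * x ^ snd v else 1)) * Var y ^ snd v)"
  proof (rule sum.cong[OF refl])
    fix y assume "y \<in> idx e m"
    have "?c (?h' y) = cF (om s ^ fst v) * ?c y" if "hit e i y"
    proof -
      have "\<zeta> ^ (fst v * fst (?h' y)) = (\<zeta> ^ nbr e (opp s) (fst y)) ^ fst v"
        using that by (simp add: hop_hit mult.commute flip: power_mult)
      also have "\<dots> = om s ^ fst v * \<zeta> ^ (fst v * fst y)"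
        by (simp add: zeta_nbr power_mult_distrib mult.commute flip: power_mult)
      finally show ?thesis by (simp add: cF_mult)
    qed
    moreover have "?c (?h' y) = ?c y" if "\<not> hit e i y" using that by (simp add: hop_hit)
    ultimately show "Const (?c (?h' y) * (if hit e i y then x ^ snd v else 1)) * Var y ^ snd v
      = Const (?c y * (if hit e i y then cF (om s ^ fst v) * x ^ snd v else 1)) * Var y ^ snd v"
      by (simp add: mult_ac)
  qed
  finally show ?thesis .
qed

text \<open>For \<open>v = (k, r)\<close> the image of \<open>p\<^sub>v\<close> depends on \<open>x\<close> only through a factor \<open>\<omega>\<^sup>k x\<^sup>r\<close> at the positions
  selected by \<open>i\<close>, and is affine in this factor; the value \<open>1\<close> of the factor gives \<open>p\<^sub>v\<close> itself.\<close>

lemma TT_ps_interpolate: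
  assumes "i \<in> Iset e m" "snd v \<ge> 1"
  shows "TT e x s i (ps e m \<zeta> v) = Const (1 - uu s x v) * ps e m \<zeta> v + Const (uu s x v) * TT e tF s i (ps e m \<zeta> v)"
proof -
  let ?o = "cF (om s ^ fst v)"
  have "uu s x v * (1 - ?o * tF ^ snd v) = 1 - ?o * x ^ snd v"
    using one_minus_t_nonzero[OF assms(2)] by (simp add: uu_def)
  then have key: "(if b then ?o * x ^ snd v else 1) = (1 - uu s x v) + uu s x v * (if b then ?o * tF ^ snd v else 1)" for b
    by (simp add: algebra_simps)
  show ?thesis
    unfolding TT_ps[OF assms(1)] unfolding ps_def sum_distrib_left sum.distrib[symmetric]
    by (intro sum.cong refl) (simp only: key[of "hit e i _"], simp only: Const_add Const_mult distrib_left distrib_right mult_ac)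
qed

lemma ps_adjoint: "pairing_form (ps e m \<zeta> v * F) G = pairing_form F (down m v G)"
proof (induction F rule: mpol_induct)
  case (monom c \<beta>)
  have "ps e m \<zeta> v * (Const c * monom_arr \<beta>) =
      (\<Sum>x\<in>idx e m. Const (cF (\<zeta> ^ (fst v * fst x)) * c) * monom_arr (\<beta> + Poly_Mapping.single x (snd v)))"
    by (simp add: ps_def sum_distrib_right sum_distrib_left Const_mult monom_arr_add monom_scale mult_ac)
  then show ?case
    by (simp only: pairing_form_sum pairing_form_monom) (simp add: down_def sum_distrib_left mult_ac)
qed (simp add: distrib_left pairing_form_add)

lemma lookup_Var_mult:
  "lookup (Var x ^ s * F) \<gamma> = (if s \<le> lookup \<gamma> x then lookup F (\<gamma> - Poly_Mapping.single x s) else 0)"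
proof (cases "s \<le> lookup \<gamma> x")
  case True
  then have "\<gamma> = Poly_Mapping.single x s + (\<gamma> - Poly_Mapping.single x s)"
    by (intro poly_mapping_eqI) (auto simp: lookup_add lookup_minus lookup_single when_def)
  then show ?thesis using True by (metis monom_scale lookup_monom_mult)
next
  case False
  have "lookup (Var x ^ s * F) \<gamma> = 0"
  proof (rule ccontr)
    assume "lookup (Var x ^ s * F) \<gamma> \<noteq> 0"
    then obtain \<alpha> \<beta> where "\<gamma> = \<alpha> + \<beta>" "lookup (Var x ^ s) \<alpha> \<noteq> 0" by (rule keys_mult_elim)
    then have "\<gamma> = Poly_Mapping.single x s + \<beta>" by (auto simp: lookup_monom split: if_splits simp flip: monom_scale)
    then show False using False by (simp add: lookup_add)
  qed
  with False show ?thesis by simp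
qed

lemma lookup_ps_mult:
  "lookup (ps e m \<zeta> v * F) \<gamma> = (\<Sum>x\<in>idx e m. cF (\<zeta> ^ (fst v * fst x)) *
     (if snd v \<le> lookup \<gamma> x then lookup F (\<gamma> - Poly_Mapping.single x (snd v)) else 0))"
  unfolding ps_def sum_distrib_right lookup_sum mult.assoc lookup_Const_mult lookup_Var_mult ..

text \<open>The cancellation behind the commutation relations: changing one entry of an array with a
  repeated entry in a block leaves the repetition, unless one of the two equal entries is changed,
  and these two changes give opposite values of an alternating function.\<close>

lemma alternating_cancel:
  assumes F: "alternating e m F" and k: "k < e"
    and rep: "\<And>u. u < m k \<Longrightarrow> Q (lookup \<gamma> (k, u)) \<Longrightarrow>
        lookup F (\<gamma> + Poly_Mapping.single (k, u) a - Poly_Mapping.single (k, u) b) \<noteq> 0 \<Longrightarrow>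
        \<exists>u'<m k. u' \<noteq> u \<and> lookup \<gamma> (k, u') = lookup \<gamma> (k, u)"
  shows "(\<Sum>u<m k. if Q (lookup \<gamma> (k, u)) then
      lookup F (\<gamma> + Poly_Mapping.single (k, u) a - Poly_Mapping.single (k, u) b) else 0) = 0"
proof -
  let ?g = "\<lambda>u. \<gamma> + Poly_Mapping.single (k, u) a - Poly_Mapping.single (k, u) b"
  let ?t = "\<lambda>u. if Q (lookup \<gamma> (k, u)) then lookup F (?g u) else 0"
  have lg: "lookup (?g u) y = (if y = (k, u) then lookup \<gamma> y + a - b else lookup \<gamma> y)" for u y
    by (simp add: lookup_add lookup_minus lookup_single when_def)
  show ?thesis
  proof (cases "\<forall>u<m k. ?t u = 0")
    case True
    then show ?thesis by (intro sum.neutral) simp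
  next
    case False
    then obtain u where u: "u < m k" "?t u \<noteq> 0" by blast
    then have Q: "Q (lookup \<gamma> (k, u))" and nz: "lookup F (?g u) \<noteq> 0" by (auto split: if_splits)
    obtain u' where u': "u' < m k" "u' \<noteq> u" "lookup \<gamma> (k, u') = lookup \<gamma> (k, u)"
      using rep[OF u(1) Q nz] by blast
    have "?t j = 0" if "j < m k" "j \<noteq> u" "j \<noteq> u'" for j
    proof -
      have "lookup F (?g j) = 0"
        by (rule alternating_repeat[OF F k u(1) u'(1) u'(2)[symmetric]]) (use that u'(3) in \<open>simp add: lg\<close>)
      then show ?thesis by simp
    qed
    then have "(\<Sum>j<m k. ?t j) = (\<Sum>j\<in>{u, u'}. ?t j)"
      by (intro sum.mono_neutral_right) (use u u' in auto)
    also have "\<dots> = ?t u + ?t u'" using u'(2) by simp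
    also have "act (transpose (k, u) (k, u')) (?g u) = ?g u'"
      by (rule act_eqI) (use u'(2,3) in \<open>auto simp: lg transpose_def bij_swap_iff\<close>)
    then have "lookup F (?g u') = - lookup F (?g u)"
      using alternating_swap[OF F k u(1) u'(1) u'(2)[symmetric], of "?g u"] by simp
    then have "?t u + ?t u' = 0" using Q u'(3) by simp
    finally show ?thesis .
  qed
qed

text \<open>The exponent is a permutation of \<open>\<delta> + \<alpha>\<close> for an \<open>e\<close>-partition \<open>\<alpha>\<close> of \<open>d\<close>. It has at most \<open>d\<close> parts,
  so that the entries of \<open>\<delta>\<close> smaller than \<open>m\<^sub>k - d\<close> are left unchanged.\<close>

lemma full_block:
  assumes F: "alternating e m F" "supp_in (idx e m) F" "homog (d + total (delta e m)) F"
    and nz: "lookup F \<gamma> \<noteq> 0" and k: "k < e" and a: "a + d < m k"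
  shows "\<exists>u<m k. lookup \<gamma> (k, u) = a"
proof -
  obtain w \<alpha> where w: "w \<in> Sm e m" "act w (Lam e m \<alpha>) = \<gamma>" "\<alpha> \<in> Z00 e m d"
    using alternating_rep_homog[OF F nz] .
  let ?j = "m k - 1 - a"
  have j: "?j < m k" "d \<le> ?j" using a by auto
  have "fits e (\<lambda>_. d) \<alpha>" using w(3) by (intro epart_fits) (auto simp: Z00_def)
  then have "lookup \<alpha> (k, ?j) = 0" using fits_block k j(2) by blast
  then have L: "lookup (Lam e m \<alpha>) (k, ?j) = a" using k j a by (simp add: Lam_lookup lookup_delta)
  obtain u where u: "w (k, ?j) = (k, u)" using Sm_fst[OF w(1), of "(k, ?j)"] by (metis fst_conv prod.collapse)
  have "u < m k" using Sm_in_idx[OF w(1), of "(k, ?j)"] k j u by simp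
  moreover have "lookup \<gamma> (k, u) = a" using L lookup_act_apply[OF Sm_bij[OF w(1)], of "Lam e m \<alpha>" "(k, ?j)"] w(2) u by simp
  ultimately show ?thesis by blast
qed

text \<open>Raising an entry by \<open>r\<close> and lowering one by \<open>s\<close> commute except when both affect the same entry
  and it is smaller than \<open>s\<close>. If \<open>r = s\<close> these entries are \<open>0, \<dots>, s - 1\<close>, each once; otherwise the
  terms cancel in pairs.\<close>

lemma block_commutator:
  assumes F: "alternating e m F" "supp_in (idx e m) F" "homog (d + total (delta e m)) F"
    and k: "k < e" and s: "d + s \<le> m k" "s \<ge> 1" "r \<ge> 1"
  shows "(\<Sum>u<m k. if lookup \<gamma> (k, u) < s \<and> s \<le> lookup \<gamma> (k, u) + r then
      lookup F (\<gamma> + Poly_Mapping.single (k, u) r - Poly_Mapping.single (k, u) s) else 0)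
    = (if r = s then of_nat s * lookup F \<gamma> else 0)"
proof (cases "r = s")
  case True
  have "(\<Sum>u<m k. if lookup \<gamma> (k, u) < s \<and> s \<le> lookup \<gamma> (k, u) + r then
      lookup F (\<gamma> + Poly_Mapping.single (k, u) r - Poly_Mapping.single (k, u) s) else 0)
    = (\<Sum>u\<in>{u \<in> {..<m k}. lookup \<gamma> (k, u) < s}. lookup F \<gamma>)"
    unfolding True by (simp only: le_add2 simp_thms add_diff_cancel_right' sum.inter_filter[OF finite_lessThan])
  also have "\<dots> = of_nat (card {u \<in> {..<m k}. lookup \<gamma> (k, u) < s}) * lookup F \<gamma>" by simp
  also have "\<dots> = of_nat s * lookup F \<gamma>"
  proof (cases "lookup F \<gamma> = 0")
    case False
    have "bij_betw (\<lambda>u. lookup \<gamma> (k, u)) {u \<in> {..<m k}. lookup \<gamma> (k, u) < s} {..<s}"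
    proof (rule bij_betw_imageI)
      show "inj_on (\<lambda>u. lookup \<gamma> (k, u)) {u \<in> {..<m k}. lookup \<gamma> (k, u) < s}"
        using alternating_inj[OF F(1) False k] by (rule inj_on_subset) auto
      have "\<exists>u<m k. lookup \<gamma> (k, u) = a" if "a < s" for a
        using full_block[OF F False k] that s(1) by force
      then show "(\<lambda>u. lookup \<gamma> (k, u)) ` {u \<in> {..<m k}. lookup \<gamma> (k, u) < s} = {..<s}"
        by (fastforce simp: image_iff)
    qed
    from bij_betw_same_card[OF this] show ?thesis by simp
  qed simp
  finally show ?thesis using True by simp
next
  case False
  have "(\<Sum>u<m k. if lookup \<gamma> (k, u) < s \<and> s \<le> lookup \<gamma> (k, u) + r then
      lookup F (\<gamma> + Poly_Mapping.single (k, u) r - Poly_Mapping.single (k, u) s) else 0) = 0"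
  proof (rule alternating_cancel[OF F(1) k, where Q = "\<lambda>c. c < s \<and> s \<le> c + r"])
    fix u let ?g = "\<gamma> + Poly_Mapping.single (k, u) r - Poly_Mapping.single (k, u) s"
    assume u: "u < m k" "lookup \<gamma> (k, u) < s \<and> s \<le> lookup \<gamma> (k, u) + r" "lookup F ?g \<noteq> 0"
    have "lookup \<gamma> (k, u) + d < m k" using u(2) s(1) by linarith
    then obtain u' where u': "u' < m k" "lookup ?g (k, u') = lookup \<gamma> (k, u)"
      using full_block[OF F u(3) k] by blast
    have "u' \<noteq> u" using u'(2) u(2) False by (auto simp: lookup_add lookup_minus)
    then show "\<exists>u'<m k. u' \<noteq> u \<and> lookup \<gamma> (k, u') = lookup \<gamma> (k, u)"
      using u' by (intro exI[of _ u']) (auto simp: lookup_add lookup_minus lookup_single when_def)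
  qed
  then show ?thesis using False by simp
qed

text \<open>The adjoint of \<open>p\<^sub>v\<close> commutes with the multiplication by \<open>p\<^bsub>v'\<^esub>\<close> up to the scalar \<open>e r\<close> if
  \<open>v = v' = (k, r)\<close>; the orthogonality of the powers of \<open>\<zeta>\<close> removes the other cases with equal \<open>r\<close>.\<close>

lemma down_ps:
  assumes F: "alternating e m F" "supp_in (idx e m) F" "homog (d + total (delta e m)) F"
    and v: "fst v < e" "snd v \<ge> 1" and v': "fst v' < e" "snd v' \<ge> 1" and le: "\<And>k. k < e \<Longrightarrow> d + snd v' \<le> m k"
  shows "down m v (lookup (ps e m \<zeta> v' * F)) \<gamma> =
    (\<Sum>y\<in>idx e m. cF (\<zeta> ^ (fst v' * fst y)) * (if snd v' \<le> lookup \<gamma> y then down m v (lookup F) (\<gamma> - Poly_Mapping.single y (snd v')) else 0))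
    + (if v = v' then of_nat (e * snd v) * lookup F \<gamma> else 0)"
proof -
  let ?r = "snd v" and ?s = "snd v'" and ?I = "idx e m"
  let ?a = "\<lambda>x. cF (cnj \<zeta> ^ (fst v * fst x))" and ?b = "\<lambda>y. cF (\<zeta> ^ (fst v' * fst y))"
  let ?g = "\<lambda>x y. lookup F (\<gamma> + Poly_Mapping.single x ?r - Poly_Mapping.single y ?s)"
  have L: "down m v (lookup (ps e m \<zeta> v' * F)) \<gamma> =
      (\<Sum>x\<in>?I. \<Sum>y\<in>?I. ?a x * ?b y * (if ?s \<le> lookup (\<gamma> + Poly_Mapping.single x ?r) y then ?g x y else 0))"
    by (simp add: down_def lookup_ps_mult sum_distrib_left mult.assoc)
  have "(\<Sum>y\<in>?I. ?b y * (if ?s \<le> lookup \<gamma> y then down m v (lookup F) (\<gamma> - Poly_Mapping.single y ?s) else 0))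
    = (\<Sum>y\<in>?I. \<Sum>x\<in>?I. ?a x * ?b y * (if ?s \<le> lookup \<gamma> y then ?g x y else 0))"
  proof (rule sum.cong[OF refl])
    fix y assume "y \<in> ?I"
    have "lookup F (\<gamma> - Poly_Mapping.single y ?s + Poly_Mapping.single x ?r) = ?g x y" if "?s \<le> lookup \<gamma> y" for x
      by (rule arg_cong[where f = "lookup F"], rule poly_mapping_eqI)
         (use that in \<open>auto simp: lookup_add lookup_minus lookup_single when_def\<close>)
    then show "?b y * (if ?s \<le> lookup \<gamma> y then down m v (lookup F) (\<gamma> - Poly_Mapping.single y ?s) else 0)
      = (\<Sum>x\<in>?I. ?a x * ?b y * (if ?s \<le> lookup \<gamma> y then ?g x y else 0))"
      by (simp add: down_def sum_distrib_left mult_ac)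
  qed
  then have R: "(\<Sum>y\<in>?I. ?b y * (if ?s \<le> lookup \<gamma> y then down m v (lookup F) (\<gamma> - Poly_Mapping.single y ?s) else 0))
    = (\<Sum>x\<in>?I. \<Sum>y\<in>?I. ?a x * ?b y * (if ?s \<le> lookup \<gamma> y then ?g x y else 0))"
    by (rule trans[OF _ sum.swap])
  have dterm: "?a x * ?b y * (if ?s \<le> lookup (\<gamma> + Poly_Mapping.single x ?r) y then ?g x y else 0)
     = ?a x * ?b y * (if ?s \<le> lookup \<gamma> y then ?g x y else 0)
      + (if y = x then ?a x * ?b x * (if lookup \<gamma> x < ?s \<and> ?s \<le> lookup \<gamma> x + ?r then ?g x x else 0) else 0)" for x y
    by (auto simp: lookup_add lookup_single when_def)
  have "(\<Sum>x\<in>?I. ?a x * ?b x * (if lookup \<gamma> x < ?s \<and> ?s \<le> lookup \<gamma> x + ?r then ?g x x else 0))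
    = (\<Sum>k<e. cF (\<zeta> ^ (fst v' * k) * cnj \<zeta> ^ (fst v * k)) * (\<Sum>u<m k. if lookup \<gamma> (k, u) < ?s \<and> ?s \<le> lookup \<gamma> (k, u) + ?r then ?g (k, u) (k, u) else 0))"
    unfolding sum_idx sum_distrib_left by (intro sum.cong refl) (simp add: cF_mult mult_ac)
  also have "\<dots> = (\<Sum>k<e. cF (\<zeta> ^ (fst v' * k) * cnj \<zeta> ^ (fst v * k)) * (if ?r = ?s then of_nat ?s * lookup F \<gamma> else 0))"
    by (intro sum.cong refl arg_cong[where f = "\<lambda>z. _ * z"] block_commutator[OF F] le) (use v v' in auto)
  also have "\<dots> = cF (\<Sum>k<e. \<zeta> ^ (fst v' * k) * cnj \<zeta> ^ (fst v * k)) * (if ?r = ?s then of_nat ?s * lookup F \<gamma> else 0)"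
    by (simp only: cF_sum sum_distrib_right)
  also have "\<dots> = (if v = v' then of_nat (e * snd v) * lookup F \<gamma> else 0)"
    unfolding zeta_orth[OF v(1) v'(1)] by (auto simp: cF_of_nat prod_eq_iff)
  finally have diag: "(\<Sum>x\<in>?I. ?a x * ?b x * (if lookup \<gamma> x < ?s \<and> ?s \<le> lookup \<gamma> x + ?r then ?g x x else 0))
    = (if v = v' then of_nat (e * snd v) * lookup F \<gamma> else 0)" .
  show ?thesis
    unfolding L R diag[symmetric] dterm sum.distrib by (simp add: sum.delta)
qed

text \<open>If raising one entry of \<open>\<gamma>\<close> gives a permutation of \<open>\<delta>\<close>, all numbers below \<open>m\<^sub>k\<close> occur in the
  result; so the old entry occurs a second time in \<open>\<gamma>\<close>, and the terms cancel in pairs.\<close>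

lemma down_delta:
  assumes "snd v \<ge> 1"
  shows "down m v (lookup (adelta e m)) \<gamma> = 0"
proof -
  let ?F = "adelta e m"
  have F: "alternating e m ?F" "supp_in (idx e m) ?F" "homog (0 + total (delta e m)) ?F"
    using homog_alt'[of "delta e m"] by (simp_all add: alternating_alt supp_in_alt' keys_delta)
  have "(\<Sum>u<m k. lookup ?F (\<gamma> + Poly_Mapping.single (k, u) (snd v))) = 0" if k: "k < e" for k
  proof -
    have "(\<Sum>u<m k. if True then lookup ?F (\<gamma> + Poly_Mapping.single (k, u) (snd v) - Poly_Mapping.single (k, u) 0) else 0) = 0"
    proof (rule alternating_cancel[OF F(1) k, where Q = "\<lambda>_. True"])
      fix u let ?g = "\<gamma> + Poly_Mapping.single (k, u) (snd v) - Poly_Mapping.single (k, u) 0"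
      assume u: "u < m k" and nz: "lookup ?F ?g \<noteq> 0"
      obtain w where w: "w \<in> Sm e m" "act w (delta e m) = ?g" using lookup_alternant_nonzero[OF nz] .
      have "lookup ?g (k, u) < m k"
      proof -
        have wi: "pinv w \<in> Sm e m" by (rule Sm_inv[OF w(1)])
        have "fst (pinv w (k, u)) = k" "pinv w (k, u) \<in> idx e m"
          using Sm_fst[OF wi, of "(k, u)"] Sm_in_idx[OF wi, of "(k, u)"] k u by auto
        then have "lookup (delta e m) (pinv w (k, u)) < m k"
          by (cases "pinv w (k, u)") (auto simp: lookup_delta)
        then show ?thesis by (simp only: lookup_act[OF Sm_bij[OF w(1)]] w(2)[symmetric])
      qed
      then have "lookup \<gamma> (k, u) + 0 < m k" by (simp add: lookup_add)
      then obtain u' where u': "u' < m k" "lookup ?g (k, u') = lookup \<gamma> (k, u)"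
        using full_block[OF F nz k] by blast
      have "u' \<noteq> u" using u'(2) assms by (auto simp: lookup_add)
      then show "\<exists>u'<m k. u' \<noteq> u \<and> lookup \<gamma> (k, u') = lookup \<gamma> (k, u)"
        using u' by (intro exI[of _ u']) (auto simp: lookup_add lookup_single when_def)
    qed
    then show ?thesis by simp
  qed
  then show ?thesis by (simp add: down_def sum_idx flip: sum_distrib_left)
qed

section \<open>Products of power sums\<close>

lemma symmetric_pmono: "symmetric_poly e m (pmono m B N)"
  unfolding pmono_def by (intro symmetric_prod symmetric_power symmetric_ps)

lemma supp_pmono: "supp_in (idx e m) (pmono m B N)"
  unfolding pmono_def by (intro supp_in_prod supp_in_power supp_ps)

lemma homog_pmono: "homog (wt B N) (pmono m B N)"
  unfolding pmono_def wt_def by (intro homog_prod homog_power homog_ps)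

lemma pmono_alternating:
  "alternating e m (pmono m B N * adelta e m)" "supp_in (idx e m) (pmono m B N * adelta e m)"
  "homog (wt B N + total (delta e m)) (pmono m B N * adelta e m)"
  by (intro alternating_mult symmetric_pmono alternating_alt supp_in_mult supp_pmono supp_in_alt' keys_delta
      homog_mult homog_pmono homog_alt')+

lemma pmono_Suc:
  assumes "finite B" "v \<in> B" "N v > 0"
  shows "pmono m B N = ps e m \<zeta> v * pmono m B (N(v := N v - 1))" "wt B N = wt B (N(v := N v - 1)) + snd v"
proof -
  have "(\<Prod>x\<in>B - {v}. ps e m \<zeta> x ^ N x) = (\<Prod>x\<in>B - {v}. ps e m \<zeta> x ^ (N(v := N v - 1)) x)"
    by (intro prod.cong) auto
  moreover have "ps e m \<zeta> v ^ N v = ps e m \<zeta> v * ps e m \<zeta> v ^ (N v - 1)"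
    using assms(3) by (cases "N v") auto
  ultimately show "pmono m B N = ps e m \<zeta> v * pmono m B (N(v := N v - 1))"
    unfolding pmono_def using assms by (simp add: prod.remove mult.assoc)
  have "(\<Sum>x\<in>B - {v}. N x * snd x) = (\<Sum>x\<in>B - {v}. (N(v := N v - 1)) x * snd x)"
    by (intro sum.cong) auto
  moreover have "N v * snd v = (N v - 1) * snd v + snd v" using assms(3) by (cases "N v") auto
  ultimately show "wt B N = wt B (N(v := N v - 1)) + snd v"
    unfolding wt_def using assms by (simp add: sum.remove)
qed

text \<open>On \<open>a\<^sub>\<delta>\<close> times polynomials in the power sums the adjoint of \<open>p\<^sub>v\<close> acts as \<open>e r\<close> times the
  derivative with respect to \<open>p\<^sub>v\<close>.\<close>

lemma down_pmono:
  assumes B: "labels B" and v: "v \<in> B" and le: "\<forall>k<e. wt B N \<le> m k"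
  shows "down m v (lookup (pmono m B N * adelta e m)) = (\<lambda>\<gamma>. of_nat (e * snd v * N v) * lookup (pmono m B (N(v := N v - 1)) * adelta e m) \<gamma>)"
  using le
proof (induction "\<Sum>v\<in>B. N v" arbitrary: N)
  case 0
  have fin: "finite B" using B by (simp add: labels_def)
  have z: "N x = 0" if "x \<in> B" for x using 0(1) fin that by simp
  then have "pmono m B N = 1" by (simp add: pmono_def)
  moreover have "snd v \<ge> 1" using B v by (auto simp: labels_def)
  ultimately show ?case using z[OF v] by (intro ext) (simp add: down_delta)
next
  case (Suc n)
  have fin: "finite B" using B by (simp add: labels_def)
  obtain v' where v': "v' \<in> B" "N v' > 0"
  proof (rule ccontr)
    assume "\<not> thesis"
    then have "\<forall>v\<in>B. N v = 0" using that by auto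
    then show False using Suc.hyps(2) by simp
  qed
  let ?N = "N(v' := N v' - 1)"
  note S = pmono_Suc[where N = N, OF fin v']
  have n: "n = (\<Sum>v\<in>B. ?N v)"
  proof -
    have "(\<Sum>x\<in>B - {v'}. N x) = (\<Sum>x\<in>B - {v'}. ?N x)" by (intro sum.cong) auto
    then show ?thesis using Suc.hyps(2) v' fin by (simp add: sum.remove)
  qed
  have le': "wt B ?N + snd v' \<le> m k" if "k < e" for k using Suc.prems that S(2) by force
  have IH: "down m v (lookup (pmono m B ?N * adelta e m)) = (\<lambda>\<gamma>. of_nat (e * snd v * ?N v) * lookup (pmono m B (?N(v := ?N v - 1)) * adelta e m) \<gamma>)"
    by (rule Suc.hyps(1)[OF n]) (use le' in \<open>meson add_leD1\<close>)
  have lab: "fst v < e" "snd v \<ge> 1" "fst v' < e" "snd v' \<ge> 1" using B v v'(1) by (auto simp: labels_def)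
  show ?case
  proof
    fix \<gamma>
    define F where "F = pmono m B ?N * adelta e m"
    define G where "G = pmono m B (?N(v := ?N v - 1)) * adelta e m"
    define c :: fld where "c = of_nat (e * snd v * ?N v)"
    have F: "alternating e m F" "supp_in (idx e m) F" "homog (wt B ?N + total (delta e m)) F"
      unfolding F_def by (rule pmono_alternating)+
    have "down m v (lookup (pmono m B N * adelta e m)) \<gamma> = down m v (lookup (ps e m \<zeta> v' * F)) \<gamma>"
      by (simp only: S(1) mult.assoc F_def)
    also have "\<dots> = (\<Sum>y\<in>idx e m. cF (\<zeta> ^ (fst v' * fst y)) * (if snd v' \<le> lookup \<gamma> y then c * lookup G (\<gamma> - Poly_Mapping.single y (snd v')) else 0))
        + (if v = v' then of_nat (e * snd v) * lookup F \<gamma> else 0)"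
      using down_ps[where m = m, OF F lab le'] IH by (simp only: F_def G_def c_def)
    also have "(\<Sum>y\<in>idx e m. cF (\<zeta> ^ (fst v' * fst y)) * (if snd v' \<le> lookup \<gamma> y then c * lookup G (\<gamma> - Poly_Mapping.single y (snd v')) else 0))
        = c * lookup (ps e m \<zeta> v' * G) \<gamma>"
      unfolding lookup_ps_mult sum_distrib_left by (intro sum.cong refl) simp
    also have "c * lookup (ps e m \<zeta> v' * G) \<gamma> + (if v = v' then of_nat (e * snd v) * lookup F \<gamma> else 0) = of_nat (e * snd v * ?N v) * lookup (ps e m \<zeta> v' * (pmono m B (?N(v := ?N v - 1)) * adelta e m)) \<gamma>
        + (if v = v' then of_nat (e * snd v) * lookup (pmono m B ?N * adelta e m) \<gamma> else 0)"
      by (simp only: F_def G_def c_def)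
    also have "\<dots> = of_nat (e * snd v * N v) * lookup (pmono m B (N(v := N v - 1)) * adelta e m) \<gamma>"
    proof (cases "v = v'")
      case True
      have a: "of_nat (e * snd v * ?N v) * lookup (ps e m \<zeta> v' * (pmono m B (?N(v := ?N v - 1)) * adelta e m)) \<gamma>
        = of_nat (e * snd v * ?N v) * lookup (pmono m B ?N * adelta e m) \<gamma>"
      proof (cases "?N v = 0")
        case False
        then show ?thesis using pmono_Suc(1)[OF fin v, of ?N m] True by (simp only: mult.assoc neq0_conv)
      qed simp
      have b: "N v = Suc (?N v)" using v'(2) True by simp
      have c: "of_nat (x * k) * y + of_nat x * y = of_nat (x * Suc k) * (y::fld)" for x k y
        by (simp add: algebra_simps)
      have "N(v := N v - 1) = ?N" using True by simp
      then show ?thesis unfolding a if_P[OF True] c b[symmetric] by (simp only:)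
    next
      case False
      have "ps e m \<zeta> v' * pmono m B (?N(v := ?N v - 1)) = pmono m B (N(v := N v - 1))"
      proof -
        have eq: "(N(v := N v - 1))(v' := (N(v := N v - 1)) v' - 1) = ?N(v := ?N v - 1)"
          using False by (auto simp: fun_eq_iff)
        show ?thesis
          using pmono_Suc(1)[OF fin v'(1), of "N(v := N v - 1)" m] v'(2) False unfolding eq by simp
      qed
      then show ?thesis using False by (simp flip: mult.assoc)
    qed
    finally show "down m v (lookup (pmono m B N * adelta e m)) \<gamma> = of_nat (e * snd v * N v) * lookup (pmono m B (N(v := N v - 1)) * adelta e m) \<gamma>" .
  qed
qed

lemma wt_mono: "(\<And>v. v \<in> B \<Longrightarrow> N v \<le> N' v) \<Longrightarrow> wt B N \<le> wt B N'"
  unfolding wt_def by (intro sum_mono mult_le_mono1)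

lemma Bf_ps_power:
  assumes B: "labels B" and v: "v \<in> B" and le: "\<forall>k<e. wt B N \<le> m k"
  shows "Bf (ps e m \<zeta> v ^ k * F) (pmono m B N * adelta e m) = of_nat (KK v k (N v)) * Bf F (pmono m B (N(v := N v - k)) * adelta e m)"
  using le
proof (induction k arbitrary: N)
  case 0
  then show ?case by (simp add: KK_def)
next
  case (Suc k)
  have "wt B (N(v := N v - 1)) \<le> wt B N" by (rule wt_mono) simp
  then have le': "\<forall>k<e. wt B (N(v := N v - 1)) \<le> m k" using Suc.prems by (meson le_trans)
  have "Bf (ps e m \<zeta> v ^ Suc k * F) (pmono m B N * adelta e m) = pairing_form (ps e m \<zeta> v ^ k * F) (down m v (lookup (pmono m B N * adelta e m)))"
    by (simp add: mult.assoc ps_adjoint)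
  also have "\<dots> = of_nat (e * snd v * N v) * Bf (ps e m \<zeta> v ^ k * F) (pmono m B (N(v := N v - 1)) * adelta e m)"
    unfolding down_pmono[where N = N and m = m, OF B v Suc.prems] pairing_form_scale_right by simp
  also have "\<dots> = of_nat (e * snd v * N v * KK v k (N v - 1)) * Bf F (pmono m B (N(v := N v - Suc k)) * adelta e m)"
    unfolding Suc.IH[where N = "N(v := N v - 1)", OF le'] by simp
  also have "e * snd v * N v * KK v k (N v - 1) = KK v (Suc k) (N v)"
  proof (cases "N v")
    case (Suc n)
    have "Suc n * (n choose k) = Suc k * (Suc n choose Suc k)" by (metis Suc_times_binomial_eq mult.commute)
    then have "e * snd v * ((e * snd v) ^ k * fact k) * (Suc n * (n choose k)) = e * snd v * ((e * snd v) ^ k * fact k) * (Suc k * (Suc n choose Suc k))"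
      by (rule arg_cong)
    then show ?thesis using Suc by (simp only: KK_def fact_Suc power_Suc diff_Suc_1 mult_ac of_nat_id)
  qed (simp add: KK_def)
  finally show ?case .
qed

lemma Bf_prod_power:
  assumes B: "labels B" and W: "W \<subseteq> B" and le: "\<forall>k<e. wt B N \<le> m k"
  shows "Bf ((\<Prod>v\<in>W. ps e m \<zeta> v ^ \<sigma> v) * F) (pmono m B N * adelta e m)
    = of_nat (\<Prod>v\<in>W. KK v (\<sigma> v) (N v)) * Bf F (pmono m B (\<lambda>v. if v \<in> W then N v - \<sigma> v else N v) * adelta e m)"
proof -
  have "finite W" using B W by (auto simp: labels_def intro: finite_subset)
  then show ?thesis using W
  proof (induction W arbitrary: F)
    case (insert v W)
    let ?N = "\<lambda>x. if x \<in> W then N x - \<sigma> x else N x"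
    have N: "?N v = N v" "?N(v := N v - \<sigma> v) = (\<lambda>x. if x \<in> insert v W then N x - \<sigma> x else N x)"
      using insert.hyps by auto
    have "Bf ((\<Prod>v\<in>insert v W. ps e m \<zeta> v ^ \<sigma> v) * F) (pmono m B N * adelta e m)
      = Bf ((\<Prod>v\<in>W. ps e m \<zeta> v ^ \<sigma> v) * (ps e m \<zeta> v ^ \<sigma> v * F)) (pmono m B N * adelta e m)"
      using insert.hyps by (simp add: mult_ac)
    also have "\<dots> = of_nat (\<Prod>v\<in>W. KK v (\<sigma> v) (N v)) * Bf (ps e m \<zeta> v ^ \<sigma> v * F) (pmono m B ?N * adelta e m)"
      using insert.IH insert.prems by simp
    also have "Bf (ps e m \<zeta> v ^ \<sigma> v * F) (pmono m B ?N * adelta e m) = of_nat (KK v (\<sigma> v) (?N v)) * Bf F (pmono m B (?N(v := ?N v - \<sigma> v)) * adelta e m)"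
    proof (rule Bf_ps_power[OF B])
      have "wt B ?N \<le> wt B N" by (rule wt_mono) simp
      then show "\<forall>k<e. wt B ?N \<le> m k" using le by (meson le_trans)
    qed (use insert.prems in auto)
    finally show ?case unfolding N using insert.hyps by (simp add: mult_ac)
  qed simp
qed

lemma Bf_pmono_mult:
  assumes B: "labels B" and le: "\<forall>k<e. wt B N \<le> m k"
  shows "Bf (pmono m B \<sigma> * F) (pmono m B N * adelta e m) = of_nat (\<Prod>v\<in>B. KK v (\<sigma> v) (N v)) * Bf F (pmono m B (\<lambda>v. N v - \<sigma> v) * adelta e m)"
proof -
  have "pmono m B (\<lambda>v. if v \<in> B then N v - \<sigma> v else N v) = pmono m B (\<lambda>v. N v - \<sigma> v)"
    unfolding pmono_def by (intro prod.cong) auto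
  then show ?thesis using Bf_prod_power[where m = m and \<sigma> = \<sigma> and F = F and N = N, OF B subset_refl le] by (simp add: pmono_def)
qed

lemma Bf_adelta_nonzero: "Bf (adelta e m) (adelta e m) \<noteq> 0" "cnj_F (Bf (adelta e m) (adelta e m)) = Bf (adelta e m) (adelta e m)"
proof -
  let ?F = "adelta e m"
  have F1: "lookup ?F (delta e m) = 1"
    using lookup_alt_Lam[of 0 e 0 m] by (simp add: epart_def Lam_def)
  have "pairing_form ?F G = (\<Sum>w\<in>Sm e m. of_int (sign w) * cnj_F (G (act w (delta e m))))" for G
    unfolding alternant_def pairing_form_sum Const_of_int[symmetric] pairing_form_monom ..
  then have "Bf ?F ?F = (\<Sum>w\<in>Sm e m. of_int (sign w) * cnj_F (lookup ?F (act w (delta e m))))" .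
  also have "\<dots> = (\<Sum>w\<in>Sm e m. 1)"
    by (intro sum.cong refl) (simp add: alternating_lookup[OF alternating_alt] F1 of_int_sign_sq[of _ 1, simplified])
  also have "\<dots> = of_nat (card (Sm e m))" by simp
  finally have eq: "Bf ?F ?F = of_nat (card (Sm e m))" .
  have "card (Sm e m) \<noteq> 0" by (metis Sm_id card_eq_0_iff empty_iff finite_Sm)
  then show "Bf (adelta e m) (adelta e m) \<noteq> 0" by (simp add: eq)
  show "cnj_F (Bf (adelta e m) (adelta e m)) = Bf (adelta e m) (adelta e m)" by (simp add: eq)
qed

lemma Bf_adelta_pmono:
  assumes B: "labels B" and le: "\<forall>k<e. wt B N \<le> m k" and nz: "v \<in> B" "N v \<noteq> 0"
  shows "Bf (adelta e m) (pmono m B N * adelta e m) = 0"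
proof -
  have "(\<Prod>v\<in>B. KK v (N v) 0) = 0"
    using nz B by (intro prod_zero) (auto simp: labels_def KK_def intro!: bexI[of _ v])
  then have "Bf (pmono m B N * adelta e m) (pmono m B (\<lambda>_. 0) * adelta e m) = 0"
    by (subst Bf_pmono_mult[OF B]) (simp_all add: wt_def)
  then show ?thesis by (subst Bf_hermitian) (simp add: pmono_def)
qed

lemma pmono_orthogonal:
  assumes B: "labels B" and le: "\<forall>k<e. wt B N \<le> m k" "\<forall>k<e. wt B N' \<le> m k"
  shows "Bf (pmono m B N * adelta e m) (pmono m B N' * adelta e m)
    = (if \<forall>v\<in>B. N v = N' v then of_nat (\<Prod>v\<in>B. (e * snd v) ^ N v * fact (N v)) * Bf (adelta e m) (adelta e m) else 0)"
proof -
  have eq: "Bf (pmono m B N * adelta e m) (pmono m B N' * adelta e m)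
    = of_nat (\<Prod>v\<in>B. KK v (N v) (N' v)) * Bf (adelta e m) (pmono m B (\<lambda>v. N' v - N v) * adelta e m)"
    by (rule Bf_pmono_mult[OF B le(2)])
  show ?thesis
  proof (cases "\<forall>v\<in>B. N v = N' v")
    case True
    then have "pmono m B (\<lambda>v. N' v - N v) = 1" by (simp add: pmono_def)
    moreover have "(\<Prod>v\<in>B. KK v (N v) (N' v)) = (\<Prod>v\<in>B. (e * snd v) ^ N v * fact (N v))"
      by (intro prod.cong refl) (use True in \<open>simp add: KK_def\<close>)
    ultimately show ?thesis using True eq by simp
  next
    case ne: False
    then obtain v where v: "v \<in> B" "N v \<noteq> N' v" by blast
    have "Bf (pmono m B N * adelta e m) (pmono m B N' * adelta e m) = 0"
    proof (cases "N' v < N v")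
      case True
      then have "(\<Prod>v\<in>B. KK v (N v) (N' v)) = 0"
        using v B by (intro prod_zero) (auto simp: labels_def KK_def intro!: bexI[of _ v])
      then show ?thesis by (simp add: eq)
    next
      case False
      have "Bf (adelta e m) (pmono m B (\<lambda>v. N' v - N v) * adelta e m) = 0"
      proof (rule Bf_adelta_pmono[OF B _ v(1)])
        have "wt B (\<lambda>v. N' v - N v) \<le> wt B N'" by (rule wt_mono) simp
        then show "\<forall>k<e. wt B (\<lambda>v. N' v - N v) \<le> m k" using le(2) by (meson le_trans)
      qed (use False v in auto)
      then show ?thesis by (simp add: eq)
    qed
    then show ?thesis by (simp only: if_not_P[OF ne])
  qed
qed

section \<open>Adjointness of the operators\<close>

lemma Num_pmono:
  assumes B: "labels B" and n: "\<forall>v\<in>B. N v \<le> n"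
  shows "Num e m x s (pmono m B N) = (\<Sum>\<sigma>\<in>PiE B (\<lambda>_. {..n}).
     Const (\<Prod>v\<in>B. cc s x N \<sigma> v) * (pmono m B \<sigma> * Num e m tF s (pmono m B (\<lambda>v. N v - \<sigma> v))))"
proof -
  have fin: "finite B" using B by (simp add: labels_def)
  have TT: "TT e x s i (pmono m B N) = (\<Sum>\<sigma>\<in>PiE B (\<lambda>_. {..n}). Const (\<Prod>v\<in>B. cc s x N \<sigma> v) * (pmono m B \<sigma> * TT e tF s i (pmono m B (\<lambda>v. N v - \<sigma> v))))"
    if i: "i \<in> Iset e m" for i
  proof -
    let ?p = "\<lambda>v. ps e m \<zeta> v" and ?u = "\<lambda>v. uu s x v"
    have "TT e x s i (pmono m B N) = (\<Prod>v\<in>B. (Const (1 - ?u v) * ?p v + Const (?u v) * TT e tF s i (?p v)) ^ N v)"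
      unfolding pmono_def TT_prod TT_power
      by (intro prod.cong refl arg_cong[where f = "\<lambda>z. z ^ _"] TT_ps_interpolate[OF i]) (use B in \<open>auto simp: labels_def\<close>)
    also have "\<dots> = (\<Prod>v\<in>B. \<Sum>k\<in>{..n}. Const (of_nat (N v choose k) * (1 - ?u v) ^ k * ?u v ^ (N v - k)) * (?p v ^ k * TT e tF s i (?p v) ^ (N v - k)))"
    proof (intro prod.cong refl)
      fix v assume v: "v \<in> B"
      have "(Const (1 - ?u v) * ?p v + Const (?u v) * TT e tF s i (?p v)) ^ N v
        = (\<Sum>k\<le>N v. of_nat (N v choose k) * (Const (1 - ?u v) * ?p v) ^ k * (Const (?u v) * TT e tF s i (?p v)) ^ (N v - k))"
        by (rule binomial_ring)
      also have "\<dots> = (\<Sum>k\<le>N v. Const (of_nat (N v choose k) * (1 - ?u v) ^ k * ?u v ^ (N v - k)) * (?p v ^ k * TT e tF s i (?p v) ^ (N v - k)))"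
        by (intro sum.cong refl) (simp add: Const_mult Const_power Const_of_nat power_mult_distrib mult_ac)
      also have "\<dots> = (\<Sum>k\<in>{..n}. Const (of_nat (N v choose k) * (1 - ?u v) ^ k * ?u v ^ (N v - k)) * (?p v ^ k * TT e tF s i (?p v) ^ (N v - k)))"
      proof (rule sum.mono_neutral_left)
        have "N v choose k = 0" if "k \<in> {..n} - {..N v}" for k using that by (intro binomial_eq_0) auto
        then show "\<forall>k\<in>{..n} - {..N v}. Const (of_nat (N v choose k) * (1 - ?u v) ^ k * ?u v ^ (N v - k)) * (?p v ^ k * TT e tF s i (?p v) ^ (N v - k)) = 0"
          by (intro ballI) (simp only: of_nat_0 mult_zero_left Const_0)
      qed (use n v in auto)
      finally show "(Const (1 - ?u v) * ?p v + Const (?u v) * TT e tF s i (?p v)) ^ N v = \<dots>" .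
    qed
    also have "\<dots> = (\<Sum>\<sigma>\<in>PiE B (\<lambda>_. {..n}). \<Prod>v\<in>B. Const (of_nat (N v choose \<sigma> v) * (1 - ?u v) ^ \<sigma> v * ?u v ^ (N v - \<sigma> v)) * (?p v ^ \<sigma> v * TT e tF s i (?p v) ^ (N v - \<sigma> v)))"
      by (rule prod_sum_PiE) (use fin in auto)
    also have "\<dots> = (\<Sum>\<sigma>\<in>PiE B (\<lambda>_. {..n}). Const (\<Prod>v\<in>B. cc s x N \<sigma> v) * (pmono m B \<sigma> * TT e tF s i (pmono m B (\<lambda>v. N v - \<sigma> v))))"
      by (intro sum.cong refl) (simp add: prod.distrib Const_prod pmono_def TT_prod TT_power flip: cc_def)
    finally show ?thesis .
  qed
  have "Num e m x s (pmono m B N) = (\<Sum>i\<in>Iset e m. \<Sum>\<sigma>\<in>PiE B (\<lambda>_. {..n}).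
     Const (\<Prod>v\<in>B. cc s x N \<sigma> v) * (pmono m B \<sigma> * (TT e tF s i (adelta e m) * TT e tF s i (pmono m B (\<lambda>v. N v - \<sigma> v)))))"
    unfolding Num_def by (intro sum.cong refl) (simp add: TT sum_distrib_left mult_ac)
  also have "\<dots> = (\<Sum>\<sigma>\<in>PiE B (\<lambda>_. {..n}). \<Sum>i\<in>Iset e m. 
     Const (\<Prod>v\<in>B. cc s x N \<sigma> v) * (pmono m B \<sigma> * (TT e tF s i (adelta e m) * TT e tF s i (pmono m B (\<lambda>v. N v - \<sigma> v)))))"
    by (rule sum.swap)
  also have "\<dots> = (\<Sum>\<sigma>\<in>PiE B (\<lambda>_. {..n}).
     Const (\<Prod>v\<in>B. cc s x N \<sigma> v) * (pmono m B \<sigma> * Num e m tF s (pmono m B (\<lambda>v. N v - \<sigma> v))))"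
    unfolding Num_def by (simp only: sum_distrib_left)
  finally show ?thesis .
qed

lemma Bf_Num_pmono:
  assumes B: "labels B" and n: "\<forall>v\<in>B. N v \<le> n" and le: "\<forall>k<e. wt B N' \<le> m k"
  shows "Bf (Num e m x s (pmono m B N)) (pmono m B N' * adelta e m) = (\<Sum>\<sigma>\<in>PiE B (\<lambda>_. {..n}).
     (\<Prod>v\<in>B. cc s x N \<sigma> v * of_nat (KK v (\<sigma> v) (N' v))) * Bf (Num e m tF s (pmono m B (\<lambda>v. N v - \<sigma> v))) (pmono m B (\<lambda>v. N' v - \<sigma> v) * adelta e m))"
  unfolding Num_pmono[where N = N and m = m, OF B n] pairing_form_sum pairing_form_Const Bf_pmono_mult[where m = m, OF B le]
  by (intro sum.cong refl) (simp add: prod.distrib)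

text \<open>Both sides are expanded over \<open>\<sigma>\<close>, and the power sums outside the operator are moved to the other
  argument of the pairing. This leaves operators for \<open>t\<close>, which are adjoint, and the additional
  factors make the coefficients symmetric in \<open>N\<close> and \<open>N'\<close>. They are those of \<open>z\<^sub>\<alpha>(x,t)\<close>, which is why
  the scalar product depends on \<open>q\<close> in this way.\<close>

lemma Num_adjoint:
  assumes B: "labels B" and n: "\<forall>v\<in>B. N v \<le> n" "\<forall>v\<in>B. N' v \<le> n"
    and le: "\<forall>k<e. wt B N \<le> m k" "\<forall>k<e. wt B N' \<le> m k" and x: "cnj_F x = x"
  shows "(\<Prod>v\<in>B. uu s x v ^ N' v) * Bf (Num e m x s (pmono m B N)) (pmono m B N' * adelta e m)
    = (\<Prod>v\<in>B. uu s x v ^ N v) * Bf (pmono m B N * adelta e m) (Num e m x (opp s) (pmono m B N'))"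
proof -
  have "Bf (pmono m B N * adelta e m) (Num e m x (opp s) (pmono m B N')) = (\<Sum>\<sigma>\<in>PiE B (\<lambda>_. {..n}).
     (\<Prod>v\<in>B. cc s x N' \<sigma> v * of_nat (KK v (\<sigma> v) (N v))) * Bf (pmono m B (\<lambda>v. N v - \<sigma> v) * adelta e m) (Num e m tF (opp s) (pmono m B (\<lambda>v. N' v - \<sigma> v))))"
  proof -
    have "cnj_F (cc (opp s) x N' \<sigma> v) = cc s x N' \<sigma> v" for \<sigma> v
      by (simp add: cc_def cnj_uu[OF x])
    then show ?thesis
      by (subst Bf_hermitian) (simp add: Bf_Num_pmono[where N = N' and m = m, OF B n(2) le(1)] Bf_hermitian[of "pmono m B _ * adelta e m"])
  qed
  moreover have "(\<Prod>v\<in>B. uu s x v ^ N' v) * (\<Prod>v\<in>B. cc s x N \<sigma> v * of_nat (KK v (\<sigma> v) (N' v)))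
      = (\<Prod>v\<in>B. uu s x v ^ N v) * (\<Prod>v\<in>B. cc s x N' \<sigma> v * of_nat (KK v (\<sigma> v) (N v)))" for \<sigma>
  proof -
    have "uu s x v ^ N' v * (cc s x N \<sigma> v * of_nat (KK v (\<sigma> v) (N' v))) = uu s x v ^ N v * (cc s x N' \<sigma> v * of_nat (KK v (\<sigma> v) (N v)))" for v
    proof (cases "\<sigma> v \<le> N v \<and> \<sigma> v \<le> N' v")
      case True
      then have "uu s x v ^ N' v * uu s x v ^ (N v - \<sigma> v) = uu s x v ^ N v * uu s x v ^ (N' v - \<sigma> v)"
        by (simp add: add.commute flip: power_add)
      then show ?thesis by (simp add: cc_def KK_def)
    next
      case False
      then have "N v choose \<sigma> v = 0 \<or> N' v choose \<sigma> v = 0" by auto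
      then show ?thesis by (auto simp: cc_def KK_def)
    qed
    then show ?thesis by (simp flip: prod.distrib)
  qed
  ultimately show ?thesis
    unfolding Bf_Num_pmono[where N = N and m = m, OF B n(1) le(2)] Num_t_adjoint
    by (simp add: sum_distrib_left flip: mult.assoc)
qed

end

end

section \<open>Multiplicities of the parts\<close>

definition mult_of :: "arr \<Rightarrow> nat \<times> nat \<Rightarrow> nat" where
  "mult_of \<alpha> v = card {j. lookup \<alpha> (fst v, j) = snd v}"

definition lab :: "nat \<Rightarrow> nat \<Rightarrow> (nat \<times> nat) set" where
  "lab e n = {..<e} \<times> {1..n}"

lemma labels_lab: "labels e (lab e n)"
  by (auto simp: labels_def lab_def)

lemma finite_lab [simp]: "finite (lab e n)"
  by (simp add: lab_def)

lemma part_label: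
  assumes "\<alpha> \<in> epart e" "total \<alpha> \<le> n" "x \<in> keys \<alpha>"
  shows "(fst x, lookup \<alpha> x) \<in> lab e n"
proof -
  have "lookup \<alpha> x \<le> total \<alpha>" unfolding total_def using assms(3) by (intro member_le_sum) auto
  moreover have "lookup \<alpha> x \<ge> 1" using assms(3) by (simp add: in_keys_iff)
  moreover have "fst x < e" using assms(1,3) by (cases x) (auto simp: epart_def)
  ultimately show ?thesis using assms(2) by (simp add: lab_def)
qed

lemma part_fiber:
  assumes "v \<in> lab e n" shows "card {x \<in> keys \<alpha>. (fst x, lookup \<alpha> x) = v} = mult_of \<alpha> v"
proof -
  have "{x \<in> keys \<alpha>. (fst x, lookup \<alpha> x) = v} = Pair (fst v) ` {j. lookup \<alpha> (fst v, j) = snd v}"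
    using assms by (force simp: lab_def in_keys_iff)
  then show ?thesis by (simp add: mult_of_def card_image inj_on_def)
qed

lemma prod_parts:
  assumes "\<alpha> \<in> epart e" "total \<alpha> \<le> n"
  shows "(\<Prod>x\<in>keys \<alpha>. f (fst x, lookup \<alpha> x)) = (\<Prod>v\<in>lab e n. f v ^ mult_of \<alpha> v)"
proof -
  have "(\<Prod>x\<in>keys \<alpha>. f (fst x, lookup \<alpha> x)) = (\<Prod>v\<in>lab e n. \<Prod>x\<in>{x \<in> keys \<alpha>. (fst x, lookup \<alpha> x) = v}. f (fst x, lookup \<alpha> x))"
    by (rule prod.group[symmetric]) (use part_label[OF assms] in auto)
  also have "\<dots> = (\<Prod>v\<in>lab e n. \<Prod>x\<in>{x \<in> keys \<alpha>. (fst x, lookup \<alpha> x) = v}. f v)"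
    by (intro prod.cong refl) auto
  finally show ?thesis by (simp add: part_fiber cong: prod.cong)
qed

lemma sum_parts:
  assumes "\<alpha> \<in> epart e" "total \<alpha> \<le> n"
  shows "(\<Sum>x\<in>keys \<alpha>. f (fst x, lookup \<alpha> x)) = (\<Sum>v\<in>lab e n. mult_of \<alpha> v * (f v :: nat))"
proof -
  have "(\<Sum>x\<in>keys \<alpha>. f (fst x, lookup \<alpha> x)) = (\<Sum>v\<in>lab e n. \<Sum>x\<in>{x \<in> keys \<alpha>. (fst x, lookup \<alpha> x) = v}. f (fst x, lookup \<alpha> x))"
    by (rule sum.group[symmetric]) (use part_label[OF assms] in auto)
  also have "\<dots> = (\<Sum>v\<in>lab e n. \<Sum>x\<in>{x \<in> keys \<alpha>. (fst x, lookup \<alpha> x) = v}. f v)"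
    by (intro sum.cong refl) auto
  finally show ?thesis by (simp add: part_fiber cong: sum.cong)
qed

lemma wt_mult_of:
  assumes "\<alpha> \<in> epart e" "total \<alpha> \<le> n" shows "wt (lab e n) (mult_of \<alpha>) = total \<alpha>"
  using sum_parts[OF assms, of snd] by (simp add: wt_def total_def)

lemma mult_of_le:
  assumes "\<alpha> \<in> epart e" "total \<alpha> \<le> n" "v \<in> lab e n" shows "mult_of \<alpha> v \<le> n"
proof -
  have "mult_of \<alpha> v \<le> mult_of \<alpha> v * snd v" using assms(3) by (simp add: lab_def mem_Times_iff)
  also have "\<dots> \<le> wt (lab e n) (mult_of \<alpha>)" unfolding wt_def
    using assms(3) member_le_sum[of v "lab e n" "\<lambda>v. mult_of \<alpha> v * snd v"] by simp
  finally show ?thesis using wt_mult_of[OF assms(1,2)] assms(2) by simp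
qed

lemma mset_eq_upto_zero:
  assumes "size A = size B" "\<And>r. r \<noteq> 0 \<Longrightarrow> count A r = count B r" shows "A = (B :: nat multiset)"
proof -
  have f: "filter_mset (\<lambda>r. r \<noteq> 0) A = filter_mset (\<lambda>r. r \<noteq> 0) B"
    using assms(2) by (intro multiset_eqI) simp
  have s: "size C = size (filter_mset (\<lambda>r. r \<noteq> 0) C) + count C 0" for C :: "nat multiset"
  proof -
    have "C = filter_mset (\<lambda>r. r \<noteq> 0) C + filter_mset (\<lambda>r. r = 0) C" by (rule multiset_eqI) auto
    then have "size C = size (filter_mset (\<lambda>r. r \<noteq> 0) C) + size (filter_mset (\<lambda>r. r = 0) C)" by (metis size_union)
    moreover have "filter_mset (\<lambda>r. r = 0) C = replicate_mset (count C 0) 0" by (rule multiset_eqI) auto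
    ultimately show ?thesis by simp
  qed
  have "count A 0 = count B 0" using s[of A] s[of B] f assms(1) by simp
  then show ?thesis using assms(2) by (intro multiset_eqI) (metis (full_types))
qed

lemma mult_of_inj:
  assumes \<alpha>: "\<alpha> \<in> epart e" "total \<alpha> \<le> n" and \<beta>: "\<beta> \<in> epart e" "total \<beta> \<le> n"
    and eq: "\<And>v. v \<in> lab e n \<Longrightarrow> mult_of \<alpha> v = mult_of \<beta> v"
  shows "\<alpha> = \<beta>"
proof -
  let ?m = "\<lambda>_::nat. n"
  have fit: "fits e ?m \<alpha>" "fits e ?m \<beta>" using \<alpha> \<beta> by (auto intro: epart_fits)
  have cnt: "count (blk ?m \<gamma> k) r = mult_of \<gamma> (k, r)" if "fits e ?m \<gamma>" "k < e" "r \<noteq> 0" for \<gamma> k r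
  proof -
    have "{j. lookup \<gamma> (k, j) = r} = {j \<in> {..<n}. lookup \<gamma> (k, j) = r}"
    proof -
      have "j < n" if "lookup \<gamma> (k, j) = r" for j
      proof (rule ccontr)
        assume "\<not> j < n"
        then have "lookup \<gamma> (k, j) = 0" using fits_block[OF \<open>fits e ?m \<gamma>\<close> \<open>k < e\<close>] by simp
        then show False using that \<open>r \<noteq> 0\<close> by simp
      qed
      then show ?thesis by auto
    qed
    then show ?thesis by (simp add: blk_def count_image_mset_eq_card_vimage mult_of_def)
  qed
  have large: "mult_of \<gamma> (k, r) = 0" if "total \<gamma> \<le> n" "n < r" for \<gamma> k r
  proof -
    have "lookup \<gamma> x \<le> total \<gamma>" for x
    proof (cases "x \<in> keys \<gamma>")
      case True
      then show ?thesis unfolding total_def by (intro member_le_sum) auto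
    qed (simp add: in_keys_iff)
    then have "lookup \<gamma> (k, j) \<noteq> r" for j using that by (metis leD le_trans)
    then show ?thesis by (simp add: mult_of_def)
  qed
  have "blk ?m \<alpha> k = blk ?m \<beta> k" if k: "k < e" for k
  proof (rule mset_eq_upto_zero)
    fix r :: nat assume r: "r \<noteq> 0"
    show "count (blk ?m \<alpha> k) r = count (blk ?m \<beta> k) r"
      using eq[of "(k, r)"] k r large[OF \<alpha>(2), of r k] large[OF \<beta>(2), of r k]
      by (cases "r \<le> n") (auto simp: cnt[OF fit(1) k r] cnt[OF fit(2) k r] lab_def)
  qed (simp add: blk_def)
  then show ?thesis
    using fit epart_mono[OF \<alpha>(1)] epart_mono[OF \<beta>(1)] by (intro decreasing_unique[of \<alpha> e ?m \<beta>]) (auto simp: fits_def)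
qed

lemma card_parts:
  assumes "\<alpha> \<in> epart e" "total \<alpha> \<le> n"
  shows "(\<Sum>k<e. card {j. lookup \<alpha> (k, j) \<noteq> 0}) = (\<Sum>v\<in>lab e n. mult_of \<alpha> v)"
proof -
  have "keys \<alpha> = Sigma {..<e} (\<lambda>k. {j. lookup \<alpha> (k, j) \<noteq> 0})"
    using assms(1) by (auto simp: epart_def in_keys_iff)
  moreover have "finite {j. lookup \<alpha> (k, j) \<noteq> 0}" for k
  proof -
    have "{j. lookup \<alpha> (k, j) \<noteq> 0} \<subseteq> snd ` keys \<alpha>" by (force simp: in_keys_iff)
    then show ?thesis by (rule finite_subset) simp
  qed
  ultimately have "card (keys \<alpha>) = (\<Sum>k<e. card {j. lookup \<alpha> (k, j) \<noteq> 0})"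
    by (simp add: card_SigmaI)
  then show ?thesis using sum_parts[OF assms, of "\<lambda>_. 1"] by simp
qed

section \<open>The scalar product\<close>

global_interpretation mpol_vs: vector_space "\<lambda>c (f::mpol). Const c * f"
  by standard (simp_all add: Const_add Const_mult algebra_simps)

context
  fixes e :: nat and \<zeta> :: complex
  assumes e_pos: "e \<ge> 1" and zeta: "primitive_root_of_unity e \<zeta>"
begin

definition pf :: "(nat \<Rightarrow> nat) \<Rightarrow> nat \<Rightarrow> arr \<Rightarrow> mpol" where
  "pf m n \<alpha> = pmono e \<zeta> m (lab e n) (mult_of \<alpha>)"

lemma pfun_pf:
  assumes "\<alpha> \<in> epart e" "total \<alpha> \<le> n" shows "pfun e m \<zeta> \<alpha> l = pf (shift m l) n \<alpha>"
proof -
  have "pfun e m \<zeta> \<alpha> l = (\<Prod>x\<in>keys \<alpha>. ps e (shift m l) \<zeta> (fst x, lookup \<alpha> x))"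
    by (simp add: pfun_def psum_ps case_prod_unfold)
  then show ?thesis by (simp add: prod_parts[OF assms] pf_def pmono_def)
qed

lemma restr_ps:
  assumes "\<And>k. m k \<le> m' k" "snd v \<ge> 1" shows "restr m (ps e m' \<zeta> v) = ps e m \<zeta> v"
proof -
  have "restr m (ps e m' \<zeta> v) = (\<Sum>x\<in>idx e m'. Const (cF (\<zeta> ^ (fst v * fst x))) * (if snd x < m (fst x) then Var x else 0) ^ snd v)"
    unfolding ps_def restr_sum restr_Const
    by (intro sum.cong refl arg_cong[where f = "\<lambda>z. _ * z"]) (simp add: restr_def msubst_power case_prod_unfold)
  also have "\<dots> = (\<Sum>x\<in>idx e m. Const (cF (\<zeta> ^ (fst v * fst x))) * (if snd x < m (fst x) then Var x else 0) ^ snd v)"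
    by (rule sum.mono_neutral_right) (use assms(2) in \<open>auto simp: zero_power intro: less_le_trans[OF _ assms(1)]\<close>)
  also have "\<dots> = ps e m \<zeta> v" unfolding ps_def by (intro sum.cong refl) auto
  finally show ?thesis .
qed

lemma pfun_hom_Xi:
  assumes "\<alpha> \<in> epart e" shows "pfun e m \<zeta> \<alpha> \<in> hom_Xi e m (total \<alpha>)"
  unfolding hom_Xi_def
proof (clarify, intro conjI)
  fix l
  note p = pfun_pf[OF assms order_refl, of m]
  show "pfun e m \<zeta> \<alpha> l \<in> Xi_fin e (shift m l)"
    unfolding p pf_def Xi_fin_iff using symmetric_pmono[OF e_pos zeta] supp_pmono[OF e_pos zeta] by blast
  show "homog (total \<alpha>) (pfun e m \<zeta> \<alpha> l)"
    unfolding p pf_def using homog_pmono[OF e_pos zeta, of "lab e (total \<alpha>)" "mult_of \<alpha>"] wt_mult_of[OF assms order_refl]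
    by simp
  have "restr (shift m l) (ps e (shift m (Suc l)) \<zeta> v) = ps e (shift m l) \<zeta> v" if "v \<in> lab e (total \<alpha>)" for v
    by (rule restr_ps) (use that in \<open>auto simp: shift_def lab_def\<close>)
  then show "restr (shift m l) (pfun e m \<zeta> \<alpha> (Suc l)) = pfun e m \<zeta> \<alpha> l"
    unfolding p pf_def pmono_def
    by (simp add: restr_def msubst_prod msubst_power)
qed

abbreviation B0 :: "(nat \<Rightarrow> nat) \<Rightarrow> fld" where
  "B0 m \<equiv> Bf (adelta e m) (adelta e m)"

definition z0 :: "nat \<Rightarrow> arr \<Rightarrow> nat" where
  "z0 n \<alpha> = (\<Prod>v\<in>lab e n. (e * snd v) ^ mult_of \<alpha> v * fact (mult_of \<alpha> v))"

lemma z0_nonzero: "z0 n \<alpha> \<noteq> 0"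
  using e_pos by (simp add: z0_def) (auto simp: lab_def)

lemma pf_orthogonal:
  assumes \<alpha>: "\<alpha> \<in> epart e" "total \<alpha> \<le> n" and \<beta>: "\<beta> \<in> epart e" "total \<beta> \<le> n" and n: "\<forall>k<e. n \<le> m k"
  shows "Bf (pf m n \<alpha> * adelta e m) (pf m n \<beta> * adelta e m) = (if \<alpha> = \<beta> then of_nat (z0 n \<alpha>) * B0 m else 0)"
proof -
  have "(\<forall>v\<in>lab e n. mult_of \<alpha> v = mult_of \<beta> v) \<longleftrightarrow> \<alpha> = \<beta>" using mult_of_inj[OF \<alpha> \<beta>] by blast
  moreover have "\<forall>k<e. wt (lab e n) (mult_of \<alpha>) \<le> m k" "\<forall>k<e. wt (lab e n) (mult_of \<beta>) \<le> m k"
    using n \<alpha>(2) \<beta>(2) by (auto simp: wt_mult_of[OF \<alpha>] wt_mult_of[OF \<beta>] intro: le_trans)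
  ultimately show ?thesis
    unfolding pf_def using pmono_orthogonal[OF e_pos zeta labels_lab, of n "mult_of \<alpha>" m "mult_of \<beta>"] by (simp add: z0_def)
qed

lemma z_qt_z0:
  assumes \<alpha>: "\<alpha> \<in> epart e" "total \<alpha> = n"
  shows "z_qt e \<zeta> \<alpha> = of_nat (z0 n \<alpha>) * (\<Prod>v\<in>lab e n. uu \<zeta> SPlus qF v ^ mult_of \<alpha> v)"
proof -
  have \<alpha>': "total \<alpha> \<le> n" using \<alpha> by simp
  have "(\<Prod>k<e. z_block \<alpha> k) = (\<Prod>v\<in>lab e n. snd v ^ mult_of \<alpha> v * fact (mult_of \<alpha> v))"
    unfolding z_block_def Let_def \<alpha>(2) lab_def
    by (subst prod.Sigma) (auto simp: mult_of_def case_prod_unfold)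
  moreover have "e ^ (\<Sum>k<e. card {j. lookup \<alpha> (k, j) \<noteq> 0}) = (\<Prod>v\<in>lab e n. e ^ mult_of \<alpha> v)"
    unfolding card_parts[OF \<alpha>(1) \<alpha>'] by (rule power_sum)
  ultimately have "e ^ (\<Sum>k<e. card {j. lookup \<alpha> (k, j) \<noteq> 0}) * (\<Prod>k<e. z_block \<alpha> k) = z0 n \<alpha>"
    by (simp add: z0_def power_mult_distrib mult_ac flip: prod.distrib)
  moreover have "(\<Prod>(k, j)\<in>keys \<alpha>. (1 - cF (\<zeta> ^ k) * qF ^ lookup \<alpha> (k, j)) / (1 - cF (\<zeta> ^ k) * tF ^ lookup \<alpha> (k, j)))
      = (\<Prod>x\<in>keys \<alpha>. uu \<zeta> SPlus qF (fst x, lookup \<alpha> x))"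
    by (intro prod.cong refl) (auto simp: uu_def om_def)
  ultimately show ?thesis
    unfolding z_qt_def prod_parts[OF \<alpha>(1) \<alpha>', of "uu \<zeta> SPlus qF"] by simp
qed

lemma uu_nonzero: "v \<in> lab e n \<Longrightarrow> uu \<zeta> s qF v \<noteq> 0"
  using one_minus_q_nonzero[of "snd v"] one_minus_t_nonzero[of "snd v"]
  by (auto simp: uu_def lab_def)

lemma z_qt_nonzero: "\<alpha> \<in> epart e \<Longrightarrow> total \<alpha> = n \<Longrightarrow> z_qt e \<zeta> \<alpha> \<noteq> 0"
  using uu_nonzero z0_nonzero by (simp add: z_qt_z0)

text \<open>Coordinates with respect to the power sum products, on the level of alternating polynomials.\<close>

definition pcf :: "(nat \<Rightarrow> nat) \<Rightarrow> nat \<Rightarrow> mpol \<Rightarrow> arr \<Rightarrow> fld" where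
  "pcf m n F \<alpha> = Bf F (pf m n \<alpha> * adelta e m) / (of_nat (z0 n \<alpha>) * B0 m)"

lemma pcf_add: "pcf m n (F + G) \<alpha> = pcf m n F \<alpha> + pcf m n G \<alpha>"
  by (simp add: pcf_def pairing_form_add add_divide_distrib)
lemma pcf_Const: "pcf m n (Const c * F) \<alpha> = c * pcf m n F \<alpha>"
  by (simp add: pcf_def pairing_form_Const)
lemma pcf_sum: "pcf m n (sum F A) \<alpha> = (\<Sum>a\<in>A. pcf m n (F a) \<alpha>)"
  by (simp add: pcf_def pairing_form_sum sum_divide_distrib)

lemma B0_nonzero: "B0 m \<noteq> 0" by (rule Bf_adelta_nonzero[OF e_pos zeta])

lemma pcf_pf:
  assumes "\<alpha> \<in> epart e" "total \<alpha> \<le> n" "\<beta> \<in> epart e" "total \<beta> \<le> n" "\<forall>k<e. n \<le> m k"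
  shows "pcf m n (pf m n \<alpha> * adelta e m) \<beta> = (if \<alpha> = \<beta> then 1 else 0)"
  using pf_orthogonal[OF assms] B0_nonzero[of m] z0_nonzero[of n \<beta>] by (cases "\<alpha> = \<beta>") (simp_all add: pcf_def)

lemma pcf_lincomb:
  assumes A: "finite A" "\<And>\<alpha>. \<alpha> \<in> A \<Longrightarrow> \<alpha> \<in> epart e \<and> total \<alpha> \<le> n" and n: "\<forall>k<e. n \<le> m k"
    and \<beta>: "\<beta> \<in> epart e" "total \<beta> \<le> n"
  shows "pcf m n ((\<Sum>\<alpha>\<in>A. Const (c \<alpha>) * pf m n \<alpha>) * adelta e m) \<beta> = (if \<beta> \<in> A then c \<beta> else 0)"
proof -
  have "pcf m n ((\<Sum>\<alpha>\<in>A. Const (c \<alpha>) * pf m n \<alpha>) * adelta e m) \<beta>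
    = (\<Sum>\<alpha>\<in>A. if \<alpha> = \<beta> then c \<alpha> else 0)"
    unfolding sum_distrib_right pcf_sum mult.assoc pcf_Const
    by (intro sum.cong refl) (use A(2) \<beta> n in \<open>simp add: pcf_pf\<close>)
  then show ?thesis using A(1) by (simp add: sum.delta)
qed

text \<open>The power sum products are orthogonal, hence independent, and there are as many of them as
  monomial symmetric polynomials; so they span the symmetric polynomials of degree \<open>n\<close>.\<close>

lemma pf_expand:
  assumes f: "symmetric_poly e m f" "supp_in (idx e m) f" "homog n f" and n: "\<forall>k<e. n \<le> m k"
  shows "f = (\<Sum>\<alpha>\<in>Z00 e m n. Const (pcf m n (f * adelta e m) \<alpha>) * pf m n \<alpha>)"
proof -
  let ?Z = "Z00 e m n" and ?p = "pf m n"
  have Z: "\<alpha> \<in> epart e \<and> total \<alpha> \<le> n" if "\<alpha> \<in> ?Z" for \<alpha> using that by (simp add: Z00_def)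
  have inj: "inj_on ?p ?Z"
  proof (rule inj_onI)
    fix \<alpha> \<beta> assume *: "\<alpha> \<in> ?Z" "\<beta> \<in> ?Z" "?p \<alpha> = ?p \<beta>"
    then show "\<alpha> = \<beta>"
      using pcf_pf[of \<alpha> n \<beta> m] pcf_pf[of \<beta> n \<beta> m] Z n by (metis zero_neq_one)
  qed
  have sym: "symmetric_poly e m (?p \<alpha>)" "supp_in (idx e m) (?p \<alpha>)" "homog n (?p \<alpha>)" if "\<alpha> \<in> ?Z" for \<alpha>
    using symmetric_pmono[OF e_pos zeta] supp_pmono[OF e_pos zeta] homog_pmono[OF e_pos zeta, of "lab e n" "mult_of \<alpha>" m]
      wt_mult_of[of \<alpha> e n] that by (auto simp: pf_def Z00_def)
  have ind: "mpol_vs.independent (?p ` ?Z)"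
  proof (rule mpol_vs.independent_if_scalars_zero)
    fix c x assume s: "(\<Sum>x\<in>?p ` ?Z. Const (c x) * x) = 0" and x: "x \<in> ?p ` ?Z"
    then obtain \<beta> where \<beta>: "\<beta> \<in> ?Z" "x = ?p \<beta>" by blast
    have "(\<Sum>\<alpha>\<in>?Z. Const (c (?p \<alpha>)) * ?p \<alpha>) = 0" using s by (simp add: sum.reindex[OF inj])
    then have "pcf m n ((\<Sum>\<alpha>\<in>?Z. Const (c (?p \<alpha>)) * ?p \<alpha>) * adelta e m) \<beta> = 0"
      by (simp add: pcf_def)
    then show "c x = 0"
      using pcf_lincomb[of ?Z n m \<beta> "\<lambda>\<alpha>. c (?p \<alpha>)"] Z \<beta> n by auto
  qed simp
  have span_m: "x \<in> mpol_vs.span (monsym e m ` ?Z)"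
    if "symmetric_poly e m x" "supp_in (idx e m) x" "homog n x" for x
    by (subst symmetric_expand[OF that])
       (intro mpol_vs.span_sum mpol_vs.span_scale mpol_vs.span_base imageI)
  have sub: "?p ` ?Z \<subseteq> mpol_vs.span (monsym e m ` ?Z)"
    using span_m sym by auto
  obtain B where B: "?p ` ?Z \<subseteq> B" "B \<subseteq> mpol_vs.span (monsym e m ` ?Z)" "mpol_vs.independent B"
      "mpol_vs.span (monsym e m ` ?Z) \<subseteq> mpol_vs.span B"
    using mpol_vs.maximal_independent_subset_extend[OF sub ind] by metis
  have "finite B \<and> card B \<le> card (monsym e m ` ?Z)"
    by (rule mpol_vs.independent_span_bound) (use B in auto)
  moreover have "card (monsym e m ` ?Z) \<le> card (?p ` ?Z)"
    using card_image_le[of ?Z "monsym e m"] by (simp add: card_image[OF inj])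
  ultimately have "?p ` ?Z = B" using B(1) by (intro card_seteq) auto
  then have "f \<in> mpol_vs.span (?p ` ?Z)" using span_m[OF f] B(4) by blast
  then obtain c where c: "f = (\<Sum>x\<in>?p ` ?Z. Const (c x) * x)"
    by (subst (asm) mpol_vs.span_finite) auto
  then have c': "f = (\<Sum>\<alpha>\<in>?Z. Const (c (?p \<alpha>)) * ?p \<alpha>)" by (simp add: sum.reindex[OF inj])
  have "pcf m n (f * adelta e m) \<alpha> = c (?p \<alpha>)" if "\<alpha> \<in> ?Z" for \<alpha>
    by (subst c') (use pcf_lincomb[of ?Z n m \<alpha> "\<lambda>\<alpha>. c (?p \<alpha>)"] Z that n in auto)
  then have "(\<Sum>\<alpha>\<in>?Z. Const (pcf m n (f * adelta e m) \<alpha>) * ?p \<alpha>) = (\<Sum>\<alpha>\<in>?Z. Const (c (?p \<alpha>)) * ?p \<alpha>)"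
    by (intro sum.cong refl) simp
  with c' show ?thesis by simp
qed

text \<open>Other coordinates of \<open>f\<close> could involve power sum products of other degrees. They are excluded at
  a level \<open>N\<close> above all degrees that occur, where the power sum products are orthogonal.\<close>

lemma pcoord_eq:
  assumes f: "f \<in> hom_Xi e m n" and L: "\<forall>k<e. n \<le> shift m L k"
  defines "c \<equiv> pcf (shift m L) n (f L * adelta e (shift m L))"
  shows "keys (pcoord e m \<zeta> f) \<subseteq> Z00 e (shift m L) n"
    "\<And>\<alpha>. \<alpha> \<in> Z00 e (shift m L) n \<Longrightarrow> lookup (pcoord e m \<zeta> f) \<alpha> = c \<alpha>"
proof -
  let ?Z = "Z00 e (shift m L) n"
  define C where "C = (\<Sum>\<alpha>\<in>?Z. Poly_Mapping.single \<alpha> (c \<alpha>))"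
  have lC: "lookup C \<alpha> = (if \<alpha> \<in> ?Z then c \<alpha> else 0)" for \<alpha>
    by (simp add: C_def lookup_sum lookup_single when_def sum.delta)
  have kC: "keys C \<subseteq> ?Z" by (auto simp: in_keys_iff lC split: if_splits)
  have Z: "\<alpha> \<in> epart e \<and> total \<alpha> = n" if "\<alpha> \<in> ?Z" for \<alpha> using that by (simp add: Z00_def)
  have lin: "lincomb (keys D) (lookup D) g = lincomb A (lookup D) g" if "finite A" "keys D \<subseteq> A" for A D and g :: "arr \<Rightarrow> symfun"
    unfolding lincomb_def by (rule ext, rule sum.mono_neutral_left) (use that in \<open>auto simp: in_keys_iff\<close>)
  have "lincomb ?Z (lookup C) (pfun e m \<zeta>) = f"
  proof (rule hom_Xi_eqI[OF _ f L])
    show "lincomb ?Z (lookup C) (pfun e m \<zeta>) \<in> hom_Xi e m n"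
      by (rule hom_Xi_lincomb) (use Z pfun_hom_Xi in blast)
    have fL: "symmetric_poly e (shift m L) (f L)" "supp_in (idx e (shift m L)) (f L)" "homog n (f L)"
      using f by (auto simp: hom_Xi_def Xi_fin_iff)
    show "lincomb ?Z (lookup C) (pfun e m \<zeta>) L = f L"
      by (subst pf_expand[OF fL L]) (auto simp: lincomb_def lC c_def Z pfun_pf[of _ n] intro!: sum.cong)
  qed
  then have fC: "f = lincomb (keys C) (lookup C) (pfun e m \<zeta>)" using lin[OF finite_Z00 kC] by simp
  have "pcoord e m \<zeta> f = C"
    unfolding pcoord_def
  proof (rule the_equality)
    show "keys C \<subseteq> epart e \<and> f = lincomb (keys C) (lookup C) (pfun e m \<zeta>)" using fC kC Z by blast
  next
    fix D assume D: "keys D \<subseteq> epart e \<and> f = lincomb (keys D) (lookup D) (pfun e m \<zeta>)"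
    let ?A = "keys C \<union> keys D"
    define N where "N = (\<Sum>\<alpha>\<in>?A. total \<alpha>)"
    have A: "\<alpha> \<in> epart e \<and> total \<alpha> \<le> N" if "\<alpha> \<in> ?A" for \<alpha>
    proof
      show "\<alpha> \<in> epart e" using that D kC Z by blast
      show "total \<alpha> \<le> N" unfolding N_def using that by (intro member_le_sum) auto
    qed
    have N: "\<forall>k<e. N \<le> shift m N k" by (simp add: shift_def)
    have expand: "f N = (\<Sum>\<alpha>\<in>?A. Const (lookup Y \<alpha>) * pf (shift m N) N \<alpha>)"
      if "f = lincomb (keys Y) (lookup Y) (pfun e m \<zeta>)" "keys Y \<subseteq> ?A" for Y
    proof -
      have "f N = lincomb ?A (lookup Y) (pfun e m \<zeta>) N" using that lin[of ?A Y] by simp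
      then show ?thesis using A by (auto simp: lincomb_def pfun_pf[of _ N] intro!: sum.cong)
    qed
    have "lookup D \<alpha> = lookup C \<alpha>" if "\<alpha> \<in> ?A" for \<alpha>
    proof -
      have "pcf (shift m N) N (f N * adelta e (shift m N)) \<alpha> = lookup Y \<alpha>"
        if "f = lincomb (keys Y) (lookup Y) (pfun e m \<zeta>)" "keys Y \<subseteq> ?A" for Y
        unfolding expand[OF that] using pcf_lincomb[of ?A N "shift m N" \<alpha> "lookup Y"] A N \<open>\<alpha> \<in> ?A\<close> by simp
      from this[of C] this[of D] fC D show ?thesis by simp
    qed
    moreover have "lookup D \<alpha> = lookup C \<alpha>" if "\<alpha> \<notin> ?A" for \<alpha> using that by (simp add: in_keys_iff)
    ultimately show "D = C" by (intro poly_mapping_eqI) blast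
  qed
  then show "keys (pcoord e m \<zeta> f) \<subseteq> ?Z" "\<And>\<alpha>. \<alpha> \<in> ?Z \<Longrightarrow> lookup (pcoord e m \<zeta> f) \<alpha> = c \<alpha>"
    using kC lC by simp_all
qed

text \<open>The scalar product of \<open>f\<close> and \<open>g\<close> as a form in \<open>f a\<^sub>\<delta>\<close> and \<open>g a\<^sub>\<delta>\<close>, so that it applies to the
  numerators of the operators.\<close>

definition SF :: "(nat \<Rightarrow> nat) \<Rightarrow> nat \<Rightarrow> mpol \<Rightarrow> mpol \<Rightarrow> fld" where
  "SF m n F G = (\<Sum>\<alpha>\<in>Z00 e m n. pcf m n F \<alpha> * cnj_F (pcf m n G \<alpha>) * z_qt e \<zeta> \<alpha>)"

lemma SF_add_left: "SF m n (F + F') G = SF m n F G + SF m n F' G"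
  by (simp add: SF_def pcf_add distrib_right sum.distrib)
lemma SF_add_right: "SF m n F (G + G') = SF m n F G + SF m n F G'"
  by (simp add: SF_def pcf_add distrib_left distrib_right sum.distrib)
lemma SF_Const_left: "SF m n (Const c * F) G = c * SF m n F G"
  unfolding SF_def pcf_Const sum_distrib_left by (simp add: mult_ac)
lemma SF_Const_right: "SF m n F (Const c * G) = cnj_F c * SF m n F G"
  unfolding SF_def pcf_Const sum_distrib_left by (simp add: mult_ac)

lemma scal_SF:
  assumes f: "f \<in> hom_Xi e m n" and g: "g \<in> hom_Xi e m n" and L: "\<forall>k<e. n \<le> shift m L k"
  shows "scal e m \<zeta> f g = SF (shift m L) n (f L * adelta e (shift m L)) (g L * adelta e (shift m L))"
proof -
  let ?Z = "Z00 e (shift m L) n"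
  have "scal e m \<zeta> f g = (\<Sum>\<alpha>\<in>?Z. lookup (pcoord e m \<zeta> f) \<alpha> * cnj_F (lookup (pcoord e m \<zeta> g) \<alpha>) * z_qt e \<zeta> \<alpha>)"
    unfolding scal_def using pcoord_eq(1)[OF f L]
    by (intro sum.mono_neutral_left) (auto simp: in_keys_iff)
  then show ?thesis
    unfolding SF_def using pcoord_eq(2)[OF f L] pcoord_eq(2)[OF g L] by (simp cong: sum.cong)
qed

lemma SF_nondegenerate_left:
  assumes f: "symmetric_poly e m f" "supp_in (idx e m) f" "homog n f" and n: "\<forall>k<e. n \<le> m k"
    and z: "\<And>\<alpha>. \<alpha> \<in> Z00 e m n \<Longrightarrow> SF m n (f * adelta e m) (pf m n \<alpha> * adelta e m) = 0"
  shows "f = 0"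
proof -
  have "pcf m n (f * adelta e m) \<alpha> = 0" if \<alpha>: "\<alpha> \<in> Z00 e m n" for \<alpha>
  proof -
    let ?F = "f * adelta e m"
    have "SF m n ?F (pf m n \<alpha> * adelta e m) = (\<Sum>\<beta>\<in>Z00 e m n. if \<beta> = \<alpha> then pcf m n ?F \<beta> * z_qt e \<zeta> \<beta> else 0)"
      unfolding SF_def by (intro sum.cong refl) (use \<alpha> n in \<open>auto simp: pcf_pf Z00_def\<close>)
    then have "pcf m n ?F \<alpha> * z_qt e \<zeta> \<alpha> = 0" using z[OF \<alpha>] \<alpha> by (simp add: sum.delta)
    then show ?thesis using z_qt_nonzero[of \<alpha> n] \<alpha> by (simp add: Z00_def)
  qed
  then show ?thesis by (subst pf_expand[OF f n]) simp
qed

lemma SF_nondegenerate_right: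
  assumes f: "symmetric_poly e m f" "supp_in (idx e m) f" "homog n f" and n: "\<forall>k<e. n \<le> m k"
    and z: "\<And>\<alpha>. \<alpha> \<in> Z00 e m n \<Longrightarrow> SF m n (pf m n \<alpha> * adelta e m) (f * adelta e m) = 0"
  shows "f = 0"
proof -
  have "pcf m n (f * adelta e m) \<alpha> = 0" if \<alpha>: "\<alpha> \<in> Z00 e m n" for \<alpha>
  proof -
    let ?F = "f * adelta e m"
    have "SF m n (pf m n \<alpha> * adelta e m) ?F = (\<Sum>\<beta>\<in>Z00 e m n. if \<beta> = \<alpha> then cnj_F (pcf m n ?F \<beta>) * z_qt e \<zeta> \<beta> else 0)"
      unfolding SF_def by (intro sum.cong refl) (use \<alpha> n in \<open>auto simp: pcf_pf Z00_def\<close>)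
    then have "cnj_F (pcf m n ?F \<alpha>) * z_qt e \<zeta> \<alpha> = 0" using z[OF \<alpha>] \<alpha> by (simp add: sum.delta)
    then show ?thesis using z_qt_nonzero[of \<alpha> n] \<alpha> by (simp add: Z00_def)
  qed
  then show ?thesis by (subst pf_expand[OF f n]) simp
qed

text \<open>The factors in \<open>Num_adjoint\<close> are those of \<open>z\<^sub>\<beta>(q,t)\<close> on the left and of \<open>z\<^sub>\<alpha>(q,t)\<close> on the
  right.\<close>

lemma SF_Num_adjoint:
  assumes f: "symmetric_poly e m f" "supp_in (idx e m) f" "homog n f"
    and g: "symmetric_poly e m g" "supp_in (idx e m) g" "homog n g" and n: "\<forall>k<e. n \<le> m k"
  shows "SF m n (Num e m qF SPlus f) (g * adelta e m) = SF m n (f * adelta e m) (Num e m qF SMinus g)"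
proof -
  let ?Z = "Z00 e m n" and ?a = "adelta e m"
  define a where "a = pcf m n (f * ?a)"
  define b where "b = pcf m n (g * ?a)"
  let ?u = "\<lambda>\<alpha>. \<Prod>v\<in>lab e n. uu \<zeta> SPlus qF v ^ mult_of \<alpha> v"
  have fe: "f = (\<Sum>\<alpha>\<in>?Z. Const (a \<alpha>) * pf m n \<alpha>)" unfolding a_def by (rule pf_expand[OF f n])
  have ge: "g = (\<Sum>\<alpha>\<in>?Z. Const (b \<alpha>) * pf m n \<alpha>)" unfolding b_def by (rule pf_expand[OF g n])
  have Z: "\<alpha> \<in> epart e" "total \<alpha> = n" "total \<alpha> \<le> n" if "\<alpha> \<in> ?Z" for \<alpha> using that by (simp_all add: Z00_def)
  let ?c = "\<lambda>\<alpha> \<beta>. Bf (Num e m qF SPlus (pf m n \<alpha>)) (pf m n \<beta> * ?a)"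
  let ?d = "\<lambda>\<alpha> \<beta>. Bf (pf m n \<alpha> * ?a) (Num e m qF SMinus (pf m n \<beta>))"
  have adj: "?u \<beta> * ?c \<alpha> \<beta> = ?u \<alpha> * ?d \<alpha> \<beta>" if "\<alpha> \<in> ?Z" "\<beta> \<in> ?Z" for \<alpha> \<beta>
  proof -
    have 1: "\<forall>v\<in>lab e n. mult_of \<gamma> v \<le> n" "\<forall>k<e. wt (lab e n) (mult_of \<gamma>) \<le> m k" if "\<gamma> \<in> ?Z" for \<gamma>
      using mult_of_le[OF Z(1,3)[OF that]] wt_mult_of[OF Z(1,3)[OF that]] Z(2)[OF that] n by auto
    show ?thesis
      using Num_adjoint[OF e_pos zeta labels_lab 1(1)[OF that(1)] 1(1)[OF that(2)] 1(2)[OF that(1)] 1(2)[OF that(2)] cnj_F_qF, of SPlus]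
      by (simp add: pf_def)
  qed
  have "SF m n (Num e m qF SPlus f) (g * ?a) = (\<Sum>\<beta>\<in>?Z. \<Sum>\<alpha>\<in>?Z. a \<alpha> * cnj_F (b \<beta>) * (?u \<beta> * ?c \<alpha> \<beta>) / B0 m)"
  proof -
    have "pcf m n (Num e m qF SPlus f) \<beta> = (\<Sum>\<alpha>\<in>?Z. a \<alpha> * ?c \<alpha> \<beta> / (of_nat (z0 n \<beta>) * B0 m))" for \<beta>
      unfolding fe Num_sum Num_Const pcf_sum pcf_Const by (simp add: pcf_def)
    then show ?thesis
      unfolding SF_def b_def[symmetric]
      by (intro sum.cong refl)
         (simp add: z_qt_z0[OF Z(1,2)] sum_distrib_left sum_distrib_right z0_nonzero mult_ac)
  qed
  also have "\<dots> = (\<Sum>\<beta>\<in>?Z. \<Sum>\<alpha>\<in>?Z. a \<alpha> * cnj_F (b \<beta>) * (?u \<alpha> * ?d \<alpha> \<beta>) / B0 m)"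
    by (intro sum.cong refl) (simp add: adj)
  also have "\<dots> = (\<Sum>\<alpha>\<in>?Z. \<Sum>\<beta>\<in>?Z. a \<alpha> * cnj_F (b \<beta>) * (?u \<alpha> * ?d \<alpha> \<beta>) / B0 m)" by (rule sum.swap)
  also have "\<dots> = SF m n (f * ?a) (Num e m qF SMinus g)"
  proof -
    have "cnj_F (pcf m n (Num e m qF SMinus g) \<alpha>) = (\<Sum>\<beta>\<in>?Z. cnj_F (b \<beta>) * ?d \<alpha> \<beta> / (of_nat (z0 n \<alpha>) * B0 m))" for \<alpha>
      unfolding ge Num_sum Num_Const pcf_sum pcf_Const
      by (simp add: pcf_def Bf_adelta_nonzero(2)[OF e_pos zeta] Bf_hermitian[of "pf m n \<alpha> * ?a"])
    then show ?thesis
      unfolding SF_def a_def[symmetric]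
      by (intro sum.cong refl)
         (simp add: z_qt_z0[OF Z(1,2)] sum_distrib_left sum_distrib_right z0_nonzero mult_ac)
  qed
  finally show ?thesis .
qed

text \<open>The scalar summands of the operators need not be self-conjugate, which accounts for \<open>\<kappa>\<close>. A multiple
  of the scalar product does no harm, because it vanishes where it is applied to orthogonal
  functions.\<close>

lemma SF_E_adjoint:
  assumes n: "\<forall>k<e. n \<le> shift m L k"
  obtains \<kappa> where "\<And>f g. symmetric_poly e (shift m L) f \<Longrightarrow> supp_in (idx e (shift m L)) f \<Longrightarrow> homog n f \<Longrightarrow>
     symmetric_poly e (shift m L) g \<Longrightarrow> supp_in (idx e (shift m L)) g \<Longrightarrow> homog n g \<Longrightarrow>
     SF (shift m L) n (E_level e m c SPlus L f * adelta e (shift m L)) (g * adelta e (shift m L))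
     = SF (shift m L) n (f * adelta e (shift m L)) (E_level e m c SMinus L g * adelta e (shift m L))
      + \<kappa> * SF (shift m L) n (f * adelta e (shift m L)) (g * adelta e (shift m L))"
proof -
  let ?M = "shift m L"
  define C where "C = c L - (\<Sum>i\<in>Iset e ?M. tF powi (int (pairing e (delta e ?M) i) - int (\<Sum>k<e. ?M k)))"
  show ?thesis
  proof (rule that[of "C - cnj_F C"])
    fix f g assume f: "symmetric_poly e ?M f" "supp_in (idx e ?M) f" "homog n f"
      and g: "symmetric_poly e ?M g" "supp_in (idx e ?M) g" "homog n g"
    have e: "e > 0" using e_pos by simp
    show "SF ?M n (E_level e m c SPlus L f * adelta e ?M) (g * adelta e ?M)
     = SF ?M n (f * adelta e ?M) (E_level e m c SMinus L g * adelta e ?M)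
      + (C - cnj_F C) * SF ?M n (f * adelta e ?M) (g * adelta e ?M)"
      unfolding E_level_times_delta[OF e f] E_level_times_delta[OF e g] C_def[symmetric]
        SF_add_left SF_add_right SF_Const_left SF_Const_right SF_Num_adjoint[OF f g n]
      by (simp add: algebra_simps)
  qed
qed

end

section \<open>Linear algebra\<close>

text \<open>Gaussian elimination, removing one equation and one unknown at a time.\<close>

lemma dependent_rows:
  fixes M :: "'j \<Rightarrow> 'i \<Rightarrow> 'k::field"
  assumes "finite B" "finite J" "card B < card J"
  shows "\<exists>c. (\<exists>j\<in>J. c j \<noteq> 0) \<and> (\<forall>\<beta>\<in>B. (\<Sum>j\<in>J. c j * M j \<beta>) = 0)"
  using assms
proof (induction B arbitrary: J M rule: finite_induct)
  case empty
  then have "J \<noteq> {}" by auto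
  then show ?case by (intro exI[of _ "\<lambda>_. 1"]) auto
next
  case (insert \<beta> B)
  show ?case
  proof (cases "\<forall>j\<in>J. M j \<beta> = 0")
    case True
    have "card B < card J" using insert.prems insert.hyps by simp
    then obtain c where "\<exists>j\<in>J. c j \<noteq> 0" "\<forall>\<beta>\<in>B. (\<Sum>j\<in>J. c j * M j \<beta>) = 0"
      using insert.IH[OF insert.prems(1)] by blast
    then show ?thesis using True by (intro exI[of _ c]) simp
  next
    case False
    then obtain j0 where j0: "j0 \<in> J" "M j0 \<beta> \<noteq> 0" by blast
    let ?J = "J - {j0}" and ?M = "\<lambda>j \<gamma>. M j \<gamma> - M j \<beta> / M j0 \<beta> * M j0 \<gamma>"
    have "card B < card ?J" using insert.prems insert.hyps j0 by simp
    then obtain c where c: "\<exists>j\<in>?J. c j \<noteq> 0" "\<forall>\<gamma>\<in>B. (\<Sum>j\<in>?J. c j * ?M j \<gamma>) = 0"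
      using insert.IH[of ?J ?M] insert.prems(1) by auto
    define s where "s = - (\<Sum>j\<in>?J. c j * M j \<beta>) / M j0 \<beta>"
    define d where "d = c(j0 := s)"
    have eq: "(\<Sum>j\<in>J. d j * M j \<gamma>) = s * M j0 \<gamma> + (\<Sum>j\<in>?J. c j * M j \<gamma>)" for \<gamma>
    proof -
      have "(\<Sum>j\<in>?J. d j * M j \<gamma>) = (\<Sum>j\<in>?J. c j * M j \<gamma>)" by (intro sum.cong) (auto simp: d_def)
      then show ?thesis using j0(1) insert.prems(1) by (simp add: sum.remove d_def)
    qed
    have "(\<Sum>j\<in>J. d j * M j \<beta>) = 0" using j0(2) by (simp add: eq s_def)
    moreover have "(\<Sum>j\<in>J. d j * M j \<gamma>) = 0" if "\<gamma> \<in> B" for \<gamma>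
    proof -
      have "0 = (\<Sum>j\<in>?J. c j * M j \<gamma>) - (\<Sum>j\<in>?J. c j * M j \<beta>) / M j0 \<beta> * M j0 \<gamma>"
        using c(2) that by (simp add: right_diff_distrib sum_subtractf sum_distrib_right sum_divide_distrib mult.assoc)
      then show ?thesis by (simp add: eq s_def)
    qed
    moreover have "\<exists>j\<in>J. d j \<noteq> 0" using c(1) by (auto simp: d_def)
    ultimately show ?thesis by (intro exI[of _ d]) simp
  qed
qed

definition mat_vec :: "'i set \<Rightarrow> 'j set \<Rightarrow> ('i \<Rightarrow> 'j \<Rightarrow> 'k::field) \<Rightarrow> ('j \<Rightarrow> 'k) \<Rightarrow> 'i \<Rightarrow> 'k" where
  "mat_vec A B Y v = (\<lambda>\<alpha>. if \<alpha> \<in> A then \<Sum>\<beta>\<in>B. Y \<alpha> \<beta> * v \<beta> else 0)"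

text \<open>The vector \<open>p(a) v\<close> for a polynomial \<open>p\<close> and a matrix \<open>a\<close>.\<close>

definition poly_mat :: "'i set \<Rightarrow> ('i \<Rightarrow> 'i \<Rightarrow> 'k::field) \<Rightarrow> ('i \<Rightarrow> 'k) \<Rightarrow> 'k poly \<Rightarrow> 'i \<Rightarrow> 'k" where
  "poly_mat A a v p = (\<lambda>\<alpha>. \<Sum>k\<le>degree p. coeff p k * (mat_vec A A a ^^ k) v \<alpha>)"

lemma poly_mat_bound:
  "degree p \<le> N \<Longrightarrow> poly_mat A a v p \<alpha> = (\<Sum>k\<le>N. coeff p k * (mat_vec A A a ^^ k) v \<alpha>)"
  unfolding poly_mat_def by (intro sum.mono_neutral_left) (auto simp: coeff_eq_0)

lemma mat_vec_sum: "mat_vec A B Y (\<lambda>\<beta>. \<Sum>k\<in>K. c k * v k \<beta>) \<alpha> = (\<Sum>k\<in>K. c k * mat_vec A B Y (v k) \<alpha>)"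
proof (cases "\<alpha> \<in> A")
  case True
  have "(\<Sum>\<beta>\<in>B. Y \<alpha> \<beta> * (\<Sum>k\<in>K. c k * v k \<beta>)) = (\<Sum>\<beta>\<in>B. \<Sum>k\<in>K. c k * (Y \<alpha> \<beta> * v k \<beta>))"
    by (simp add: sum_distrib_left mult_ac)
  also have "\<dots> = (\<Sum>k\<in>K. \<Sum>\<beta>\<in>B. c k * (Y \<alpha> \<beta> * v k \<beta>))" by (rule sum.swap)
  finally show ?thesis using True by (simp add: mat_vec_def sum_distrib_left)
qed (simp add: mat_vec_def)

lemma poly_mat_linear_factor:
  "poly_mat A a v ([:- \<kappa>, 1:] * q) \<alpha> = mat_vec A A a (poly_mat A a v q) \<alpha> - \<kappa> * poly_mat A a v q \<alpha>"
proof -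
  let ?N = "degree q" and ?w = "\<lambda>k. (mat_vec A A a ^^ k) v"
  have "[:- \<kappa>, 1:] * q = pCons 0 q + smult (- \<kappa>) q" by simp
  then have c: "coeff ([:- \<kappa>, 1:] * q) k = coeff (pCons 0 q) k - \<kappa> * coeff q k" for k by simp
  have "degree ([:- \<kappa>, 1:] * q) \<le> Suc ?N"
    using degree_mult_le[of "[:- \<kappa>, 1:]" q] by simp
  then have "poly_mat A a v ([:- \<kappa>, 1:] * q) \<alpha> = (\<Sum>k\<le>Suc ?N. coeff ([:- \<kappa>, 1:] * q) k * ?w k \<alpha>)"
    by (rule poly_mat_bound)
  also have "\<dots> = (\<Sum>k\<le>Suc ?N. coeff (pCons 0 q) k * ?w k \<alpha>) - \<kappa> * (\<Sum>k\<le>Suc ?N. coeff q k * ?w k \<alpha>)"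
    unfolding c by (simp only: left_diff_distrib sum_subtractf sum_distrib_left mult.assoc)
  also have "(\<Sum>k\<le>Suc ?N. coeff q k * ?w k \<alpha>) = poly_mat A a v q \<alpha>"
    by (rule poly_mat_bound[symmetric]) simp
  also have "(\<Sum>k\<le>Suc ?N. coeff (pCons 0 q) k * ?w k \<alpha>) = (\<Sum>k\<le>?N. coeff q k * ?w (Suc k) \<alpha>)"
    by (subst sum.atMost_Suc_shift) simp
  also have "\<dots> = mat_vec A A a (poly_mat A a v q) \<alpha>"
    unfolding poly_mat_def mat_vec_sum by simp
  finally show ?thesis .
qed

lemma mat_vec_supp: "\<alpha> \<notin> A \<Longrightarrow> mat_vec A B Y v \<alpha> = 0"
  by (simp add: mat_vec_def)

lemma poly_mat_supp:
  assumes "\<And>\<alpha>. \<alpha> \<notin> A \<Longrightarrow> v \<alpha> = 0" "\<alpha> \<notin> A" shows "poly_mat A a v p \<alpha> = 0"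
proof -
  have "(mat_vec A A a ^^ k) v \<alpha> = 0" for k
    using assms by (cases k) (simp_all add: mat_vec_supp)
  then show ?thesis by (simp add: poly_mat_def)
qed

lemma poly_mat_intertwine:
  assumes com: "\<And>v. mat_vec A A a (mat_vec A B Y v) = mat_vec A B Y (mat_vec B B b v)"
  shows "mat_vec A B Y (poly_mat B b v p) = poly_mat A a (mat_vec A B Y v) p"
proof
  fix \<alpha>
  have "mat_vec A B Y ((mat_vec B B b ^^ k) v) = (mat_vec A A a ^^ k) (mat_vec A B Y v)" for k
    by (induction k) (simp_all flip: com)
  then show "mat_vec A B Y (poly_mat B b v p) \<alpha> = poly_mat A a (mat_vec A B Y v) p \<alpha>"
    unfolding poly_mat_def mat_vec_sum by simp
qed

text \<open>The first \<open>|B| + 1\<close> iterates of \<open>v\<close> are linearly dependent.\<close>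

lemma poly_mat_annihilator:
  fixes b :: "'i \<Rightarrow> 'i \<Rightarrow> 'k::field"
  assumes "finite B" "\<And>\<alpha>. \<alpha> \<notin> B \<Longrightarrow> v \<alpha> = 0"
  shows "\<exists>p. p \<noteq> 0 \<and> poly_mat B b v p = (\<lambda>_. 0)"
proof -
  let ?J = "{..card B}"
  obtain c where c: "\<exists>j\<in>?J. c j \<noteq> 0" "\<forall>\<beta>\<in>B. (\<Sum>j\<in>?J. c j * (mat_vec B B b ^^ j) v \<beta>) = 0"
    using dependent_rows[OF assms(1), of ?J "\<lambda>j. (mat_vec B B b ^^ j) v"] by auto
  define p where "p = (\<Sum>j\<in>?J. monom (c j) j)"
  have cp: "coeff p k = (if k \<in> ?J then c k else 0)" for k
    by (simp add: p_def coeff_sum sum.delta)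
  have "degree p \<le> card B" by (rule degree_le) (simp add: cp)
  then have "poly_mat B b v p \<beta> = (\<Sum>k\<le>card B. coeff p k * (mat_vec B B b ^^ k) v \<beta>)" for \<beta>
    by (rule poly_mat_bound)
  then have "poly_mat B b v p \<beta> = (\<Sum>k\<le>card B. c k * (mat_vec B B b ^^ k) v \<beta>)" for \<beta>
    by (simp add: cp)
  then have "poly_mat B b v p \<beta> = 0" for \<beta>
    using c(2) poly_mat_supp[where A = B and v = v and a = b and p = p, OF assms(2)] by (cases "\<beta> \<in> B") auto
  moreover have "p \<noteq> 0" using c(1) cp by (metis coeff_0)
  ultimately show ?thesis by blast
qed

text \<open>If a nonzero \<open>Y\<close> intertwines \<open>a\<close> and \<open>b\<close>, and \<open>u = Y v \<noteq> 0\<close>, take a minimal annihilating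
  polynomial of \<open>v\<close> for \<open>b\<close> and among its divisors a minimal one annihilating \<open>u\<close> for \<open>a\<close>: a root
  of the latter is a common eigenvalue.\<close>

lemma intertwiner_common_eigenvalue:
  fixes a :: "'i \<Rightarrow> 'i \<Rightarrow> 'k::alg_closed_field"
  assumes fin: "finite A" "finite B"
    and com: "\<And>\<alpha> \<beta>. \<alpha> \<in> A \<Longrightarrow> \<beta> \<in> B \<Longrightarrow> (\<Sum>\<gamma>\<in>A. a \<alpha> \<gamma> * Y \<gamma> \<beta>) = (\<Sum>\<gamma>\<in>B. Y \<alpha> \<gamma> * b \<gamma> \<beta>)"
    and nz: "\<alpha>0 \<in> A" "\<beta>0 \<in> B" "Y \<alpha>0 \<beta>0 \<noteq> 0"
  shows "\<exists>\<kappa>. (\<exists>v. (\<exists>\<alpha>\<in>A. v \<alpha> \<noteq> 0) \<and> (\<forall>\<alpha>\<in>A. (\<Sum>\<beta>\<in>A. a \<alpha> \<beta> * v \<beta>) = \<kappa> * v \<alpha>)) \<and>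
             (\<exists>v. (\<exists>\<alpha>\<in>B. v \<alpha> \<noteq> 0) \<and> (\<forall>\<alpha>\<in>B. (\<Sum>\<beta>\<in>B. b \<alpha> \<beta> * v \<beta>) = \<kappa> * v \<alpha>))"
proof -
  have com': "mat_vec A A a (mat_vec A B Y v) = mat_vec A B Y (mat_vec B B b v)" for v
  proof
    fix \<alpha> show "mat_vec A A a (mat_vec A B Y v) \<alpha> = mat_vec A B Y (mat_vec B B b v) \<alpha>"
    proof (cases "\<alpha> \<in> A")
      case True
      have "(\<Sum>\<gamma>\<in>A. a \<alpha> \<gamma> * (\<Sum>\<beta>\<in>B. Y \<gamma> \<beta> * v \<beta>)) = (\<Sum>\<beta>\<in>B. (\<Sum>\<gamma>\<in>A. a \<alpha> \<gamma> * Y \<gamma> \<beta>) * v \<beta>)"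
        unfolding sum_distrib_left sum_distrib_right by (subst sum.swap) (simp add: mult.assoc)
      also have "\<dots> = (\<Sum>\<beta>\<in>B. (\<Sum>\<gamma>\<in>B. Y \<alpha> \<gamma> * b \<gamma> \<beta>) * v \<beta>)"
        by (intro sum.cong refl) (simp add: com True)
      also have "\<dots> = (\<Sum>\<gamma>\<in>B. Y \<alpha> \<gamma> * (\<Sum>\<beta>\<in>B. b \<gamma> \<beta> * v \<beta>))"
        unfolding sum_distrib_left sum_distrib_right by (subst sum.swap) (simp add: mult.assoc)
      finally show ?thesis using True by (simp add: mat_vec_def)
    qed (simp add: mat_vec_def)
  qed
  define v where "v = (\<lambda>\<beta>. if \<beta> = \<beta>0 then 1 else 0 :: 'k)"
  have vB: "v \<alpha> = 0" if "\<alpha> \<notin> B" for \<alpha> using that nz(2) by (auto simp: v_def)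
  define u where "u = mat_vec A B Y v"
  have "u \<alpha>0 = (\<Sum>\<beta>\<in>B. if \<beta> = \<beta>0 then Y \<alpha>0 \<beta> else 0)"
    unfolding u_def mat_vec_def using nz(1) by (auto simp: v_def intro!: sum.cong)
  then have u0: "u \<alpha>0 \<noteq> 0" using nz fin by (simp add: sum.delta)
  have uA: "u \<alpha> = 0" if "\<alpha> \<notin> A" for \<alpha> using that by (simp add: u_def mat_vec_supp)
  let ?P = "\<lambda>p. p \<noteq> 0 \<and> poly_mat B b v p = (\<lambda>_. 0)"
  have "\<exists>p. ?P p" by (rule poly_mat_annihilator[OF fin(2)]) (rule vB)
  then obtain p0 where "?P p0" by blast
  from ex_has_least_nat[of ?P, OF this, of degree]
  obtain p where p: "?P p" and pmin: "\<And>q. ?P q \<Longrightarrow> degree p \<le> degree q" by auto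
  let ?Q = "\<lambda>g. g dvd p \<and> poly_mat A a u g = (\<lambda>_. 0)"
  have "poly_mat A a u p = mat_vec A B Y (poly_mat B b v p)"
    unfolding u_def by (rule poly_mat_intertwine[symmetric]) (rule com')
  also have "\<dots> = mat_vec A B Y (\<lambda>_. 0)" using p by simp
  also have "\<dots> = (\<lambda>_. 0)" by (auto simp: mat_vec_def)
  finally have "?Q p" by simp
  from ex_has_least_nat[of ?Q, OF this, of degree]
  obtain g where g: "?Q g" and gmin: "\<And>h. ?Q h \<Longrightarrow> degree g \<le> degree h" by auto
  have g0: "g \<noteq> 0" using g p by auto
  have "degree g \<noteq> 0"
  proof
    assume "degree g = 0"
    then obtain c where c: "g = [:c:]" by (rule degree_eq_zeroE)
    then have "c \<noteq> 0" using g0 by auto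
    have "poly_mat A a u g \<alpha>0 = c * u \<alpha>0" by (simp add: c poly_mat_def)
    then show False using g u0 \<open>c \<noteq> 0\<close> by simp
  qed
  then obtain \<kappa> where "poly g \<kappa> = 0" using alg_closed_imp_poly_has_root by blast
  then obtain q where q: "g = [:- \<kappa>, 1:] * q" by (auto simp: poly_eq_0_iff_dvd elim: dvdE)
  then have q0: "q \<noteq> 0" using g0 by auto
  have dq: "degree q < degree g" unfolding q by (subst degree_mult_eq) (use q0 in auto)
  have "q dvd p" using g q by (metis dvd_mult_right)
  then have "poly_mat A a u q \<noteq> (\<lambda>_. 0)" using gmin[of q] dq by auto
  then obtain \<alpha>1 where \<alpha>1: "poly_mat A a u q \<alpha>1 \<noteq> 0" by auto
  then have "\<alpha>1 \<in> A" using poly_mat_supp[where A = A and v = u and a = a and p = q and \<alpha> = \<alpha>1, OF uA] by (cases "\<alpha>1 \<in> A") auto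
  moreover have "mat_vec A A a (poly_mat A a u q) \<alpha> = \<kappa> * poly_mat A a u q \<alpha>" for \<alpha>
    using poly_mat_linear_factor[of A a u \<kappa> q \<alpha>] g unfolding q[symmetric] by simp
  then have "(\<Sum>\<beta>\<in>A. a \<alpha> \<beta> * poly_mat A a u q \<beta>) = \<kappa> * poly_mat A a u q \<alpha>" if A: "\<alpha> \<in> A" for \<alpha>
    using A unfolding mat_vec_def by metis
  ultimately have 1: "\<exists>v. (\<exists>\<alpha>\<in>A. v \<alpha> \<noteq> 0) \<and> (\<forall>\<alpha>\<in>A. (\<Sum>\<beta>\<in>A. a \<alpha> \<beta> * v \<beta>) = \<kappa> * v \<alpha>)"
    using \<alpha>1 by blast
  have "[:- \<kappa>, 1:] dvd p" using g q by (metis dvd_mult_left)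
  then obtain q' where q': "p = [:- \<kappa>, 1:] * q'" by (elim dvdE)
  then have q'0: "q' \<noteq> 0" using p by auto
  have "degree q' < degree p" unfolding q' by (subst degree_mult_eq) (use q'0 in auto)
  then have "poly_mat B b v q' \<noteq> (\<lambda>_. 0)" using pmin[of q'] q'0 by auto
  then obtain \<beta>1 where \<beta>1: "poly_mat B b v q' \<beta>1 \<noteq> 0" by auto
  then have "\<beta>1 \<in> B" using poly_mat_supp[where A = B and v = v and a = b and p = q' and \<alpha> = \<beta>1, OF vB] by (cases "\<beta>1 \<in> B") auto
  moreover have "mat_vec B B b (poly_mat B b v q') \<alpha> = \<kappa> * poly_mat B b v q' \<alpha>" for \<alpha>
    using poly_mat_linear_factor[of B b v \<kappa> q' \<alpha>] p unfolding q'[symmetric] by simp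
  then have "(\<Sum>\<beta>\<in>B. b \<alpha> \<beta> * poly_mat B b v q' \<beta>) = \<kappa> * poly_mat B b v q' \<alpha>" if B: "\<alpha> \<in> B" for \<alpha>
    using B unfolding mat_vec_def by metis
  ultimately have "\<exists>v. (\<exists>\<alpha>\<in>B. v \<alpha> \<noteq> 0) \<and> (\<forall>\<alpha>\<in>B. (\<Sum>\<beta>\<in>B. b \<alpha> \<beta> * v \<beta>) = \<kappa> * v \<alpha>)"
    using \<beta>1 by blast
  with 1 show ?thesis by blast
qed

text \<open>Eigenvalues are taken in the algebraic closure, where the equation still holds.\<close>

lemma sylvester_zero:
  assumes "finite A" "finite B"
    and "\<not> (\<exists>\<kappa>. eigenvalue_on A H \<kappa> \<and> eigenvalue_on B H \<kappa>)"
    and com: "\<And>\<alpha> \<beta>. \<alpha> \<in> A \<Longrightarrow> \<beta> \<in> B \<Longrightarrow> (\<Sum>\<gamma>\<in>A. H \<alpha> \<gamma> * W \<gamma> \<beta>) = (\<Sum>\<gamma>\<in>B. W \<alpha> \<gamma> * H \<gamma> \<beta>)"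
    and "\<alpha> \<in> A" "\<beta> \<in> B"
  shows "W \<alpha> \<beta> = 0"
proof (rule ccontr)
  assume "W \<alpha> \<beta> \<noteq> 0"
  then have nz: "to_ac (W \<alpha> \<beta>) \<noteq> 0" by simp
  have c: "(\<Sum>\<gamma>\<in>A. to_ac (H \<alpha> \<gamma>) * to_ac (W \<gamma> \<beta>)) = (\<Sum>\<gamma>\<in>B. to_ac (W \<alpha> \<gamma>) * to_ac (H \<gamma> \<beta>))"
    if "\<alpha> \<in> A" "\<beta> \<in> B" for \<alpha> \<beta>
    using arg_cong[OF com[OF that], of to_ac] by (simp add: to_ac_sum)
  show False
    using intertwiner_common_eigenvalue[OF assms(1,2), of "\<lambda>\<alpha> \<beta>. to_ac (H \<alpha> \<beta>)" "\<lambda>\<alpha> \<beta>. to_ac (W \<alpha> \<beta>)" "\<lambda>\<alpha> \<beta>. to_ac (H \<alpha> \<beta>)", OF c assms(5,6) nz] assms(3)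
    unfolding eigenvalue_on_def by blast
qed

section \<open>Eigenvector systems\<close>

definition fam :: "nat \<Rightarrow> (nat \<Rightarrow> nat) \<Rightarrow> nat \<Rightarrow> arr \<Rightarrow> arr set" where
  "fam e m n \<alpha> = {\<beta> \<in> Z00 e m n. sim e m \<beta> \<alpha>}"

lemma sim_refl [simp]: "sim e m \<alpha> \<alpha>" by (simp add: sim_def)
lemma sim_sym: "sim e m \<alpha> \<beta> \<Longrightarrow> sim e m \<beta> \<alpha>" by (simp add: sim_def)
lemma fam_families: "\<alpha> \<in> Z00 e m n \<Longrightarrow> fam e m n \<alpha> \<in> families e m n"
  by (auto simp: families_def fam_def quotient_def sim_def Image_def intro!: bexI[of _ \<alpha>])

lemma finite_fam [simp]: "finite (fam e m n \<alpha>)" by (simp add: fam_def)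

text \<open>Propagation of zeros in a solution \<open>W\<close> of the eigenvector equation, from larger to smaller
  families: each block solves a homogeneous Sylvester equation once the larger ones vanish.\<close>

lemma eigen_system_zero:
  assumes conj: "\<And>\<F> \<F>'. \<F> \<in> families e m n \<Longrightarrow> \<F>' \<in> families e m n \<Longrightarrow> \<F> \<noteq> \<F>' \<Longrightarrow>
      \<not> (\<exists>\<kappa>. eigenvalue_on \<F> h \<kappa> \<and> eigenvalue_on \<F>' h \<kappa>)"
    and tri: "\<And>\<alpha> \<beta>. \<alpha> \<in> Z00 e m n \<Longrightarrow> \<beta> \<in> Z00 e m n \<Longrightarrow> h \<alpha> \<beta> \<noteq> 0 \<Longrightarrow> sim e m \<beta> \<alpha> \<or> below e m \<beta> \<alpha>"
    and eig: "\<And>\<alpha> \<beta>. \<alpha> \<in> Z00 e m n \<Longrightarrow> \<beta> \<in> Z00 e m n \<Longrightarrow>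
      (\<Sum>\<gamma>\<in>Z00 e m n. W \<alpha> \<gamma> * h \<gamma> \<beta>) = (\<Sum>\<gamma>\<in>fam e m n \<alpha>. h \<alpha> \<gamma> * W \<gamma> \<beta>)"
    and closed: "\<And>\<alpha> \<beta> \<gamma>. S \<alpha> \<beta> \<Longrightarrow> below e m \<beta> \<gamma> \<Longrightarrow> S \<alpha> \<gamma>"
    and sat: "\<And>\<alpha> \<alpha>' \<beta> \<beta>'. S \<alpha> \<beta> \<Longrightarrow> sim e m \<alpha>' \<alpha> \<Longrightarrow> sim e m \<beta>' \<beta> \<Longrightarrow> S \<alpha>' \<beta>'"
    and diag: "\<And>\<alpha> \<beta>. \<alpha> \<in> Z00 e m n \<Longrightarrow> \<beta> \<in> Z00 e m n \<Longrightarrow> S \<alpha> \<beta> \<Longrightarrow> sim e m \<beta> \<alpha> \<Longrightarrow> W \<alpha> \<beta> = 0"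
    and "\<alpha> \<in> Z00 e m n" "\<beta> \<in> Z00 e m n" "S \<alpha> \<beta>"
  shows "W \<alpha> \<beta> = 0"
proof -
  let ?Z = "Z00 e m n" and ?fam = "fam e m n"
  let ?R = "{(\<beta>, \<alpha>). \<alpha> \<in> ?Z \<and> \<beta> \<in> ?Z \<and> below e m \<beta> \<alpha>}"
  have "wf (?R\<inverse>)"
  proof (rule finite_acyclic_wf_converse)
    show "finite ?R" by (rule finite_subset[of _ "?Z \<times> ?Z"]) auto
    show "acyclic ?R" by (rule wf_acyclic[OF finite_wf_below[OF finite_Z00]])
  qed
  then show ?thesis using assms(7-)
  proof (induction \<beta> arbitrary: \<alpha> rule: wf_induct_rule)
    case (less \<beta>)
    show ?case
    proof (cases "sim e m \<beta> \<alpha>")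
      case True
      then show ?thesis by (rule diag[OF less.prems])
    next
      case False
      have ne: "?fam \<alpha> \<noteq> ?fam \<beta>"
      proof
        assume "?fam \<alpha> = ?fam \<beta>"
        moreover have "\<beta> \<in> ?fam \<beta>" using less.prems(2) by (simp add: fam_def)
        ultimately have "\<beta> \<in> ?fam \<alpha>" by simp
        then show False using False by (simp add: fam_def)
      qed
      show ?thesis
      proof (rule sylvester_zero[OF finite_fam finite_fam conj[OF fam_families[OF less.prems(1)] fam_families[OF less.prems(2)] ne]])
        fix \<alpha>' \<beta>' assume \<alpha>': "\<alpha>' \<in> ?fam \<alpha>" and \<beta>': "\<beta>' \<in> ?fam \<beta>"
        have z: "\<alpha>' \<in> ?Z" "\<beta>' \<in> ?Z" and sm: "sim e m \<alpha>' \<alpha>" "sim e m \<beta>' \<beta>" using \<alpha>' \<beta>' by (auto simp: fam_def)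
        have f: "?fam \<alpha>' = ?fam \<alpha>" using sm(1) by (auto simp: fam_def sim_def)
        have S': "S \<alpha>' \<beta>'" by (rule sat[OF less.prems(3) sm])
        have "W \<alpha>' \<gamma> * h \<gamma> \<beta>' = 0" if \<gamma>: "\<gamma> \<in> ?Z" "\<gamma> \<notin> ?fam \<beta>" for \<gamma>
        proof (rule ccontr)
          assume *: "W \<alpha>' \<gamma> * h \<gamma> \<beta>' \<noteq> 0"
          then have "sim e m \<beta>' \<gamma> \<or> below e m \<beta>' \<gamma>" using tri[OF \<gamma>(1) z(2)] by simp
          moreover have "\<not> sim e m \<beta>' \<gamma>" using \<gamma> sm(2) by (auto simp: fam_def sim_def)
          ultimately have b: "below e m \<beta>' \<gamma>" by simp
          then have b2: "below e m \<beta> \<gamma>" using below_sim_left[OF sm(2)] by simp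
          have "S \<alpha>' \<gamma>" by (rule closed[OF S' b])
          then have "W \<alpha>' \<gamma> = 0" using less.IH[of \<gamma> \<alpha>'] b2 less.prems(2) \<gamma>(1) z(1) by simp
          then show False using * by simp
        qed
        then have "(\<Sum>\<gamma>\<in>?Z. W \<alpha>' \<gamma> * h \<gamma> \<beta>') = (\<Sum>\<gamma>\<in>?fam \<beta>. W \<alpha>' \<gamma> * h \<gamma> \<beta>')"
          by (intro sum.mono_neutral_right) (auto simp: fam_def)
        then show "(\<Sum>\<gamma>\<in>?fam \<alpha>. h \<alpha>' \<gamma> * W \<gamma> \<beta>') = (\<Sum>\<gamma>\<in>?fam \<beta>. W \<alpha>' \<gamma> * h \<gamma> \<beta>')"
          using eig[OF z] f by simp
      qed (use less.prems in \<open>simp_all add: fam_def\<close>)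
    qed
  qed
qed

text \<open>The indices that may occur in the Macdonald function of \<open>\<alpha>\<close> besides \<open>\<alpha>\<close>. Since families are
  intervals, these sets are unions of families, closed downwards, and the same for all members of
  a family.\<close>

definition lower :: "nat \<Rightarrow> (nat \<Rightarrow> nat) \<Rightarrow> nat \<Rightarrow> (arr \<times> arr) set \<Rightarrow> arr \<Rightarrow> arr set" where
  "lower e m n r \<alpha> = {\<beta> \<in> Z00 e m n. (\<beta>, \<alpha>) \<in> r \<and> \<not> sim e m \<beta> \<alpha>}"

context
  fixes e :: nat and m :: "nat \<Rightarrow> nat" and n :: nat and r :: "(arr \<times> arr) set"
  assumes order: "admissible_order e m n r"
begin

lemma order_Z: "(\<alpha>, \<beta>) \<in> r \<Longrightarrow> \<alpha> \<in> Z00 e m n \<and> \<beta> \<in> Z00 e m n"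
  using order by (auto simp: admissible_order_def)

lemma order_trans: "(\<alpha>, \<beta>) \<in> r \<Longrightarrow> (\<beta>, \<gamma>) \<in> r \<Longrightarrow> (\<alpha>, \<gamma>) \<in> r"
  using order unfolding admissible_order_def strict_linear_order_on_def by (meson transD)

lemma order_irrefl: "(\<alpha>, \<alpha>) \<notin> r"
  using order unfolding admissible_order_def strict_linear_order_on_def irrefl_def by blast

lemma order_total: "\<alpha> \<in> Z00 e m n \<Longrightarrow> \<beta> \<in> Z00 e m n \<Longrightarrow> \<alpha> = \<beta> \<or> (\<alpha>, \<beta>) \<in> r \<or> (\<beta>, \<alpha>) \<in> r"
proof -
  have "total_on (Z00 e m n) r" using order by (simp add: admissible_order_def strict_linear_order_on_def)
  then show "\<alpha> \<in> Z00 e m n \<Longrightarrow> \<beta> \<in> Z00 e m n \<Longrightarrow> \<alpha> = \<beta> \<or> (\<alpha>, \<beta>) \<in> r \<or> (\<beta>, \<alpha>) \<in> r"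
    unfolding total_on_def by blast
qed

lemma order_below: "\<alpha> \<in> Z00 e m n \<Longrightarrow> \<beta> \<in> Z00 e m n \<Longrightarrow> below e m \<beta> \<alpha> \<Longrightarrow> (\<beta>, \<alpha>) \<in> r"
  using order unfolding admissible_order_def by blast

lemma order_interval:
  assumes "(\<alpha>, \<beta>) \<in> r" "(\<beta>, \<gamma>) \<in> r" "sim e m \<alpha> \<gamma>" shows "sim e m \<beta> \<alpha>"
proof -
  have z: "\<alpha> \<in> Z00 e m n" "\<gamma> \<in> Z00 e m n" using assms order_Z by auto
  have "\<alpha> \<in> fam e m n \<alpha>" "\<gamma> \<in> fam e m n \<alpha>" using z assms(3) by (auto simp: fam_def sim_def)
  moreover have "\<forall>\<F>\<in>families e m n. \<forall>\<alpha>\<in>\<F>. \<forall>\<gamma>\<in>\<F>. \<forall>\<beta>. (\<alpha>, \<beta>) \<in> r \<and> (\<beta>, \<gamma>) \<in> r \<longrightarrow> \<beta> \<in> \<F>"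
    using order unfolding admissible_order_def by (elim conjE)
  then have "\<forall>\<alpha>'\<in>fam e m n \<alpha>. \<forall>\<gamma>\<in>fam e m n \<alpha>. \<forall>\<beta>. (\<alpha>', \<beta>) \<in> r \<and> (\<beta>, \<gamma>) \<in> r \<longrightarrow> \<beta> \<in> fam e m n \<alpha>"
    using fam_families[OF z(1)] by (rule bspec)
  ultimately have "\<beta> \<in> fam e m n \<alpha>" using assms(1,2) by blast
  then show ?thesis by (simp add: fam_def)
qed

lemma lower_sim:
  assumes "\<gamma> \<in> lower e m n r \<alpha>" "\<alpha> \<in> Z00 e m n" "\<beta> \<in> Z00 e m n" "sim e m \<beta> \<gamma>" shows "\<beta> \<in> lower e m n r \<alpha>"
proof -
  have g: "(\<gamma>, \<alpha>) \<in> r" "\<not> sim e m \<gamma> \<alpha>" using assms(1) by (auto simp: lower_def)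
  have ns: "\<not> sim e m \<beta> \<alpha>" using g(2) assms(4) by (auto simp: sim_def)
  then have "\<beta> \<noteq> \<alpha>" by auto
  moreover have "(\<alpha>, \<beta>) \<notin> r" using order_interval[OF g(1), of \<beta>] assms(4) g(2) by (auto simp: sim_def)
  ultimately have "(\<beta>, \<alpha>) \<in> r" using order_total[OF assms(3,2)] by blast
  then show ?thesis using ns assms(3) by (simp add: lower_def)
qed

lemma lower_less:
  assumes "\<gamma> \<in> lower e m n r \<alpha>" "(\<beta>, \<gamma>) \<in> r" shows "\<beta> \<in> lower e m n r \<alpha>"
proof -
  have g: "(\<gamma>, \<alpha>) \<in> r" "\<not> sim e m \<gamma> \<alpha>" using assms(1) by (auto simp: lower_def)
  have "(\<beta>, \<alpha>) \<in> r" by (rule order_trans[OF assms(2) g(1)])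
  moreover have "\<not> sim e m \<beta> \<alpha>"
    using order_interval[OF assms(2) g(1)] g(2) by (auto simp: sim_def)
  ultimately show ?thesis using order_Z[OF assms(2)] by (simp add: lower_def)
qed

lemma lower_cong:
  assumes "\<alpha> \<in> Z00 e m n" "\<alpha>' \<in> Z00 e m n" "sim e m \<alpha>' \<alpha>" shows "lower e m n r \<alpha>' = lower e m n r \<alpha>"
proof -
  have *: "lower e m n r \<alpha>' \<subseteq> lower e m n r \<alpha>" if z: "\<alpha> \<in> Z00 e m n" "\<alpha>' \<in> Z00 e m n" and s: "sim e m \<alpha>' \<alpha>" for \<alpha> \<alpha>'
  proof
    fix \<beta> assume "\<beta> \<in> lower e m n r \<alpha>'"
    then have b: "\<beta> \<in> Z00 e m n" "(\<beta>, \<alpha>') \<in> r" "\<not> sim e m \<beta> \<alpha>'" by (auto simp: lower_def)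
    then have ns: "\<not> sim e m \<beta> \<alpha>" using s by (simp add: sim_def)
    then have "\<beta> \<noteq> \<alpha>" by auto
    moreover have "(\<alpha>, \<beta>) \<notin> r" using order_interval[OF _ b(2), of \<alpha>] s ns by (auto simp: sim_def)
    ultimately have "(\<beta>, \<alpha>) \<in> r" using order_total[OF b(1) z(1)] by blast
    then show "\<beta> \<in> lower e m n r \<alpha>" using b ns by (simp add: lower_def)
  qed
  from *[OF assms] *[OF assms(2,1) sim_sym[OF assms(3)]] show ?thesis by blast
qed

lemma below_lower: "\<alpha> \<in> Z00 e m n \<Longrightarrow> \<beta> \<in> Z00 e m n \<Longrightarrow> below e m \<beta> \<alpha> \<Longrightarrow> \<beta> \<in> lower e m n r \<alpha>"
  using order_below[of \<alpha> \<beta>] below_sim[of e m \<beta> \<alpha>] by (simp add: lower_def)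

lemma lower_Z: "\<beta> \<in> lower e m n r \<alpha> \<Longrightarrow> \<beta> \<in> Z00 e m n"
  by (simp add: lower_def)

lemma finite_lower [simp]: "finite (lower e m n r \<alpha>)"
  by (simp add: lower_def)

lemma wf_order: "wf r"
proof (rule finite_acyclic_wf)
  show "finite r" by (rule finite_subset[of _ "Z00 e m n \<times> Z00 e m n"]) (use order_Z in auto)
  have "trans r" by (rule transI) (rule order_trans)
  then show "acyclic r" by (simp add: acyclic_def order_irrefl)
qed

text \<open>Induction along the order: by unitriangularity, the monomial function of \<open>\<nu>\<close> is a combination of
  \<open>P\<^sub>\<nu>\<close> and earlier monomial functions.\<close>

lemma functional_zero:
  fixes \<phi> :: "mpol \<Rightarrow> fld" and mo P :: "arr \<Rightarrow> mpol"
  assumes add: "\<And>f g. \<phi> (f + g) = \<phi> f + \<phi> g" and sc: "\<And>c f. \<phi> (Const c * f) = \<tau> c * \<phi> f"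
    and P: "\<And>\<beta>. \<beta> \<in> Z00 e m n \<Longrightarrow> P \<beta> = mo \<beta> + (\<Sum>\<gamma>\<in>lower e m n r \<beta>. Const (u \<beta> \<gamma>) * mo \<gamma>)"
    and D: "D \<subseteq> Z00 e m n" "\<And>\<beta> \<gamma>. \<beta> \<in> D \<Longrightarrow> \<gamma> \<in> lower e m n r \<beta> \<Longrightarrow> \<gamma> \<in> D"
    and z: "\<And>\<beta>. \<beta> \<in> D \<Longrightarrow> \<phi> (P \<beta>) = 0"
    and "\<nu> \<in> D"
  shows "\<phi> (mo \<nu>) = 0"
  using wf_order \<open>\<nu> \<in> D\<close>
proof (induction \<nu> rule: wf_induct_rule)
  case (less \<nu>)
  have "\<phi> 0 = 0" using add[of 0 0] by simp
  then have sum: "\<phi> (sum f A) = (\<Sum>a\<in>A. \<phi> (f a))" for f :: "arr \<Rightarrow> mpol" and A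
    by (induction A rule: infinite_finite_induct) (simp_all add: add)
  have "\<phi> (mo \<gamma>) = 0" if "\<gamma> \<in> lower e m n r \<nu>" for \<gamma>
    using less.IH[of \<gamma>] that D(2)[OF less.prems that] by (simp add: lower_def)
  then have "\<phi> (\<Sum>\<gamma>\<in>lower e m n r \<nu>. Const (u \<nu> \<gamma>) * mo \<gamma>) = 0" by (simp add: sum sc)
  then show ?case using z[OF less.prems] P[of \<nu>] D(1) less.prems add[of "mo \<nu>"] by auto
qed

text \<open>The key step: applying the operator to a member of an orthogonal system gives a combination
  of the members of the same family. The difference \<open>R\<close> of the two sides lies in the span of the
  strictly lower families, and is orthogonal to all members of the dual system.\<close>

lemma orthogonal_eigen:
  fixes S :: "mpol \<Rightarrow> mpol \<Rightarrow> fld" and mo P P' :: "arr \<Rightarrow> mpol"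
  assumes S: "\<And>f f' g. S (f + f') g = S f g + S f' g" "\<And>c f g. S (Const c * f) g = \<tau> c * S f g"
      "\<And>f g g'. S f (g + g') = S f g + S f g'" "\<And>c f g. S f (Const c * g) = \<tau>' c * S f g"
    and P: "\<And>\<beta>. \<beta> \<in> Z00 e m n \<Longrightarrow> P \<beta> = mo \<beta> + (\<Sum>\<gamma>\<in>lower e m n r \<beta>. Const (u \<beta> \<gamma>) * mo \<gamma>)"
      "\<And>\<beta>. \<beta> \<in> Z00 e m n \<Longrightarrow> P' \<beta> = mo \<beta> + (\<Sum>\<gamma>\<in>lower e m n r \<beta>. Const (u' \<beta> \<gamma>) * mo \<gamma>)"
    and tri: "\<And>\<alpha> \<beta>. \<alpha> \<in> Z00 e m n \<Longrightarrow> \<beta> \<in> Z00 e m n \<Longrightarrow> h \<alpha> \<beta> \<noteq> 0 \<Longrightarrow> sim e m \<beta> \<alpha> \<or> below e m \<beta> \<alpha>"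
      "\<And>\<alpha> \<beta>. \<alpha> \<in> Z00 e m n \<Longrightarrow> \<beta> \<in> Z00 e m n \<Longrightarrow> h' \<alpha> \<beta> \<noteq> 0 \<Longrightarrow> sim e m \<beta> \<alpha> \<or> below e m \<beta> \<alpha>"
    and E: "\<And>\<alpha>. \<alpha> \<in> Z00 e m n \<Longrightarrow> E (P \<alpha>) = (\<Sum>\<beta>\<in>Z00 e m n. Const (h \<alpha> \<beta>) * mo \<beta>) + (\<Sum>\<gamma>\<in>lower e m n r \<alpha>. Const (u \<alpha> \<gamma>) * (\<Sum>\<beta>\<in>Z00 e m n. Const (h \<gamma> \<beta>) * mo \<beta>))"
      "\<And>\<alpha>. \<alpha> \<in> Z00 e m n \<Longrightarrow> E' (P' \<alpha>) = (\<Sum>\<beta>\<in>Z00 e m n. Const (h' \<alpha> \<beta>) * mo \<beta>) + (\<Sum>\<gamma>\<in>lower e m n r \<alpha>. Const (u' \<alpha> \<gamma>) * (\<Sum>\<beta>\<in>Z00 e m n. Const (h' \<gamma> \<beta>) * mo \<beta>))"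
    and adj: "\<And>\<alpha> \<gamma>. \<alpha> \<in> Z00 e m n \<Longrightarrow> \<gamma> \<in> Z00 e m n \<Longrightarrow> S (E (P \<alpha>)) (P' \<gamma>) = S (P \<alpha>) (E' (P' \<gamma>)) + \<kappa> * S (P \<alpha>) (P' \<gamma>)"
    and orth: "\<And>\<alpha> \<gamma>. \<alpha> \<in> Z00 e m n \<Longrightarrow> \<gamma> \<in> Z00 e m n \<Longrightarrow> \<not> sim e m \<alpha> \<gamma> \<Longrightarrow> S (P \<alpha>) (P' \<gamma>) = 0"
    and nondeg: "\<And>a. (\<And>\<nu>. \<nu> \<in> Z00 e m n \<Longrightarrow> S (\<Sum>\<beta>\<in>Z00 e m n. Const (a \<beta>) * mo \<beta>) (mo \<nu>) = 0) \<Longrightarrow> (\<Sum>\<beta>\<in>Z00 e m n. Const (a \<beta>) * mo \<beta>) = 0"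
    and \<alpha>: "\<alpha> \<in> Z00 e m n"
  shows "E (P \<alpha>) = (\<Sum>\<beta>\<in>fam e m n \<alpha>. Const (h \<alpha> \<beta>) * P \<beta>)"
proof -
  let ?Z = "Z00 e m n" and ?D = "lower e m n r"
  have S0: "S 0 g = 0" "S f 0 = 0" for f g using S(1)[of 0 0 g] S(3)[of f 0 0] by simp_all
  have Ssum: "S (sum f A) g = (\<Sum>a\<in>A. S (f a) g)" "S g (sum f A) = (\<Sum>a\<in>A. S g (f a))"
    for f :: "arr \<Rightarrow> mpol" and A g
    by (induction A rule: infinite_finite_induct) (simp_all add: S S0)
  have sub: "?D \<beta> \<subseteq> ?Z" for \<beta> by (auto simp: lower_def)
  have coords: "(\<Sum>\<beta>\<in>?Z. Const (h \<alpha> \<beta>) * mo \<beta>) + (\<Sum>\<gamma>\<in>?D \<alpha>. Const (u \<alpha> \<gamma>) * (\<Sum>\<beta>\<in>?Z. Const (h \<gamma> \<beta>) * mo \<beta>))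
      = (\<Sum>\<beta>\<in>?Z. Const (h \<alpha> \<beta> + (\<Sum>\<gamma>\<in>?D \<alpha>. u \<alpha> \<gamma> * h \<gamma> \<beta>)) * mo \<beta>)" for h u :: "arr \<Rightarrow> arr \<Rightarrow> fld" and \<alpha>
  proof -
    have "(\<Sum>\<gamma>\<in>?D \<alpha>. Const (u \<alpha> \<gamma>) * (\<Sum>\<beta>\<in>?Z. Const (h \<gamma> \<beta>) * mo \<beta>)) = (\<Sum>\<beta>\<in>?Z. Const (\<Sum>\<gamma>\<in>?D \<alpha>. u \<alpha> \<gamma> * h \<gamma> \<beta>) * mo \<beta>)"
      unfolding sum_distrib_left Const_sum sum_distrib_right by (subst sum.swap) (simp only: Const_mult mult.assoc)
    then show ?thesis by (simp add: Const_add distrib_right sum.distrib)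
  qed
  have img: "h \<alpha> \<beta> + (\<Sum>\<gamma>\<in>?D \<alpha>. u \<alpha> \<gamma> * h \<gamma> \<beta>) = (if sim e m \<beta> \<alpha> then h \<alpha> \<beta> else 0)"
    if tri: "\<And>\<alpha> \<beta>. \<alpha> \<in> ?Z \<Longrightarrow> \<beta> \<in> ?Z \<Longrightarrow> h \<alpha> \<beta> \<noteq> 0 \<Longrightarrow> sim e m \<beta> \<alpha> \<or> below e m \<beta> \<alpha>"
      and z: "\<alpha> \<in> ?Z" "\<beta> \<in> ?Z" "\<beta> \<notin> ?D \<alpha>" for h u :: "arr \<Rightarrow> arr \<Rightarrow> fld" and \<alpha> \<beta>
  proof -
    have zero: "u \<alpha> \<gamma> * h \<gamma> \<beta> = 0" if g: "\<gamma> \<in> ?D \<alpha>" for \<gamma>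
    proof (rule ccontr)
      assume "u \<alpha> \<gamma> * h \<gamma> \<beta> \<noteq> 0"
      then have "sim e m \<beta> \<gamma> \<or> below e m \<beta> \<gamma>" using tri[of \<gamma> \<beta>] g sub z(2) by auto
      then show False
        using lower_sim[OF g z(1,2)] lower_less[OF g] order_below[of \<gamma> \<beta>] g sub z(2,3) by blast
    qed
    have "(\<Sum>\<gamma>\<in>?D \<alpha>. u \<alpha> \<gamma> * h \<gamma> \<beta>) = 0" by (rule sum.neutral) (use zero in blast)
    moreover have "h \<alpha> \<beta> = 0" if "\<not> sim e m \<beta> \<alpha>" using tri[OF z(1,2)] that below_lower[OF z(1,2)] z(3) by blast
    ultimately show ?thesis by simp
  qed
  have Dclosed: "\<gamma>' \<in> ?D \<alpha>" if "\<gamma> \<in> ?D \<alpha>" "\<gamma>' \<in> ?D \<gamma>" for \<gamma> \<gamma>'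
    using that lower_less[of \<gamma> \<alpha> \<gamma>'] by (auto simp: lower_def)
  define x where "x = (\<lambda>\<beta>. h \<alpha> \<beta> + (\<Sum>\<gamma>\<in>?D \<alpha>. u \<alpha> \<gamma> * h \<gamma> \<beta>))"
  have Ex: "E (P \<alpha>) = (\<Sum>\<beta>\<in>?Z. Const (x \<beta>) * mo \<beta>)" unfolding E(1)[OF \<alpha>] coords x_def ..
  define R where "R = E (P \<alpha>) - (\<Sum>\<beta>\<in>fam e m n \<alpha>. Const (h \<alpha> \<beta>) * P \<beta>)"
  define \<rho> where "\<rho> = (\<lambda>\<beta>. x \<beta> - (\<Sum>\<beta>'\<in>fam e m n \<alpha>. h \<alpha> \<beta>' * u \<beta>' \<beta>))"
  have famsub: "fam e m n \<alpha> \<subseteq> ?Z - ?D \<alpha>" by (auto simp: fam_def lower_def)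
  have R: "R = (\<Sum>\<beta>\<in>?D \<alpha>. Const (\<rho> \<beta>) * mo \<beta>)"
  proof -
    have "E (P \<alpha>) = (\<Sum>\<beta>\<in>?D \<alpha>. Const (x \<beta>) * mo \<beta>) + (\<Sum>\<beta>\<in>?Z - ?D \<alpha>. Const (x \<beta>) * mo \<beta>)"
      unfolding Ex by (rule sum.subset_diff[of "?D \<alpha>", THEN trans]) (use sub in \<open>auto simp: add.commute\<close>)
    also have "(\<Sum>\<beta>\<in>?Z - ?D \<alpha>. Const (x \<beta>) * mo \<beta>) = (\<Sum>\<beta>\<in>fam e m n \<alpha>. Const (x \<beta>) * mo \<beta>)"
    proof (rule sum.mono_neutral_right)
      show "\<forall>\<beta>\<in>?Z - ?D \<alpha> - fam e m n \<alpha>. Const (x \<beta>) * mo \<beta> = 0"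
        using img[OF tri(1) \<alpha>] by (auto simp: x_def fam_def)
    qed (use famsub in auto)
    also have "\<dots> = (\<Sum>\<beta>\<in>fam e m n \<alpha>. Const (h \<alpha> \<beta>) * mo \<beta>)"
      by (intro sum.cong refl) (use img[OF tri(1) \<alpha>] famsub in \<open>auto simp: x_def fam_def\<close>)
    finally have 1: "E (P \<alpha>) = (\<Sum>\<beta>\<in>?D \<alpha>. Const (x \<beta>) * mo \<beta>) + (\<Sum>\<beta>\<in>fam e m n \<alpha>. Const (h \<alpha> \<beta>) * mo \<beta>)" .
    have "(\<Sum>\<beta>'\<in>fam e m n \<alpha>. Const (h \<alpha> \<beta>') * P \<beta>') = (\<Sum>\<beta>'\<in>fam e m n \<alpha>. Const (h \<alpha> \<beta>') * mo \<beta>' + (\<Sum>\<beta>\<in>?D \<alpha>. Const (h \<alpha> \<beta>' * u \<beta>' \<beta>) * mo \<beta>))"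
    proof (rule sum.cong[OF refl])
      fix \<beta>' assume "\<beta>' \<in> fam e m n \<alpha>"
      then have b: "\<beta>' \<in> ?Z" "sim e m \<beta>' \<alpha>" by (auto simp: fam_def)
      show "Const (h \<alpha> \<beta>') * P \<beta>' = Const (h \<alpha> \<beta>') * mo \<beta>' + (\<Sum>\<beta>\<in>?D \<alpha>. Const (h \<alpha> \<beta>' * u \<beta>' \<beta>) * mo \<beta>)"
        unfolding P(1)[OF b(1)] lower_cong[OF \<alpha> b] by (simp only: distrib_left sum_distrib_left Const_mult mult.assoc)
    qed
    also have "\<dots> = (\<Sum>\<beta>\<in>fam e m n \<alpha>. Const (h \<alpha> \<beta>) * mo \<beta>) + (\<Sum>\<beta>\<in>?D \<alpha>. Const (\<Sum>\<beta>'\<in>fam e m n \<alpha>. h \<alpha> \<beta>' * u \<beta>' \<beta>) * mo \<beta>)"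
      unfolding sum.distrib Const_sum sum_distrib_right by (subst (2) sum.swap) simp
    finally have 2: "(\<Sum>\<beta>'\<in>fam e m n \<alpha>. Const (h \<alpha> \<beta>') * P \<beta>') = \<dots>" .
    show ?thesis unfolding R_def 1 2 \<rho>_def by (simp add: Const_diff left_diff_distrib sum_subtractf)
  qed
  have orthP: "S R (P' \<gamma>) = 0" if \<gamma>: "\<gamma> \<in> ?Z" for \<gamma>
  proof (cases "\<gamma> \<in> ?D \<alpha>")
    case True
    then have ns: "\<not> sim e m \<gamma> \<alpha>" by (simp add: lower_def)
    \<comment> \<open>the image of \<open>P'\<close> stays in the lower set, which is orthogonal to \<open>P \<alpha>\<close>\<close>
    have mo0: "S (P \<alpha>) (mo \<nu>) = 0" if "\<nu> \<in> ?D \<alpha>" for \<nu>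
    proof (rule functional_zero[where \<phi> = "S (P \<alpha>)" and P = P' and D = "?D \<alpha>" and u = u' and mo = mo and \<tau> = \<tau>'])
      show "S (P \<alpha>) (P' \<beta>) = 0" if "\<beta> \<in> ?D \<alpha>" for \<beta>
        using orth[OF \<alpha>, of \<beta>] that by (auto simp: lower_def sim_def)
    qed (use S P(2) sub Dclosed that in auto)
    define y where "y = (\<lambda>\<beta>. h' \<gamma> \<beta> + (\<Sum>\<gamma>'\<in>?D \<gamma>. u' \<gamma> \<gamma>' * h' \<gamma>' \<beta>))"
    have y: "y \<beta> = 0" if b: "\<beta> \<in> ?Z" "\<beta> \<notin> ?D \<alpha>" for \<beta>
    proof -
      have "\<beta> \<notin> ?D \<gamma>" using Dclosed[OF True] b(2) by blast
      moreover have "\<not> sim e m \<beta> \<gamma>" using lower_sim[OF True \<alpha> b(1)] b(2) by blast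
      ultimately show ?thesis unfolding y_def using img[OF tri(2) \<gamma> b(1)] by simp
    qed
    have "S (P \<alpha>) (E' (P' \<gamma>)) = (\<Sum>\<beta>\<in>?Z. \<tau>' (y \<beta>) * S (P \<alpha>) (mo \<beta>))"
      by (simp only: E(2)[OF \<gamma>] coords Ssum S(4) y_def)
    also have "\<dots> = 0"
    proof (rule sum.neutral, rule ballI)
      fix \<beta> assume b: "\<beta> \<in> ?Z"
      show "\<tau>' (y \<beta>) * S (P \<alpha>) (mo \<beta>) = 0"
      proof (cases "\<beta> \<in> ?D \<alpha>")
        case False
        then have "S (P \<alpha>) (Const (y \<beta>) * mo \<beta>) = 0" using y[OF b False] S0 by simp
        then show ?thesis by (simp add: S(4))
      qed (simp add: mo0)
    qed
    finally have "S (E (P \<alpha>)) (P' \<gamma>) = 0"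
      using adj[OF \<alpha> \<gamma>] orth[OF \<alpha> \<gamma>] ns by (auto simp: sim_def)
    moreover have "S (\<Sum>\<beta>\<in>fam e m n \<alpha>. Const (h \<alpha> \<beta>) * P \<beta>) (P' \<gamma>) = 0"
      unfolding Ssum S(2)
    proof (rule sum.neutral, rule ballI)
      fix \<beta> assume "\<beta> \<in> fam e m n \<alpha>"
      then have "S (P \<beta>) (P' \<gamma>) = 0" using orth[OF _ \<gamma>, of \<beta>] ns by (auto simp: fam_def sim_def)
      then show "\<tau> (h \<alpha> \<beta>) * S (P \<beta>) (P' \<gamma>) = 0" by simp
    qed
    moreover have "S (E (P \<alpha>)) (P' \<gamma>) = S R (P' \<gamma>) + S (\<Sum>\<beta>\<in>fam e m n \<alpha>. Const (h \<alpha> \<beta>) * P \<beta>) (P' \<gamma>)"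
      unfolding S(1)[symmetric] by (simp add: R_def)
    ultimately show ?thesis by simp
  next
    case False
    have "S (mo \<nu>) (P' \<gamma>) = 0" if "\<nu> \<in> ?D \<alpha>" for \<nu>
    proof (rule functional_zero[where \<phi> = "\<lambda>f. S f (P' \<gamma>)" and P = P and D = "?D \<alpha>" and u = u and mo = mo and \<tau> = \<tau>])
      show "S (P \<beta>) (P' \<gamma>) = 0" if b: "\<beta> \<in> ?D \<alpha>" for \<beta>
      proof -
        have "\<not> sim e m \<beta> \<gamma>" using lower_sim[OF b \<alpha> \<gamma>] False by (auto simp: sim_def)
        then show ?thesis using orth[OF _ \<gamma>, of \<beta>] b by (simp add: lower_def)
      qed
    qed (use S P(1) sub Dclosed that in auto)
    then show ?thesis unfolding R Ssum S(2) by simp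
  qed
  have "S R (mo \<nu>) = 0" if "\<nu> \<in> ?Z" for \<nu>
    by (rule functional_zero[where \<phi> = "S R" and P = P' and D = ?Z and u = u' and mo = mo and \<tau> = \<tau>'])
       (use S P(2) lower_Z orthP that in auto)
  moreover have Rz: "R = (\<Sum>\<beta>\<in>?Z. Const (if \<beta> \<in> ?D \<alpha> then \<rho> \<beta> else 0) * mo \<beta>)"
    unfolding R by (rule sum.mono_neutral_cong_left) (use sub in auto)
  ultimately have "R = 0" using nondeg[of "\<lambda>\<beta>. if \<beta> \<in> ?D \<alpha> then \<rho> \<beta> else 0"] by simp
  then show ?thesis by (simp add: R_def)
qed

end

section \<open>The characterization\<close>

text \<open>The data of the theorem at the level where all \<open>e\<close>-partitions of \<open>n\<close> are visible.\<close>

context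
  fixes e n L :: nat and m :: "nat \<Rightarrow> nat" and \<zeta> :: complex
    and c :: "nat \<Rightarrow> fld" and h :: "pm \<Rightarrow> arr \<Rightarrow> arr \<Rightarrow> fld"
  assumes e_pos: "e \<ge> 1" and zeta: "primitive_root_of_unity e \<zeta>"
    and L_large: "\<forall>k<e. n \<le> shift m L k"
    and h_coeffs: "\<forall>s. \<forall>\<alpha>\<in>Z00 e (shift m L) n.
           E_lim e m c s (msym e m \<alpha>) = lincomb (Z00 e (shift m L) n) (h s \<alpha>) (msym e m)"
begin

abbreviation (input) "M \<equiv> shift m L"
abbreviation (input) "Z \<equiv> Z00 e M n"
abbreviation (input) "ad \<equiv> adelta e M"

lemma Z_epart: "\<alpha> \<in> Z \<Longrightarrow> \<alpha> \<in> epart e \<and> total \<alpha> = n \<and> fits e M \<alpha>"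
  by (simp add: Z00_def fits_def)

lemma msym_Z: "\<alpha> \<in> Z \<Longrightarrow> msym e m \<alpha> \<in> hom_Xi e m n"
  using msym_hom_Xi[of \<alpha> e m] Z_epart by auto

lemma msym_L: "\<alpha> \<in> Z \<Longrightarrow> msym e m \<alpha> L = monsym e M \<alpha>"
  using msym_mono[of \<alpha> e m L] Z_epart by auto

lemma hom_XiD:
  "f \<in> hom_Xi e m n \<Longrightarrow> symmetric_poly e (shift m l) (f l)"
  "f \<in> hom_Xi e m n \<Longrightarrow> supp_in (idx e (shift m l)) (f l)"
  "f \<in> hom_Xi e m n \<Longrightarrow> homog n (f l)"
  by (auto simp: hom_Xi_def Xi_fin_iff)

text \<open>The operators are linear, because the quotients that define them exist.\<close>

lemma E_lim_lincomb:
  assumes "finite A" "\<And>i. i \<in> A \<Longrightarrow> g i \<in> hom_Xi e m n"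
  shows "E_lim e m c s (lincomb A a g) = lincomb A a (\<lambda>i. E_lim e m c s (g i))"
proof
  fix l
  let ?M = "shift m l" and ?d = "adelta e (shift m l)"
  have e: "e > 0" using e_pos by simp
  have lin: "lincomb A a g \<in> hom_Xi e m n" by (rule hom_Xi_lincomb) (rule assms(2))
  define t where "t = Const (tF powi (- int (\<Sum>k<e. shift m l k)))"
  define u where "u = Const (c l - (\<Sum>i\<in>Iset e ?M. tF powi (int (pairing e (delta e ?M) i) - int (\<Sum>k<e. ?M k))))"
  have E: "E_level e m c s l f * ?d = t * Num e ?M qF s f + u * (f * ?d)"
    if "symmetric_poly e ?M f" "supp_in (idx e ?M) f" "homog n f" for f
    unfolding t_def u_def by (rule E_level_times_delta[OF e that])
  have "E_lim e m c s (lincomb A a g) l * ?d = lincomb A a (\<lambda>i. E_lim e m c s (g i)) l * ?d"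
  proof -
    have "E_lim e m c s (lincomb A a g) l * ?d = t * Num e ?M qF s (lincomb A a g l) + u * (lincomb A a g l * ?d)"
      unfolding E_lim_def by (rule E[OF hom_XiD[OF lin]])
    also have "\<dots> = (\<Sum>i\<in>A. Const (a i) * (t * Num e ?M qF s (g i l) + u * (g i l * ?d)))"
      unfolding lincomb_def Num_sum Num_Const
      by (simp only: sum_distrib_left sum_distrib_right sum.distrib distrib_left mult_ac)
    also have "\<dots> = (\<Sum>i\<in>A. Const (a i) * (E_level e m c s l (g i l) * ?d))"
      by (intro sum.cong refl) (simp only: E[OF hom_XiD[OF assms(2)]])
    finally show ?thesis by (simp only: lincomb_def E_lim_def sum_distrib_right mult.assoc)
  qed
  then show "E_lim e m c s (lincomb A a g) l = lincomb A a (\<lambda>i. E_lim e m c s (g i)) l"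
    using alt_delta_nonzero[of e ?M] by simp
qed

lemma E_msym_L:
  assumes "\<alpha> \<in> Z" shows "E_level e m c s L (monsym e M \<alpha>) = (\<Sum>\<beta>\<in>Z. Const (h s \<alpha> \<beta>) * monsym e M \<beta>)"
proof -
  have "E_lim e m c s (msym e m \<alpha>) L = lincomb Z (h s \<alpha>) (msym e m) L"
    using h_coeffs assms by simp
  then show ?thesis using assms by (simp add: E_lim_def lincomb_def msym_L)
qed

lemma h_triangular:
  assumes \<alpha>: "\<alpha> \<in> Z" and \<beta>: "\<beta> \<in> Z" and nz: "h s \<alpha> \<beta> \<noteq> 0"
  shows "sim e M \<beta> \<alpha> \<or> below e M \<beta> \<alpha>"
proof (cases "\<beta> = \<alpha>")
  case False
  have e: "e > 0" using e_pos by simp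
  define T where "T = tF powi (- int (\<Sum>k<e. M k))"
  define u where "u = c L - (\<Sum>i\<in>Iset e M. tF powi (int (pairing e (delta e M) i) - int (\<Sum>k<e. M k)))"
  have T: "T \<noteq> 0" by (simp add: T_def)
  have E: "E_level e m c s L (monsym e M \<alpha>) = Const T * Dop e M s (monsym e M \<alpha>) + Const u * monsym e M \<alpha>"
    by (simp add: E_level_def Eop_def Let_def T_def u_def Const_diff left_diff_distrib)
  define h' where "h' = (\<lambda>\<beta>. (h s \<alpha> \<beta> - (if \<beta> = \<alpha> then u else 0)) / T)"
  have "Const T * Dop e M s (monsym e M \<alpha>) = (\<Sum>\<beta>\<in>Z. Const (h s \<alpha> \<beta>) * monsym e M \<beta>) - Const u * monsym e M \<alpha>"
    using E E_msym_L[OF \<alpha>, of s] by simp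
  also have "Const u * monsym e M \<alpha> = (\<Sum>\<beta>\<in>Z. Const (if \<beta> = \<alpha> then u else 0) * monsym e M \<beta>)"
  proof -
    have "(\<Sum>\<beta>\<in>Z. Const (if \<beta> = \<alpha> then u else 0) * monsym e M \<beta>) = (\<Sum>\<beta>\<in>Z. if \<beta> = \<alpha> then Const u * monsym e M \<alpha> else 0)"
      by (intro sum.cong) auto
    then show ?thesis using \<alpha> by (simp add: sum.delta)
  qed
  finally have "Const T * Dop e M s (monsym e M \<alpha>) = (\<Sum>\<beta>\<in>Z. Const (h s \<alpha> \<beta> - (if \<beta> = \<alpha> then u else 0)) * monsym e M \<beta>)"
    by (simp only: sum_subtractf[symmetric] left_diff_distrib[symmetric] Const_diff[symmetric])
  then have 1: "Const (inverse T) * (Const T * Dop e M s (monsym e M \<alpha>)) = (\<Sum>\<beta>\<in>Z. Const (inverse T) * (Const (h s \<alpha> \<beta> - (if \<beta> = \<alpha> then u else 0)) * monsym e M \<beta>))"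
    by (simp only: sum_distrib_left)
  have 2: "Const (inverse T) * (Const T * Dop e M s (monsym e M \<alpha>)) = Dop e M s (monsym e M \<alpha>)"
    by (simp only: mult.assoc[symmetric] Const_mult[symmetric] left_inverse[OF T] Const_1 mult_1)
  have 3: "Const (inverse T) * (Const (h s \<alpha> \<beta> - (if \<beta> = \<alpha> then u else 0)) * monsym e M \<beta>) = Const (h' \<beta>) * monsym e M \<beta>" for \<beta>
    by (simp only: h'_def divide_inverse mult.assoc[symmetric] Const_mult[symmetric] mult.commute[of "inverse T"])
  have "Dop e M s (monsym e M \<alpha>) = (\<Sum>\<beta>\<in>Z. Const (h' \<beta>) * monsym e M \<beta>)"
    by (rule trans[OF trans[OF 2[symmetric] 1]]) (simp only: 3)
  from Dop_mono_triangular[OF e \<alpha> this \<beta>] show ?thesis using nz False T by (simp add: h'_def)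
qed simp

lemma lincomb_unique:
  assumes "lincomb Z a (msym e m) = lincomb Z b (msym e m)" "\<beta> \<in> Z" shows "a \<beta> = b \<beta>"
proof (rule mono_coeffs_unique[OF _ assms(2)])
  show "(\<Sum>\<beta>\<in>Z. Const (a \<beta>) * monsym e M \<beta>) = (\<Sum>\<beta>\<in>Z. Const (b \<beta>) * monsym e M \<beta>)"
    using fun_cong[OF assms(1), of L] by (simp add: lincomb_def msym_L)
qed

lemma lincomb_lincomb:
  assumes "finite A" "finite B"
  shows "lincomb A a (\<lambda>i. lincomb B (b i) g) = lincomb B (\<lambda>j. \<Sum>i\<in>A. a i * b i j) g"
proof
  fix l
  show "lincomb A a (\<lambda>i. lincomb B (b i) g) l = lincomb B (\<lambda>j. \<Sum>i\<in>A. a i * b i j) g l"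
    unfolding lincomb_def sum_distrib_left Const_sum sum_distrib_right
    by (subst sum.swap) (simp only: Const_mult mult.assoc)
qed

text \<open>In coordinates \<open>W\<close>, the two characterizing properties become unitriangularity and a matrix
  equation.\<close>

definition coords :: "(arr \<Rightarrow> symfun) \<Rightarrow> (arr \<Rightarrow> arr \<Rightarrow> fld) \<Rightarrow> bool" where
  "coords Q W \<longleftrightarrow> (\<forall>\<alpha>\<in>Z. Q (Lam e M \<alpha>) = lincomb Z (W \<alpha>) (msym e m))"

lemma coords_eigen:
  assumes W: "coords Q W" and eig: "\<forall>\<alpha>\<in>Z. E_lim e m c s (Q (Lam e M \<alpha>)) = lincomb (fam e M n \<alpha>) (h s \<alpha>) (\<lambda>\<beta>. Q (Lam e M \<beta>))"
    and \<alpha>: "\<alpha> \<in> Z" and \<beta>: "\<beta> \<in> Z"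
  shows "(\<Sum>\<gamma>\<in>Z. W \<alpha> \<gamma> * h s \<gamma> \<beta>) = (\<Sum>\<gamma>\<in>fam e M n \<alpha>. h s \<alpha> \<gamma> * W \<gamma> \<beta>)"
proof -
  have Q: "Q (Lam e M \<alpha>) = lincomb Z (W \<alpha>) (msym e m)" if "\<alpha> \<in> Z" for \<alpha> using W that by (simp add: coords_def)
  have "E_lim e m c s (Q (Lam e M \<alpha>)) = lincomb Z (W \<alpha>) (\<lambda>\<gamma>. E_lim e m c s (msym e m \<gamma>))"
    unfolding Q[OF \<alpha>] by (rule E_lim_lincomb) (simp_all add: msym_Z)
  also have "\<dots> = lincomb Z (W \<alpha>) (\<lambda>\<gamma>. lincomb Z (h s \<gamma>) (msym e m))"
    unfolding lincomb_def by (rule ext, intro sum.cong refl) (use h_coeffs in \<open>simp add: lincomb_def\<close>)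
  also have "\<dots> = lincomb Z (\<lambda>\<beta>. \<Sum>\<gamma>\<in>Z. W \<alpha> \<gamma> * h s \<gamma> \<beta>) (msym e m)"
    by (rule lincomb_lincomb) simp_all
  finally have 1: "E_lim e m c s (Q (Lam e M \<alpha>)) = lincomb Z (\<lambda>\<beta>. \<Sum>\<gamma>\<in>Z. W \<alpha> \<gamma> * h s \<gamma> \<beta>) (msym e m)" .
  have "lincomb (fam e M n \<alpha>) (h s \<alpha>) (\<lambda>\<beta>. Q (Lam e M \<beta>)) = lincomb (fam e M n \<alpha>) (h s \<alpha>) (\<lambda>\<gamma>. lincomb Z (W \<gamma>) (msym e m))"
    unfolding lincomb_def by (rule ext, intro sum.cong refl) (use Q in \<open>simp add: lincomb_def fam_def\<close>)
  also have "\<dots> = lincomb Z (\<lambda>\<beta>. \<Sum>\<gamma>\<in>fam e M n \<alpha>. h s \<alpha> \<gamma> * W \<gamma> \<beta>) (msym e m)"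
    by (rule lincomb_lincomb) simp_all
  finally have "lincomb Z (\<lambda>\<beta>. \<Sum>\<gamma>\<in>Z. W \<alpha> \<gamma> * h s \<gamma> \<beta>) (msym e m) = lincomb Z (\<lambda>\<beta>. \<Sum>\<gamma>\<in>fam e M n \<alpha>. h s \<alpha> \<gamma> * W \<gamma> \<beta>) (msym e m)"
    using 1 eig \<alpha> by simp
  from lincomb_unique[OF this \<beta>] show ?thesis .
qed

lemma lincomb_triangular:
  assumes "\<alpha> \<in> Z" "B \<subseteq> Z" "\<alpha> \<notin> B"
  shows "(\<lambda>l. msym e m \<alpha> l + lincomb B w (msym e m) l)
    = lincomb Z (\<lambda>\<beta>. if \<beta> = \<alpha> then 1 else if \<beta> \<in> B then w \<beta> else 0) (msym e m)" (is "_ = lincomb Z ?W _")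
proof
  fix l
  have "lincomb Z ?W (msym e m) l = lincomb (insert \<alpha> B) ?W (msym e m) l"
    unfolding lincomb_def by (rule sum.mono_neutral_right) (use assms in auto)
  also have "\<dots> = msym e m \<alpha> l + (\<Sum>\<beta>\<in>B. Const (?W \<beta>) * msym e m \<beta> l)"
    unfolding lincomb_def by (subst sum.insert) (use assms finite_subset[OF assms(2)] in auto)
  also have "(\<Sum>\<beta>\<in>B. Const (?W \<beta>) * msym e m \<beta> l) = lincomb B w (msym e m) l"
    unfolding lincomb_def by (intro sum.cong refl) (use assms in auto)
  finally show "msym e m \<alpha> l + lincomb B w (msym e m) l = lincomb Z ?W (msym e m) l" by simp
qed

lemma fam_eq: "fam e M n \<alpha> = {\<beta> \<in> Z. sim e M \<beta> \<alpha>}" by (simp add: fam_def)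

context
  assumes conj_A: "conjecture_A e M n h"
begin

lemma conj_A': "\<F> \<in> families e M n \<Longrightarrow> \<F>' \<in> families e M n \<Longrightarrow> \<F> \<noteq> \<F>' \<Longrightarrow>
      \<not> (\<exists>\<kappa>. eigenvalue_on \<F> (h s) \<kappa> \<and> eigenvalue_on \<F>' (h s) \<kappa>)"
  using conj_A unfolding conjecture_A_def by blast

text \<open>By the propagation of zeros, a solution of the matrix equation is triangular for the order
  by dominance, and it is determined by its blocks inside the families.\<close>

lemma eigen_triangular:
  assumes eig: "\<And>\<alpha> \<beta>. \<alpha> \<in> Z \<Longrightarrow> \<beta> \<in> Z \<Longrightarrow> (\<Sum>\<gamma>\<in>Z. W \<alpha> \<gamma> * h s \<gamma> \<beta>) = (\<Sum>\<gamma>\<in>fam e M n \<alpha>. h s \<alpha> \<gamma> * W \<gamma> \<beta>)"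
    and "\<alpha> \<in> Z" "\<beta> \<in> Z" "\<not> sim e M \<beta> \<alpha>" "\<not> below e M \<beta> \<alpha>"
  shows "W \<alpha> \<beta> = 0"
proof (rule eigen_system_zero[where S = "\<lambda>\<alpha> \<beta>. \<not> sim e M \<beta> \<alpha> \<and> \<not> below e M \<beta> \<alpha>" and h = "h s" and W = W, OF conj_A' h_triangular eig])
  fix \<alpha> \<beta> \<gamma> assume "\<not> sim e M \<beta> \<alpha> \<and> \<not> below e M \<beta> \<alpha>" "below e M \<beta> \<gamma>"
  then show "\<not> sim e M \<gamma> \<alpha> \<and> \<not> below e M \<gamma> \<alpha>"
    using below_trans[of e M \<beta> \<gamma> \<alpha>] below_sim_right[of e M \<gamma> \<alpha> \<beta>] by blast
next
  fix \<alpha> \<alpha>' \<beta> \<beta>' assume "\<not> sim e M \<beta> \<alpha> \<and> \<not> below e M \<beta> \<alpha>" "sim e M \<alpha>' \<alpha>" "sim e M \<beta>' \<beta>"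
  then show "\<not> sim e M \<beta>' \<alpha>' \<and> \<not> below e M \<beta>' \<alpha>'"
    by (auto simp: sim_lam below_def)
qed (use assms in auto)

lemma eigen_unique:
  assumes eig: "\<And>\<alpha> \<beta>. \<alpha> \<in> Z \<Longrightarrow> \<beta> \<in> Z \<Longrightarrow> (\<Sum>\<gamma>\<in>Z. W \<alpha> \<gamma> * h s \<gamma> \<beta>) = (\<Sum>\<gamma>\<in>fam e M n \<alpha>. h s \<alpha> \<gamma> * W \<gamma> \<beta>)"
    and eig': "\<And>\<alpha> \<beta>. \<alpha> \<in> Z \<Longrightarrow> \<beta> \<in> Z \<Longrightarrow> (\<Sum>\<gamma>\<in>Z. W' \<alpha> \<gamma> * h s \<gamma> \<beta>) = (\<Sum>\<gamma>\<in>fam e M n \<alpha>. h s \<alpha> \<gamma> * W' \<gamma> \<beta>)"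
    and diag: "\<And>\<alpha> \<beta>. \<alpha> \<in> Z \<Longrightarrow> \<beta> \<in> Z \<Longrightarrow> sim e M \<beta> \<alpha> \<Longrightarrow> W \<alpha> \<beta> = W' \<alpha> \<beta>"
    and "\<alpha> \<in> Z" "\<beta> \<in> Z"
  shows "W \<alpha> \<beta> = W' \<alpha> \<beta>"
proof -
  have "(\<lambda>\<alpha> \<beta>. W \<alpha> \<beta> - W' \<alpha> \<beta>) \<alpha> \<beta> = 0"
  proof (rule eigen_system_zero[where S = "\<lambda>_ _. True" and h = "h s", OF conj_A' h_triangular])
    fix \<alpha> \<beta> assume z: "\<alpha> \<in> Z" "\<beta> \<in> Z"
    show "(\<Sum>\<gamma>\<in>Z. (W \<alpha> \<gamma> - W' \<alpha> \<gamma>) * h s \<gamma> \<beta>) = (\<Sum>\<gamma>\<in>fam e M n \<alpha>. h s \<alpha> \<gamma> * (W \<gamma> \<beta> - W' \<gamma> \<beta>))"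
      using eig[OF z] eig'[OF z] by (simp add: left_diff_distrib right_diff_distrib sum_subtractf)
  qed (use assms in auto)
  then show ?thesis by simp
qed

lemma characterized_coords:
  assumes ch: "characterized e m L n c h s Q"
  obtains W where "coords Q W"
    "\<forall>\<alpha>\<in>Z. \<forall>\<beta>\<in>Z. sim e M \<beta> \<alpha> \<longrightarrow> W \<alpha> \<beta> = (if \<beta> = \<alpha> then 1 else 0)"
    "\<forall>\<alpha>\<in>Z. \<forall>\<beta>\<in>Z. (\<Sum>\<gamma>\<in>Z. W \<alpha> \<gamma> * h s \<gamma> \<beta>) = (\<Sum>\<gamma>\<in>fam e M n \<alpha>. h s \<alpha> \<gamma> * W \<gamma> \<beta>)"
proof -
  obtain w where w: "\<forall>\<alpha>\<in>Z. Q (Lam e M \<alpha>) = (\<lambda>l. msym e m \<alpha> l + lincomb {\<beta>\<in>Z. below e M \<beta> \<alpha>} (w \<alpha>) (msym e m) l)"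
    using ch unfolding characterized_def Let_def by blast
  have eig: "\<forall>\<alpha>\<in>Z. E_lim e m c s (Q (Lam e M \<alpha>)) = lincomb (fam e M n \<alpha>) (h s \<alpha>) (\<lambda>\<beta>. Q (Lam e M \<beta>))"
    using ch unfolding characterized_def Let_def fam_eq by blast
  define W where "W = (\<lambda>\<alpha> \<beta>. if \<beta> = \<alpha> then 1 else if \<beta> \<in> {\<beta>\<in>Z. below e M \<beta> \<alpha>} then w \<alpha> \<beta> else 0)"
  have W: "coords Q W" unfolding coords_def
  proof
    fix \<alpha> assume \<alpha>: "\<alpha> \<in> Z"
    show "Q (Lam e M \<alpha>) = lincomb Z (W \<alpha>) (msym e m)"
      using bspec[OF w \<alpha>] lincomb_triangular[OF \<alpha>, of "{\<beta>\<in>Z. below e M \<beta> \<alpha>}" "w \<alpha>"]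
      by (simp add: W_def below_irrefl)
  qed
  show ?thesis
  proof (rule that[OF W])
    show "\<forall>\<alpha>\<in>Z. \<forall>\<beta>\<in>Z. sim e M \<beta> \<alpha> \<longrightarrow> W \<alpha> \<beta> = (if \<beta> = \<alpha> then 1 else 0)"
      using below_sim by (auto simp: W_def)
  qed (intro ballI coords_eigen[OF W eig])
qed

lemma coords_characterized:
  assumes W: "coords Q W"
    and diag: "\<And>\<alpha> \<beta>. \<alpha> \<in> Z \<Longrightarrow> \<beta> \<in> Z \<Longrightarrow> sim e M \<beta> \<alpha> \<Longrightarrow> W \<alpha> \<beta> = (if \<beta> = \<alpha> then 1 else 0)"
    and eig: "\<forall>\<alpha>\<in>Z. E_lim e m c s (Q (Lam e M \<alpha>)) = lincomb (fam e M n \<alpha>) (h s \<alpha>) (\<lambda>\<beta>. Q (Lam e M \<beta>))"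
  shows "characterized e m L n c h s Q"
  unfolding characterized_def Let_def
proof (intro conjI)
  have Q: "Q (Lam e M \<alpha>) = lincomb Z (W \<alpha>) (msym e m)" if "\<alpha> \<in> Z" for \<alpha> using W that by (simp add: coords_def)
  show "\<forall>\<alpha>\<in>Z. Q (Lam e M \<alpha>) \<in> Xi e m"
    using hom_Xi_Xi[OF hom_Xi_lincomb[of Z "msym e m" e m n]] msym_Z Q by simp
  show "\<forall>\<alpha>\<in>Z. E_lim e m c s (Q (Lam e M \<alpha>)) = lincomb {\<beta>\<in>Z. sim e M \<beta> \<alpha>} (h s \<alpha>) (\<lambda>\<beta>. Q (Lam e M \<beta>))"
    using eig unfolding fam_eq .
  show "\<exists>w. \<forall>\<alpha>\<in>Z. Q (Lam e M \<alpha>) = (\<lambda>l. msym e m \<alpha> l + lincomb {\<beta>\<in>Z. below e M \<beta> \<alpha>} (w \<alpha>) (msym e m) l)"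
  proof (intro exI[of _ W] ballI)
    fix \<alpha> assume \<alpha>: "\<alpha> \<in> Z"
    have tri: "W \<alpha> \<beta> = (if \<beta> = \<alpha> then 1 else if \<beta> \<in> {\<beta>\<in>Z. below e M \<beta> \<alpha>} then W \<alpha> \<beta> else 0)" if \<beta>: "\<beta> \<in> Z" for \<beta>
    proof (cases "sim e M \<beta> \<alpha>")
      case True
      then have "\<not> below e M \<beta> \<alpha>" using below_sim by blast
      then show ?thesis using diag[OF \<alpha> \<beta> True] by simp
    next
      case False
      then have "\<beta> \<noteq> \<alpha>" by auto
      moreover have "W \<alpha> \<beta> = 0" if "\<not> below e M \<beta> \<alpha>"
        by (rule eigen_triangular[OF _ \<alpha> \<beta> False that]) (rule coords_eigen[OF W eig])
      ultimately show ?thesis using \<beta> by simp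
    qed
    then have "lincomb Z (W \<alpha>) (msym e m) = lincomb Z (\<lambda>\<beta>. if \<beta> = \<alpha> then 1 else if \<beta> \<in> {\<beta>\<in>Z. below e M \<beta> \<alpha>} then W \<alpha> \<beta> else 0) (msym e m)"
      unfolding lincomb_def using tri by (intro ext sum.cong refl arg_cong2[where f = "(*)"] arg_cong[where f = Const])
    then show "Q (Lam e M \<alpha>) = (\<lambda>l. msym e m \<alpha> l + lincomb {\<beta>\<in>Z. below e M \<beta> \<alpha>} (W \<alpha>) (msym e m) l)"
      unfolding Q[OF \<alpha>] using lincomb_triangular[OF \<alpha>, of "{\<beta>\<in>Z. below e M \<beta> \<alpha>}" "W \<alpha>"] by (simp add: below_irrefl)
  qed
qed

lemma characterized_unique:
  assumes "characterized e m L n c h s Q" "characterized e m L n c h s Q'" "\<alpha> \<in> Z"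
  shows "Q (Lam e M \<alpha>) = Q' (Lam e M \<alpha>)"
proof -
  obtain W where W: "coords Q W"
    "\<forall>\<alpha>\<in>Z. \<forall>\<beta>\<in>Z. sim e M \<beta> \<alpha> \<longrightarrow> W \<alpha> \<beta> = (if \<beta> = \<alpha> then 1 else 0)"
    "\<forall>\<alpha>\<in>Z. \<forall>\<beta>\<in>Z. (\<Sum>\<gamma>\<in>Z. W \<alpha> \<gamma> * h s \<gamma> \<beta>) = (\<Sum>\<gamma>\<in>fam e M n \<alpha>. h s \<alpha> \<gamma> * W \<gamma> \<beta>)"
    using characterized_coords[OF assms(1)] .
  obtain W' where W': "coords Q' W'"
    "\<forall>\<alpha>\<in>Z. \<forall>\<beta>\<in>Z. sim e M \<beta> \<alpha> \<longrightarrow> W' \<alpha> \<beta> = (if \<beta> = \<alpha> then 1 else 0)"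
    "\<forall>\<alpha>\<in>Z. \<forall>\<beta>\<in>Z. (\<Sum>\<gamma>\<in>Z. W' \<alpha> \<gamma> * h s \<gamma> \<beta>) = (\<Sum>\<gamma>\<in>fam e M n \<alpha>. h s \<alpha> \<gamma> * W' \<gamma> \<beta>)"
    using characterized_coords[OF assms(2)] .
  have "W \<alpha> \<beta> = W' \<alpha> \<beta>" if "\<beta> \<in> Z" for \<beta>
    by (rule eigen_unique[where s = s]) (use W(2,3) W'(2,3) assms(3) that in auto)
  then have "lincomb Z (W \<alpha>) (msym e m) = lincomb Z (W' \<alpha>) (msym e m)"
    unfolding lincomb_def by (intro ext sum.cong) auto
  then show ?thesis using W(1) W'(1) assms(3) by (simp add: coords_def)
qed

text \<open>Orthogonality gives the eigenvector property. At first the coordinates over the monomial functions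
  are triangular only for the total order; they are trivial inside the families, and the eigenvector
  property restricts them to the order by dominance.\<close>

lemma macdonald_characterized:
  assumes order: "admissible_order e M n r" and mac: "macdonald e m L \<zeta> n r P"
  shows "characterized e m L n c h s (P s)"
proof -
  let ?D = "lower e M n r"
  let ?p = "\<lambda>s \<alpha>. P s (Lam e M \<alpha>)"
  have PXi: "\<And>s \<alpha>. \<alpha> \<in> Z \<Longrightarrow> ?p s \<alpha> \<in> Xi e m"
    and Psch: "\<And>s. \<exists>u. \<forall>\<alpha>\<in>Z. ?p s \<alpha> = (\<lambda>l. schur e m \<alpha> l + lincomb (?D \<alpha>) (u \<alpha>) (schur e m) l)"
    and Port: "\<And>\<alpha> \<beta>. \<alpha> \<in> Z \<Longrightarrow> \<beta> \<in> Z \<Longrightarrow> \<not> sim e M \<alpha> \<beta> \<Longrightarrow> scal e m \<zeta> (?p SPlus \<alpha>) (?p SMinus \<beta>) = 0"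
    using mac unfolding macdonald_def Let_def lower_def by blast+
  have Phom: "?p s \<alpha> \<in> hom_Xi e m n" if \<alpha>: "\<alpha> \<in> Z" for s \<alpha>
  proof (rule hom_XiI[OF PXi[OF \<alpha>]])
    fix l
    obtain u where u: "\<forall>\<alpha>\<in>Z. ?p s \<alpha> = (\<lambda>l. schur e m \<alpha> l + lincomb (?D \<alpha>) (u \<alpha>) (schur e m) l)"
      using Psch by blast
    have sch: "homog n (schur e m \<beta> l)" if "\<beta> \<in> Z" for \<beta>
      using schur_homog[of \<beta> e m l] Z_epart[OF that] by simp
    have "homog n (schur e m \<alpha> l + (\<Sum>\<beta>\<in>?D \<alpha>. Const (u \<alpha> \<beta>) * schur e m \<beta> l))"
      by (intro homog_add homog_sum homog_Const sch \<alpha>) (simp add: lower_def)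
    then show "homog n (?p s \<alpha> l)" using u \<alpha> by (simp add: lincomb_def)
  qed
  \<comment> \<open>Dominance is contained in the total order, so that inserting the expansions of the Schur
    functions keeps the sums over the same lower sets.\<close>
  define K where "K = (\<lambda>\<alpha>. SOME K. schur e m \<alpha> L = monsym e M \<alpha> + (\<Sum>\<beta>\<in>{\<beta> \<in> Z. below e M \<beta> \<alpha>}. Const (K \<beta>) * monsym e M \<beta>))"
  have K: "schur e m \<alpha> L = monsym e M \<alpha> + (\<Sum>\<beta>\<in>{\<beta> \<in> Z. below e M \<beta> \<alpha>}. Const (K \<alpha> \<beta>) * monsym e M \<beta>)" if "\<alpha> \<in> Z" for \<alpha>
    using someI_ex[OF schur_unitriangular[OF that]] unfolding K_def .
  define K' where "K' = (\<lambda>\<alpha> \<beta>. if below e M \<beta> \<alpha> then K \<alpha> \<beta> else 0)"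
  have sch: "schur e m \<gamma> L = monsym e M \<gamma> + (\<Sum>\<beta>\<in>?D \<alpha>. Const (K' \<gamma> \<beta>) * monsym e M \<beta>)"
    if \<gamma>: "\<gamma> \<in> Z" and sub: "?D \<gamma> \<subseteq> ?D \<alpha>" for \<gamma> \<alpha>
  proof -
    have "(\<Sum>\<beta>\<in>?D \<alpha>. Const (K' \<gamma> \<beta>) * monsym e M \<beta>) = (\<Sum>\<beta>\<in>{\<beta> \<in> Z. below e M \<beta> \<gamma>}. Const (K' \<gamma> \<beta>) * monsym e M \<beta>)"
    proof (rule sum.mono_neutral_right)
      show "{\<beta> \<in> Z. below e M \<beta> \<gamma>} \<subseteq> ?D \<alpha>" using below_lower[OF order \<gamma>] sub by blast
      show "\<forall>\<beta>\<in>?D \<alpha> - {\<beta> \<in> Z. below e M \<beta> \<gamma>}. Const (K' \<gamma> \<beta>) * monsym e M \<beta> = 0"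
        by (auto simp: K'_def lower_def)
    qed (simp add: lower_def)
    also have "\<dots> = (\<Sum>\<beta>\<in>{\<beta> \<in> Z. below e M \<beta> \<gamma>}. Const (K \<gamma> \<beta>) * monsym e M \<beta>)"
      by (intro sum.cong refl) (simp add: K'_def)
    finally show ?thesis using K[OF \<gamma>] by simp
  qed
  have u_ex: "\<exists>u. \<forall>\<alpha>\<in>Z. ?p s \<alpha> L = monsym e M \<alpha> + (\<Sum>\<beta>\<in>?D \<alpha>. Const (u \<alpha> \<beta>) * monsym e M \<beta>)" for s
  proof -
    obtain u where u: "\<forall>\<alpha>\<in>Z. ?p s \<alpha> = (\<lambda>l. schur e m \<alpha> l + lincomb (?D \<alpha>) (u \<alpha>) (schur e m) l)"
      using Psch by blast
    let ?u = "\<lambda>\<alpha> \<beta>. K' \<alpha> \<beta> + (u \<alpha> \<beta> + (\<Sum>\<gamma>\<in>?D \<alpha>. u \<alpha> \<gamma> * K' \<gamma> \<beta>))"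
    have "?p s \<alpha> L = monsym e M \<alpha> + (\<Sum>\<beta>\<in>?D \<alpha>. Const (?u \<alpha> \<beta>) * monsym e M \<beta>)" if \<alpha>: "\<alpha> \<in> Z" for \<alpha>
    proof -
      have Dsub: "\<gamma> \<in> Z" "?D \<gamma> \<subseteq> ?D \<alpha>" if "\<gamma> \<in> ?D \<alpha>" for \<gamma>
        using lower_less[OF order that] that by (auto simp: lower_def)
      have "?p s \<alpha> L = schur e m \<alpha> L + (\<Sum>\<gamma>\<in>?D \<alpha>. Const (u \<alpha> \<gamma>) * schur e m \<gamma> L)"
        using u \<alpha> by (simp add: lincomb_def)
      also have "(\<Sum>\<gamma>\<in>?D \<alpha>. Const (u \<alpha> \<gamma>) * schur e m \<gamma> L)
        = (\<Sum>\<gamma>\<in>?D \<alpha>. Const (u \<alpha> \<gamma>) * monsym e M \<gamma> + (\<Sum>\<beta>\<in>?D \<alpha>. Const (u \<alpha> \<gamma> * K' \<gamma> \<beta>) * monsym e M \<beta>))"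
      proof (rule sum.cong[OF refl])
        fix \<gamma> assume g: "\<gamma> \<in> ?D \<alpha>"
        show "Const (u \<alpha> \<gamma>) * schur e m \<gamma> L = Const (u \<alpha> \<gamma>) * monsym e M \<gamma> + (\<Sum>\<beta>\<in>?D \<alpha>. Const (u \<alpha> \<gamma> * K' \<gamma> \<beta>) * monsym e M \<beta>)"
          unfolding sch[OF Dsub[OF g]] by (simp only: distrib_left sum_distrib_left Const_mult mult.assoc)
      qed
      also have "\<dots> = (\<Sum>\<beta>\<in>?D \<alpha>. Const (u \<alpha> \<beta> + (\<Sum>\<gamma>\<in>?D \<alpha>. u \<alpha> \<gamma> * K' \<gamma> \<beta>)) * monsym e M \<beta>)"
        unfolding sum.distrib Const_add distrib_right Const_sum sum_distrib_right by (subst (2) sum.swap) simp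
      finally show ?thesis
        unfolding sch[OF \<alpha> subset_refl] by (simp only: Const_add distrib_right sum.distrib add.assoc)
    qed
    then show ?thesis by (intro exI[of _ ?u]) blast
  qed
  define u where "u = (\<lambda>s. SOME u. \<forall>\<alpha>\<in>Z. ?p s \<alpha> L = monsym e M \<alpha> + (\<Sum>\<beta>\<in>?D \<alpha>. Const (u \<alpha> \<beta>) * monsym e M \<beta>))"
  have u: "?p s \<alpha> L = monsym e M \<alpha> + (\<Sum>\<beta>\<in>?D \<alpha>. Const (u s \<alpha> \<beta>) * monsym e M \<beta>)" if "\<alpha> \<in> Z" for s \<alpha>
    using someI_ex[OF u_ex[of s]] that unfolding u_def by (rule bspec)
  define W where "W = (\<lambda>s \<alpha> \<beta>. if \<beta> = \<alpha> then 1 else if \<beta> \<in> ?D \<alpha> then u s \<alpha> \<beta> else 0)"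
  have notin: "\<alpha> \<notin> ?D \<alpha>" for \<alpha> by (simp add: lower_def)
  have pW: "?p s \<alpha> = lincomb Z (W s \<alpha>) (msym e m)" if \<alpha>: "\<alpha> \<in> Z" for s \<alpha>
  proof -
    have hom: "lincomb Z (W s \<alpha>) (msym e m) \<in> hom_Xi e m n" by (rule hom_Xi_lincomb) (rule msym_Z)
    have "lincomb Z (W s \<alpha>) (msym e m) L = msym e m \<alpha> L + lincomb (?D \<alpha>) (u s \<alpha>) (msym e m) L"
      unfolding W_def by (rule fun_cong[OF lincomb_triangular[OF \<alpha> _ notin], symmetric]) (auto simp: lower_def)
    also have "\<dots> = ?p s \<alpha> L"
      unfolding u[OF \<alpha>] lincomb_def msym_L[OF \<alpha>] by (intro arg_cong[where f = "\<lambda>x. _ + x"] sum.cong refl) (simp add: msym_L lower_def)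
    finally show ?thesis by (intro hom_Xi_eqI[OF Phom[OF \<alpha>] hom L_large]) simp
  qed
  have cW: "coords (P s) (W s)" for s by (simp add: coords_def pW)
  have diag: "W s \<alpha> \<beta> = (if \<beta> = \<alpha> then 1 else 0)" if "sim e M \<beta> \<alpha>" for s \<alpha> \<beta>
    using that by (auto simp: W_def lower_def)
  let ?S = "\<lambda>f g. SF e \<zeta> M n (f * ad) (g * ad)"
  obtain \<kappa> where \<kappa>: "\<And>f g. symmetric_poly e M f \<Longrightarrow> supp_in (idx e M) f \<Longrightarrow> homog n f \<Longrightarrow>
     symmetric_poly e M g \<Longrightarrow> supp_in (idx e M) g \<Longrightarrow> homog n g \<Longrightarrow>
     ?S (E_level e m c SPlus L f) g = ?S f (E_level e m c SMinus L g) + \<kappa> * ?S f g"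
    using SF_E_adjoint[OF e_pos zeta L_large, of c] by blast
  have S: "?S (f + f') g = ?S f g + ?S f' g" "?S (Const a * f) g = a * ?S f g"
      "?S f (g + g') = ?S f g + ?S f g'" "?S f (Const a * g) = cnj_F a * ?S f g" for f f' g g' a
    by (simp_all only: distrib_right mult.assoc SF_add_left[OF e_pos zeta] SF_add_right[OF e_pos zeta]
        SF_Const_left[OF e_pos zeta] SF_Const_right[OF e_pos zeta])
  have orth: "?S (?p SPlus \<alpha> L) (?p SMinus \<beta> L) = 0" if "\<alpha> \<in> Z" "\<beta> \<in> Z" "\<not> sim e M \<alpha> \<beta>" for \<alpha> \<beta>
    using Port[OF that] scal_SF[OF e_pos zeta Phom[OF that(1)] Phom[OF that(2)] L_large] by simp
  have EP: "E_level e m c s L (?p s \<alpha> L) = (\<Sum>\<beta>\<in>Z. Const (h s \<alpha> \<beta>) * monsym e M \<beta>)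
      + (\<Sum>\<gamma>\<in>?D \<alpha>. Const (u s \<alpha> \<gamma>) * (\<Sum>\<beta>\<in>Z. Const (h s \<gamma> \<beta>) * monsym e M \<beta>))" if \<alpha>: "\<alpha> \<in> Z" for s \<alpha>
  proof -
    have "E_lim e m c s (?p s \<alpha>) L = lincomb Z (W s \<alpha>) (\<lambda>\<gamma>. E_lim e m c s (msym e m \<gamma>)) L"
      unfolding pW[OF \<alpha>] by (rule fun_cong[OF E_lim_lincomb]) (simp_all add: msym_Z)
    also have "\<dots> = (\<Sum>\<gamma>\<in>Z. Const (W s \<alpha> \<gamma>) * (\<Sum>\<beta>\<in>Z. Const (h s \<gamma> \<beta>) * monsym e M \<beta>))"
      unfolding lincomb_def E_lim_def by (intro sum.cong refl) (simp add: msym_L E_msym_L)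
    also have "\<dots> = (\<Sum>\<gamma>\<in>insert \<alpha> (?D \<alpha>). Const (W s \<alpha> \<gamma>) * (\<Sum>\<beta>\<in>Z. Const (h s \<gamma> \<beta>) * monsym e M \<beta>))"
      by (rule sum.mono_neutral_right) (use \<alpha> in \<open>auto simp: W_def lower_def\<close>)
    also have "\<dots> = (\<Sum>\<beta>\<in>Z. Const (h s \<alpha> \<beta>) * monsym e M \<beta>) + (\<Sum>\<gamma>\<in>?D \<alpha>. Const (W s \<alpha> \<gamma>) * (\<Sum>\<beta>\<in>Z. Const (h s \<gamma> \<beta>) * monsym e M \<beta>))"
      by (subst sum.insert) (auto simp: lower_def W_def)
    also have "(\<Sum>\<gamma>\<in>?D \<alpha>. Const (W s \<alpha> \<gamma>) * (\<Sum>\<beta>\<in>Z. Const (h s \<gamma> \<beta>) * monsym e M \<beta>)) = (\<Sum>\<gamma>\<in>?D \<alpha>. Const (u s \<alpha> \<gamma>) * (\<Sum>\<beta>\<in>Z. Const (h s \<gamma> \<beta>) * monsym e M \<beta>))"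
      by (intro sum.cong refl) (use notin[of \<alpha>] in \<open>auto simp: W_def\<close>)
    finally show ?thesis by (simp add: E_lim_def)
  qed
  have span: "symmetric_poly e M f \<and> supp_in (idx e M) f \<and> homog n f" if "f = (\<Sum>\<beta>\<in>Z. Const (a \<beta>) * monsym e M \<beta>)" for f a
    unfolding that using homog_mono[of _ e M]
    by (intro conjI symmetric_sum symmetric_Const symmetric_mono supp_in_sum supp_in_Const supp_mono homog_sum homog_Const) (auto simp: Z00_def)
  have pf_span: "\<exists>b. pf e \<zeta> M n \<nu> = (\<Sum>\<beta>\<in>Z. Const (b \<beta>) * monsym e M \<beta>)" if \<nu>: "\<nu> \<in> Z" for \<nu>
  proof -
    have "pfun e m \<zeta> \<nu> L = pf e \<zeta> M n \<nu>" using pfun_pf[OF e_pos zeta, of \<nu> n m L] Z_epart[OF \<nu>] by simp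
    moreover have "pfun e m \<zeta> \<nu> \<in> hom_Xi e m n" using pfun_hom_Xi[OF e_pos zeta, of \<nu> m] Z_epart[OF \<nu>] by simp
    note symmetric_expand[OF hom_XiD[OF this, of L]]
    ultimately show ?thesis by (intro exI) simp
  qed
  have S0: "?S 0 g = 0" "?S f 0 = 0" for f g using S(1)[of 0 0 g] S(3)[of f 0 0] by simp_all
  have Ssum: "?S (sum f A) g = (\<Sum>a\<in>A. ?S (f a) g)" "?S g (sum f A) = (\<Sum>a\<in>A. ?S g (f a))"
    for f :: "arr \<Rightarrow> mpol" and A g
    by (induction A rule: infinite_finite_induct)
      (simp_all only: sum.infinite sum.empty sum.insert S(1,3) S0 simp_thms not_False_eq_True if_True if_False)
  have nd1: "(\<Sum>\<beta>\<in>Z. Const (a \<beta>) * monsym e M \<beta>) = 0" (is "?f = 0")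
    if z: "\<And>\<nu>. \<nu> \<in> Z \<Longrightarrow> ?S (\<Sum>\<beta>\<in>Z. Const (a \<beta>) * monsym e M \<beta>) (monsym e M \<nu>) = 0" for a
  proof (rule SF_nondegenerate_left[OF e_pos zeta _ _ _ L_large])
    fix \<nu> assume \<nu>: "\<nu> \<in> Z"
    obtain b where b: "pf e \<zeta> M n \<nu> = (\<Sum>\<beta>\<in>Z. Const (b \<beta>) * monsym e M \<beta>)" using pf_span[OF \<nu>] by blast
    show "?S ?f (pf e \<zeta> M n \<nu>) = 0" unfolding b Ssum(2) S(4) using z by simp
  qed (use span[OF refl] in auto)
  have nd2: "(\<Sum>\<beta>\<in>Z. Const (a \<beta>) * monsym e M \<beta>) = 0" (is "?f = 0")
    if z: "\<And>\<nu>. \<nu> \<in> Z \<Longrightarrow> ?S (monsym e M \<nu>) (\<Sum>\<beta>\<in>Z. Const (a \<beta>) * monsym e M \<beta>) = 0" for a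
  proof (rule SF_nondegenerate_right[OF e_pos zeta _ _ _ L_large])
    fix \<nu> assume \<nu>: "\<nu> \<in> Z"
    obtain b where b: "pf e \<zeta> M n \<nu> = (\<Sum>\<beta>\<in>Z. Const (b \<beta>) * monsym e M \<beta>)" using pf_span[OF \<nu>] by blast
    show "?S (pf e \<zeta> M n \<nu>) ?f = 0" unfolding b Ssum(1) S(2) using z by simp
  qed (use span[OF refl] in auto)
  have eigL: "E_level e m c s L (?p s \<alpha> L) = (\<Sum>\<beta>\<in>fam e M n \<alpha>. Const (h s \<alpha> \<beta>) * ?p s \<beta> L)" if \<alpha>: "\<alpha> \<in> Z" for s \<alpha>
  proof (cases s)
    case SPlus
    show ?thesis unfolding SPlus
    proof (rule orthogonal_eigen[where S = ?S and mo = "monsym e M" and P = "\<lambda>\<alpha>. ?p SPlus \<alpha> L" and P' = "\<lambda>\<alpha>. ?p SMinus \<alpha> L"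
          and u = "u SPlus" and u' = "u SMinus" and h = "h SPlus" and h' = "h SMinus" and E = "E_level e m c SPlus L"
          and E' = "E_level e m c SMinus L" and \<kappa> = \<kappa>, OF order S u u h_triangular h_triangular EP EP])
      show "?S (E_level e m c SPlus L (?p SPlus \<alpha> L)) (?p SMinus \<gamma> L) = ?S (?p SPlus \<alpha> L) (E_level e m c SMinus L (?p SMinus \<gamma> L)) + \<kappa> * ?S (?p SPlus \<alpha> L) (?p SMinus \<gamma> L)"
        if "\<alpha> \<in> Z" "\<gamma> \<in> Z" for \<alpha> \<gamma>
        by (rule \<kappa>[OF hom_XiD[OF Phom[OF that(1)]] hom_XiD[OF Phom[OF that(2)]]])
    qed (use orth nd1 \<alpha> in blast)+
  next
    case SMinus
    show ?thesis unfolding SMinus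
    proof (rule orthogonal_eigen[where S = "\<lambda>f g. ?S g f" and mo = "monsym e M" and P = "\<lambda>\<alpha>. ?p SMinus \<alpha> L" and P' = "\<lambda>\<alpha>. ?p SPlus \<alpha> L"
          and u = "u SMinus" and u' = "u SPlus" and h = "h SMinus" and h' = "h SPlus" and E = "E_level e m c SMinus L"
          and E' = "E_level e m c SPlus L" and \<kappa> = "- \<kappa>", OF order S(3,4,1,2) u u h_triangular h_triangular EP EP])
      show "?S (?p SPlus \<gamma> L) (E_level e m c SMinus L (?p SMinus \<alpha> L)) = ?S (E_level e m c SPlus L (?p SPlus \<gamma> L)) (?p SMinus \<alpha> L) + - \<kappa> * ?S (?p SPlus \<gamma> L) (?p SMinus \<alpha> L)"
        if "\<alpha> \<in> Z" "\<gamma> \<in> Z" for \<alpha> \<gamma>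
        using \<kappa>[OF hom_XiD[OF Phom[OF that(2)]] hom_XiD[OF Phom[OF that(1)]]] by simp
      show "?S (?p SPlus \<gamma> L) (?p SMinus \<alpha> L) = 0" if "\<alpha> \<in> Z" "\<gamma> \<in> Z" "\<not> sim e M \<alpha> \<gamma>" for \<alpha> \<gamma>
        using orth[OF that(2,1)] that(3) by (auto simp: sim_def)
    qed (use nd2 \<alpha> in blast)+
  qed
  have eig: "E_lim e m c s (?p s \<alpha>) = lincomb (fam e M n \<alpha>) (h s \<alpha>) (\<lambda>\<beta>. ?p s \<beta>)" if \<alpha>: "\<alpha> \<in> Z" for s \<alpha>
  proof (rule hom_Xi_eqI[OF _ _ L_large])
    have "E_lim e m c s (?p s \<alpha>) = lincomb Z (W s \<alpha>) (\<lambda>\<gamma>. E_lim e m c s (msym e m \<gamma>))"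
      unfolding pW[OF \<alpha>] by (rule E_lim_lincomb) (simp_all add: msym_Z)
    also have "\<dots> \<in> hom_Xi e m n"
    proof (rule hom_Xi_lincomb)
      fix \<gamma> assume "\<gamma> \<in> Z"
      then have "E_lim e m c s (msym e m \<gamma>) = lincomb Z (h s \<gamma>) (msym e m)" using h_coeffs by simp
      then show "E_lim e m c s (msym e m \<gamma>) \<in> hom_Xi e m n" using hom_Xi_lincomb[of Z "msym e m" e m n "h s \<gamma>"] msym_Z by simp
    qed
    finally show "E_lim e m c s (?p s \<alpha>) \<in> hom_Xi e m n" .
    show "lincomb (fam e M n \<alpha>) (h s \<alpha>) (\<lambda>\<beta>. ?p s \<beta>) \<in> hom_Xi e m n"
      by (rule hom_Xi_lincomb) (rule Phom, simp add: fam_def)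
    show "E_lim e m c s (?p s \<alpha>) L = lincomb (fam e M n \<alpha>) (h s \<alpha>) (\<lambda>\<beta>. ?p s \<beta>) L"
      using eigL[OF \<alpha>, of s] by (simp add: E_lim_def lincomb_def)
  qed
  show ?thesis
    by (rule coords_characterized[OF cW]) (use diag eig in auto)
qed

end

end

theorem theorem3p6:
  fixes e n L :: nat and m :: "nat \<Rightarrow> nat" and \<zeta> :: complex
    and r :: "(arr \<times> arr) set"
    and c :: "nat \<Rightarrow> fld"
    and h :: "pm \<Rightarrow> arr \<Rightarrow> arr \<Rightarrow> fld"
    and P :: "pm \<Rightarrow> arr \<Rightarrow> symfun"
  assumes e_pos: "e \<ge> 1"
    and zeta: "primitive_root_of_unity e \<zeta>"
    and m_pos: "\<forall>k<e. m k \<ge> 1"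
    and L_large: "\<forall>k<e. n \<le> shift m L k"
    and compat: "restriction_compatible e m c"
    and h_coeffs: "\<forall>s. \<forall>\<alpha>\<in>Z00 e (shift m L) n.
           E_lim e m c s (msym e m \<alpha>) = lincomb (Z00 e (shift m L) n) (h s \<alpha>) (msym e m)"
    and conj_A: "conjecture_A e (shift m L) n h"
    and order: "admissible_order e (shift m L) n r"
    and macdonald_P: "macdonald e m L \<zeta> n r P"
  shows "(\<forall>s. characterized e m L n c h s (P s) \<and>
            (\<forall>Q. characterized e m L n c h s Q \<longrightarrow>
               (\<forall>\<alpha>\<in>Z00 e (shift m L) n. Q (Lam e (shift m L) \<alpha>) = P s (Lam e (shift m L) \<alpha>)))) \<and>
         (\<forall>r' P'. admissible_order e (shift m L) n r' \<and> macdonald e m L \<zeta> n r' P' \<longrightarrow>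
            (\<forall>s. \<forall>\<alpha>\<in>Z00 e (shift m L) n.
               P' s (Lam e (shift m L) \<alpha>) = P s (Lam e (shift m L) \<alpha>)))"
proof -
  note ch = macdonald_characterized[OF e_pos zeta L_large h_coeffs conj_A]
  note uniq = characterized_unique[OF e_pos zeta L_large h_coeffs conj_A]
  have P: "characterized e m L n c h s (P s)" for s by (rule ch[OF order macdonald_P])
  have eq: "Q (Lam e (shift m L) \<alpha>) = P s (Lam e (shift m L) \<alpha>)"
    if "characterized e m L n c h s Q" "\<alpha> \<in> Z00 e (shift m L) n" for s Q \<alpha>
    by (rule uniq[OF that(1) P that(2)])
  show ?thesis
  proof (intro conjI allI impI ballI)
    fix s Q \<alpha> assume "characterized e m L n c h s Q" "\<alpha> \<in> Z00 e (shift m L) n"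
    then show "Q (Lam e (shift m L) \<alpha>) = P s (Lam e (shift m L) \<alpha>)" by (rule eq)
  next
    fix r' P' s \<alpha> assume *: "admissible_order e (shift m L) n r' \<and> macdonald e m L \<zeta> n r' P'" "\<alpha> \<in> Z00 e (shift m L) n"
    have "characterized e m L n c h s (P' s)" by (rule ch) (use * in blast)+
    then show "P' s (Lam e (shift m L) \<alpha>) = P s (Lam e (shift m L) \<alpha>)" using *(2) by (rule eq)
  qed (rule P)
qed

end
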